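(* Let $\mathfrak{X}$ be a normal excellent formal scheme which is nowhere discrete. Then the restriction map $\mathcal{O}_{\mathfrak{X}}(\mathfrak{X})\rightarrow\mathcal{O}_{\mathfrak{X}_a}^+(\mathfrak{X}_a)$ is an isomorphism of topological rings.
   Context: Formal schemes (here locally noetherian) are regarded as adic spaces in Huber's sense: $\operatorname{Spf}A$ corresponds to $\operatorname{Spa}(A,A)$ for $A$ a complete noetherian adic ring. $\mathfrak{X}$ is excellent if it is locally of the form $\operatorname{Spf}A$ with $A$ an excellent ring. $\mathfrak{X}$ is normal if the local rings of the formal scheme are normal (for $\mathfrak{X}=\operatorname{Spf}A$ with $A$ excellent this is equivalent to $A$ being normal). Nowhere discrete means that no nonempty open affine $\operatorname{Spf}A\subseteq\mathfrak{X}$ has $A$ discrete. $\mathfrak{X}_a$ denotes the open subspace of analytic points of the adic space $\mathfrak{X}$ (points $x$ whose support is not an open ideal, locally). $\mathcal{O}^+_{\mathfrak{X}_a}(\mathfrak{X}_a)=\{f\in\mathcal{O}_{\mathfrak{X}_a}(\mathfrak{X}_a):|f(x)|\le1\ \forall x\in\mathfrak{X}_a\}$, with the subspace topology from the topological ring $\mathcal{O}_{\mathfrak{X}_a}(\mathfrak{X}_a)$ (the structure sheaf being a sheaf of complete topological rings). *)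

theory Defs
  imports "HOL-Analysis.Analysis" "HOL-Algebra.Ideal_Product" "HOL-Algebra.Generated_Rings"
    "HOL-Algebra.Ring_Divisibility" "HOL-Algebra.Embedded_Algebras"
begin

section \<open>Commutative algebra\<close>

subsection \<open>Localization\<close>

definition mk_frac :: "('a, 'm) ring_scheme \<Rightarrow> 'a set \<Rightarrow> 'a \<Rightarrow> 'a \<Rightarrow> ('a \<times> 'a) set" where
  "mk_frac R S a s = {(b, t). b \<in> carrier R \<and> t \<in> S \<and>
     (\<exists>u\<in>S. u \<otimes>\<^bsub>R\<^esub> (t \<otimes>\<^bsub>R\<^esub> a \<ominus>\<^bsub>R\<^esub> s \<otimes>\<^bsub>R\<^esub> b) = \<zero>\<^bsub>R\<^esub>)}"

text \<open>The operations on classes are unions over all representatives; for a multiplicative set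
  \<open>S\<close> all members of such a union coincide.\<close>

definition localization :: "('a, 'm) ring_scheme \<Rightarrow> 'a set \<Rightarrow> ('a \<times> 'a) set ring" where
  "localization R S = \<lparr>
     carrier = {mk_frac R S a s | a s. a \<in> carrier R \<and> s \<in> S},
     mult = (\<lambda>X Y. \<Union>(a, s)\<in>X. \<Union>(b, t)\<in>Y. mk_frac R S (a \<otimes>\<^bsub>R\<^esub> b) (s \<otimes>\<^bsub>R\<^esub> t)),
     one = mk_frac R S \<one>\<^bsub>R\<^esub> \<one>\<^bsub>R\<^esub>,
     zero = mk_frac R S \<zero>\<^bsub>R\<^esub> \<one>\<^bsub>R\<^esub>,
     add = (\<lambda>X Y. \<Union>(a, s)\<in>X. \<Union>(b, t)\<in>Y.
              mk_frac R S (t \<otimes>\<^bsub>R\<^esub> a \<oplus>\<^bsub>R\<^esub> s \<otimes>\<^bsub>R\<^esub> b) (s \<otimes>\<^bsub>R\<^esub> t))\<rparr>"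

definition loc_at_prime :: "('a, 'm) ring_scheme \<Rightarrow> 'a set \<Rightarrow> ('a \<times> 'a) set ring" where
  "loc_at_prime R p = localization R (carrier R - p)"

definition fraction_field :: "('a, 'm) ring_scheme \<Rightarrow> ('a \<times> 'a) set ring" where
  "fraction_field R = localization R (carrier R - {\<zero>\<^bsub>R\<^esub>})"

subsection \<open>Normal domains\<close>

definition integral_over :: "('a, 'm) ring_scheme \<Rightarrow> 'a set \<Rightarrow> 'a \<Rightarrow> bool" where
  "integral_over K R x \<longleftrightarrow> (\<exists>n (c :: nat \<Rightarrow> 'a). (\<forall>i<n. c i \<in> R) \<and>
     x [^]\<^bsub>K\<^esub> n \<oplus>\<^bsub>K\<^esub> (\<Oplus>\<^bsub>K\<^esub>i\<in>{..<n}. c i \<otimes>\<^bsub>K\<^esub> x [^]\<^bsub>K\<^esub> i) = \<zero>\<^bsub>K\<^esub>)"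

definition normal_domain :: "('a, 'm) ring_scheme \<Rightarrow> bool" where
  "normal_domain R \<longleftrightarrow> domain R \<and>
     (let img = (\<lambda>a. mk_frac R (carrier R - {\<zero>\<^bsub>R\<^esub>}) a \<one>\<^bsub>R\<^esub>) ` carrier R in
      \<forall>x\<in>carrier (fraction_field R). integral_over (fraction_field R) img x \<longrightarrow> x \<in> img)"

subsection \<open>Regular rings\<close>

text \<open>The zero ring gets dimension \<open>0\<close> here; this is never used.\<close>

definition krull_dim :: "('a, 'm) ring_scheme \<Rightarrow> enat" where
  "krull_dim R = (SUP n \<in> {n. \<exists>p :: nat \<Rightarrow> 'a set.
     (\<forall>i\<le>n. primeideal (p i) R) \<and> (\<forall>i<n. p i \<subset> p (Suc i))}. enat n)"

definition local_noetherian_ring :: "('a, 'm) ring_scheme \<Rightarrow> bool" where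
  "local_noetherian_ring R \<longleftrightarrow> cring R \<and> noetherian_ring R \<and> (\<exists>!m. maximalideal m R)"

definition max_ideal :: "('a, 'm) ring_scheme \<Rightarrow> 'a set" where
  "max_ideal R = (THE m. maximalideal m R)"

definition regular_local_ring :: "('a, 'm) ring_scheme \<Rightarrow> bool" where
  "regular_local_ring R \<longleftrightarrow> local_noetherian_ring R \<and>
     (\<exists>S \<subseteq> carrier R. finite S \<and> genideal R S = max_ideal R \<and> enat (card S) = krull_dim R)"

definition regular_ring :: "('a, 'm) ring_scheme \<Rightarrow> bool" where
  "regular_ring R \<longleftrightarrow> cring R \<and> noetherian_ring R \<and>
     (\<forall>p. primeideal p R \<longrightarrow> regular_local_ring (loc_at_prime R p))"

subsection \<open>Adic completion and tensor products\<close>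

primrec ideal_power :: "('a, 'm) ring_scheme \<Rightarrow> 'a set \<Rightarrow> nat \<Rightarrow> 'a set" where
  "ideal_power R I 0 = carrier R"
| "ideal_power R I (Suc n) = ideal_prod R (ideal_power R I n) I"

text \<open>The inverse limit of the \<open>R/I\<^sup>n\<close>. Compatibility of a family of cosets means that the
  coset of \<open>I\<^sup>n\<^sup>+\<^sup>1\<close> is contained in the coset of \<open>I\<^sup>n\<close>.\<close>

definition adic_completion :: "('a, 'm) ring_scheme \<Rightarrow> 'a set \<Rightarrow> (nat \<Rightarrow> 'a set) ring" where
  "adic_completion R I = \<lparr>
     carrier = {x. (\<forall>n. x n \<in> carrier (R Quot ideal_power R I n)) \<and> (\<forall>n. x (Suc n) \<subseteq> x n)},
     mult = (\<lambda>x y n. x n \<otimes>\<^bsub>R Quot ideal_power R I n\<^esub> y n),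
     one = (\<lambda>n. \<one>\<^bsub>R Quot ideal_power R I n\<^esub>),
     zero = (\<lambda>n. \<zero>\<^bsub>R Quot ideal_power R I n\<^esub>),
     add = (\<lambda>x y n. x n \<oplus>\<^bsub>R Quot ideal_power R I n\<^esub> y n)\<rparr>"

definition to_adic_completion ::
    "('a, 'm) ring_scheme \<Rightarrow> 'a set \<Rightarrow> 'a \<Rightarrow> nat \<Rightarrow> 'a set" where
  "to_adic_completion R I a = (\<lambda>n. ideal_power R I n +>\<^bsub>R\<^esub> a)"

definition delta :: "'g \<Rightarrow> 'g \<Rightarrow> int" where
  "delta x = (\<lambda>y. if y = x then 1 else 0)"

text \<open>The monoid ring with integer coefficients.\<close>

definition monoid_ring :: "('g, 'm) monoid_scheme \<Rightarrow> ('g \<Rightarrow> int) ring" where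
  "monoid_ring M = \<lparr>
     carrier = {f. finite {x. f x \<noteq> 0} \<and> (\<forall>x. f x \<noteq> 0 \<longrightarrow> x \<in> carrier M)},
     mult = (\<lambda>f g z. \<Sum>(x, y) \<in> {(x, y). f x \<noteq> 0 \<and> g y \<noteq> 0 \<and> x \<otimes>\<^bsub>M\<^esub> y = z}. f x * g y),
     one = delta \<one>\<^bsub>M\<^esub>,
     zero = (\<lambda>_. 0),
     add = (\<lambda>f g x. f x + g x)\<rparr>"

text \<open>The tensor product of two commutative \<open>A\<close>-algebras \<open>f : A \<rightarrow> B\<close>, \<open>g : A \<rightarrow> C\<close>, as the quotient
  of the monoid ring on the multiplicative monoid \<open>B \<times> C\<close> by the relations of \<open>A\<close>-bilinearity.\<close>

definition tensor_relations ::
    "('a, 'm) ring_scheme \<Rightarrow> ('b, 'n) ring_scheme \<Rightarrow> ('c, 'k) ring_scheme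
      \<Rightarrow> ('a \<Rightarrow> 'b) \<Rightarrow> ('a \<Rightarrow> 'c) \<Rightarrow> ('b \<times> 'c \<Rightarrow> int) set" where
  "tensor_relations A B C f g =
     {\<lambda>z. delta (b \<oplus>\<^bsub>B\<^esub> b', c) z - delta (b, c) z - delta (b', c) z | b b' c.
        b \<in> carrier B \<and> b' \<in> carrier B \<and> c \<in> carrier C}
   \<union> {\<lambda>z. delta (b, c \<oplus>\<^bsub>C\<^esub> c') z - delta (b, c) z - delta (b, c') z | b c c'.
        b \<in> carrier B \<and> c \<in> carrier C \<and> c' \<in> carrier C}
   \<union> {\<lambda>z. delta (f a \<otimes>\<^bsub>B\<^esub> b, c) z - delta (b, g a \<otimes>\<^bsub>C\<^esub> c) z | a b c.
        a \<in> carrier A \<and> b \<in> carrier B \<and> c \<in> carrier C}"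

definition tensor_ideal ::
    "('a, 'm) ring_scheme \<Rightarrow> ('b, 'n) ring_scheme \<Rightarrow> ('c, 'k) ring_scheme
      \<Rightarrow> ('a \<Rightarrow> 'b) \<Rightarrow> ('a \<Rightarrow> 'c) \<Rightarrow> ('b \<times> 'c \<Rightarrow> int) set" where
  "tensor_ideal A B C f g = genideal (monoid_ring (B \<times>\<times> C)) (tensor_relations A B C f g)"

definition tensor ::
    "('a, 'm) ring_scheme \<Rightarrow> ('b, 'n) ring_scheme \<Rightarrow> ('c, 'k) ring_scheme
      \<Rightarrow> ('a \<Rightarrow> 'b) \<Rightarrow> ('a \<Rightarrow> 'c) \<Rightarrow> ('b \<times> 'c \<Rightarrow> int) set ring" where
  "tensor A B C f g = monoid_ring (B \<times>\<times> C) Quot tensor_ideal A B C f g"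

definition to_tensor_right ::
    "('a, 'm) ring_scheme \<Rightarrow> ('b, 'n) ring_scheme \<Rightarrow> ('c, 'k) ring_scheme
      \<Rightarrow> ('a \<Rightarrow> 'b) \<Rightarrow> ('a \<Rightarrow> 'c) \<Rightarrow> 'c \<Rightarrow> ('b \<times> 'c \<Rightarrow> int) set" where
  "to_tensor_right A B C f g c =
     tensor_ideal A B C f g +>\<^bsub>monoid_ring (B \<times>\<times> C)\<^esub> delta (\<one>\<^bsub>B\<^esub>, c)"

subsection \<open>Excellent rings\<close>

text \<open>A finitely generated algebra over (a ring on) \<open>'a\<close> has at most as many elements as the type
  \<open>'a + nat\<close>. Hence quantifying over ring structures on that type covers, up to isomorphism, all
  algebras of finite type; likewise for finite field extensions.\<close>

definition finite_type_algebra ::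
    "('a, 'm) ring_scheme \<Rightarrow> ('b, 'n) ring_scheme \<Rightarrow> ('a \<Rightarrow> 'b) \<Rightarrow> bool" where
  "finite_type_algebra A B f \<longleftrightarrow> cring B \<and> f \<in> ring_hom A B \<and>
     (\<exists>S \<subseteq> carrier B. finite S \<and> carrier B = generate_ring B (f ` carrier A \<union> S))"

definition prime_chains :: "('a, 'm) ring_scheme \<Rightarrow> 'a set \<Rightarrow> 'a set \<Rightarrow> 'a set set set" where
  "prime_chains R p q = {C. finite C \<and> chain\<^sub>\<subseteq> C \<and> p \<in> C \<and> q \<in> C \<and>
     (\<forall>r\<in>C. primeideal r R \<and> p \<subseteq> r \<and> r \<subseteq> q)}"

definition catenary :: "('a, 'm) ring_scheme \<Rightarrow> bool" where
  "catenary R \<longleftrightarrow> (\<forall>p q. primeideal p R \<and> primeideal q R \<and> p \<subseteq> q \<longrightarrow>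
     (\<exists>N. \<forall>C \<in> prime_chains R p q. card C \<le> N) \<and>
     (\<exists>n. \<forall>C \<in> prime_chains R p q.
        (\<forall>C' \<in> prime_chains R p q. C \<subseteq> C' \<longrightarrow> C' = C) \<longrightarrow> card C = n))"

definition universally_catenary :: "('a, 'm) ring_scheme \<Rightarrow> bool" where
  "universally_catenary A \<longleftrightarrow>
     (\<forall>(B :: ('a + nat) ring) f. finite_type_algebra A B f \<longrightarrow> catenary B)"

definition J2_ring :: "('a, 'm) ring_scheme \<Rightarrow> bool" where
  "J2_ring A \<longleftrightarrow> (\<forall>(B :: ('a + nat) ring) f. finite_type_algebra A B f \<longrightarrow>
     (\<exists>I. ideal I B \<and>
        (\<forall>p. primeideal p B \<longrightarrow> (regular_local_ring (loc_at_prime B p) \<longleftrightarrow> \<not> I \<subseteq> p))))"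

definition geometrically_regular ::
    "('k, 'm) ring_scheme \<Rightarrow> ('b, 'n) ring_scheme \<Rightarrow> ('k \<Rightarrow> 'b) \<Rightarrow> bool" where
  "geometrically_regular K B f \<longleftrightarrow> (\<forall>(L :: ('k + nat) ring) j.
     field L \<and> j \<in> ring_hom K L \<and> ring.finite_dimension L (j ` carrier K) (carrier L) \<longrightarrow>
     regular_ring (tensor K B L f j))"

definition residue_field :: "('a, 'm) ring_scheme \<Rightarrow> 'a set \<Rightarrow> ('a set \<times> 'a set) set ring" where
  "residue_field R q = fraction_field (R Quot q)"

definition to_residue_field ::
    "('a, 'm) ring_scheme \<Rightarrow> 'a set \<Rightarrow> 'a \<Rightarrow> ('a set \<times> 'a set) set" where
  "to_residue_field R q a =
     mk_frac (R Quot q) (carrier (R Quot q) - {\<zero>\<^bsub>R Quot q\<^esub>}) (q +>\<^bsub>R\<^esub> a) \<one>\<^bsub>R Quot q\<^esub>"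

text \<open>For a noetherian local ring \<open>R\<close>: all formal fibres are geometrically regular.\<close>

definition geom_regular_formal_fibres :: "('a, 'm) ring_scheme \<Rightarrow> bool" where
  "geom_regular_formal_fibres R \<longleftrightarrow> (\<forall>q. primeideal q R \<longrightarrow>
     (let C = adic_completion R (max_ideal R); i = to_adic_completion R (max_ideal R);
          K = residue_field R q; r = to_residue_field R q
      in geometrically_regular K (tensor R C K i r) (to_tensor_right R C K i r)))"

definition G_ring :: "('a, 'm) ring_scheme \<Rightarrow> bool" where
  "G_ring A \<longleftrightarrow> cring A \<and> noetherian_ring A \<and>
     (\<forall>p. primeideal p A \<longrightarrow> geom_regular_formal_fibres (loc_at_prime A p))"

definition excellent_ring :: "('a, 'm) ring_scheme \<Rightarrow> bool" where
  "excellent_ring A \<longleftrightarrow> cring A \<and> noetherian_ring A \<and>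
     universally_catenary A \<and> G_ring A \<and> J2_ring A"

section \<open>Topological rings\<close>

record 'a top_ring = "'a ring" + topo :: "'a topology"

definition topological_ring :: "('a, 'm) top_ring_scheme \<Rightarrow> bool" where
  "topological_ring R \<longleftrightarrow> cring R \<and> topspace (topo R) = carrier R \<and>
     continuous_map (prod_topology (topo R) (topo R)) (topo R) (\<lambda>(x, y). x \<oplus>\<^bsub>R\<^esub> y) \<and>
     continuous_map (topo R) (topo R) (\<lambda>x. \<ominus>\<^bsub>R\<^esub> x) \<and>
     continuous_map (prod_topology (topo R) (topo R)) (topo R) (\<lambda>(x, y). x \<otimes>\<^bsub>R\<^esub> y)"

definition cauchy_filter_on :: "('a, 'm) top_ring_scheme \<Rightarrow> 'a filter \<Rightarrow> bool" where
  "cauchy_filter_on R F \<longleftrightarrow> F \<noteq> bot \<and> eventually (\<lambda>x. x \<in> carrier R) F \<and>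
     (\<forall>U. openin (topo R) U \<and> \<zero>\<^bsub>R\<^esub> \<in> U \<longrightarrow>
        eventually (\<lambda>(x, y). x \<ominus>\<^bsub>R\<^esub> y \<in> U) (F \<times>\<^sub>F F))"

text \<open>Complete topological rings are understood to be Hausdorff.\<close>

definition complete_topological_ring :: "('a, 'm) top_ring_scheme \<Rightarrow> bool" where
  "complete_topological_ring R \<longleftrightarrow> topological_ring R \<and> Hausdorff_space (topo R) \<and>
     (\<forall>F. cauchy_filter_on R F \<longrightarrow> (\<exists>l. limitin (topo R) (\<lambda>x. x) l F))"

definition top_ring_hom ::
    "('a, 'm) top_ring_scheme \<Rightarrow> ('b, 'n) top_ring_scheme \<Rightarrow> ('a \<Rightarrow> 'b) \<Rightarrow> bool" where
  "top_ring_hom R S f \<longleftrightarrow> f \<in> ring_hom R S \<and> continuous_map (topo R) (topo S) f"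

definition top_ring_iso ::
    "('a, 'm) top_ring_scheme \<Rightarrow> ('b, 'n) top_ring_scheme \<Rightarrow> ('a \<Rightarrow> 'b) \<Rightarrow> bool" where
  "top_ring_iso R S f \<longleftrightarrow> f \<in> ring_iso R S \<and> homeomorphic_map (topo R) (topo S) f"

text \<open>\<open>f : R \<rightarrow> S\<close> exhibits \<open>S\<close> as the Hausdorff completion of \<open>R\<close>. (For topological groups it does
  not matter whether ``induced'' refers to the topology or to the uniformity.)\<close>

definition is_completion ::
    "('a, 'm) top_ring_scheme \<Rightarrow> ('b, 'n) top_ring_scheme \<Rightarrow> ('a \<Rightarrow> 'b) \<Rightarrow> bool" where
  "is_completion R S f \<longleftrightarrow> complete_topological_ring S \<and> f \<in> ring_hom R S \<and>
     topo R = pullback_topology (carrier R) f (topo S) \<and>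
     (topo S) closure_of (f ` carrier R) = carrier S"

definition adic_ring :: "('a, 'm) top_ring_scheme \<Rightarrow> bool" where
  "adic_ring A \<longleftrightarrow> topological_ring A \<and> (\<exists>I. ideal I A \<and>
     (\<forall>W. openin (topo A) W \<longleftrightarrow>
        W \<subseteq> carrier A \<and> (\<forall>x\<in>W. \<exists>n. ideal_power A I n +>\<^bsub>A\<^esub> x \<subseteq> W)))"

definition complete_noetherian_adic_ring :: "('a, 'm) top_ring_scheme \<Rightarrow> bool" where
  "complete_noetherian_adic_ring A \<longleftrightarrow>
     adic_ring A \<and> complete_topological_ring A \<and> noetherian_ring A"

subsection \<open>Rational localizations\<close>

definition powers :: "('a, 'm) ring_scheme \<Rightarrow> 'a \<Rightarrow> 'a set" where
  "powers A s = range (\<lambda>n :: nat. s [^]\<^bsub>A\<^esub> n)"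

text \<open>Huber's topological ring \<open>A(T/s)\<close> for an adic ring \<open>A\<close>: the ring \<open>A\<^sub>s\<close>, in which the subring
  \<open>D = A[t/s | t \<in> T]\<close> is open and carries the \<open>I\<cdot>D\<close>-adic topology for an ideal of definition \<open>I\<close>.
  Since every open ideal \<open>J\<close> of \<open>A\<close> contains a power of \<open>I\<close> and the powers of \<open>I\<close> are open, the
  ideals \<open>J\<cdot>D\<close> form a basis of neighbourhoods of \<open>0\<close>. For \<open>T = {1}\<close> one gets \<open>A\<^sub>s\<close> with
  its \<open>I\<close>-adic topology.\<close>

definition rat_loc :: "('a, 'm) top_ring_scheme \<Rightarrow> 'a set \<Rightarrow> 'a \<Rightarrow> ('a \<times> 'a) set top_ring" where
  "rat_loc A T s =
    (let S = powers A s; L = localization A S; i = (\<lambda>a. mk_frac A S a \<one>\<^bsub>A\<^esub>);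
         D = generate_ring L (i ` carrier A \<union> (\<lambda>t. mk_frac A S t s) ` T)
     in ring.extend L (top_ring.fields (topology_generated_by
          {genideal (L\<lparr>carrier := D\<rparr>) (i ` J) +>\<^bsub>L\<^esub> x | J x.
             ideal J A \<and> openin (topo A) J \<and> x \<in> carrier L})))"

text \<open>\<open>f : A \<rightarrow> S\<close> identifies \<open>S\<close> with \<open>A\<langle>T/s\<rangle>\<close>, the completion of \<open>A(T/s)\<close>, as an \<open>A\<close>-algebra.\<close>

definition completed_rat_loc ::
    "('a, 'm) top_ring_scheme \<Rightarrow> 'a set \<Rightarrow> 'a \<Rightarrow> ('b, 'n) top_ring_scheme \<Rightarrow> ('a \<Rightarrow> 'b) \<Rightarrow> bool" where
  "completed_rat_loc A T s S f \<longleftrightarrow> (\<exists>g. is_completion (rat_loc A T s) S g \<and>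
     (\<forall>a\<in>carrier A. g (mk_frac A (powers A s) a \<one>\<^bsub>A\<^esub>) = f a))"

section \<open>Valuations\<close>

record 'g value_group = "'g monoid" + leq :: "'g \<Rightarrow> 'g \<Rightarrow> bool"

definition ordered_comm_group :: "('g, 'm) value_group_scheme \<Rightarrow> bool" where
  "ordered_comm_group G \<longleftrightarrow> comm_group G \<and>
     (\<forall>x\<in>carrier G. \<forall>y\<in>carrier G. leq G x y \<or> leq G y x) \<and>
     (\<forall>x\<in>carrier G. \<forall>y\<in>carrier G. leq G x y \<and> leq G y x \<longrightarrow> x = y) \<and>
     (\<forall>x\<in>carrier G. \<forall>y\<in>carrier G. \<forall>z\<in>carrier G. leq G x y \<and> leq G y z \<longrightarrow> leq G x z) \<and>
     (\<forall>x\<in>carrier G. \<forall>y\<in>carrier G. \<forall>z\<in>carrier G.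
        leq G x y \<longrightarrow> leq G (x \<otimes>\<^bsub>G\<^esub> z) (y \<otimes>\<^bsub>G\<^esub> z))"

text \<open>Values lie in \<open>G \<union> {0}\<close>, with \<open>None\<close> for \<open>0\<close>.\<close>

fun leq0 :: "('g, 'm) value_group_scheme \<Rightarrow> 'g option \<Rightarrow> 'g option \<Rightarrow> bool" where
  "leq0 G None y \<longleftrightarrow> True"
| "leq0 G (Some x) None \<longleftrightarrow> False"
| "leq0 G (Some x) (Some y) \<longleftrightarrow> leq G x y"

fun mult0 :: "('g, 'm) value_group_scheme \<Rightarrow> 'g option \<Rightarrow> 'g option \<Rightarrow> 'g option" where
  "mult0 G (Some x) (Some y) = Some (x \<otimes>\<^bsub>G\<^esub> y)"
| "mult0 G _ _ = None"

definition valuation ::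
    "('a, 'm) ring_scheme \<Rightarrow> ('g, 'n) value_group_scheme \<Rightarrow> ('a \<Rightarrow> 'g option) \<Rightarrow> bool" where
  "valuation A G v \<longleftrightarrow> ordered_comm_group G \<and>
     (\<forall>a\<in>carrier A. v a \<in> insert None (Some ` carrier G)) \<and>
     v \<zero>\<^bsub>A\<^esub> = None \<and> v \<one>\<^bsub>A\<^esub> = Some \<one>\<^bsub>G\<^esub> \<and>
     (\<forall>a\<in>carrier A. \<forall>b\<in>carrier A. v (a \<otimes>\<^bsub>A\<^esub> b) = mult0 G (v a) (v b)) \<and>
     (\<forall>a\<in>carrier A. \<forall>b\<in>carrier A. leq0 G (v (a \<oplus>\<^bsub>A\<^esub> b)) (v a) \<or> leq0 G (v (a \<oplus>\<^bsub>A\<^esub> b)) (v b))"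

definition continuous_valuation ::
    "('a, 'm) top_ring_scheme \<Rightarrow> ('g, 'n) value_group_scheme \<Rightarrow> ('a \<Rightarrow> 'g option) \<Rightarrow> bool" where
  "continuous_valuation A G v \<longleftrightarrow> valuation A G v \<and>
     (\<forall>\<gamma> \<in> generate G {\<gamma>. \<exists>a\<in>carrier A. v a = Some \<gamma>}.
        openin (topo A) {a\<in>carrier A. leq0 G (v a) (Some \<gamma>) \<and> v a \<noteq> Some \<gamma>})"

text \<open>Two valuations are equivalent iff they induce the same relation \<open>v a \<le> v b\<close>, so an equivalence
  class is represented by that relation. The value group of a valuation on \<open>'a\<close> is generated by
  quotients \<open>v a / v b\<close>; hence the type \<open>('a \<times> 'a) set\<close> is large enough to contain it.\<close>

definition val_rel ::
    "('a, 'm) ring_scheme \<Rightarrow> ('g, 'n) value_group_scheme \<Rightarrow> ('a \<Rightarrow> 'g option) \<Rightarrow> 'a rel" where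
  "val_rel A G v = {(a, b). a \<in> carrier A \<and> b \<in> carrier A \<and> leq0 G (v a) (v b)}"

definition Spv :: "('a, 'm) ring_scheme \<Rightarrow> 'a rel set" where
  "Spv A = {val_rel A G v | (G :: ('a \<times> 'a) set value_group) v. valuation A G v}"

definition Cont :: "('a, 'm) top_ring_scheme \<Rightarrow> 'a rel set" where
  "Cont A = {val_rel A G v | (G :: ('a \<times> 'a) set value_group) v. continuous_valuation A G v}"

definition Spa :: "('a, 'm) top_ring_scheme \<Rightarrow> 'a set \<Rightarrow> 'a rel set" where
  "Spa A Aplus = {v \<in> Cont A. \<forall>f\<in>Aplus. (f, \<one>\<^bsub>A\<^esub>) \<in> v}"

definition Spa_topology :: "('a, 'm) top_ring_scheme \<Rightarrow> 'a set \<Rightarrow> 'a rel topology" where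
  "Spa_topology A Aplus = topology_generated_by
     {{v \<in> Spa A Aplus. (f, g) \<in> v \<and> (g, \<zero>\<^bsub>A\<^esub>) \<notin> v} | f g. f \<in> carrier A \<and> g \<in> carrier A}"

definition rational_datum :: "('a, 'm) top_ring_scheme \<Rightarrow> 'a set \<Rightarrow> 'a \<Rightarrow> bool" where
  "rational_datum A T s \<longleftrightarrow> finite T \<and> T \<noteq> {} \<and> T \<subseteq> carrier A \<and> s \<in> carrier A \<and>
     openin (topo A) (genideal A T)"

definition rational_subset ::
    "('a, 'm) top_ring_scheme \<Rightarrow> 'a set \<Rightarrow> 'a set \<Rightarrow> 'a \<Rightarrow> 'a rel set" where
  "rational_subset A Aplus T s =
     {v \<in> Spa A Aplus. (\<forall>t\<in>T. (t, s) \<in> v) \<and> (s, \<zero>\<^bsub>A\<^esub>) \<notin> v}"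

section \<open>Topologically ringed spaces\<close>

text \<open>Only the values of \<open>sect\<close> and \<open>restr\<close> on open sets are relevant; \<open>restr X U V\<close> is the
  restriction from \<open>U\<close> to \<open>V \<subseteq> U\<close>.\<close>

record ('x, 'a) trspace =
  under :: "'x topology"
  sect :: "'x set \<Rightarrow> 'a top_ring"
  restr :: "'x set \<Rightarrow> 'x set \<Rightarrow> 'a \<Rightarrow> 'a"

definition presheaf_of_complete_top_rings :: "('x, 'a, 'm) trspace_scheme \<Rightarrow> bool" where
  "presheaf_of_complete_top_rings X \<longleftrightarrow>
     (\<forall>U. openin (under X) U \<longrightarrow> complete_topological_ring (sect X U)) \<and>
     (\<forall>U V. openin (under X) U \<and> openin (under X) V \<and> V \<subseteq> U \<longrightarrow>
        top_ring_hom (sect X U) (sect X V) (restr X U V)) \<and>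
     (\<forall>U. openin (under X) U \<longrightarrow> (\<forall>f\<in>carrier (sect X U). restr X U U f = f)) \<and>
     (\<forall>U V W. openin (under X) U \<and> openin (under X) V \<and> openin (under X) W \<and> W \<subseteq> V \<and> V \<subseteq> U \<longrightarrow>
        (\<forall>f\<in>carrier (sect X U). restr X V W (restr X U V f) = restr X U W f))"

text \<open>A sheaf with values in topological rings: for every open cover the sections over \<open>U\<close> are the
  equalizer, with the topology induced from the product.\<close>

definition topologically_ringed_space :: "('x, 'a, 'm) trspace_scheme \<Rightarrow> bool" where
  "topologically_ringed_space X \<longleftrightarrow> presheaf_of_complete_top_rings X \<and>
     (\<forall>\<U>. (\<forall>V\<in>\<U>. openin (under X) V) \<longrightarrow>
        (\<forall>s. (\<forall>V\<in>\<U>. s V \<in> carrier (sect X V)) \<and>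
             (\<forall>V\<in>\<U>. \<forall>W\<in>\<U>. restr X V (V \<inter> W) (s V) = restr X W (V \<inter> W) (s W)) \<longrightarrow>
             (\<exists>!f. f \<in> carrier (sect X (\<Union>\<U>)) \<and> (\<forall>V\<in>\<U>. restr X (\<Union>\<U>) V f = s V))) \<and>
        embedding_map (topo (sect X (\<Union>\<U>))) (product_topology (\<lambda>V. topo (sect X V)) \<U>)
          (\<lambda>f. \<lambda>V\<in>\<U>. restr X (\<Union>\<U>) V f))"

definition germ :: "('x, 'a, 'm) trspace_scheme \<Rightarrow> 'x \<Rightarrow> 'x set \<Rightarrow> 'a \<Rightarrow> ('x set \<times> 'a) set" where
  "germ X x U f = {(V, g). openin (under X) V \<and> x \<in> V \<and> g \<in> carrier (sect X V) \<and>
     (\<exists>W. openin (under X) W \<and> x \<in> W \<and> W \<subseteq> U \<inter> V \<and> restr X U W f = restr X V W g)}"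

text \<open>As for localizations, the unions in the operations are over equal members.\<close>

definition stalk :: "('x, 'a, 'm) trspace_scheme \<Rightarrow> 'x \<Rightarrow> ('x set \<times> 'a) set ring" where
  "stalk X x = \<lparr>
     carrier = {germ X x U f | U f. openin (under X) U \<and> x \<in> U \<and> f \<in> carrier (sect X U)},
     mult = (\<lambda>P Q. \<Union>(U, f)\<in>P. \<Union>(V, g)\<in>Q. germ X x (U \<inter> V)
               (restr X U (U \<inter> V) f \<otimes>\<^bsub>sect X (U \<inter> V)\<^esub> restr X V (U \<inter> V) g)),
     one = germ X x (topspace (under X)) \<one>\<^bsub>sect X (topspace (under X))\<^esub>,
     zero = germ X x (topspace (under X)) \<zero>\<^bsub>sect X (topspace (under X))\<^esub>,
     add = (\<lambda>P Q. \<Union>(U, f)\<in>P. \<Union>(V, g)\<in>Q. germ X x (U \<inter> V)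
               (restr X U (U \<inter> V) f \<oplus>\<^bsub>sect X (U \<inter> V)\<^esub> restr X V (U \<inter> V) g))\<rparr>"

definition trspace_morphism ::
    "('y, 'b, 'm) trspace_scheme \<Rightarrow> ('x, 'a, 'n) trspace_scheme \<Rightarrow> ('y \<Rightarrow> 'x)
      \<Rightarrow> ('x set \<Rightarrow> 'a \<Rightarrow> 'b) \<Rightarrow> bool" where
  "trspace_morphism Y X \<pi> \<phi> \<longleftrightarrow> continuous_map (under Y) (under X) \<pi> \<and>
     (let pre = (\<lambda>U. {y \<in> topspace (under Y). \<pi> y \<in> U}) in
      (\<forall>U. openin (under X) U \<longrightarrow> top_ring_hom (sect X U) (sect Y (pre U)) (\<phi> U)) \<and>
      (\<forall>U V. openin (under X) U \<and> openin (under X) V \<and> V \<subseteq> U \<longrightarrow>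
         (\<forall>f\<in>carrier (sect X U). \<phi> V (restr X U V f) = restr Y (pre U) (pre V) (\<phi> U f))))"

section \<open>Formal schemes\<close>

definition Spf :: "('a, 'm) top_ring_scheme \<Rightarrow> 'a set set" where
  "Spf A = {p. primeideal p A \<and> openin (topo A) p}"

definition Spf_topology :: "('a, 'm) top_ring_scheme \<Rightarrow> 'a set topology" where
  "Spf_topology A = topology_generated_by {{p \<in> Spf A. f \<notin> p} | f. f \<in> carrier A}"

text \<open>The open subset \<open>U\<close>, with the restricted sheaf, is isomorphic to \<open>Spf A\<close> for the complete
  noetherian adic ring \<open>A = \<O>(U)\<close>, via \<open>h\<close> on points. The structure sheaf of \<open>Spf A\<close> is the sheaf of
  topological rings with value \<open>A\<langle>1/f\<rangle>\<close> (the completion of \<open>A\<^sub>f\<close>) on the basic open set \<open>D(f)\<close>, with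
  the \<open>A\<close>-algebra maps as restrictions; as the \<open>D(f)\<close> form a basis and continuous \<open>A\<close>-algebra maps
  between the \<open>A\<langle>1/f\<rangle>\<close> are unique, prescribing the \<open>A\<close>-algebras \<open>\<O>(h\<^sup>-\<^sup>1 D(f))\<close> determines the sheaf.\<close>

definition Spf_chart :: "('x, 'a, 'm) trspace_scheme \<Rightarrow> 'x set \<Rightarrow> ('x \<Rightarrow> 'a set) \<Rightarrow> bool" where
  "Spf_chart X U h \<longleftrightarrow> openin (under X) U \<and> complete_noetherian_adic_ring (sect X U) \<and>
     homeomorphic_map (subtopology (under X) U) (Spf_topology (sect X U)) h \<and>
     (\<forall>f\<in>carrier (sect X U).
        completed_rat_loc (sect X U) {\<one>\<^bsub>sect X U\<^esub>} f (sect X {x \<in> U. f \<notin> h x})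
          (restr X U {x \<in> U. f \<notin> h x}))"

definition formal_scheme :: "('x, 'a, 'm) trspace_scheme \<Rightarrow> bool" where
  "formal_scheme X \<longleftrightarrow> topologically_ringed_space X \<and>
     (\<forall>x\<in>topspace (under X). \<exists>U h. x \<in> U \<and> Spf_chart X U h)"

definition excellent_formal_scheme :: "('x, 'a, 'm) trspace_scheme \<Rightarrow> bool" where
  "excellent_formal_scheme X \<longleftrightarrow> formal_scheme X \<and>
     (\<forall>x\<in>topspace (under X). \<exists>U h. x \<in> U \<and> Spf_chart X U h \<and> excellent_ring (sect X U))"

definition normal_formal_scheme :: "('x, 'a, 'm) trspace_scheme \<Rightarrow> bool" where
  "normal_formal_scheme X \<longleftrightarrow> formal_scheme X \<and>
     (\<forall>x\<in>topspace (under X). normal_domain (stalk X x))"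

definition nowhere_discrete :: "('x, 'a, 'm) trspace_scheme \<Rightarrow> bool" where
  "nowhere_discrete X \<longleftrightarrow>
     \<not> (\<exists>U h. U \<noteq> {} \<and> Spf_chart X U h \<and>
          topo (sect X U) = discrete_topology (carrier (sect X U)))"

section \<open>Adic spaces\<close>

text \<open>\<open>stalk_val Y y\<close> is the equivalence class of valuations on the stalk at \<open>y\<close>.\<close>

record ('y, 'b) vspace = "('y, 'b) trspace" +
  stalk_val :: "'y \<Rightarrow> ('y set \<times> 'b) set rel"

definition valued_space :: "('y, 'b, 'm) vspace_scheme \<Rightarrow> bool" where
  "valued_space Y \<longleftrightarrow> topologically_ringed_space Y \<and>
     (\<forall>y\<in>topspace (under Y). stalk_val Y y \<in> Spv (stalk Y y))"

text \<open>The relation \<open>|f(y)| \<le> |g(y)|\<close> for sections over an open neighbourhood \<open>V\<close> of \<open>y\<close>.\<close>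

definition val_at :: "('y, 'b, 'm) vspace_scheme \<Rightarrow> 'y set \<Rightarrow> 'y \<Rightarrow> 'b rel" where
  "val_at Y V y = {(f, g). f \<in> carrier (sect Y V) \<and> g \<in> carrier (sect Y V) \<and>
     (germ Y y V f, germ Y y V g) \<in> stalk_val Y y}"

text \<open>The ring map \<open>\<psi> : A \<rightarrow> \<O>(V)\<close> defines an isomorphism of the open subspace \<open>V\<close> with the adic space
  \<open>Spa(A, A)\<close>. On points it is the pull-back of valuations along \<open>\<psi>\<close>. As for formal spectra, the
  structure sheaf of \<open>Spa(A, A)\<close> is determined by the \<open>A\<close>-algebras \<open>A\<langle>T/s\<rangle>\<close> over rational subsets,
  and the valuation at a point is the unique continuous extension of the given one on \<open>A\<close>.\<close>

definition Spa_chart ::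
    "('y, 'b, 'm) vspace_scheme \<Rightarrow> 'y set \<Rightarrow> ('a, 'n) top_ring_scheme \<Rightarrow> ('a \<Rightarrow> 'b) \<Rightarrow> bool" where
  "Spa_chart Y V A \<psi> \<longleftrightarrow> openin (under Y) V \<and> \<psi> \<in> ring_hom A (sect Y V) \<and>
     (let k = (\<lambda>y. {(f, g). f \<in> carrier A \<and> g \<in> carrier A \<and> (\<psi> f, \<psi> g) \<in> val_at Y V y}) in
      homeomorphic_map (subtopology (under Y) V) (Spa_topology A (carrier A)) k \<and>
      (\<forall>T s. rational_datum A T s \<longrightarrow>
         (let W = {y \<in> V. k y \<in> rational_subset A (carrier A) T s} in
          completed_rat_loc A T s (sect Y W) (\<lambda>a. restr Y V W (\<psi> a)) \<and>
          (\<forall>y\<in>W. val_at Y W y \<in> Cont (sect Y W)))))"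

text \<open>\<open>Y\<close>, with the morphism \<open>(\<pi>, \<phi>)\<close> to \<open>X\<close>, is the adic space attached to the formal scheme \<open>X\<close>: over
  every affine open \<open>U = Spf A\<close> it is \<open>Spa(A, A) \<rightarrow> Spf A\<close>, which maps \<open>v\<close> to the open prime ideal
  \<open>{f. v f < 1}\<close> and is the structure map \<open>A \<rightarrow> \<O>(Spa(A, A))\<close> on global sections. This
  determines \<open>Y\<close> up to unique isomorphism over \<open>X\<close>. An adic space
  covered by open subspaces \<open>Spa(A, A)\<close> need not come from a formal scheme (glue two copies of
  \<open>Spa(Z\<^sub>p, Z\<^sub>p)\<close> along the generic point), which is why \<open>X\<close> is part of the data.\<close>

definition attached_adic_space ::
    "('x, 'a, 'm) trspace_scheme \<Rightarrow> ('y, 'b, 'n) vspace_scheme \<Rightarrow> ('y \<Rightarrow> 'x)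
      \<Rightarrow> ('x set \<Rightarrow> 'a \<Rightarrow> 'b) \<Rightarrow> bool" where
  "attached_adic_space X Y \<pi> \<phi> \<longleftrightarrow> valued_space Y \<and> trspace_morphism Y X \<pi> \<phi> \<and>
     (\<forall>U h. Spf_chart X U h \<longrightarrow>
        (let V = {y \<in> topspace (under Y). \<pi> y \<in> U} in
         Spa_chart Y V (sect X U) (\<phi> U) \<and>
         (\<forall>y\<in>V. h (\<pi> y) = {f \<in> carrier (sect X U).
            (\<one>\<^bsub>sect Y V\<^esub>, \<phi> U f) \<notin> val_at Y V y})))"

text \<open>If the support of \<open>y\<close> in \<open>\<O>(V)\<close> is not open, then the same holds for all smaller neighbourhoods
  by continuity of restriction; so ``some \<open>V\<close>'' means ``all sufficiently small \<open>V\<close>''.\<close>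

definition analytic_points :: "('y, 'b, 'm) vspace_scheme \<Rightarrow> 'y set" where
  "analytic_points Y = {y \<in> topspace (under Y). \<exists>V. openin (under Y) V \<and> y \<in> V \<and>
     \<not> openin (topo (sect Y V)) {f \<in> carrier (sect Y V). (f, \<zero>\<^bsub>sect Y V\<^esub>) \<in> val_at Y V y}}"

definition plus_sections :: "('y, 'b, 'm) vspace_scheme \<Rightarrow> 'y set \<Rightarrow> 'b top_ring" where
  "plus_sections Y V =
    (let P = {f \<in> carrier (sect Y V). \<forall>y\<in>V. (f, \<one>\<^bsub>sect Y V\<^esub>) \<in> val_at Y V y}
     in (sect Y V)\<lparr>carrier := P, topo := subtopology (topo (sect Y V)) P\<rparr>)"

end

(*
  Locally X = Spf A with ideal of definition I = (f_0, ..., f_(r-1)). The analytic locus of Spa(A, A) is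
  covered by the rational subsets W_i = {|f_j| <= |f_i| for all j}, whose rings of functions are completions
  of the affine blowup algebras A[I/f_i]. So functions on the analytic locus with small restrictions to
  all W_i are controlled, degree by degree in the I-adic filtration, by the Cech cohomology of the
  graded module of the I^n on the blowup of I. A graded basis theorem and an induction on r show that
  H^0 and H^1 are as expected in large degrees: this gives both that the topology of A is induced from the
  analytic locus, and that every function there which is sufficiently small on all W_i comes from A.

  Let g be a function on the analytic locus with |g| <= 1. By continuity, g I^m is contained in A for
  some m. If g is not in A, take a prime p of the form (A : h g); as A is normal, h g does not map p to
  itself, so A_p is a discrete valuation ring in which g has a pole, and h g = u / t with a
  uniformizer t and a unit u. As p is an open prime, the valuation of A_p is an analytic point of Spa(A, A)
  with |g| > 1, a contradiction. Here I does not vanish in A_p: otherwise it vanishes on a component, which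
  is a chart with discrete ring of functions. The charts are glued by the sheaf property.
*)
theory Submission
  imports Defs
begin

section \<open>Filtrations by powers of an ideal\<close>

subsection \<open>Graded families of ideals\<close>

context cring begin

text \<open>Vanishing of cohomology in large degrees is all that can be expected, and it is enough
  for topological questions, as the \<open>I\<close>-adic topology only sees high powers. It says
  nothing about a function that is bounded but not small, and this gap is what normality has to
  fill. Normality, however, is a property of the stalks of the formal scheme, which are direct
  limits of completed localizations and not the rings \<open>A_p\<close>. The bridge is Krull's
  intersection theorem in the form: if locally at \<open>p\<close> an element lies in
  \<open>J + I^n\<close> for every \<open>n\<close>, then locally it lies in \<open>J\<close>. With
  \<open>J = 0\<close> it compares zero germs with zero in \<open>A_p\<close>, with \<open>J\<close>
  principal it brings divisibility down; it stands in for faithful flatness. Two encodings keep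
  everything inside one ring: a graded module is a pair of families of ideals, \<open>Q n\<close>
  inside \<open>P n\<close>, and a statement about \<open>A_p\<close> is one that holds up to a
  factor outside \<open>p\<close>. Sections over the \<open>W_i\<close> are likewise handled only as
  fractions modulo a step of a filtration, with exponents that depend on the step.\<close>

lemma ideal_zero: "ideal J R ==> \<zero> \<in> J"
 by (simp add: additive_subgroup.zero_closed ideal.axioms(1))

lemma ideal_add: "ideal J R ==> a \<in> J ==> b \<in> J ==> a \<oplus> b \<in> J"
 by (simp add: additive_subgroup.a_closed ideal.axioms(1))

lemma ideal_uminus: "ideal J R ==> a \<in> J ==> \<ominus> a \<in> J"
 by (simp add: additive_subgroup.a_inv_closed ideal.axioms(1))

lemma ideal_minus: "ideal J R ==> a \<in> J ==> b \<in> J ==> a \<ominus> b \<in> J"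
 by (simp add: a_minus_def ideal_add ideal_uminus)

lemma ideal_lmult: "ideal J R ==> a \<in> J ==> x \<in> carrier R ==> x \<otimes> a \<in> J"
 by (simp add: ideal.I_l_closed)

lemma ideal_rmult: "ideal J R ==> a \<in> J ==> x \<in> carrier R ==> a \<otimes> x \<in> J"
 by (simp add: ideal.I_r_closed)

lemma ideal_carr: "ideal J R ==> a \<in> J ==> a \<in> carrier R"
 by (rule ideal.Icarr)

lemma ideal_subst: "ideal J R ==> a \<ominus> b \<in> J ==> b \<in> J ==> a \<in> carrier R ==> a \<in> J"
proof -
 assume *: "ideal J R" "a \<ominus> b \<in> J" "b \<in> J" "a \<in> carrier R"
 have b: "b \<in> carrier R" using * ideal_carr by blast
 have "(a \<ominus> b) \<oplus> b \<in> J" using * ideal_add by blast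
 moreover have "(a \<ominus> b) \<oplus> b = a" using b *(4) by algebra
 ultimately show "a \<in> J" by simp
qed

lemma ideal_subst': "ideal J R ==> a \<ominus> b \<in> J ==> a \<in> J ==> b \<in> carrier R ==> b \<in> J"
proof -
 assume *: "ideal J R" "a \<ominus> b \<in> J" "a \<in> J" "b \<in> carrier R"
 have a: "a \<in> carrier R" using * ideal_carr by blast
 have "a \<ominus> (a \<ominus> b) \<in> J" using * ideal_minus by blast
 moreover have "a \<ominus> (a \<ominus> b) = b" using a *(4) by algebra
 ultimately show "b \<in> J" by simp
qed

lemma idealI':
 assumes "J \<subseteq> carrier R" "\<zero> \<in> J" "\<And>a b. a \<in> J ==> b \<in> J ==> a \<oplus> b \<in> J"
  "\<And>a x. a \<in> J ==> x \<in> carrier R ==> x \<otimes> a \<in> J"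
 shows "ideal J R"
proof (rule idealI)
 show "ring R" by (rule ring_axioms)
 show "subgroup J (add_monoid R)"
 proof (rule add.subgroupI)
  show "J \<subseteq> carrier R" "J \<noteq> {}" using assms by auto
  show "\<ominus> a \<in> J" if "a \<in> J" for a
  proof -
   have "\<ominus> \<one> \<otimes> a \<in> J" using assms(4) that by simp
   moreover have "\<ominus> \<one> \<otimes> a = \<ominus> a" using that assms(1) by (simp add: l_minus subset_eq)
   ultimately show ?thesis by simp
  qed
  show "a \<oplus> b \<in> J" if "a \<in> J" "b \<in> J" for a b using assms(3) that .
 qed
 show "x \<otimes> a \<in> J" if "a \<in> J" "x \<in> carrier R" for a x using assms(4) that .
 show "a \<otimes> x \<in> J" if "a \<in> J" "x \<in> carrier R" for a x
  using assms(1) assms(4)[OF that] that by (metis m_comm subsetD)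
qed

text \<open>This is the ideal \<open>Q + f 0 P + ... + f (r-1) P\<close>. The recursion splits off
  one generator at a time, which matches the later induction on \<open>r\<close>.\<close>

primrec comb :: "nat => (nat => 'a) => 'a set => 'a set => 'a set" where
 "comb 0 f P Q = Q"
| "comb (Suc r) f P Q = {x \<oplus> f r \<otimes> y | x y. x \<in> comb r f P Q \<and> y \<in> P}"

lemma comb_ideal:
 assumes "ideal P R" "ideal Q R" "\<forall>i<r. f i \<in> carrier R"
 shows "ideal (comb r f P Q) R"
 using assms(3)
proof (induction r)
 case 0
 then show ?case using assms by simp
next
 case (Suc r)
 then have I: "ideal (comb r f P Q) R" and f: "f r \<in> carrier R" by auto
 show ?case
 proof (rule idealI')
  show "comb (Suc r) f P Q \<subseteq> carrier R"
   using ideal_carr[OF I] ideal_carr[OF assms(1)] f by auto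
  show "\<zero> \<in> comb (Suc r) f P Q"
   using ideal_zero[OF I] ideal_zero[OF assms(1)] f by (auto intro!: exI[of _ \<zero>])
 next
  fix a b assume "a \<in> comb (Suc r) f P Q" "b \<in> comb (Suc r) f P Q"
  then obtain x y x' y' where *: "a = x \<oplus> f r \<otimes> y" "b = x' \<oplus> f r \<otimes> y'"
   "x \<in> comb r f P Q" "x' \<in> comb r f P Q" "y \<in> P" "y' \<in> P" by auto
  note c = *(3,4)[THEN ideal_carr[OF I]] *(5,6)[THEN ideal_carr[OF assms(1)]] f
  have "a \<oplus> b = (x \<oplus> x') \<oplus> f r \<otimes> (y \<oplus> y')" unfolding * using c by algebra
  moreover have "x \<oplus> x' \<in> comb r f P Q" "y \<oplus> y' \<in> P"
   using * ideal_add[OF I] ideal_add[OF assms(1)] by auto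
  ultimately show "a \<oplus> b \<in> comb (Suc r) f P Q" unfolding comb.simps by blast
 next
  fix a z assume "a \<in> comb (Suc r) f P Q" and z: "z \<in> carrier R"
  then obtain x y where *: "a = x \<oplus> f r \<otimes> y" "x \<in> comb r f P Q" "y \<in> P" by auto
  note c = *(2)[THEN ideal_carr[OF I]] *(3)[THEN ideal_carr[OF assms(1)]] f z
  have "z \<otimes> a = (z \<otimes> x) \<oplus> f r \<otimes> (z \<otimes> y)" unfolding * using c by algebra
  moreover have "z \<otimes> x \<in> comb r f P Q" "z \<otimes> y \<in> P"
   using * z ideal_lmult[OF I] ideal_lmult[OF assms(1)] by auto
  ultimately show "z \<otimes> a \<in> comb (Suc r) f P Q" unfolding comb.simps by blast
 qed
qed

lemma comb_mono: "P \<subseteq> P' ==> Q \<subseteq> Q' ==> comb r f P Q \<subseteq> comb r f P' Q'"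
 by (induction r) (simp, fastforce)

lemma comb_base:
 assumes "ideal P R" "ideal Q R" "\<forall>i<r. f i \<in> carrier R"
 shows "Q \<subseteq> comb r f P Q"
 using assms(3)
proof (induction r)
 case (Suc r)
 then have I: "ideal (comb r f P Q) R" and f: "f r \<in> carrier R" using comb_ideal assms by auto
 show ?case
 proof
  fix x assume "x \<in> Q"
  then have "x \<in> comb r f P Q" using Suc by auto
  moreover have "x = x \<oplus> f r \<otimes> \<zero>" using f ideal_carr[OF I calculation] by simp
  ultimately show "x \<in> comb (Suc r) f P Q" using ideal_zero[OF assms(1)] by auto
 qed
qed auto

lemma comb_gen:
 assumes "ideal P R" "ideal Q R" "\<forall>i<r. f i \<in> carrier R" "i < r" "y \<in> P"
 shows "f i \<otimes> y \<in> comb r f P Q"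
 using assms(3,4)
proof (induction r)
 case (Suc r)
 then have I: "ideal (comb r f P Q) R" and f: "f r \<in> carrier R" using comb_ideal assms by auto
 have fy: "f i \<otimes> y \<in> carrier R" using Suc.prems ideal_carr[OF assms(1,5)] by auto
 show ?case
 proof (cases "i = r")
  case True
  have "f i \<otimes> y = \<zero> \<oplus> f r \<otimes> y" using True fy by simp
  then show ?thesis using ideal_zero[OF I] assms(5) by auto
 next
  case False
  then have "f i \<otimes> y \<in> comb r f P Q" using Suc by auto
  moreover have "f i \<otimes> y = f i \<otimes> y \<oplus> f r \<otimes> \<zero>" using f fy by simp
  ultimately show ?thesis using ideal_zero[OF assms(1)] by auto
 qed
qed auto

lemma comb_least:
 assumes "ideal J R" "Q \<subseteq> J" "\<And>i y. i < r ==> y \<in> P ==> f i \<otimes> y \<in> J"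
 shows "comb r f P Q \<subseteq> J"
 using assms(3)
proof (induction r)
 case (Suc r)
 then have "comb r f P Q \<subseteq> J" by auto
 then show ?case using Suc.prems ideal_add[OF assms(1)] by auto
qed (use assms in auto)

text \<open>A graded module over the polynomial ring in \<open>r\<close> variables, the
  \<open>i\<close>-th variable acting as multiplication by \<open>f i\<close> from degree
  \<open>n\<close> to degree \<open>n + 1\<close>. The \<open>P n\<close> need not be decreasing.
  Together with a smaller family \<open>Q\<close> it represents the quotient
  \<open>P/Q\<close>.\<close>

definition gfam :: "nat => (nat => 'a) => (nat => 'a set) => bool" where
 "gfam r f P \<longleftrightarrow> (\<forall>i<r. f i \<in> carrier R) \<and> (\<forall>n. ideal (P n) R) \<and>
  (\<forall>n. \<forall>i<r. \<forall>x\<in>P n. f i \<otimes> x \<in> P (Suc n))"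

text \<open>Finite generation of the graded module \<open>P/Q\<close>: over a noetherian ring each
  single component is finitely generated anyway, so all that matters is that from some degree on
  every component comes from the one below.\<close>

definition fg :: "nat => (nat => 'a) => (nat => 'a set) => (nat => 'a set) => bool" where
 "fg r f P Q \<longleftrightarrow> (\<exists>d. \<forall>n\<ge>d. P (Suc n) \<subseteq> comb r f (P n) (Q (Suc n)))"

definition noe :: "nat => (nat => 'a) => (nat => 'a set) => (nat => 'a set) => bool" where
 "noe r f P Q \<longleftrightarrow> (\<forall>P'. gfam r f P' \<and> (\<forall>n. Q n \<subseteq> P' n \<and> P' n \<subseteq> P n) --> fg r f P' Q)"

lemma gfam_ideal: "gfam r f P ==> ideal (P n) R"
 and gfam_carr: "gfam r f P ==> i < r ==> f i \<in> carrier R"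
 and gfam_mult: "gfam r f P ==> i < r ==> x \<in> P n ==> f i \<otimes> x \<in> P (Suc n)"
 and gfam_Suc: "gfam (Suc r) f P ==> gfam r f P"
 unfolding gfam_def by auto

lemma gfam_elem: "gfam r f P ==> x \<in> P n ==> x \<in> carrier R"
 using gfam_ideal ideal_carr by blast

lemma gfam_pow:
 assumes "gfam r f P" "i < r" "x \<in> P n"
 shows "f i [^] (k::nat) \<otimes> x \<in> P (n + k)"
proof (induction k)
 case 0
 then show ?case using assms gfam_elem by auto
next
 case (Suc k)
 have "f i [^] (Suc k) \<otimes> x = f i \<otimes> (f i [^] k \<otimes> x)"
  using gfam_carr[OF assms(1,2)] gfam_elem[OF assms(1,3)] by (simp add: m_ac)
 then show ?case using gfam_mult[OF assms(1,2) Suc] by simp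
qed

text \<open>\<open>P/qhat\<close> is the cokernel of multiplication by \<open>t\<close> on
  \<open>P/Q\<close>. Multiplication raises the degree by one, so nothing is added in degree
  \<open>0\<close>.\<close>

definition qhat :: "'a => (nat => 'a set) => (nat => 'a set) => nat => 'a set" where
 "qhat t P Q n = (case n of 0 => Q 0 | Suc m => comb 1 (\<lambda>_. t) (P m) (Q (Suc m)))"

lemma qhat_0 [simp]: "qhat t P Q 0 = Q 0"
 and qhat_Suc: "qhat t P Q (Suc m) = {x \<oplus> t \<otimes> y | x y. x \<in> Q (Suc m) \<and> y \<in> P m}"
 by (simp_all add: qhat_def)

lemma qhat_ideal:
 assumes "gfam r f P" "gfam r f Q" "t \<in> carrier R"
 shows "ideal (qhat t P Q n) R"
proof (cases n)
 case 0
 then show ?thesis using assms gfam_ideal by simp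
next
 case (Suc m)
 have "ideal (comb 1 (\<lambda>_. t) (P m) (Q (Suc m))) R"
  by (rule comb_ideal) (use assms gfam_ideal in auto)
 then show ?thesis using Suc by (simp add: qhat_def)
qed

lemma qhat_base:
 assumes "gfam r f P" "gfam r f Q" "t \<in> carrier R"
 shows "Q n \<subseteq> qhat t P Q n"
proof (cases n)
 case (Suc m)
 have "Q (Suc m) \<subseteq> comb 1 (\<lambda>_. t) (P m) (Q (Suc m))"
  by (rule comb_base) (use assms gfam_ideal in auto)
 then show ?thesis using Suc by (simp add: qhat_def)
qed simp

lemma qhat_gen:
 assumes "gfam r f P" "gfam r f Q" "t \<in> carrier R" "y \<in> P m"
 shows "t \<otimes> y \<in> qhat t P Q (Suc m)"
proof -
 have "(\<lambda>_. t) 0 \<otimes> y \<in> comb 1 (\<lambda>_. t) (P m) (Q (Suc m))"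
  by (rule comb_gen) (use assms gfam_ideal in auto)
 then show ?thesis by (simp add: qhat_def)
qed

lemma qhat_gfam:
 assumes "gfam (Suc r) f P" "gfam (Suc r) f Q"
 shows "gfam r f (qhat (f r) P Q)"
proof -
 have t: "f r \<in> carrier R" using assms gfam_carr by auto
 note I = qhat_ideal[OF assms t]
 have "f i \<otimes> x \<in> qhat (f r) P Q (Suc n)" if i: "i < r" and x: "x \<in> qhat (f r) P Q n" for i n x
 proof (cases n)
  case 0
  then show ?thesis
   using x i gfam_mult[OF assms(2), of i x 0] qhat_base[OF assms t, of "Suc 0"] by auto
 next
  case (Suc m)
  with x obtain q y where *: "x = q \<oplus> f r \<otimes> y" "q \<in> Q (Suc m)" "y \<in> P m"
   by (auto simp: qhat_Suc)
  have c: "q \<in> carrier R" "y \<in> carrier R" "f i \<in> carrier R"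
   using * gfam_elem assms i gfam_carr[OF assms(1)] by (blast, blast, simp)
  have "f i \<otimes> x = f i \<otimes> q \<oplus> f r \<otimes> (f i \<otimes> y)" unfolding * using c t by algebra
  moreover have "f i \<otimes> q \<in> Q (Suc (Suc m))" "f i \<otimes> y \<in> P (Suc m)"
   using * gfam_mult assms i by auto
  ultimately show ?thesis unfolding Suc qhat_Suc by auto
 qed
 then show ?thesis using I gfam_carr[OF assms(1)] unfolding gfam_def by auto
qed

lemma qhat_sub:
 assumes "gfam (Suc r) f P" "gfam (Suc r) f Q" "\<And>n. Q n \<subseteq> P n"
 shows "qhat (f r) P Q n \<subseteq> P n"
proof (cases n)
 case 0
 then show ?thesis using assms by simp
next
 case (Suc m)
 show ?thesis unfolding Suc qhat_Suc
  using assms(3)[of "Suc m"] gfam_mult[OF assms(1), of r _ m]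
   ideal_add[OF gfam_ideal[OF assms(1)], of _ "Suc m"] by auto
qed

text \<open>Multiplication by \<open>f r\<close> has kernel and cokernel on \<open>P/Q\<close> on which \<open>f r\<close> acts as zero; this is
 what allows induction on \<open>r\<close>.\<close>

definition ker_t :: "'a => (nat => 'a set) => (nat => 'a set) => nat => 'a set" where
 "ker_t t P Q n = {x \<in> P n. t \<otimes> x \<in> Q (Suc n)}"

lemma ker_t_gfam:
 assumes "gfam (Suc r) f P" "gfam (Suc r) f Q"
 shows "gfam (Suc r) f (ker_t (f r) P Q)"
proof -
 have t: "f r \<in> carrier R" using assms gfam_carr by auto
 have "ideal (ker_t (f r) P Q n) R" for n
 proof (rule idealI')
  show "ker_t (f r) P Q n \<subseteq> carrier R" using gfam_elem[OF assms(1)] by (auto simp: ker_t_def)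
  show "\<zero> \<in> ker_t (f r) P Q n"
   using t assms gfam_ideal[THEN ideal_zero] by (auto simp: ker_t_def)
  show "a \<oplus> b \<in> ker_t (f r) P Q n" if "a \<in> ker_t (f r) P Q n" "b \<in> ker_t (f r) P Q n" for a b
   using that t assms gfam_ideal[THEN ideal_add] gfam_elem[OF assms(1)]
   by (auto simp: ker_t_def r_distr)
  show "x \<otimes> a \<in> ker_t (f r) P Q n" if "a \<in> ker_t (f r) P Q n" "x \<in> carrier R" for a x
  proof -
   have a: "a \<in> P n" "f r \<otimes> a \<in> Q (Suc n)" using that by (auto simp: ker_t_def)
   have "f r \<otimes> (x \<otimes> a) = x \<otimes> (f r \<otimes> a)"
    using that(2) t gfam_elem[OF assms(1) a(1)] by (simp add: m_ac)
   then show ?thesis using a that(2) gfam_ideal[OF assms(1)] gfam_ideal[OF assms(2)]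
    by (auto simp: ker_t_def ideal_lmult)
  qed
 qed
 moreover have "f i \<otimes> x \<in> ker_t (f r) P Q (Suc n)" if "i < Suc r" "x \<in> ker_t (f r) P Q n" for i n x
 proof -
  have x: "x \<in> P n" "f r \<otimes> x \<in> Q (Suc n)" using that by (auto simp: ker_t_def)
  have "f r \<otimes> (f i \<otimes> x) = f i \<otimes> (f r \<otimes> x)"
   using gfam_carr[OF assms(1) that(1)] t gfam_elem[OF assms(1) x(1)] by (simp add: m_ac)
  then show ?thesis
   using gfam_mult[OF assms(1) that(1) x(1)] gfam_mult[OF assms(2) that(1) x(2)]
   by (simp add: ker_t_def)
 qed
 ultimately show ?thesis using gfam_carr[OF assms(1)] unfolding gfam_def by auto
qed

lemma noe_sub: "noe r f P Q ==> (\<And>n. P' n \<subseteq> P n) ==> noe r f P' Q"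
 unfolding noe_def by (meson order_trans)

text \<open>When \<open>f r\<close> maps \<open>P\<close> into \<open>Q\<close>, a family between
  \<open>Q\<close> and \<open>P\<close> that is stable under the first \<open>r\<close> variables is
  stable under the last one as well, and the last one contributes only elements of \<open>Q\<close>
  to the generation. The smaller \<open>Q'\<close> is there because the noetherian property is known
  for \<open>P/Q'\<close> and wanted for its quotient \<open>P/Q\<close>.\<close>

lemma noe_drop:
 assumes noe: "noe (Suc r) f P Q'" and Q': "gfam (Suc r) f Q'" and Q: "gfam r f Q"
  and le: "\<And>n. Q' n \<subseteq> Q n"
  and kill: "\<And>n x. x \<in> P n ==> f r \<otimes> x \<in> Q (Suc n)"
 shows "noe r f P Q"
 unfolding noe_def
proof (intro allI impI)
 fix P' assume *: "gfam r f P' \<and> (\<forall>n. Q n \<subseteq> P' n \<and> P' n \<subseteq> P n)"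
 have t: "f r \<in> carrier R" using Q' gfam_carr by auto
 have mult: "f i \<otimes> x \<in> P' (Suc n)" if "i < Suc r" "x \<in> P' n" for i n x
 proof (cases "i = r")
  case True
  then show ?thesis using kill[of x n] that(2) * by auto
 next
  case False
  then show ?thesis using that * gfam_mult[of r f P'] by auto
 qed
 have g': "gfam (Suc r) f P'"
  using gfam_ideal[of r f P'] * mult gfam_carr[OF Q'] unfolding gfam_def[of "Suc r"] by blast
 moreover have "\<forall>n. Q' n \<subseteq> P' n \<and> P' n \<subseteq> P n" using * le by blast
 ultimately have "fg (Suc r) f P' Q'" using noe unfolding noe_def by blast
 then obtain d where d: "\<And>n. n \<ge> d ==> P' (Suc n) \<subseteq> comb (Suc r) f (P' n) (Q' (Suc n))"
  unfolding fg_def by blast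
 have "P' (Suc n) \<subseteq> comb r f (P' n) (Q (Suc n))" if "n \<ge> d" for n
 proof -
  have I: "ideal (comb r f (P' n) (Q (Suc n))) R"
   by (rule comb_ideal) (use g' Q gfam_ideal gfam_carr in auto)
  have "comb (Suc r) f (P' n) (Q' (Suc n)) \<subseteq> comb r f (P' n) (Q (Suc n))"
  proof (rule comb_least[OF I])
   have base: "Q (Suc n) \<subseteq> comb r f (P' n) (Q (Suc n))"
    by (rule comb_base) (use g' Q gfam_ideal gfam_carr in auto)
   then show "Q' (Suc n) \<subseteq> comb r f (P' n) (Q (Suc n))" using le by blast
   fix i y assume i: "i < Suc r" and y: "y \<in> P' n"
   show "f i \<otimes> y \<in> comb r f (P' n) (Q (Suc n))"
   proof (cases "i = r")
    case True
    then show ?thesis using kill[of y n] y * base by blast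
   next
    case False
    show ?thesis
     by (rule comb_gen) (use False i y g' Q gfam_ideal gfam_carr in auto)
   qed
  qed
  then show ?thesis using d[OF that] by blast
 qed
 then show "fg r f P' Q" unfolding fg_def by blast
qed

end

section \<open>Hilbert's basis theorem for graded modules\<close>

context cring begin

lemma ideal_minus_trans:
 assumes "ideal J R" "a \<ominus> b \<in> J" "b \<ominus> c \<in> J" "a \<in> carrier R" "b \<in> carrier R" "c \<in> carrier R"
 shows "a \<ominus> c \<in> J"
proof -
 have "(a \<ominus> b) \<oplus> (b \<ominus> c) \<in> J" using assms ideal_add by blast
 moreover have "(a \<ominus> b) \<oplus> (b \<ominus> c) = a \<ominus> c" using assms(4-6) by algebra
 ultimately show ?thesis by simp
qed

text \<open>Zorn's lemma applies to any class of ideals, since in a noetherian ring a nonempty chain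
  of ideals contains its own union.\<close>

lemma noetherian_maximal:
 assumes "noetherian_ring R" "I0 \<in> C" "\<And>I. I \<in> C ==> ideal I R"
 shows "\<exists>M\<in>C. I0 \<subseteq> M \<and> (\<forall>I\<in>C. M \<subseteq> I --> I = M)"
proof -
 let ?D = "{I \<in> C. I0 \<subseteq> I}"
 interpret noetherian_ring R by fact
 have "\<exists>U\<in>?D. \<forall>I\<in>c. I \<subseteq> U" if "subset.chain ?D c" for c
 proof (cases "c = {}")
  case True
  then show ?thesis using assms by auto
 next
  case False
  have "subset.chain {I. ideal I R} c"
   using that assms(3) unfolding subset.chain_def by auto
  then have "\<Union>c \<in> c" using ideal_chain_is_trivial[OF False] by auto
  then show ?thesis using that unfolding subset.chain_def by auto
 qed
 then obtain M where "M \<in> ?D" "\<forall>X\<in>?D. M \<subseteq> X --> X = M"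
  using subset_Zorn[of ?D] by blast
 then show ?thesis by (intro bexI[of _ M]) auto
qed

lemma noetherian_stable:
 assumes "noetherian_ring R" "\<And>k. ideal (L k) R" "\<And>k. L k \<subseteq> L (Suc k)"
 shows "\<exists>k. \<forall>j. L j \<subseteq> L k"
proof -
 have "\<exists>M\<in>range L. L 0 \<subseteq> M \<and> (\<forall>I\<in>range L. M \<subseteq> I --> I = M)"
  by (rule noetherian_maximal[OF assms(1)]) (use assms(2) in auto)
 then obtain M where M: "M \<in> range L" "\<forall>I\<in>range L. M \<subseteq> I --> I = M" by (elim bexE conjE)
 from M(1) obtain k where "M = L k" by (rule imageE)
 with M(2) have k: "I = L k" if "I \<in> range L" "L k \<subseteq> I" for I
  using that by (metis (no_types))
 have mono: "L i \<subseteq> L j" if "i \<le> j" for i j using lift_Suc_mono_le[of L i j] assms(3) that by blast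
 have "L j \<subseteq> L k" for j
 proof -
  have "L (max j k) = L k" using k[of "L (max j k)"] mono[of k "max j k"] by auto
  then show ?thesis using mono[of j "max j k"] by auto
 qed
 then show ?thesis by blast
qed

lemma ideal_Union_chain:
 assumes "\<And>k::nat. ideal (L k) R" "\<And>k. L k \<subseteq> L (Suc k)"
 shows "ideal (\<Union>k. L k) R"
proof (rule idealI')
 have mono: "L i \<subseteq> L j" if "i \<le> j" for i j using lift_Suc_mono_le[of L i j] assms(2) that by blast
 show "(\<Union>k. L k) \<subseteq> carrier R" using ideal_carr assms(1) by blast
 show "\<zero> \<in> (\<Union>k. L k)" using ideal_zero assms(1) by blast
 show "a \<oplus> b \<in> (\<Union>k. L k)" if ab: "a \<in> (\<Union>k. L k)" "b \<in> (\<Union>k. L k)" for a b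
 proof -
  obtain i j where "a \<in> L i" "b \<in> L j" using ab by blast
  then have "a \<in> L (max i j)" "b \<in> L (max i j)"
   using mono[of i "max i j"] mono[of j "max i j"] by auto
  then show ?thesis using ideal_add assms(1) by blast
 qed
 show "x \<otimes> a \<in> (\<Union>k. L k)" if "a \<in> (\<Union>k. L k)" "x \<in> carrier R" for a x
  using that ideal_lmult assms(1) by blast
qed

text \<open>The leading coefficients of Hilbert's proof: those \<open>x\<close> for which
  \<open>t^k x\<close> lies in \<open>N\<close>. Adding \<open>Qh\<close>, which will be
  \<open>qhat t P Q\<close>, makes the coefficient of \<open>t^k\<close> insensitive to terms with
  higher powers of \<open>t\<close>. The families increase with \<open>k\<close>.\<close>

definition tcol :: "'a => (nat => 'a set) => (nat => 'a set) => (nat => 'a set) => nat => nat => 'a set" where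
 "tcol t P Qh N k n = {x \<oplus> q | x q. x \<in> P n \<and> t [^] k \<otimes> x \<in> N (n + k) \<and> q \<in> Qh n}"

lemma tcol_ideal:
 assumes "gfam r f P" "gfam r f N" "ideal (Qh n) R" "t \<in> carrier R"
 shows "ideal (tcol t P Qh N k n) R"
proof (rule idealI')
 note IP = gfam_ideal[OF assms(1), of n] and IN = gfam_ideal[OF assms(2), of "n + k"]
 have tk: "t [^] k \<in> carrier R" using assms by simp
 show "tcol t P Qh N k n \<subseteq> carrier R"
  using ideal_carr[OF IP] ideal_carr[OF assms(3)] by (auto simp: tcol_def)
 show "\<zero> \<in> tcol t P Qh N k n"
  using ideal_zero[OF IP] ideal_zero[OF IN] ideal_zero[OF assms(3)] tk
  by (auto simp: tcol_def intro!: exI[of _ \<zero>])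
 fix a assume "a \<in> tcol t P Qh N k n"
 then obtain x q where a: "a = x \<oplus> q" "x \<in> P n" "t [^] k \<otimes> x \<in> N (n + k)" "q \<in> Qh n"
  by (auto simp: tcol_def)
 note c = ideal_carr[OF IP a(2)] ideal_carr[OF assms(3) a(4)]
 {
  fix b assume "b \<in> tcol t P Qh N k n"
  then obtain y q' where b: "b = y \<oplus> q'" "y \<in> P n" "t [^] k \<otimes> y \<in> N (n + k)" "q' \<in> Qh n"
   by (auto simp: tcol_def)
  note c' = ideal_carr[OF IP b(2)] ideal_carr[OF assms(3) b(4)]
  have "a \<oplus> b = (x \<oplus> y) \<oplus> (q \<oplus> q')" unfolding a b using c c' by algebra
  moreover have "t [^] k \<otimes> (x \<oplus> y) = t [^] k \<otimes> x \<oplus> t [^] k \<otimes> y" using c c' tk by algebra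
  then have "t [^] k \<otimes> (x \<oplus> y) \<in> N (n + k)" using ideal_add[OF IN a(3) b(3)] by simp
  ultimately show "a \<oplus> b \<in> tcol t P Qh N k n" unfolding tcol_def
   using ideal_add[OF IP a(2) b(2)] ideal_add[OF assms(3) a(4) b(4)] by blast
 }
 fix z assume z: "z \<in> carrier R"
 have "z \<otimes> a = z \<otimes> x \<oplus> z \<otimes> q" unfolding a using c z by algebra
 moreover have "t [^] k \<otimes> (z \<otimes> x) = z \<otimes> (t [^] k \<otimes> x)" using c z tk by (simp add: m_ac)
 then have "t [^] k \<otimes> (z \<otimes> x) \<in> N (n + k)" using ideal_lmult[OF IN a(3) z] by simp
 ultimately show "z \<otimes> a \<in> tcol t P Qh N k n" unfolding tcol_def
  using ideal_lmult[OF IP a(2) z] ideal_lmult[OF assms(3) a(4) z] by blast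
qed

text \<open>Hilbert's basis theorem for \<open>P/Q\<close> as a graded module over \<open>R[T\<^sub>0, ..., T\<^sub>r\<^sub>-\<^sub>1]\<close>.\<close>

theorem noe_if_fg:
 assumes noeth: "noetherian_ring R"
 shows "gfam r f P ==> gfam r f Q ==> (\<And>n. Q n \<subseteq> P n) ==> fg r f P Q ==> noe r f P Q"
proof (induction r arbitrary: P Q)
 case 0
 then show ?case unfolding noe_def fg_def by simp blast
next
 case (Suc r)
 note P = Suc.prems(1) and Q = Suc.prems(2) and QP = Suc.prems(3)
 let ?t = "f r" and ?Qh = "qhat (f r) P Q"
 have t: "?t \<in> carrier R" using P gfam_carr by auto
 have tk: "?t [^] (k::nat) \<in> carrier R" for k using t by simp
 note Qh = qhat_gfam[OF P Q] and QhP = qhat_sub[OF P Q QP]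
 have QQh: "Q n \<subseteq> ?Qh n" for n using qhat_base P Q t by blast
 \<comment> \<open>On \<open>P/?Qh\<close> the variable \<open>?t\<close> acts as zero, so the first
   \<open>r\<close> variables already generate it and the induction hypothesis applies.\<close>
 have noeh: "noe r f P ?Qh"
 proof (rule Suc.IH[OF gfam_Suc[OF P] Qh QhP])
  obtain d where d: "\<And>n. n \<ge> d ==> P (Suc n) \<subseteq> comb (Suc r) f (P n) (Q (Suc n))"
   using Suc.prems(4) unfolding fg_def by blast
  have "P (Suc n) \<subseteq> comb r f (P n) (?Qh (Suc n))" if "n \<ge> d" for n
  proof -
   have ci: "\<forall>i<r. f i \<in> carrier R" using gfam_carr[OF P] by auto
   have I: "ideal (comb r f (P n) (?Qh (Suc n))) R"
    by (rule comb_ideal[OF gfam_ideal[OF P] gfam_ideal[OF Qh] ci])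
   have b: "?Qh (Suc n) \<subseteq> comb r f (P n) (?Qh (Suc n))"
    by (rule comb_base[OF gfam_ideal[OF P] gfam_ideal[OF Qh] ci])
   have "comb (Suc r) f (P n) (Q (Suc n)) \<subseteq> comb r f (P n) (?Qh (Suc n))"
   proof (rule comb_least[OF I])
    show "Q (Suc n) \<subseteq> comb r f (P n) (?Qh (Suc n))" using b QQh by blast
    fix i y assume "i < Suc r" "y \<in> P n"
    then show "f i \<otimes> y \<in> comb r f (P n) (?Qh (Suc n))"
     using b qhat_gen[OF P Q t] comb_gen[OF gfam_ideal[OF P] gfam_ideal[OF Qh] ci]
     by (cases "i = r") auto
   qed
   then show ?thesis using d[OF that] by blast
  qed
  then show "fg r f P ?Qh" unfolding fg_def by blast
 qed
 show ?case unfolding noe_def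
 proof (intro allI impI)
  fix N assume "gfam (Suc r) f N \<and> (\<forall>n. Q n \<subseteq> N n \<and> N n \<subseteq> P n)"
  then have N: "gfam (Suc r) f N" and QN: "\<And>n. Q n \<subseteq> N n" and NP: "\<And>n. N n \<subseteq> P n" by auto
  define L where "L = tcol ?t P ?Qh N"
  have LI: "ideal (L k n) R" for k n
   unfolding L_def using tcol_ideal[of "Suc r" f P N ?Qh n ?t k] P N gfam_ideal[OF Qh] t by blast
  have QhL: "?Qh n \<subseteq> L k n" for k n
  proof
   fix q assume q: "q \<in> ?Qh n"
   have "q = \<zero> \<oplus> q" using gfam_elem[OF Qh q] by simp
   then show "q \<in> L k n" unfolding L_def tcol_def
    using q ideal_zero[OF gfam_ideal[OF P], of n] ideal_zero[OF gfam_ideal[OF N], of "n + k"] tk[of k]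
    by (intro CollectI exI[of _ \<zero>] exI[of _ q]) simp
  qed
  have LP: "L k n \<subseteq> P n" for k n
   using QhP[of n] ideal_add[OF gfam_ideal[OF P, of n]] by (auto simp: L_def tcol_def)
  have LS: "L k n \<subseteq> L (Suc k) n" for k n
  proof -
   have "?t [^] (Suc k) \<otimes> x \<in> N (n + Suc k)" if "?t [^] k \<otimes> x \<in> N (n + k)" "x \<in> P n" for x
   proof -
    have "?t [^] (Suc k) \<otimes> x = ?t \<otimes> (?t [^] k \<otimes> x)"
     using t gfam_elem[OF P that(2)] by (simp add: m_ac)
    moreover have "?t \<otimes> (?t [^] k \<otimes> x) \<in> N (Suc (n + k))"
     by (rule gfam_mult[OF N _ that(1)]) simp
    ultimately show ?thesis by (simp only: add_Suc_right)
   qed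
   then show ?thesis unfolding L_def tcol_def
    by (intro subsetI, elim CollectE exE conjE, intro CollectI exI conjI) auto
  qed
  have LM: "L i n \<subseteq> L j n" if "i \<le> j" for i j n
   using lift_Suc_mono_le[of "\<lambda>k. L k n" i j] LS that by blast
  have Lg: "gfam r f (L k)" for k
   unfolding gfam_def
  proof (intro conjI allI ballI impI)
   show "f i \<in> carrier R" if "i < r" for i using gfam_carr[OF P] that by auto
   show "ideal (L k n) R" for n by (rule LI)
   fix n i a assume i: "i < r" and "a \<in> L k n"
   then obtain x q where a: "a = x \<oplus> q" "x \<in> P n" "?t [^] k \<otimes> x \<in> N (n + k)" "q \<in> ?Qh n"
    by (auto simp: L_def tcol_def)
   have c: "x \<in> carrier R" "q \<in> carrier R" "f i \<in> carrier R"
    using gfam_elem[OF P] gfam_elem[OF Qh] a gfam_carr[OF P] i by auto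
   have "f i \<otimes> a = f i \<otimes> x \<oplus> f i \<otimes> q" unfolding a using c by algebra
   moreover have "?t [^] k \<otimes> (f i \<otimes> x) = f i \<otimes> (?t [^] k \<otimes> x)" using c tk[of k] by (simp add: m_ac)
   then have "?t [^] k \<otimes> (f i \<otimes> x) \<in> N (Suc n + k)" using gfam_mult[OF N _ a(3), of i] i by simp
   ultimately show "f i \<otimes> a \<in> L k (Suc n)" unfolding L_def tcol_def
    using gfam_mult[OF P _ a(2), of i] gfam_mult[OF Qh i a(4)] i by auto
  qed
  \<comment> \<open>The limit of the \<open>L k\<close>. Being finitely generated modulo
    \<open>?Qh\<close>, it is determined by the degrees up to \<open>d\<close>, and in each of these
    finitely many degrees the chain of the \<open>L k\<close> is stationary; so one
    \<open>k0\<close> works in all degrees.\<close>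
  define Li where "Li = (\<lambda>n. \<Union>k. L k n)"
  have "gfam r f Li"
   unfolding gfam_def
  proof (intro conjI allI ballI impI)
   show "f i \<in> carrier R" if "i < r" for i using gfam_carr[OF P] that by auto
   show "ideal (Li n) R" for n
    unfolding Li_def by (rule ideal_Union_chain) (rule LI, rule LS)
   show "f i \<otimes> x \<in> Li (Suc n)" if "i < r" "x \<in> Li n" for i n x
    using gfam_mult[OF Lg] that unfolding Li_def by blast
  qed
  moreover have "\<forall>n. ?Qh n \<subseteq> Li n \<and> Li n \<subseteq> P n" using QhL LP unfolding Li_def by blast
  ultimately have "fg r f Li ?Qh" using noeh unfolding noe_def by blast
  then obtain d where d: "\<And>n. n \<ge> d ==> Li (Suc n) \<subseteq> comb r f (Li n) (?Qh (Suc n))"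
   unfolding fg_def by blast
  have "\<exists>k. \<forall>j. L j n \<subseteq> L k n" for n
   by (rule noetherian_stable[OF noeth, of "\<lambda>k. L k n"]) (rule LI, rule LS)
  then have "\<forall>n. \<exists>k. \<forall>j. L j n \<subseteq> L k n" by blast
  from choice[OF this] obtain kk where kk: "\<And>n j. L j n \<subseteq> L (kk n) n" by blast
  define k0 where "k0 = Max (kk ` {..d})"
  have k0: "kk n \<le> k0" if "n \<le> d" for n unfolding k0_def using that by auto
  have Li0: "Li n \<subseteq> L k0 n" for n
  proof (cases "n \<le> d")
   case True
   then show ?thesis using kk[of _ n] LM[OF k0[OF True], of n] unfolding Li_def by blast
  next
   case False
   then have "d \<le> n" by simp
   then show ?thesis
   proof (induction n rule: dec_induct)
    case base
    then show ?case using kk[of _ d] LM[OF k0[of d], of d] unfolding Li_def by blast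
   next
    case (step n)
    have "Li (Suc n) \<subseteq> comb r f (Li n) (?Qh (Suc n))" using d step by simp
    also have "\<dots> \<subseteq> comb r f (L k0 n) (?Qh (Suc n))" using comb_mono[OF step.IH] by blast
    also have "\<dots> \<subseteq> L k0 (Suc n)"
     by (rule comb_least[OF LI QhL]) (rule gfam_mult[OF Lg])
    finally show ?case .
   qed
  qed
  have "fg r f (L k) ?Qh" for k using noeh Lg QhL LP unfolding noe_def by blast
  then have "\<forall>k. \<exists>D. \<forall>n\<ge>D. L k (Suc n) \<subseteq> comb r f (L k n) (?Qh (Suc n))"
   unfolding fg_def by blast
  from choice[OF this] obtain dd
   where dd: "\<And>k n. n \<ge> dd k ==> L k (Suc n) \<subseteq> comb r f (L k n) (?Qh (Suc n))" by blast
  \<comment> \<open>The finitely many families \<open>L k\<close> with \<open>k <= k0\<close> share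
    the bound \<open>D\<close>; for larger \<open>k\<close> they no longer grow. This is the origin
    of the bound \<open>D + k0\<close> below: if \<open>k + j = n\<close> and
    \<open>k <= k0\<close>, then \<open>j >= D\<close>.\<close>
  define D where "D = Max (dd ` {..k0})"
  have D: "dd k \<le> D" if "k \<le> k0" for k unfolding D_def using that by auto
  have "N (Suc n) \<subseteq> comb (Suc r) f (N n) (Q (Suc n))" if n: "n \<ge> D + k0" for n
  proof
   fix x assume x: "x \<in> N (Suc n)"
   define S where "S = comb (Suc r) f (N n) (Q (Suc n))"
   have ci: "\<forall>i<Suc r. f i \<in> carrier R" using gfam_carr[OF P] by auto
   have SI: "ideal S R" unfolding S_def
    by (rule comb_ideal[OF gfam_ideal[OF N] gfam_ideal[OF Q] ci])
   have QS: "Q (Suc n) \<subseteq> S" unfolding S_def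
    by (rule comb_base[OF gfam_ideal[OF N] gfam_ideal[OF Q] ci])
   have fS: "f i \<otimes> y \<in> S" if "i < Suc r" "y \<in> N n" for i y unfolding S_def
    by (rule comb_gen[OF gfam_ideal[OF N] gfam_ideal[OF Q] ci that])
   have SN: "S \<subseteq> N (Suc n)" unfolding S_def
    by (rule comb_least[OF gfam_ideal[OF N] QN]) (rule gfam_mult[OF N])
   have xc: "x \<in> carrier R" using gfam_elem[OF N x] .
   \<comment> \<open>Membership of \<open>w\<close> in \<open>G k j\<close> means that, modulo what
     is already generated, \<open>t^k w\<close> can be rewritten with one more factor
     \<open>t\<close>. That leading coefficients lie in \<open>G k j\<close> is the division
     step.\<close>
   define G where "G = (\<lambda>k j. {w \<in> carrier R. \<exists>w'\<in>P j. ?t [^] k \<otimes> w \<ominus> ?t [^] Suc k \<otimes> w' \<in> S})"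
   have Gin: "w \<in> G k j" if "w \<in> carrier R" "w' \<in> P j" "?t [^] k \<otimes> w \<ominus> ?t [^] Suc k \<otimes> w' = s" "s \<in> S"
    for w w' s k j
    unfolding G_def using that by blast
   have GI: "ideal (G k j) R" for k j
   proof (rule idealI')
    show "G k j \<subseteq> carrier R" unfolding G_def by auto
    have "?t [^] k \<otimes> \<zero> \<ominus> ?t [^] Suc k \<otimes> \<zero> = \<zero>" using tk t by (simp add: a_minus_def)
    then show "\<zero> \<in> G k j"
     using Gin[OF _ ideal_zero[OF gfam_ideal[OF P]] _ ideal_zero[OF SI]] by blast
    fix a assume a: "a \<in> G k j"
    then obtain a' where a': "a \<in> carrier R" "a' \<in> P j" "?t [^] k \<otimes> a \<ominus> ?t [^] Suc k \<otimes> a' \<in> S"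
     unfolding G_def by auto
    note ca = a'(1) gfam_elem[OF P a'(2)] tk[of k] tk[of "Suc k"]
    {
     fix b assume "b \<in> G k j"
     then obtain b' where b': "b \<in> carrier R" "b' \<in> P j" "?t [^] k \<otimes> b \<ominus> ?t [^] Suc k \<otimes> b' \<in> S"
      unfolding G_def by auto
     note cb = b'(1) gfam_elem[OF P b'(2)]
     have "?t [^] k \<otimes> (a \<oplus> b) \<ominus> ?t [^] Suc k \<otimes> (a' \<oplus> b')
       = (?t [^] k \<otimes> a \<ominus> ?t [^] Suc k \<otimes> a') \<oplus> (?t [^] k \<otimes> b \<ominus> ?t [^] Suc k \<otimes> b')"
      using ca cb by algebra
     then show "a \<oplus> b \<in> G k j"
      using Gin[OF _ ideal_add[OF gfam_ideal[OF P] a'(2) b'(2)] _ ideal_add[OF SI a'(3) b'(3)]]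
       a'(1) b'(1) by simp
    }
    fix z assume z: "z \<in> carrier R"
    have "?t [^] k \<otimes> (z \<otimes> a) \<ominus> ?t [^] Suc k \<otimes> (z \<otimes> a')
      = z \<otimes> (?t [^] k \<otimes> a \<ominus> ?t [^] Suc k \<otimes> a')"
     using ca z by algebra
    then show "z \<otimes> a \<in> G k j"
     using Gin[OF _ ideal_lmult[OF gfam_ideal[OF P] a'(2) z] _ ideal_lmult[OF SI a'(3) z]]
      a'(1) z by simp
   qed
   have QhG: "?Qh (Suc j) \<subseteq> G k j" if "k + j = n" for k j
   proof
    fix a assume "a \<in> ?Qh (Suc j)"
    then obtain q y where a: "a = q \<oplus> ?t \<otimes> y" "q \<in> Q (Suc j)" "y \<in> P j" by (auto simp: qhat_Suc)
    have c: "q \<in> carrier R" "y \<in> carrier R" using gfam_elem[OF Q a(2)] gfam_elem[OF P a(3)] by auto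
    have ts: "?t [^] Suc k = ?t [^] k \<otimes> ?t" by simp
    have "?t [^] k \<otimes> a \<ominus> ?t [^] Suc k \<otimes> y = ?t [^] k \<otimes> q"
     unfolding a ts using c tk[of k] t by algebra
    moreover have "?t [^] k \<otimes> q \<in> Q (Suc n)"
     using gfam_pow[OF Q _ a(2), of r k] that by (simp add: add.commute)
    ultimately show "a \<in> G k j"
     using Gin[OF _ a(3), of a k] a(1) c t QS by auto
   qed
   have LG: "L k (Suc j) \<subseteq> G k j" if kj: "k + j = n" for k j
   proof (cases "k \<le> k0")
    case True
    then have "j \<ge> dd k" using n kj D[OF True] by simp
    from dd[OF this] have "L k (Suc j) \<subseteq> comb r f (L k j) (?Qh (Suc j))" .
    also have "\<dots> \<subseteq> G k j"
    proof (rule comb_least[OF GI QhG[OF kj]])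
     fix i y assume i: "i < r" and "y \<in> L k j"
     then obtain u q where y: "y = u \<oplus> q" "u \<in> P j" "?t [^] k \<otimes> u \<in> N (j + k)" "q \<in> ?Qh j"
      by (auto simp: L_def tcol_def)
     have c: "u \<in> carrier R" "q \<in> carrier R" "f i \<in> carrier R"
      using gfam_elem[OF P y(2)] gfam_elem[OF Qh y(4)] gfam_carr[OF P] i by auto
     have "f i \<otimes> (?t [^] k \<otimes> u) \<in> S" using fS[of i] y(3) i kj by (simp add: add.commute)
     moreover have "f i \<otimes> (?t [^] k \<otimes> u) = ?t [^] k \<otimes> (f i \<otimes> u) \<ominus> ?t [^] Suc k \<otimes> \<zero>"
      using c tk[of k] tk[of "Suc k"] by algebra
     ultimately have "f i \<otimes> u \<in> G k j"
      using Gin[OF _ ideal_zero[OF gfam_ideal[OF P]], of "f i \<otimes> u" k] c by simp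
     moreover have "f i \<otimes> q \<in> G k j" using QhG[OF kj] gfam_mult[OF Qh i y(4)] by blast
     moreover have "f i \<otimes> y = f i \<otimes> u \<oplus> f i \<otimes> q" unfolding y using c by algebra
     ultimately show "f i \<otimes> y \<in> G k j" using ideal_add[OF GI] by simp
    qed
    finally show ?thesis .
   next
    \<comment> \<open>Beyond \<open>k0\<close> the leading coefficients for \<open>k\<close> are
      already leading coefficients for \<open>k' = k - 1\<close>. So \<open>t^k' u\<close> lies in
      \<open>N\<close>, in degree \<open>n\<close>, and its product with \<open>t\<close> is among
      the generated elements.\<close>
    case False
    then obtain k' where k': "k = Suc k'" "k0 \<le> k'" by (cases k) auto
    show ?thesis
    proof
     fix w assume "w \<in> L k (Suc j)"
     then have "w \<in> L k' (Suc j)" using Li0[of "Suc j"] LM[OF k'(2)] unfolding Li_def by blast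
     then obtain u q where w: "w = u \<oplus> q" "u \<in> P (Suc j)" "?t [^] k' \<otimes> u \<in> N (Suc j + k')"
      "q \<in> ?Qh (Suc j)"
      by (auto simp: L_def tcol_def)
     have c: "u \<in> carrier R" "q \<in> carrier R"
      using gfam_elem[OF P w(2)] gfam_elem[OF Qh w(4)] by auto
     have "Suc j + k' = n" using kj k' by simp
     then have "?t \<otimes> (?t [^] k' \<otimes> u) \<in> S" using fS[of r] w(3) by simp
     moreover have "?t \<otimes> (?t [^] k' \<otimes> u) = ?t [^] k \<otimes> u \<ominus> ?t [^] Suc k \<otimes> \<zero>"
      using c t tk[of k'] unfolding k' by (simp add: m_ac a_minus_def)
     ultimately have "u \<in> G k j"
      using Gin[OF _ ideal_zero[OF gfam_ideal[OF P]], of u k] c by simp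
     then show "w \<in> G k j" unfolding w using QhG[OF kj] w(4) ideal_add[OF GI] by blast
    qed
   qed
   have tN: "?t [^] k \<otimes> w \<in> N (Suc n)"
    if "x \<ominus> ?t [^] k \<otimes> w \<in> S" "w \<in> carrier R" for k :: nat and w
    by (rule ideal_subst'[OF gfam_ideal[OF N] _ x], use that SN in blast, use that(2) tk[of k] in simp)
   have mem: "w \<in> L k j" if "w \<in> P j" "?t [^] k \<otimes> w \<in> N (j + k)" for w j k
   proof -
    have "w = w \<oplus> \<zero>" using gfam_elem[OF P that(1)] by simp
    then show ?thesis unfolding L_def tcol_def
     using that ideal_zero[OF gfam_ideal[OF Qh]] by (intro CollectI exI[of _ w] exI[of _ \<zero>]) simp
   qed
   \<comment> \<open>Starting from \<open>x\<close> itself, the division is repeated until the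
     remaining cofactor has degree \<open>0\<close>.\<close>
   have step: "\<exists>w\<in>P (Suc n - k). x \<ominus> ?t [^] k \<otimes> w \<in> S" if "k \<le> Suc n" for k
    using that
   proof (induction k)
    case 0
    have "x \<ominus> ?t [^] (0::nat) \<otimes> x = \<zero>" using xc by (simp add: r_right_minus_eq)
    then have "x \<ominus> ?t [^] (0::nat) \<otimes> x \<in> S" using ideal_zero[OF SI] by (simp only:)
    then show ?case using x NP[of "Suc n"] by (intro bexI[of _ x]) auto
   next
    case (Suc k)
    then obtain w where w: "w \<in> P (Suc n - k)" "x \<ominus> ?t [^] k \<otimes> w \<in> S" by auto
    define j where "j = n - k"
    have kj: "k + j = n" "Suc n - k = Suc j" "Suc n - Suc k = j"
     using Suc.prems unfolding j_def by auto
    have wc: "w \<in> carrier R" using gfam_elem[OF P w(1)] .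
    have "?t [^] k \<otimes> w \<in> N (Suc j + k)" using tN[OF w(2) wc] kj(1) by (simp add: add.commute)
    moreover have "w \<in> P (Suc j)" using w(1) kj(2) by simp
    ultimately have "w \<in> G k j" using mem[of w "Suc j" k] LG[OF kj(1)] by blast
    then obtain w' where w': "w' \<in> P j" "?t [^] k \<otimes> w \<ominus> ?t [^] Suc k \<otimes> w' \<in> S"
     unfolding G_def by blast
    note cc = m_closed[OF tk[of k] wc] m_closed[OF tk[of "Suc k"] gfam_elem[OF P w'(1)]]
    have "x \<ominus> ?t [^] Suc k \<otimes> w' \<in> S"
     by (rule ideal_minus_trans[OF SI w(2) w'(2) xc cc])
    then show ?case using w'(1) unfolding kj(3) by (rule bexI)
   qed
   obtain w where w: "w \<in> P 0" "x \<ominus> ?t [^] Suc n \<otimes> w \<in> S"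
    using step[OF order_refl] unfolding diff_self_eq_0 by blast
   have wc: "w \<in> carrier R" using gfam_elem[OF P w(1)] .
   have "w \<in> L (Suc n) 0" using mem[OF w(1), of "Suc n"] tN[OF w(2) wc] unfolding add_0 by blast
   \<comment> \<open>In degree \<open>0\<close> no further division is possible. But since
     \<open>n >= k0\<close>, the leading coefficients for \<open>n + 1\<close> are those for
     \<open>n\<close>, so the last factor \<open>t\<close> can be split off from an element of
     \<open>N n\<close>.\<close>
   then have "w \<in> L n 0" using Li0[of 0] LM[of k0 n 0] n unfolding Li_def by auto
   then obtain u q where u: "w = u \<oplus> q" "u \<in> P 0" "?t [^] n \<otimes> u \<in> N n" "q \<in> Q 0"
    by (auto simp: L_def tcol_def)
   have c: "u \<in> carrier R" "q \<in> carrier R"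
    using gfam_elem[OF P u(2)] gfam_elem[OF Q u(4)] by auto
   have ts: "?t [^] Suc n = ?t [^] n \<otimes> ?t" by simp
   have "?t [^] Suc n \<otimes> w = ?t \<otimes> (?t [^] n \<otimes> u) \<oplus> ?t [^] Suc n \<otimes> q"
    unfolding u ts using c t tk[of n] by algebra
   moreover have "?t \<otimes> (?t [^] n \<otimes> u) \<in> S" using fS[of r] u(3) by simp
   moreover have "?t [^] Suc n \<otimes> q \<in> S" using gfam_pow[OF Q lessI u(4), of "Suc n"] QS unfolding add_0 by blast
   ultimately have "?t [^] Suc n \<otimes> w \<in> S" using ideal_add[OF SI] by simp
   then show "x \<in> comb (Suc r) f (N n) (Q (Suc n))"
    using ideal_subst[OF SI w(2) _ xc] unfolding S_def by blast
  qed
  then show "fg (Suc r) f N Q" unfolding fg_def by blast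
 qed
qed

end

section \<open>Local cohomology in degrees 0 and 1, far out in the grading\<close>

context cring begin

text \<open>Vanishing of the local cohomology of \<open>P/Q\<close> with support in the common zeros
  of the variables, in degree \<open>n\<close> of the grading: its \<open>H^0\<close> consists of
  the elements that are killed by powers of all variables.\<close>

definition H0_vanishes :: "nat => (nat => 'a) => (nat => 'a set) => (nat => 'a set) => nat => bool" where
 "H0_vanishes r f P Q n \<longleftrightarrow>
  (\<forall>x\<in>P n. (\<forall>i<r. \<exists>L::nat. f i [^] L \<otimes> x \<in> Q (n + L)) --> x \<in> Q n)"

text \<open>The family \<open>x\<close> stands for the fractions \<open>x i / f i ^ L\<close> of degree \<open>n\<close>.\<close>

definition cocycle :: "nat => (nat => 'a) => (nat => 'a set) => (nat => 'a set) => nat => nat => (nat => 'a) => bool" where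
 "cocycle r f P Q n L x \<longleftrightarrow> (\<forall>i<r. x i \<in> P (n + L)) \<and>
  (\<forall>i<r. \<forall>j<r. f j [^] L \<otimes> x i \<ominus> f i [^] L \<otimes> x j \<in> Q (n + L + L))"

text \<open>The exponent \<open>M\<close> expresses equality of fractions in the localization at
  \<open>f i\<close>. In a cocycle the corresponding exponent is absorbed into
  \<open>L\<close>.\<close>

definition coboundary :: "nat => (nat => 'a) => (nat => 'a set) => (nat => 'a set) => nat => nat => (nat => 'a) => bool" where
 "coboundary r f P Q n L x \<longleftrightarrow>
  (\<exists>y\<in>P n. \<exists>M::nat. \<forall>i<r. f i [^] M \<otimes> (f i [^] L \<otimes> y \<ominus> x i) \<in> Q (n + L + M))"

text \<open>The first local cohomology is the cokernel of the map from \<open>P n / Q n\<close> to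
  compatible families of fractions; so the vanishing amounts to every such family coming from a
  global element.\<close>

definition H1_vanishes :: "nat => (nat => 'a) => (nat => 'a set) => (nat => 'a set) => nat => bool" where
 "H1_vanishes r f P Q n \<longleftrightarrow> (\<forall>L x. cocycle r f P Q n L x --> coboundary r f P Q n L x)"

lemma gfam_pow':
 assumes "gfam r f P" "i < r" "x \<in> P n" "m = n + k"
 shows "f i [^] (k::nat) \<otimes> x \<in> P m"
 using gfam_pow[OF assms(1-3)] assms(4) by simp

text \<open>If \<open>f r^(L+1) x\<close> lies in \<open>Q\<close>, then \<open>f r^L x\<close> lies
  in the kernel of \<open>f r\<close>, where \<open>H^0\<close> for the remaining variables
  vanishes; so the exponent can be lowered one by one. On the way all degrees above \<open>n\<close>
  are met, hence the hypothesis for all of them.\<close>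

lemma H0_step:
 assumes P: "gfam (Suc r) f P" and Q: "gfam (Suc r) f Q"
  and H0: "\<And>n. n \<ge> n0 ==> H0_vanishes r f (ker_t (f r) P Q) Q n" and n: "n \<ge> n0"
 shows "H0_vanishes (Suc r) f P Q n"
 unfolding H0_vanishes_def
proof (intro ballI impI)
 fix x assume x: "x \<in> P n" and *: "\<forall>i<Suc r. \<exists>L::nat. f i [^] L \<otimes> x \<in> Q (n + L)"
 have t: "f r \<in> carrier R" using gfam_carr[OF P] by simp
 have xc: "x \<in> carrier R" using gfam_elem[OF P x] .
 obtain L :: nat where "f r [^] L \<otimes> x \<in> Q (n + L)" using * by blast
 then have "x \<in> Q n"
 proof (induction L)
  case 0
  then show ?case using xc by simp
 next
  case (Suc L)
  let ?y = "f r [^] L \<otimes> x"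
  have "f r \<otimes> ?y = f r [^] Suc L \<otimes> x" using t xc by (simp add: m_ac)
  then have "?y \<in> ker_t (f r) P Q (n + L)"
   using Suc.prems gfam_pow[OF P lessI x, of L] unfolding ker_t_def by simp
  moreover have "\<exists>M::nat. f i [^] M \<otimes> ?y \<in> Q (n + L + M)" if i: "i < r" for i
  proof -
   obtain M :: nat where M: "f i [^] M \<otimes> x \<in> Q (n + M)" using * less_SucI[OF i] by blast
   have "f i [^] M \<otimes> ?y = f r [^] L \<otimes> (f i [^] M \<otimes> x)"
    using gfam_carr[OF P, of i] i t xc by (simp add: m_ac)
   moreover have "f r [^] L \<otimes> (f i [^] M \<otimes> x) \<in> Q (n + L + M)"
    by (rule gfam_pow'[OF Q lessI M]) simp
   ultimately show ?thesis by (intro exI[of _ M]) (simp only:)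
  qed
  ultimately have "?y \<in> Q (n + L)" using H0[of "n + L"] n unfolding H0_vanishes_def by auto
  then show ?case by (rule Suc.IH)
 qed
 then show "x \<in> Q n" .
qed

text \<open>A diagram chase with \<open>t = f r\<close>. Let \<open>y\<close> be a global element
  for the family \<open>t x\<close>. Locally \<open>y\<close> is a multiple of \<open>t\<close>
  modulo \<open>Q\<close>, hence globally by \<open>H^0\<close> of the cokernel:
  \<open>y = q + t w\<close>. Then \<open>x - w\<close> is a cocycle in the kernel of
  \<open>t\<close>, and \<open>H^1\<close> of the kernel provides the correction
  \<open>v\<close>.\<close>

lemma coboundary_step:
 assumes P: "gfam (Suc r) f P" and Q: "gfam (Suc r) f Q" and QP: "\<And>n. Q n \<subseteq> P n"
  and H0: "H0_vanishes r f P (qhat (f r) P Q) (Suc n)"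
  and H1: "H1_vanishes r f (ker_t (f r) P Q) Q n"
  and x: "cocycle (Suc r) f P Q n L x"
  and cob: "coboundary (Suc r) f P Q (Suc n) L (\<lambda>i. f r \<otimes> x i)"
 shows "coboundary (Suc r) f P Q n L x"
proof -
 let ?t = "f r"
 have fc: "f i \<in> carrier R" if "i < Suc r" for i using gfam_carr[OF P that] .
 have fp: "f i [^] (k::nat) \<in> carrier R" if "i < Suc r" for i k using fc[OF that] by simp
 have t: "?t \<in> carrier R" using fc by simp
 have xP: "x i \<in> P (n + L)" if "i < Suc r" for i using x that unfolding cocycle_def by blast
 have xc: "x i \<in> carrier R" if "i < Suc r" for i using gfam_elem[OF P xP[OF that]] .
 have xx: "f j [^] L \<otimes> x i \<ominus> f i [^] L \<otimes> x j \<in> Q (n + L + L)" if "i < Suc r" "j < Suc r" for i j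
  using x that unfolding cocycle_def by blast
 obtain y M where y: "y \<in> P (Suc n)"
  and M: "\<And>i. i < Suc r ==> f i [^] (M::nat) \<otimes> (f i [^] L \<otimes> y \<ominus> ?t \<otimes> x i) \<in> Q (Suc n + L + M)"
  using cob unfolding coboundary_def by blast
 have yc: "y \<in> carrier R" using gfam_elem[OF P y] .
 have "y \<in> qhat ?t P Q (Suc n)"
 proof -
  have "\<exists>K::nat. f i [^] K \<otimes> y \<in> qhat ?t P Q (Suc n + K)" if i: "i < r" for i
  proof -
   have i': "i < Suc r" using i by simp
   note c = fp[OF i', of M] fp[OF i', of L] xc[OF i'] yc t
   have "f i [^] (M + L) \<otimes> y = f i [^] M \<otimes> f i [^] L \<otimes> y" using fc[OF i'] by (simp add: nat_pow_mult)
   also have "\<dots> = f i [^] M \<otimes> (f i [^] L \<otimes> y \<ominus> ?t \<otimes> x i) \<oplus> ?t \<otimes> (f i [^] M \<otimes> x i)"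
    using c by algebra
   finally have e: "f i [^] (M + L) \<otimes> y = f i [^] M \<otimes> (f i [^] L \<otimes> y \<ominus> ?t \<otimes> x i) \<oplus> ?t \<otimes> (f i [^] M \<otimes> x i)" .
   have "f i [^] M \<otimes> x i \<in> P (n + (M + L))" by (rule gfam_pow'[OF P i' xP[OF i']]) simp
   moreover have "Suc n + L + M = Suc (n + (M + L))" by simp
   then have "f i [^] M \<otimes> (f i [^] L \<otimes> y \<ominus> ?t \<otimes> x i) \<in> Q (Suc (n + (M + L)))"
    using M[OF i'] by (simp only:)
   ultimately have "f i [^] (M + L) \<otimes> y \<in> qhat ?t P Q (Suc (n + (M + L)))"
    unfolding e qhat_Suc by blast
   then show ?thesis by (intro exI[of _ "M + L"]) (simp only: add_Suc)
  qed
  then show ?thesis using H0 y unfolding H0_vanishes_def by blast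
 qed
 then obtain q w where yw: "y = q \<oplus> ?t \<otimes> w" "q \<in> Q (Suc n)" "w \<in> P n" by (auto simp: qhat_Suc)
 have qc: "q \<in> carrier R" and wc: "w \<in> carrier R" using gfam_elem[OF Q yw(2)] gfam_elem[OF P yw(3)] .
 \<comment> \<open>The factor \<open>f i [^] M\<close> turns the vanishing of
   \<open>t (x i - f i^L w)\<close> in a localization into an honest membership in \<open>Q\<close>,
   at the price of replacing \<open>L\<close> by \<open>L + M\<close>.\<close>
 define z where "z = (\<lambda>i. f i [^] M \<otimes> (x i \<ominus> f i [^] L \<otimes> w))"
 have zc: "z i \<in> carrier R" if "i < Suc r" for i
  unfolding z_def using xc[OF that] fp[OF that] wc by simp
 have tz: "?t \<otimes> z i \<in> Q (Suc (n + (L + M)))" if i: "i < Suc r" for i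
 proof -
  note c = fp[OF i, of M] fp[OF i, of L] xc[OF i] t qc wc
  have "?t \<otimes> z i = f i [^] M \<otimes> (f i [^] L \<otimes> q) \<ominus> f i [^] M \<otimes> (f i [^] L \<otimes> y \<ominus> ?t \<otimes> x i)"
   unfolding z_def yw(1) using c by algebra
  moreover have "f i [^] L \<otimes> q \<in> Q (Suc n + L)" by (rule gfam_pow[OF Q i yw(2)])
  then have "f i [^] M \<otimes> (f i [^] L \<otimes> q) \<in> Q (Suc n + L + M)" by (rule gfam_pow[OF Q i])
  ultimately have "?t \<otimes> z i \<in> Q (Suc n + L + M)"
   using ideal_minus[OF gfam_ideal[OF Q] _ M[OF i]] by simp
  moreover have "Suc n + L + M = Suc (n + (L + M))" by simp
  ultimately show ?thesis by (simp only:)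
 qed
 have zP: "z i \<in> P (n + (L + M))" if i: "i < Suc r" for i
 proof -
  have "f i [^] L \<otimes> w \<in> P (n + L)" by (rule gfam_pow[OF P i yw(3)])
  then have "x i \<ominus> f i [^] L \<otimes> w \<in> P (n + L)" by (rule ideal_minus[OF gfam_ideal[OF P] xP[OF i]])
  then show ?thesis unfolding z_def by (rule gfam_pow'[OF P i]) simp
 qed
 have "cocycle r f (ker_t ?t P Q) Q n (L + M) z"
  unfolding cocycle_def
 proof (intro conjI allI impI)
  fix i assume i: "i < r"
  then show "z i \<in> ker_t ?t P Q (n + (L + M))" unfolding ker_t_def using tz zP by simp
  fix j assume j: "j < r"
  have ij: "i < Suc r" "j < Suc r" using i j by auto
  note c = fp[OF ij(1), of M] fp[OF ij(1), of L] fp[OF ij(2), of M] fp[OF ij(2), of L]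
   xc[OF ij(1)] xc[OF ij(2)] wc
  have e: "f j [^] (L + M) \<otimes> z i \<ominus> f i [^] (L + M) \<otimes> z j
   = f j [^] M \<otimes> (f i [^] M \<otimes> (f j [^] L \<otimes> x i \<ominus> f i [^] L \<otimes> x j))"
   unfolding z_def nat_pow_mult[OF fc[OF ij(1)], symmetric] nat_pow_mult[OF fc[OF ij(2)], symmetric]
   using c by algebra
  have "f i [^] M \<otimes> (f j [^] L \<otimes> x i \<ominus> f i [^] L \<otimes> x j) \<in> Q (n + L + L + M)"
   by (rule gfam_pow[OF Q ij(1) xx[OF ij]])
  then have "f j [^] M \<otimes> (f i [^] M \<otimes> (f j [^] L \<otimes> x i \<ominus> f i [^] L \<otimes> x j)) \<in> Q (n + (L + M) + (L + M))"
   by (rule gfam_pow'[OF Q ij(2)]) simp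
  then show "f j [^] (L + M) \<otimes> z i \<ominus> f i [^] (L + M) \<otimes> z j \<in> Q (n + (L + M) + (L + M))"
   unfolding e .
 qed
 then obtain v M' where v: "v \<in> ker_t ?t P Q n"
  and M': "\<And>i. i < r ==> f i [^] (M'::nat) \<otimes> (f i [^] (L + M) \<otimes> v \<ominus> z i) \<in> Q (n + (L + M) + M')"
  using H1 unfolding H1_vanishes_def coboundary_def by blast
 have vP: "v \<in> P n" and vt: "?t \<otimes> v \<in> Q (Suc n)" using v unfolding ker_t_def by auto
 have vc: "v \<in> carrier R" using gfam_elem[OF P vP] .
 \<comment> \<open>The index \<open>r\<close> is not covered by the cohomology of the first
   \<open>r\<close> variables. There \<open>f r\<close> itself kills both \<open>v\<close> and
   \<open>z r\<close> modulo \<open>Q\<close>, which costs one more factor; hence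
   \<open>Suc M'\<close>.\<close>
 have M'': "f i [^] (Suc M') \<otimes> (f i [^] (L + M) \<otimes> v \<ominus> z i) \<in> Q (n + (L + M) + Suc M')" if i: "i < Suc r" for i
 proof (cases "i = r")
  case True
  have vp: "f i [^] (L + M) \<otimes> v \<in> carrier R" using fp[OF i] vc by simp
  have "?t \<otimes> (f r [^] (L + M) \<otimes> v \<ominus> z r) = f r [^] (L + M) \<otimes> (?t \<otimes> v) \<ominus> ?t \<otimes> z r"
   using fp[OF lessI, of "L + M"] vc zc[OF lessI] t by algebra
  moreover have "f r [^] (L + M) \<otimes> (?t \<otimes> v) \<in> Q (Suc (n + (L + M)))"
   by (rule gfam_pow'[OF Q lessI vt]) simp
  ultimately have "?t \<otimes> (f r [^] (L + M) \<otimes> v \<ominus> z r) \<in> Q (Suc (n + (L + M)))"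
   using ideal_minus[OF gfam_ideal[OF Q] _ tz[OF lessI]] by simp
  then have "f r [^] M' \<otimes> (?t \<otimes> (f r [^] (L + M) \<otimes> v \<ominus> z r)) \<in> Q (n + (L + M) + Suc M')"
   by (rule gfam_pow'[OF Q lessI]) simp
  moreover have "f r [^] M' \<otimes> (?t \<otimes> (f r [^] (L + M) \<otimes> v \<ominus> z r))
    = f r [^] (Suc M') \<otimes> (f r [^] (L + M) \<otimes> v \<ominus> z r)"
   using t zc[OF lessI] vc fp[OF lessI] by (simp add: m_assoc)
  ultimately show ?thesis unfolding True by (simp only:)
 next
  case False
  then have i': "i < r" using i by simp
  have "f i \<otimes> (f i [^] M' \<otimes> (f i [^] (L + M) \<otimes> v \<ominus> z i)) \<in> Q (Suc (n + (L + M) + M'))"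
   by (rule gfam_mult[OF Q i M'[OF i']])
  moreover have "f i \<otimes> (f i [^] M' \<otimes> (f i [^] (L + M) \<otimes> v \<ominus> z i))
    = f i [^] (Suc M') \<otimes> (f i [^] (L + M) \<otimes> v \<ominus> z i)"
   using fc[OF i] zc[OF i] vc fp[OF i] by (simp add: m_ac)
  ultimately show ?thesis by (simp only: add_Suc_right)
 qed
 show ?thesis unfolding coboundary_def
 proof (intro bexI[of _ "v \<oplus> w"] exI[of _ "Suc M' + M"] allI impI)
  show "v \<oplus> w \<in> P n" by (rule ideal_add[OF gfam_ideal[OF P] vP yw(3)])
  fix i assume i: "i < Suc r"
  note c = fp[OF i, of M] fp[OF i, of L] fp[OF i, of "Suc M'"] xc[OF i] vc wc
  have e: "f i [^] (Suc M' + M) \<otimes> (f i [^] L \<otimes> (v \<oplus> w) \<ominus> x i)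
   = f i [^] (Suc M') \<otimes> (f i [^] (L + M) \<otimes> v \<ominus> z i)"
   unfolding z_def nat_pow_mult[OF fc[OF i], symmetric] using c by algebra
  have "n + (L + M) + Suc M' = n + L + (Suc M' + M)" by simp
  then show "f i [^] (Suc M' + M) \<otimes> (f i [^] L \<otimes> (v \<oplus> w) \<ominus> x i) \<in> Q (n + L + (Suc M' + M))"
   using M''[OF i] unfolding e by (simp only:)
 qed
qed

lemma cocycle_mult:
 assumes P: "gfam r f P" and Q: "gfam r f Q" and x: "cocycle r f P Q n L x" and k: "k < r"
 shows "cocycle r f P Q (Suc n) L (\<lambda>i. f k \<otimes> x i)"
 unfolding cocycle_def
proof (intro conjI allI impI)
 fix i assume i: "i < r"
 have xi: "x i \<in> P (n + L)" if "i < r" for i using x that unfolding cocycle_def by blast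
 show "f k \<otimes> x i \<in> P (Suc n + L)" using gfam_mult[OF P k xi[OF i]] by simp
 fix j assume j: "j < r"
 note c = gfam_carr[OF P k] gfam_elem[OF P xi[OF i]] gfam_elem[OF P xi[OF j]]
  nat_pow_closed[OF gfam_carr[OF P i], of L] nat_pow_closed[OF gfam_carr[OF P j], of L]
 have e: "f j [^] L \<otimes> (f k \<otimes> x i) \<ominus> f i [^] L \<otimes> (f k \<otimes> x j)
  = f k \<otimes> (f j [^] L \<otimes> x i \<ominus> f i [^] L \<otimes> x j)"
  using c by algebra
 have "f j [^] L \<otimes> x i \<ominus> f i [^] L \<otimes> x j \<in> Q (n + L + L)"
  using x i j unfolding cocycle_def by blast
 from gfam_mult[OF Q k this] show "f j [^] L \<otimes> (f k \<otimes> x i) \<ominus> f i [^] L \<otimes> (f k \<otimes> x j) \<in> Q (Suc n + L + L)"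
  unfolding e by simp
qed

text \<open>After multiplication by \<open>f r^L\<close> any cocycle becomes the coboundary of its
  last numerator \<open>x r\<close>: this is the cocycle condition for the pairs
  \<open>(i, r)\<close>. The \<open>L\<close> factors \<open>f r\<close> are then removed one at a
  time by \<open>coboundary_step\<close>.\<close>

lemma H1_step:
 assumes P: "gfam (Suc r) f P" and Q: "gfam (Suc r) f Q" and QP: "\<And>n. Q n \<subseteq> P n"
  and H0: "\<And>n. n \<ge> n0 ==> H0_vanishes r f P (qhat (f r) P Q) n"
  and H1: "\<And>n. n \<ge> n0 ==> H1_vanishes r f (ker_t (f r) P Q) Q n"
  and n: "n \<ge> n0"
 shows "H1_vanishes (Suc r) f P Q n"
 unfolding H1_vanishes_def
proof (intro allI impI)
 fix L x assume x: "cocycle (Suc r) f P Q n L x"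
 let ?t = "f r"
 have t: "?t \<in> carrier R" using gfam_carr[OF P] by simp
 have *: "coboundary (Suc r) f P Q m L y"
  if "m \<ge> n0" "cocycle (Suc r) f P Q m L y"
   "coboundary (Suc r) f P Q (m + e) L (\<lambda>i. ?t [^] e \<otimes> y i)" for m e y
  using that
 proof (induction e arbitrary: m y)
  case 0
  have "?t [^] (0::nat) \<otimes> y i = y i" if "i < Suc r" for i
   using gfam_elem[OF P, of "y i"] 0(2) that unfolding cocycle_def by auto
  then show ?case using 0(3) unfolding coboundary_def by simp
 next
  case (Suc e)
  have yc: "y i \<in> carrier R" if "i < Suc r" for i
   using gfam_elem[OF P, of "y i"] Suc.prems(2) that unfolding cocycle_def by auto
  have "?t [^] Suc e \<otimes> y i = ?t [^] e \<otimes> (?t \<otimes> y i)" if "i < Suc r" for i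
   using t yc[OF that] by (simp add: m_assoc)
  then have "coboundary (Suc r) f P Q (Suc m + e) L (\<lambda>i. ?t [^] e \<otimes> (?t \<otimes> y i))"
   using Suc.prems(3) unfolding coboundary_def by simp
  then have "coboundary (Suc r) f P Q (Suc m) L (\<lambda>i. ?t \<otimes> y i)"
   using Suc.IH[of "Suc m" "\<lambda>i. ?t \<otimes> y i"] Suc.prems(1) cocycle_mult[OF P Q Suc.prems(2) lessI] by simp
  then show ?case
   using coboundary_step[OF P Q QP H0 H1 Suc.prems(2)] Suc.prems(1) by simp
 qed
 have "coboundary (Suc r) f P Q (n + L) L (\<lambda>i. ?t [^] L \<otimes> x i)"
  unfolding coboundary_def
 proof (intro bexI[of _ "x r"] exI[of _ 0] allI impI)
  show xr: "x r \<in> P (n + L)" using x unfolding cocycle_def by blast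
  fix i assume i: "i < Suc r"
  have "f i [^] L \<otimes> x r \<ominus> ?t [^] L \<otimes> x i \<in> Q (n + L + L)"
   using x i unfolding cocycle_def by blast
  then show "f i [^] (0::nat) \<otimes> (f i [^] L \<otimes> x r \<ominus> ?t [^] L \<otimes> x i) \<in> Q (n + L + L + 0)"
   using ideal_carr[OF gfam_ideal[OF Q]] by (metis add_0_right l_one nat_pow_0)
 qed
 then show "coboundary (Suc r) f P Q n L x" by (rule *[OF n x])
qed

theorem H01_vanish:
 assumes "gfam r f P" "gfam r f Q" "\<And>n. Q n \<subseteq> P n" "noe r f P Q"
 shows "\<exists>n0. \<forall>n\<ge>n0. H0_vanishes r f P Q n \<and> H1_vanishes r f P Q n"
 using assms
proof (induction r arbitrary: P Q)
 case 0
 \<comment> \<open>With no variables left, finite generation says that \<open>P\<close> and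
   \<open>Q\<close> agree in large degrees.\<close>
 have "fg 0 f P Q" using 0 unfolding noe_def by blast
 then obtain d where d: "\<And>n. n \<ge> d ==> P (Suc n) \<subseteq> Q (Suc n)" unfolding fg_def by auto
 have "P n \<subseteq> Q n" if "n \<ge> Suc d" for n using d[of "n - 1"] that by (cases n) auto
 moreover have "P n \<noteq> {}" for n using ideal_zero[OF gfam_ideal[OF 0(1)]] by blast
 ultimately show ?case
  unfolding H0_vanishes_def H1_vanishes_def coboundary_def
  by (intro exI[of _ "Suc d"]) (auto simp: ex_in_conv)
next
 case (Suc r)
 note P = Suc.prems(1) and Q = Suc.prems(2) and QP = Suc.prems(3) and noe = Suc.prems(4)
 let ?K = "ker_t (f r) P Q" and ?Qh = "qhat (f r) P Q"
 have t: "f r \<in> carrier R" using gfam_carr[OF P] by simp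
 have K: "gfam r f ?K" using ker_t_gfam[OF P Q] gfam_Suc by blast
 have KP: "?K n \<subseteq> P n" for n unfolding ker_t_def by blast
 have QK: "Q n \<subseteq> ?K n" for n using QP gfam_mult[OF Q lessI] unfolding ker_t_def by blast
 have Qh: "gfam r f ?Qh" by (rule qhat_gfam[OF P Q])
 have QQh: "Q n \<subseteq> ?Qh n" for n by (rule qhat_base[OF P Q t])
 have nK: "noe r f ?K Q"
  by (rule noe_drop[OF noe_sub[OF noe KP] Q gfam_Suc[OF Q]]) (auto simp: ker_t_def)
 have nQ: "noe r f P ?Qh"
  by (rule noe_drop[OF noe Q Qh QQh]) (rule qhat_gen[OF P Q t])
 obtain n1 where n1: "\<And>n. n \<ge> n1 ==> H0_vanishes r f ?K Q n \<and> H1_vanishes r f ?K Q n"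
  using Suc.IH[OF K gfam_Suc[OF Q] QK nK] by blast
 obtain n2 where n2: "\<And>n. n \<ge> n2 ==> H0_vanishes r f P ?Qh n \<and> H1_vanishes r f P ?Qh n"
  using Suc.IH[OF gfam_Suc[OF P] Qh qhat_sub[OF P Q QP] nQ] by blast
 have "H0_vanishes (Suc r) f P Q n \<and> H1_vanishes (Suc r) f P Q n" if n: "n \<ge> max n1 n2" for n
 proof
  show "H0_vanishes (Suc r) f P Q n"
   by (rule H0_step[OF P Q _ n]) (use n1 in auto)
  show "H1_vanishes (Suc r) f P Q n"
   by (rule H1_step[OF P Q QP _ _ n]) (use n1 n2 in auto)
 qed
 then show ?case by blast
qed

end

subsection \<open>Powers of an ideal\<close>

context cring begin

lemma ideal_power_ideal [simp]: "ideal I R ==> ideal (ideal_power R I n) R"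
 by (induction n) (auto simp: oneideal intro: ideal_prod_is_ideal)

lemma ideal_power_carr: "ideal I R ==> x \<in> ideal_power R I n ==> x \<in> carrier R"
 using ideal_power_ideal ideal_carr by blast

lemma ideal_power_add:
 assumes I: "ideal I R"
 shows "ideal_power R I (n + m) = ideal_power R I n \<cdot> ideal_power R I m"
proof (induction m)
 case 0
 then show ?case using ideal_prod_one[OF ideal_power_ideal[OF I]] by simp
next
 case (Suc m)
 then show ?case using ideal_prod_assoc[OF ideal_power_ideal[OF I] ideal_power_ideal[OF I] I] by simp
qed

lemma ideal_power_1: "ideal I R ==> ideal_power R I (Suc 0) = I"
 using ideal_prod_commute[OF oneideal, of I] ideal_prod_one[of I] by simp

lemma ideal_power_mult:
 assumes "ideal I R" "a \<in> ideal_power R I n" "b \<in> ideal_power R I m"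
 shows "a \<otimes> b \<in> ideal_power R I (n + m)"
 unfolding ideal_power_add[OF assms(1)] using assms by (intro ideal_prod.prod)

lemma ideal_power_antimono:
 assumes "ideal I R" "m \<le> n" shows "ideal_power R I n \<subseteq> ideal_power R I m"
 using ideal_power_add[OF assms(1), of m "n - m"] assms(2)
  ideal_prod_inter[OF ideal_power_ideal[OF assms(1)] ideal_power_ideal[OF assms(1)], of m "n - m"]
 by auto

lemma ideal_power_pow:
 assumes "ideal I R" "a \<in> I" shows "a [^] n \<in> ideal_power R I n"
proof (induction n)
 case (Suc n)
 then show ?case using assms by (auto intro: ideal_prod.prod)
qed simp

lemma genideal_comb:
 assumes f: "\<And>i. i < r ==> f i \<in> carrier R"
 shows "Idl (f ` {..<r}) = comb r f (carrier R) {\<zero>}"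
proof
 have I: "ideal (comb r f (carrier R) {\<zero>}) R" by (rule comb_ideal) (use f oneideal zeroideal in auto)
 have "f i \<in> comb r f (carrier R) {\<zero>}" if "i < r" for i
  using comb_gen[OF oneideal zeroideal _ that, of f \<one>] f that by auto
 then show "Idl (f ` {..<r}) \<subseteq> comb r f (carrier R) {\<zero>}" by (intro genideal_minimal[OF I]) auto
 have sub: "f ` {..<r} \<subseteq> carrier R" using f by auto
 note G = genideal_ideal[OF sub]
 show "comb r f (carrier R) {\<zero>} \<subseteq> Idl (f ` {..<r})"
  by (rule comb_least[OF G]) (use ideal_zero[OF G] genideal_self[OF sub] ideal_rmult[OF G] in auto)
qed

end

section \<open>Rees algebra and associated graded ring\<close>

locale fg_ideal = cring R for R :: "('a, 'm) ring_scheme" (structure) +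
 fixes I :: "'a set" and r :: nat and f :: "nat => 'a"
 assumes noeth: "noetherian_ring R"
  and f_carr: "\<And>i. i < r ==> f i \<in> carrier R"
  and I_gen: "I = genideal R (f ` {..<r})"
begin

abbreviation Ip :: "nat => 'a set" where "Ip \<equiv> ideal_power R I"

lemma I_ideal: "ideal I R"
 unfolding I_gen by (rule genideal_ideal) (use f_carr in auto)

lemma I_comb: "I = comb r f (carrier R) {\<zero>}"
 unfolding I_gen by (rule genideal_comb[OF f_carr])

lemma f_I: "i < r ==> f i \<in> I"
 unfolding I_gen using genideal_self[of "f ` {..<r}"] f_carr by blast

lemmas Ip_ideal = ideal_power_ideal[OF I_ideal]
lemmas Ip_carr = ideal_power_carr[OF I_ideal]
lemmas Ip_mult = ideal_power_mult[OF I_ideal]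
lemmas Ip_antimono = ideal_power_antimono[OF I_ideal]

lemma f_pow_Ip:
 assumes "i < r" "a \<in> Ip n" "m = n + k" shows "f i [^] (k::nat) \<otimes> a \<in> Ip m"
 using Ip_mult[OF ideal_power_pow[OF I_ideal f_I[OF assms(1)], of k] assms(2)] assms(3)
 by (simp add: add.commute)

lemma Ip_gfam: "gfam r f (\<lambda>n. Ip (n + k))"
proof -
 have "f i \<otimes> x \<in> Ip (Suc n)" if "i < r" "x \<in> Ip n" for i x n
  using f_pow_Ip[OF that, of "Suc n" "Suc 0"] f_carr[OF that(1)] by simp
 then show ?thesis unfolding gfam_def using f_carr Ip_ideal by simp
qed

lemma Ip_Suc_comb:
 assumes Q: "ideal Q R"
 shows "Ip (Suc n) \<subseteq> comb r f (Ip n) Q"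
proof
 have fc: "\<forall>i<r. f i \<in> carrier R" using f_carr by auto
 let ?C = "comb r f (Ip n) Q"
 have C: "ideal ?C R" by (rule comb_ideal[OF Ip_ideal Q fc])
 fix x assume "x \<in> Ip (Suc n)"
 then have "x \<in> Ip n \<cdot> I" by simp
 then show "x \<in> ?C"
 proof (induction rule: ideal_prod.induct)
  case (prod a b)
  have ac: "a \<in> carrier R" using Ip_carr prod(1) .
  have J: "ideal {c \<in> carrier R. a \<otimes> c \<in> ?C} R"
  proof (rule idealI')
   show "\<zero> \<in> {c \<in> carrier R. a \<otimes> c \<in> ?C}" using ideal_zero[OF C] ac by simp
   show "c \<oplus> d \<in> {c \<in> carrier R. a \<otimes> c \<in> ?C}"
    if "c \<in> {c \<in> carrier R. a \<otimes> c \<in> ?C}" "d \<in> {c \<in> carrier R. a \<otimes> c \<in> ?C}" for c d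
    using that ideal_add[OF C] ac by (simp add: r_distr)
   show "z \<otimes> c \<in> {c \<in> carrier R. a \<otimes> c \<in> ?C}"
    if "c \<in> {c \<in> carrier R. a \<otimes> c \<in> ?C}" "z \<in> carrier R" for c z
   proof -
    have "a \<otimes> (z \<otimes> c) = z \<otimes> (a \<otimes> c)" using that ac by (simp add: m_ac)
    then show ?thesis using that ideal_lmult[OF C] by simp
   qed
  qed auto
  have "comb r f (carrier R) {\<zero>} \<subseteq> {c \<in> carrier R. a \<otimes> c \<in> ?C}"
  proof (rule comb_least[OF J])
   show "{\<zero>} \<subseteq> {c \<in> carrier R. a \<otimes> c \<in> ?C}" using ideal_zero[OF J] by simp
   fix i y assume i: "i < r" and y: "y \<in> carrier R"
   have "a \<otimes> (f i \<otimes> y) = f i \<otimes> (a \<otimes> y)" using ac y f_carr[OF i] by (simp add: m_ac)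
   moreover have "f i \<otimes> (a \<otimes> y) \<in> ?C"
    by (rule comb_gen[OF Ip_ideal Q fc i]) (use ideal_rmult[OF Ip_ideal prod(1)] y in blast)
   ultimately show "f i \<otimes> y \<in> {c \<in> carrier R. a \<otimes> c \<in> ?C}" using f_carr[OF i] y by simp
  qed
  then show ?case using prod(2) unfolding I_comb by blast
 next
  case (sum s t)
  then show ?case using ideal_add[OF C] by blast
 qed
qed

text \<open>The powers of \<open>I\<close> modulo zero are the Rees algebra, and modulo the next
  power, below, the associated graded ring. Both are generated in degree one, hence finitely
  generated over the polynomial ring.\<close>

lemma rees_H01:
 "\<exists>n0. \<forall>n\<ge>n0. H0_vanishes r f Ip (\<lambda>_. {\<zero>}) n \<and> H1_vanishes r f Ip (\<lambda>_. {\<zero>}) n"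
proof (rule H01_vanish)
 show g: "gfam r f Ip" using Ip_gfam[of 0] by simp
 show z: "gfam r f (\<lambda>_. {\<zero>})" unfolding gfam_def using f_carr zeroideal by simp
 show s: "{\<zero>} \<subseteq> Ip n" for n using ideal_zero[OF Ip_ideal] by simp
 show "noe r f Ip (\<lambda>_. {\<zero>})"
  by (rule noe_if_fg[OF noeth g z s]) (use Ip_Suc_comb[OF zeroideal] in \<open>auto simp: fg_def\<close>)
qed

lemma gr_H01:
 "\<exists>n0. \<forall>n\<ge>n0. H0_vanishes r f Ip (\<lambda>n. Ip (Suc n)) n \<and> H1_vanishes r f Ip (\<lambda>n. Ip (Suc n)) n"
proof (rule H01_vanish)
 show g: "gfam r f Ip" using Ip_gfam[of 0] by simp
 show z: "gfam r f (\<lambda>n. Ip (Suc n))" using Ip_gfam[of 1] by simp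
 show s: "Ip (Suc n) \<subseteq> Ip n" for n by (rule Ip_antimono) simp
 show "noe r f Ip (\<lambda>n. Ip (Suc n))"
  by (rule noe_if_fg[OF noeth g z s]) (unfold fg_def, intro exI allI impI Ip_Suc_comb Ip_ideal)
qed

lemma max_exponent:
 assumes "\<And>i. i < r ==> \<exists>K::nat. T i K" "\<And>i K K'. i < r ==> T i K ==> K \<le> K' ==> T i K'"
 shows "\<exists>K. \<forall>i<r. T i K"
proof -
 have "\<forall>i. \<exists>K. i < r --> T i K" using assms(1) by blast
 from choice[OF this] obtain k where k: "\<And>i. i < r ==> T i (k i)" by blast
 have "T i (\<Sum>i<r. k i)" if i: "i < r" for i
  by (rule assms(2)[OF i k[OF i]]) (use member_le_sum[of i "{..<r}" k] i in auto)
 then show ?thesis by blast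
qed

text \<open>The elements \<open>a\<close> in question form the Ratliff-Rush closure of
  \<open>I^n\<close>: they lie in \<open>I^n\<close> on every chart of the blowup. The fractions
  \<open>f i^K a / f i^K\<close> are a cocycle of the Rees algebra, so they come from some
  \<open>y\<close> in \<open>I^n\<close>, and \<open>y = a\<close> because nothing is killed by a
  common power of all \<open>f i\<close>.\<close>

lemma ratliff_rush:
 assumes tf: "\<And>x N. x \<in> carrier R ==> (\<And>i. i < r ==> f i [^] (N::nat) \<otimes> x = \<zero>) ==> x = \<zero>"
 shows "\<exists>n0. \<forall>n\<ge>n0. \<forall>a\<in>carrier R. (\<forall>i<r. \<exists>K::nat. f i [^] K \<otimes> a \<in> Ip (n + K)) --> a \<in> Ip n"
proof -
 obtain n0 where n0: "\<And>n. n \<ge> n0 ==> H1_vanishes r f Ip (\<lambda>_. {\<zero>}) n" using rees_H01 by blast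
 have "a \<in> Ip n" if n: "n \<ge> n0" and a: "a \<in> carrier R" and *: "\<forall>i<r. \<exists>K::nat. f i [^] K \<otimes> a \<in> Ip (n + K)" for n a
 proof -
  have fp: "f i [^] (k::nat) \<in> carrier R" if "i < r" for i k using f_carr[OF that] by simp
  have "\<exists>K. \<forall>i<r. f i [^] (K::nat) \<otimes> a \<in> Ip (n + K)"
  proof (rule max_exponent)
   show "\<exists>K::nat. f i [^] K \<otimes> a \<in> Ip (n + K)" if "i < r" for i using * that by blast
   fix i and K K' :: nat assume i: "i < r" and K: "f i [^] K \<otimes> a \<in> Ip (n + K)" and le: "K \<le> K'"
   have "f i [^] (K' - K) \<otimes> (f i [^] K \<otimes> a) \<in> Ip (n + K')"
    by (rule f_pow_Ip[OF i K]) (use le in simp)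
   moreover have "f i [^] (K' - K) \<otimes> (f i [^] K \<otimes> a) = f i [^] K' \<otimes> a"
    using le f_carr[OF i] a fp[OF i] by (simp add: m_assoc[symmetric] nat_pow_mult)
   ultimately show "f i [^] K' \<otimes> a \<in> Ip (n + K')" by simp
  qed
  then obtain K :: nat where K: "\<And>i. i < r ==> f i [^] K \<otimes> a \<in> Ip (n + K)" by blast
  have "cocycle r f Ip (\<lambda>_. {\<zero>}) n K (\<lambda>i. f i [^] K \<otimes> a)"
   unfolding cocycle_def
  proof (intro conjI allI impI)
   fix i j assume ij: "i < r" "j < r"
   have "f j [^] K \<otimes> (f i [^] K \<otimes> a) \<ominus> f i [^] K \<otimes> (f j [^] K \<otimes> a) = \<zero>"
    using fp[OF ij(1), of K] fp[OF ij(2), of K] a by algebra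
   then show "f j [^] K \<otimes> (f i [^] K \<otimes> a) \<ominus> f i [^] K \<otimes> (f j [^] K \<otimes> a) \<in> {\<zero>}" by simp
  qed (use K in auto)
  then have "coboundary r f Ip (\<lambda>_. {\<zero>}) n K (\<lambda>i. f i [^] K \<otimes> a)"
   using n0[OF n] unfolding H1_vanishes_def by blast
  then obtain y M where y: "y \<in> Ip n"
   and M: "\<And>i. i < r ==> f i [^] (M::nat) \<otimes> (f i [^] K \<otimes> y \<ominus> f i [^] K \<otimes> a) = \<zero>"
   unfolding coboundary_def by blast
  have yc: "y \<in> carrier R" using Ip_carr[OF y] .
  have "y \<ominus> a = \<zero>"
  proof (rule tf[of _ "M + K"])
   show "y \<ominus> a \<in> carrier R" using yc a by simp
   fix i assume i: "i < r"
   have "f i [^] (M + K) \<otimes> (y \<ominus> a) = f i [^] M \<otimes> (f i [^] K \<otimes> y \<ominus> f i [^] K \<otimes> a)"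
    unfolding nat_pow_mult[OF f_carr[OF i], symmetric]
    using fp[OF i, of M] fp[OF i, of K] yc a by algebra
   then show "f i [^] (M + K) \<otimes> (y \<ominus> a) = \<zero>" using M[OF i] by simp
  qed
  then have "y = a" using yc a by (simp add: r_right_minus_eq)
  then show ?thesis using y by simp
 qed
 then show ?thesis by blast
qed

text \<open>The hypothesis has the shape in which it will arise: the difference of two fractions
  with denominators \<open>f i^L\<close> and \<open>f j^L\<close> is small on an overlap, where the
  denominators are powers of \<open>f i f j\<close>, of order two. The exponents \<open>K\<close>
  are first made uniform and then absorbed into \<open>L\<close>, which turns the family into a
  cocycle of the associated graded ring.\<close>

lemma gr_lift:
 "\<exists>n0. \<forall>n\<ge>n0. \<forall>L x. (\<forall>i<r. x i \<in> Ip (n + L)) -->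
  (\<forall>i<r. \<forall>j<r. \<exists>K::nat. (f i \<otimes> f j) [^] K \<otimes> (f j [^] L \<otimes> x i \<ominus> f i [^] L \<otimes> x j) \<in> Ip (Suc n + 2 * (L + K))) -->
  (\<exists>a\<in>Ip n. \<exists>M::nat. \<forall>i<r. f i [^] M \<otimes> (f i [^] L \<otimes> a \<ominus> x i) \<in> Ip (Suc n + (L + M)))"
proof -
 obtain n0 where n0: "\<And>n. n \<ge> n0 ==> H1_vanishes r f Ip (\<lambda>n. Ip (Suc n)) n" using gr_H01 by blast
 have fp: "f i [^] (k::nat) \<in> carrier R" if "i < r" for i k using f_carr[OF that] by simp
 have "\<exists>a\<in>Ip n. \<exists>M::nat. \<forall>i<r. f i [^] M \<otimes> (f i [^] L \<otimes> a \<ominus> x i) \<in> Ip (Suc n + (L + M))"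
  if n: "n \<ge> n0" and x: "\<forall>i<r. x i \<in> Ip (n + L)"
   and *: "\<forall>i<r. \<forall>j<r. \<exists>K::nat. (f i \<otimes> f j) [^] K \<otimes> (f j [^] L \<otimes> x i \<ominus> f i [^] L \<otimes> x j) \<in> Ip (Suc n + 2 * (L + K))"
  for n L x
 proof -
  have xc: "x i \<in> carrier R" if "i < r" for i using x that Ip_carr by blast
  have up: "(f i \<otimes> f j) [^] K' \<otimes> (f j [^] L \<otimes> x i \<ominus> f i [^] L \<otimes> x j) \<in> Ip (Suc n + 2 * (L + K'))"
   if i: "i < r" and j: "j < r" and le: "(K::nat) \<le> K'"
    and K: "(f i \<otimes> f j) [^] K \<otimes> (f j [^] L \<otimes> x i \<ominus> f i [^] L \<otimes> x j) \<in> Ip (Suc n + 2 * (L + K))" for i j K K'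
  proof -
   let ?e = "f j [^] L \<otimes> x i \<ominus> f i [^] L \<otimes> x j"
   have ec: "?e \<in> carrier R" using xc[OF i] xc[OF j] fp[OF i] fp[OF j] by simp
   have "f j [^] (K' - K) \<otimes> ((f i \<otimes> f j) [^] K \<otimes> ?e) \<in> Ip (Suc n + 2 * (L + K) + (K' - K))"
    by (rule f_pow_Ip[OF j K]) simp
   then have "f i [^] (K' - K) \<otimes> (f j [^] (K' - K) \<otimes> ((f i \<otimes> f j) [^] K \<otimes> ?e)) \<in> Ip (Suc n + 2 * (L + K'))"
    by (rule f_pow_Ip[OF i]) (use le in simp)
   moreover have "f i [^] (K' - K) \<otimes> (f j [^] (K' - K) \<otimes> ((f i \<otimes> f j) [^] K \<otimes> ?e))
     = (f i \<otimes> f j) [^] (K' - K) \<otimes> (f i \<otimes> f j) [^] K \<otimes> ?e"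
    using f_carr[OF i] f_carr[OF j] ec by (simp add: nat_pow_distrib m_assoc)
   moreover have "(f i \<otimes> f j) [^] (K' - K) \<otimes> (f i \<otimes> f j) [^] K = (f i \<otimes> f j) [^] K'"
    using f_carr[OF i] f_carr[OF j] le by (simp add: nat_pow_mult)
   ultimately show ?thesis by simp
  qed
  have "\<exists>K. \<forall>i<r. \<forall>j<r. (f i \<otimes> f j) [^] (K::nat) \<otimes> (f j [^] L \<otimes> x i \<ominus> f i [^] L \<otimes> x j) \<in> Ip (Suc n + 2 * (L + K))"
  proof (rule max_exponent)
   fix i assume i: "i < r"
   show "\<exists>K. \<forall>j<r. (f i \<otimes> f j) [^] (K::nat) \<otimes> (f j [^] L \<otimes> x i \<ominus> f i [^] L \<otimes> x j) \<in> Ip (Suc n + 2 * (L + K))"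
    by (rule max_exponent) (use * i up in blast)+
  qed (use up in blast)
  then obtain K where K: "\<And>i j. i < r ==> j < r ==>
    (f i \<otimes> f j) [^] (K::nat) \<otimes> (f j [^] L \<otimes> x i \<ominus> f i [^] L \<otimes> x j) \<in> Ip (Suc n + 2 * (L + K))" by blast
  have "cocycle r f Ip (\<lambda>n. Ip (Suc n)) n (L + K) (\<lambda>i. f i [^] K \<otimes> x i)"
   unfolding cocycle_def
  proof (intro conjI allI impI)
   fix i assume i: "i < r"
   show "f i [^] K \<otimes> x i \<in> Ip (n + (L + K))"
    by (rule f_pow_Ip[OF i, of _ "n + L"]) (use x i in auto)
   fix j assume j: "j < r"
   have "f j [^] (L + K) \<otimes> (f i [^] K \<otimes> x i) \<ominus> f i [^] (L + K) \<otimes> (f j [^] K \<otimes> x j)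
    = (f i \<otimes> f j) [^] K \<otimes> (f j [^] L \<otimes> x i \<ominus> f i [^] L \<otimes> x j)"
    unfolding nat_pow_mult[OF f_carr[OF i], symmetric] nat_pow_mult[OF f_carr[OF j], symmetric]
     nat_pow_distrib[OF f_carr[OF i] f_carr[OF j]]
    using fp[OF i, of L] fp[OF i, of K] fp[OF j, of L] fp[OF j, of K] xc[OF i] xc[OF j] by algebra
   moreover have "Suc n + 2 * (L + K) = Suc (n + (L + K) + (L + K))" by simp
   ultimately show "f j [^] (L + K) \<otimes> (f i [^] K \<otimes> x i) \<ominus> f i [^] (L + K) \<otimes> (f j [^] K \<otimes> x j)
     \<in> Ip (Suc (n + (L + K) + (L + K)))"
    using K[OF i j] by (simp only:)
  qed
  then have "coboundary r f Ip (\<lambda>n. Ip (Suc n)) n (L + K) (\<lambda>i. f i [^] K \<otimes> x i)"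
   using n0[OF n] unfolding H1_vanishes_def by blast
  then obtain a M where a: "a \<in> Ip n"
   and M: "\<And>i. i < r ==> f i [^] (M::nat) \<otimes> (f i [^] (L + K) \<otimes> a \<ominus> f i [^] K \<otimes> x i) \<in> Ip (Suc (n + (L + K) + M))"
   unfolding coboundary_def by blast
  have ac: "a \<in> carrier R" using Ip_carr[OF a] .
  have "f i [^] (M + K) \<otimes> (f i [^] L \<otimes> a \<ominus> x i) \<in> Ip (Suc n + (L + (M + K)))" if i: "i < r" for i
  proof -
   have "f i [^] (M + K) \<otimes> (f i [^] L \<otimes> a \<ominus> x i) = f i [^] M \<otimes> (f i [^] (L + K) \<otimes> a \<ominus> f i [^] K \<otimes> x i)"
    unfolding nat_pow_mult[OF f_carr[OF i], symmetric]
    using fp[OF i, of L] fp[OF i, of K] fp[OF i, of M] xc[OF i] ac by algebra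
   moreover have "Suc n + (L + (M + K)) = Suc (n + (L + K) + M)" by simp
   ultimately show ?thesis using M[OF i] by (simp only:)
  qed
  then show ?thesis using a by blast
 qed
 then show ?thesis by blast
qed

text \<open>Instead of expanding monomials, \<open>H^0\<close> is applied to the graded module
  \<open>(I^n + J)/J\<close>: all its elements are killed by powers of the \<open>f i\<close>, so it
  is zero in large degrees.\<close>

lemma power_sub_if_nilpotent:
 assumes J: "ideal J R" and nil: "\<And>i. i < r ==> \<exists>k::nat. f i [^] k \<in> J"
 shows "\<exists>m. Ip m \<subseteq> J"
proof -
 define P where "P = (\<lambda>n. comb 1 (\<lambda>_. \<one>) (Ip n) J)"
 have PI: "ideal (P n) R" for n unfolding P_def by (rule comb_ideal) (use J Ip_ideal in auto)
 have JP: "J \<subseteq> P n" for n unfolding P_def by (rule comb_base) (use J Ip_ideal in auto)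
 have IP: "x \<in> P n" if "x \<in> Ip n" for x n
  using comb_gen[OF Ip_ideal J _ _ that, of 1 "\<lambda>_. \<one>" 0] Ip_carr[OF that] by (simp add: P_def)
 have Pleast: "P n \<subseteq> S" if "ideal S R" "J \<subseteq> S" "Ip n \<subseteq> S" for n S
  unfolding P_def by (rule comb_least) (use that Ip_carr in auto)
 have g: "gfam r f P"
  unfolding gfam_def
 proof (intro conjI allI ballI impI PI)
  fix n i x assume i: "i < r" and x: "x \<in> P n"
  have S: "ideal {x \<in> carrier R. f i \<otimes> x \<in> P (Suc n)} R"
  proof (rule idealI')
   show "z \<otimes> c \<in> {x \<in> carrier R. f i \<otimes> x \<in> P (Suc n)}"
    if "c \<in> {x \<in> carrier R. f i \<otimes> x \<in> P (Suc n)}" "z \<in> carrier R" for c z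
   proof -
    have "f i \<otimes> (z \<otimes> c) = z \<otimes> (f i \<otimes> c)" using that f_carr[OF i] by (simp add: m_ac)
    then show ?thesis using that ideal_lmult[OF PI] by simp
   qed
  qed (use f_carr[OF i] ideal_zero[OF PI] ideal_add[OF PI] in \<open>auto simp: r_distr\<close>)
  have "P n \<subseteq> {x \<in> carrier R. f i \<otimes> x \<in> P (Suc n)}"
  proof (rule Pleast[OF S])
   show "J \<subseteq> {x \<in> carrier R. f i \<otimes> x \<in> P (Suc n)}"
    using JP[of "Suc n"] ideal_lmult[OF J] ideal_carr[OF J] f_carr[OF i] by auto
   show "Ip n \<subseteq> {x \<in> carrier R. f i \<otimes> x \<in> P (Suc n)}"
    using IP f_pow_Ip[OF i, of _ n "Suc n" "Suc 0"] f_carr[OF i] Ip_carr by auto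
  qed
  then show "f i \<otimes> x \<in> P (Suc n)" using x by blast
 qed (use f_carr in auto)
 have gJ: "gfam r f (\<lambda>_. J)" unfolding gfam_def using f_carr J ideal_lmult[OF J] by auto
 have "fg r f P (\<lambda>_. J)" unfolding fg_def
 proof (intro exI allI impI)
  fix n
  have C: "ideal (comb r f (P n) J) R" by (rule comb_ideal[OF PI J]) (use f_carr in auto)
  show "P (Suc n) \<subseteq> comb r f (P n) J"
  proof (rule Pleast[OF C])
   show "J \<subseteq> comb r f (P n) J" by (rule comb_base[OF PI J]) (use f_carr in auto)
   show "Ip (Suc n) \<subseteq> comb r f (P n) J"
    using Ip_Suc_comb[OF J, of n] comb_mono[of "Ip n" "P n" J J r f] IP by blast
  qed
 qed
 then obtain n0 where n0: "H0_vanishes r f P (\<lambda>_. J) n0"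
  using H01_vanish[OF g gJ JP noe_if_fg[OF noeth g gJ JP]] by blast
 have "x \<in> J" if x: "x \<in> Ip n0" for x
 proof -
  have "\<exists>L::nat. f i [^] L \<otimes> x \<in> J" if "i < r" for i
   using nil[OF that] ideal_rmult[OF J] Ip_carr[OF x] by blast
  then show ?thesis using n0 IP[OF x] unfolding H0_vanishes_def by blast
 qed
 then show ?thesis by blast
qed

end

subsection \<open>Krull's intersection theorem\<close>

context cring begin

lemma ideal_plus_principal:
 assumes J: "ideal J R" and x: "x \<in> carrier R"
 shows "ideal {j \<oplus> x \<otimes> z | j z. j \<in> J \<and> z \<in> carrier R} R"
  and "J \<subseteq> {j \<oplus> x \<otimes> z | j z. j \<in> J \<and> z \<in> carrier R}"
  and "x \<in> {j \<oplus> x \<otimes> z | j z. j \<in> J \<and> z \<in> carrier R}"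
proof -
 have e: "{j \<oplus> x \<otimes> z | j z. j \<in> J \<and> z \<in> carrier R} = comb 1 (\<lambda>_. x) (carrier R) J" by simp
 show "ideal {j \<oplus> x \<otimes> z | j z. j \<in> J \<and> z \<in> carrier R} R"
  unfolding e by (rule comb_ideal[OF oneideal J]) (use x in simp)
 show "J \<subseteq> {j \<oplus> x \<otimes> z | j z. j \<in> J \<and> z \<in> carrier R}"
  unfolding e by (rule comb_base[OF oneideal J]) (use x in simp)
 show "x \<in> {j \<oplus> x \<otimes> z | j z. j \<in> J \<and> z \<in> carrier R}"
  using comb_gen[OF oneideal J, of 1 "\<lambda>_. x" 0 \<one>] x unfolding e by simp
qed

lemma colon_ideal:
 assumes J: "ideal J R" and x: "x \<in> carrier R"
 shows "ideal {c \<in> carrier R. x \<otimes> c \<in> J} R"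
proof (rule idealI')
 show "z \<otimes> c \<in> {c \<in> carrier R. x \<otimes> c \<in> J}" if "c \<in> {c \<in> carrier R. x \<otimes> c \<in> J}" "z \<in> carrier R" for c z
 proof -
  have "x \<otimes> (z \<otimes> c) = z \<otimes> (x \<otimes> c)" using that x by (simp add: m_ac)
  then show ?thesis using that ideal_lmult[OF J] by simp
 qed
qed (use x ideal_zero[OF J] ideal_add[OF J] in \<open>auto simp: r_distr\<close>)

text \<open>An associated prime of \<open>R/N\<close>, found as a maximal one among the colon ideals
  \<open>(N : h)\<close> with \<open>h\<close> outside \<open>N\<close>.\<close>

lemma exists_prime_colon:
 assumes noeth: "noetherian_ring R" and N: "ideal N R" and proper: "N \<noteq> carrier R"
 shows "\<exists>h\<in>carrier R. primeideal {c \<in> carrier R. h \<otimes> c \<in> N} R"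
proof -
 let ?q = "\<lambda>h. {c \<in> carrier R. h \<otimes> c \<in> N}"
 let ?C = "?q ` (carrier R - N)"
 have "\<one> \<notin> N" using proper ideal.one_imp_carrier[OF N] by blast
 then have "?q \<one> \<in> ?C" by blast
 from noetherian_maximal[OF noeth this] colon_ideal[OF N]
 obtain M where M: "M \<in> ?C" "\<forall>I\<in>?C. M \<subseteq> I --> I = M" by (metis (no_types, lifting) DiffE imageE)
 then obtain h where h: "h \<in> carrier R" "h \<notin> N" "M = ?q h" by blast
 have "primeideal (?q h) R"
 proof (rule primeidealI[OF colon_ideal[OF N h(1)] is_cring])
  have "\<one> \<notin> ?q h" using h by simp
  then show "carrier R \<noteq> ?q h" by blast
  fix a b assume ab: "a \<in> carrier R" "b \<in> carrier R" "a \<otimes> b \<in> ?q h"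
  show "a \<in> ?q h \<or> b \<in> ?q h"
  proof (rule disjCI)
   assume "b \<notin> ?q h"
   then have hb: "h \<otimes> b \<in> carrier R - N" using ab h by auto
   have "?q h \<subseteq> ?q (h \<otimes> b)"
   proof
    fix c assume c: "c \<in> ?q h"
    have "h \<otimes> b \<otimes> c = b \<otimes> (h \<otimes> c)" using c h(1) ab(2) by (simp add: m_ac)
    then show "c \<in> ?q (h \<otimes> b)" using c ideal_lmult[OF N _ ab(2)] by simp
   qed
   then have "?q (h \<otimes> b) = ?q h" using M(2) hb unfolding h(3) by blast
   moreover have "h \<otimes> b \<otimes> a = h \<otimes> (a \<otimes> b)" using h(1) ab by (simp add: m_ac)
   then have "a \<in> ?q (h \<otimes> b)" using ab by simp
   ultimately show "a \<in> ?q h" by blast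
  qed
 qed
 then show ?thesis using h(1) by blast
qed

end

context fg_ideal begin

text \<open>Take an ideal \<open>M\<close> above \<open>J\<close> that is maximal among those not
  containing \<open>a\<close> locally at \<open>p\<close>. If all \<open>f i\<close> are nilpotent
  modulo \<open>M\<close>, then \<open>M\<close> contains a power of \<open>I\<close>, and the
  approximations of \<open>a\<close> by elements of \<open>J\<close> give a contradiction. The
  maximality of \<open>M\<close> does the work of the Artin-Rees lemma.\<close>

theorem krull_intersection:
 assumes p: "primeideal p R" and Ip': "I \<subseteq> p" and J: "ideal J R" and a: "a \<in> carrier R"
  and *: "\<And>n. \<exists>s\<in>carrier R - p. \<exists>j\<in>J. s \<otimes> a \<ominus> j \<in> Ip n"
 shows "\<exists>s\<in>carrier R - p. s \<otimes> a \<in> J"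
proof (rule ccontr)
 assume neg: "\<not> ?thesis"
 interpret p: primeideal p R by fact
 have pI: "ideal p R" by (rule p.is_ideal)
 have p1: "\<one> \<in> carrier R - p" using p.I_notcarr p.one_imp_carrier by auto
 have pm: "s \<otimes> t \<in> carrier R - p" if "s \<in> carrier R - p" "t \<in> carrier R - p" for s t
  using that p.I_prime by auto
 let ?C = "{J'. ideal J' R \<and> J \<subseteq> J' \<and> (\<forall>s\<in>carrier R - p. s \<otimes> a \<notin> J')}"
 have "J \<in> ?C" using J neg by blast
 then have "\<exists>M\<in>?C. J \<subseteq> M \<and> (\<forall>I\<in>?C. M \<subseteq> I --> I = M)"
  by (rule noetherian_maximal[OF noeth]) blast
 then obtain M where "ideal M R \<and> J \<subseteq> M \<and> (\<forall>s\<in>carrier R - p. s \<otimes> a \<notin> M)"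
  and max: "\<forall>I\<in>?C. M \<subseteq> I --> I = M" by blast
 then have M: "ideal M R" and JM: "J \<subseteq> M" and Ma: "\<And>s. s \<in> carrier R - p ==> s \<otimes> a \<notin> M" by auto
 have big: "\<exists>s\<in>carrier R - p. s \<otimes> a \<in> S" if "ideal S R" "M \<subseteq> S" "S \<noteq> M" for S
  using max that JM by blast
 have nil: "\<exists>k::nat. f i [^] k \<in> M" if i: "i < r" for i
 proof (rule ccontr)
  assume nn: "\<not> ?thesis"
  have fc: "f i \<in> carrier R" and fp: "f i [^] (k::nat) \<in> carrier R" for k using f_carr[OF i] by auto
  let ?L = "\<lambda>k::nat. {c \<in> carrier R. f i [^] k \<otimes> c \<in> M}"
  have LI: "ideal (?L k) R" for k by (rule colon_ideal[OF M fp])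
  have "?L k \<subseteq> ?L (Suc k)" for k
  proof
   fix c assume c: "c \<in> ?L k"
   have "f i [^] Suc k \<otimes> c = f i \<otimes> (f i [^] k \<otimes> c)" using c fc by (simp add: m_ac)
   then show "c \<in> ?L (Suc k)" using c ideal_lmult[OF M _ fc] by simp
  qed
  then obtain k where k: "\<And>j. ?L j \<subseteq> ?L k" using noetherian_stable[OF noeth, of ?L] LI by blast
  \<comment> \<open>For stationary \<open>k\<close> the ideals \<open>(M : f i^k)\<close> and
    \<open>M + f i^k R\<close> intersect in \<open>M\<close>. If both were larger than
    \<open>M\<close>, both would contain \<open>a\<close> locally at \<open>p\<close>, and so would
    \<open>M\<close>.\<close>
  have "?L k = M"
  proof (rule ccontr)
   assume "?L k \<noteq> M"
   moreover have "M \<subseteq> ?L k" using ideal_lmult[OF M _ fp] ideal_carr[OF M] by blast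
   ultimately obtain s where s: "s \<in> carrier R - p" "s \<otimes> a \<in> ?L k" using big[OF LI] by blast
   let ?S = "{j \<oplus> f i [^] k \<otimes> z | j z. j \<in> M \<and> z \<in> carrier R}"
   have "?S \<noteq> M" using ideal_plus_principal(3)[OF M fp[of k]] nn by blast
   then obtain s' where s': "s' \<in> carrier R - p" "s' \<otimes> a \<in> ?S"
    using big[OF ideal_plus_principal(1,2)[OF M fp[of k]]] by blast
   then obtain j z where jz: "s' \<otimes> a = j \<oplus> f i [^] k \<otimes> z" "j \<in> M" "z \<in> carrier R" by blast
   have jc: "j \<in> carrier R" using ideal_carr[OF M jz(2)] .
   have sc: "s \<in> carrier R" "s' \<in> carrier R" using s s' by auto
   have e1: "f i [^] (k + k) \<otimes> (s \<otimes> z) = s' \<otimes> (f i [^] k \<otimes> (s \<otimes> a)) \<ominus> f i [^] k \<otimes> (s \<otimes> j)"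
   proof -
    have "s' \<otimes> (f i [^] k \<otimes> (s \<otimes> a)) = f i [^] k \<otimes> (s \<otimes> (s' \<otimes> a))"
     using sc fp[of k] a by (simp add: m_ac)
    also have "\<dots> = f i [^] k \<otimes> (s \<otimes> j) \<oplus> f i [^] k \<otimes> f i [^] k \<otimes> (s \<otimes> z)"
     unfolding jz(1) using sc fp[of k] jc jz(3) by algebra
    finally show ?thesis
     unfolding nat_pow_mult[OF fc, symmetric] using sc fp[of k] jc jz(3) a by algebra
   qed
   have "s' \<otimes> (f i [^] k \<otimes> (s \<otimes> a)) \<in> M" using s(2) ideal_lmult[OF M _ sc(2)] by blast
   moreover have "f i [^] k \<otimes> (s \<otimes> j) \<in> M" by (rule ideal_lmult[OF M ideal_lmult[OF M jz(2) sc(1)] fp])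
   ultimately have "f i [^] (k + k) \<otimes> (s \<otimes> z) \<in> M" unfolding e1 by (rule ideal_minus[OF M])
   then have "s \<otimes> z \<in> ?L (k + k)" using sc jz(3) by simp
   then have "f i [^] k \<otimes> (s \<otimes> z) \<in> M" using k by blast
   moreover have "s \<otimes> s' \<otimes> a = s \<otimes> j \<oplus> f i [^] k \<otimes> (s \<otimes> z)"
   proof -
    have "s \<otimes> s' \<otimes> a = s \<otimes> (j \<oplus> f i [^] k \<otimes> z)" using sc a jz(1) by (simp add: m_assoc)
    then show ?thesis using sc fp[of k] jc jz(3) by algebra
   qed
   ultimately have "s \<otimes> s' \<otimes> a \<in> M" using ideal_add[OF M ideal_lmult[OF M jz(2) sc(1)]] by simp
   then show False using Ma[OF pm[OF s(1) s'(1)]] by blast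
  qed
  then have nzd: "c \<in> M" if "c \<in> carrier R" "f i \<otimes> c \<in> M" for c
  proof -
   have "c \<in> ?L 1" using that fc by simp
   then show ?thesis using k[of 1] \<open>?L k = M\<close> by blast
  qed
  have fa: "f i \<otimes> a \<in> carrier R" using fc a by simp
  let ?S = "{j \<oplus> f i \<otimes> a \<otimes> z | j z. j \<in> M \<and> z \<in> carrier R}"
  have "a \<notin> M" using Ma[OF p1] a by simp
  then have "f i \<otimes> a \<notin> M" using nzd a by blast
  then have "?S \<noteq> M" using ideal_plus_principal(3)[OF M fa] by blast
  then obtain s where s: "s \<in> carrier R - p" "s \<otimes> a \<in> ?S"
   using big[OF ideal_plus_principal(1,2)[OF M fa]] by blast
  then obtain j z where jz: "s \<otimes> a = j \<oplus> f i \<otimes> a \<otimes> z" "j \<in> M" "z \<in> carrier R" by blast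
  have jc: "j \<in> carrier R" using ideal_carr[OF M jz(2)] .
  have sc: "s \<in> carrier R" using s by auto
  \<comment> \<open>As in Nakayama's lemma: \<open>s - f i z\<close> is still outside
    \<open>p\<close>, because \<open>f i\<close> lies in \<open>I\<close> and hence in
    \<open>p\<close>.\<close>
  have "(s \<ominus> f i \<otimes> z) \<otimes> a = s \<otimes> a \<ominus> f i \<otimes> a \<otimes> z" using sc fc jz(3) a by algebra
  also have "\<dots> = j" unfolding jz(1) using jc fc jz(3) a by algebra
  finally have "(s \<ominus> f i \<otimes> z) \<otimes> a \<in> M" using jz(2) by simp
  moreover have "s \<ominus> f i \<otimes> z \<in> carrier R - p"
  proof -
   have "f i \<otimes> z \<in> p" using f_I[OF i] Ip' ideal_rmult[OF pI _ jz(3)] by blast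
   then have "s \<ominus> f i \<otimes> z \<notin> p" using ideal_subst[OF pI _ _ sc] s(1) by blast
   then show ?thesis using sc fc jz(3) by simp
  qed
  ultimately show False using Ma by blast
 qed
 obtain m where m: "Ip m \<subseteq> M" using power_sub_if_nilpotent[OF M nil] by blast
 obtain s j where "s \<in> carrier R - p" "j \<in> J" "s \<otimes> a \<ominus> j \<in> Ip m" using *[of m] by blast
 then show False using Ma[of s] ideal_subst[OF M, of "s \<otimes> a" j] m JM a by blast
qed

end

subsection \<open>Elements with open conductor\<close>

context cring begin

text \<open>Vanishing in the local ring at \<open>p\<close>, kept free of fractions; all statements
  about that local ring are written in this style, up to a factor outside \<open>p\<close>.\<close>

definition loc_zero :: "'a set => 'a => bool" where
 "loc_zero p x \<longleftrightarrow> (\<exists>s\<in>carrier R - p. s \<otimes> x = \<zero>)"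

lemma prime_compl_mult:
 "primeideal p R ==> s \<in> carrier R - p ==> t \<in> carrier R - p ==> s \<otimes> t \<in> carrier R - p"
 using primeideal.I_prime[of p R s t] by auto

lemma prime_compl_one: "primeideal p R ==> \<one> \<in> carrier R - p"
 using primeideal.I_notcarr[of p R] ideal.one_imp_carrier[of p R] primeideal.axioms(1)[of p R] by auto

lemma prime_pow:
 assumes "primeideal p R" "x \<in> carrier R" "x [^] (n::nat) \<in> p"
 shows "x \<in> p"
 using assms(3)
proof (induction n)
 case 0
 then show ?case using prime_compl_one[OF assms(1)] by simp
next
 case (Suc n)
 then show ?case using primeideal.I_prime[OF assms(1), of "x [^] n" x] assms(2) by auto
qed

lemma prime_compl_pow:
 "primeideal p R ==> s \<in> carrier R - p ==> s [^] (n::nat) \<in> carrier R - p"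
 using prime_pow[of p s n] by auto

lemma comb_sum:
 assumes f: "\<And>i. i < n ==> f i \<in> carrier R" and x: "x \<in> comb n f (carrier R) {\<zero>}"
 shows "\<exists>c. (\<forall>i<n. c i \<in> carrier R) \<and> x = (\<Oplus>i\<in>{..<n}. c i \<otimes> f i)"
 using assms
proof (induction n arbitrary: x)
 case 0
 then show ?case by simp
next
 case (Suc n)
 from Suc.prems(2) obtain y z where xy: "x = y \<oplus> f n \<otimes> z" "y \<in> comb n f (carrier R) {\<zero>}" "z \<in> carrier R"
  by auto
 obtain c where c: "\<And>i. i < n ==> c i \<in> carrier R" "y = (\<Oplus>i\<in>{..<n}. c i \<otimes> f i)"
  using Suc.IH[OF _ xy(2)] Suc.prems(1) by auto
 define c' where "c' = c(n := z)"
 have cc: "c' i \<in> carrier R" if "i < Suc n" for i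
  unfolding c'_def using c xy(3) that by (cases "i = n") auto
 have "(\<Oplus>i\<in>{..<n}. c' i \<otimes> f i) = y"
  unfolding c(2) by (rule finsum_cong') (use c Suc.prems(1) in \<open>auto simp: c'_def\<close>)
 moreover have "y \<in> carrier R" unfolding c(2) by (rule finsum_closed) (use c Suc.prems(1) in auto)
 moreover have "(\<Oplus>i\<in>{..<Suc n}. c' i \<otimes> f i) = c' n \<otimes> f n \<oplus> (\<Oplus>i\<in>{..<n}. c' i \<otimes> f i)"
  unfolding lessThan_Suc by (rule finsum_insert) (use cc Suc.prems(1) in auto)
 ultimately have "x = (\<Oplus>i\<in>{..<Suc n}. c' i \<otimes> f i)"
  unfolding xy(1) c'_def using Suc.prems(1)[of n] xy(3) by (simp add: m_comm a_comm)
 then show ?case using cc by blast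
qed

end

text \<open>The assumptions say that for each open prime \<open>p\<close> the local ring \<open>R\<^sub>p\<close> is an integrally closed
 domain in which \<open>I\<close> does not vanish. In \<open>nor\<close> the element \<open>e 1 / e 0\<close> is the integral one,
 with powers \<open>e i / e 0\<close>.\<close>

locale locally_normal = fg_ideal +
 assumes dom: "\<And>p a b. primeideal p R ==> I \<subseteq> p ==> a \<in> carrier R ==> b \<in> carrier R ==>
   loc_zero p (a \<otimes> b) ==> loc_zero p a \<or> loc_zero p b"
  and nz: "\<And>p. primeideal p R ==> I \<subseteq> p ==> \<exists>i<r. \<not> loc_zero p (f i)"
  and nor: "\<And>p n e c. primeideal p R ==> I \<subseteq> p ==> 0 < n ==> (\<And>i. i \<le> n ==> e i \<in> carrier R) ==>
   (\<And>i. i < n ==> c i \<in> carrier R) ==> (\<And>i. i < n ==> e i \<otimes> e 1 = e (Suc i) \<otimes> e 0) ==>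
   e n = (\<Oplus>i\<in>{..<n}. c i \<otimes> e i) ==> \<not> loc_zero p (e 0) ==>
   \<exists>s\<in>carrier R - p. \<exists>a\<in>carrier R. s \<otimes> e 1 = e 0 \<otimes> a"
begin

lemma I_sub_prime:
 assumes "primeideal p R" "\<And>i. i < r ==> f i [^] (N::nat) \<in> p"
 shows "I \<subseteq> p"
 unfolding I_gen
 using prime_pow[OF assms(1) f_carr assms(2)]
 by (intro genideal_minimal[OF primeideal.axioms(1)[OF assms(1)]]) auto

lemma loc_zero_pow:
 assumes p: "primeideal p R" "I \<subseteq> p" and a: "a \<in> carrier R" and z: "loc_zero p (a [^] (n::nat))"
 shows "loc_zero p a"
 using z
proof (induction n)
 case 0
 then obtain s where "s \<in> carrier R - p" "s \<otimes> \<one> = \<zero>" unfolding loc_zero_def by auto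
 then show ?case unfolding loc_zero_def using a by (intro bexI[of _ s]) auto
next
 case (Suc n)
 then show ?case using dom[OF p nat_pow_closed[OF a] a, of n] by auto
qed

text \<open>Otherwise some multiple \<open>x h\<close> has a prime annihilator. It contains powers
  of all \<open>f i\<close>, hence \<open>I\<close>. But some \<open>f i\<close> is nonzero in the
  local domain at this prime, so \<open>x h\<close> vanishes there, that is, it is killed by an
  element outside its own annihilator.\<close>

lemma torsion_free:
 assumes x: "x \<in> carrier R" and "\<And>i. i < r ==> f i [^] (N::nat) \<otimes> x = \<zero>"
 shows "x = \<zero>"
proof (rule ccontr)
 assume "x \<noteq> \<zero>"
 have N: "ideal {c \<in> carrier R. x \<otimes> c \<in> {\<zero>}} R" (is "ideal ?N R") by (rule colon_ideal[OF zeroideal x])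
 have "\<one> \<notin> ?N" using x \<open>x \<noteq> \<zero>\<close> by simp
 then have "?N \<noteq> carrier R" by blast
 from exists_prime_colon[OF noeth N this] obtain h where h: "h \<in> carrier R"
  and p: "primeideal {c \<in> carrier R. h \<otimes> c \<in> ?N} R" (is "primeideal ?p R") by blast
 have xh: "x \<otimes> h \<in> carrier R" using x h by simp
 have kill: "f i [^] N \<otimes> (x \<otimes> h) = \<zero>" if i: "i < r" for i
 proof -
  have "f i [^] N \<otimes> (x \<otimes> h) = (f i [^] N \<otimes> x) \<otimes> h" using x h f_carr[OF i] by (simp add: m_assoc)
  then show ?thesis using assms(2)[OF i] h by simp
 qed
 have "f i [^] N \<in> ?p" if i: "i < r" for i
 proof -
  have "x \<otimes> (h \<otimes> f i [^] N) = f i [^] N \<otimes> (x \<otimes> h)" using x h f_carr[OF i] by (simp add: m_ac)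
  then show ?thesis using kill[OF i] h f_carr[OF i] by simp
 qed
 then have Isub: "I \<subseteq> ?p" by (rule I_sub_prime[OF p])
 obtain i where i: "i < r" "\<not> loc_zero ?p (f i)" using nz[OF p Isub] by blast
 have "loc_zero ?p (f i [^] N \<otimes> (x \<otimes> h))"
  unfolding kill[OF i(1)] loc_zero_def using prime_compl_one[OF p] by (intro bexI[of _ \<one>]) auto
 then have "loc_zero ?p (x \<otimes> h)"
  using dom[OF p Isub _ xh, of "f i [^] N"] loc_zero_pow[OF p Isub f_carr[OF i(1)], of N] i f_carr[OF i(1)]
  by blast
 then obtain s where s: "s \<in> carrier R - ?p" "s \<otimes> (x \<otimes> h) = \<zero>" unfolding loc_zero_def by blast
 have "x \<otimes> (h \<otimes> s) = s \<otimes> (x \<otimes> h)" using s(1) x h by (simp add: m_ac)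
 then have "s \<in> ?p" using s h by simp
 then show False using s(1) by blast
qed

lemma I_adic_saturation:
 "\<exists>n0. \<forall>n\<ge>n0. \<forall>a\<in>carrier R. (\<forall>i<r. \<exists>K::nat. f i [^] K \<otimes> a \<in> Ip (n + K)) --> a \<in> Ip n"
 by (rule ratliff_rush) (rule torsion_free)

text \<open>For a prime \<open>p = (R : h g)\<close>, the element \<open>h g\<close> cannot map \<open>p\<close> into itself, for then it
 would be integral over \<open>R\<close>.\<close>

theorem pole_divisor:
 fixes S :: "('s, 'k) ring_scheme"
 assumes S: "cring S" and \<rho>: "\<rho> \<in> ring_hom R S" and inj: "inj_on \<rho> (carrier R)"
  and tf: "\<And>x N. x \<in> carrier S ==> (\<And>i. i < r ==> \<rho> (f i) [^]\<^bsub>S\<^esub> (N::nat) \<otimes>\<^bsub>S\<^esub> x = \<zero>\<^bsub>S\<^esub>) ==> x = \<zero>\<^bsub>S\<^esub>"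
  and g: "g \<in> carrier S" and cond: "\<And>c. c \<in> Ip m ==> \<rho> c \<otimes>\<^bsub>S\<^esub> g \<in> \<rho> ` carrier R"
  and notin: "g \<notin> \<rho> ` carrier R"
 shows "\<exists>p t u h. primeideal p R \<and> I \<subseteq> p \<and> t \<in> p \<and> u \<in> carrier R - p \<and> h \<in> carrier R \<and>
  \<rho> t \<otimes>\<^bsub>S\<^esub> (\<rho> h \<otimes>\<^bsub>S\<^esub> g) = \<rho> u \<and> (\<forall>c\<in>p. \<exists>d\<in>carrier R. u \<otimes> c = t \<otimes> d)"
proof -
 interpret S: cring S by fact
 interpret \<rho>: ring_hom_cring R S \<rho>
  by (intro ring_hom_cring.intro ring_hom_cring_axioms.intro is_cring S \<rho>)
 note rc = \<rho>.hom_closed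
 have hpow: "\<rho> (x [^] n) = \<rho> x [^]\<^bsub>S\<^esub> n" if "x \<in> carrier R" for x and n :: nat
  by (induction n) (use that in auto)
 \<comment> \<open>The conductor of \<open>g\<close>. The prime \<open>p\<close> is an associated
   prime of it and is itself the conductor of \<open>y = h g\<close>.\<close>
 let ?N = "{h \<in> carrier R. \<rho> h \<otimes>\<^bsub>S\<^esub> g \<in> \<rho> ` carrier R}"
 have N: "ideal ?N R"
 proof (rule idealI')
  have "\<rho> \<zero> \<otimes>\<^bsub>S\<^esub> g = \<rho> \<zero>" using g by simp
  then show "\<zero> \<in> ?N" by force
  show "a \<oplus> b \<in> ?N" if "a \<in> ?N" "b \<in> ?N" for a b
  proof -
   obtain a' b' where *: "a' \<in> carrier R" "b' \<in> carrier R" "\<rho> a \<otimes>\<^bsub>S\<^esub> g = \<rho> a'" "\<rho> b \<otimes>\<^bsub>S\<^esub> g = \<rho> b'"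
    using \<open>a \<in> ?N\<close> \<open>b \<in> ?N\<close> by auto
   then have "\<rho> (a \<oplus> b) \<otimes>\<^bsub>S\<^esub> g = \<rho> (a' \<oplus> b')" using that g by (simp add: S.l_distr)
   moreover have "a' \<oplus> b' \<in> carrier R" using * by simp
   ultimately have "\<rho> (a \<oplus> b) \<otimes>\<^bsub>S\<^esub> g \<in> \<rho> ` carrier R" by (simp only: imageI)
   then show ?thesis using that by (simp del: \<rho>.hom_add)
  qed
  show "z \<otimes> a \<in> ?N" if "a \<in> ?N" "z \<in> carrier R" for a z
  proof -
   obtain a' where *: "a' \<in> carrier R" "\<rho> a \<otimes>\<^bsub>S\<^esub> g = \<rho> a'" using \<open>a \<in> ?N\<close> by auto
   then have "\<rho> (z \<otimes> a) \<otimes>\<^bsub>S\<^esub> g = \<rho> (z \<otimes> a')" using that g by (simp add: S.m_assoc)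
   moreover have "z \<otimes> a' \<in> carrier R" using * that by simp
   ultimately have "\<rho> (z \<otimes> a) \<otimes>\<^bsub>S\<^esub> g \<in> \<rho> ` carrier R" by (simp only: imageI)
   then show ?thesis using that by (simp del: \<rho>.hom_mult)
  qed
 qed auto
 have "\<one> \<notin> ?N" using notin g by simp
 then have "?N \<noteq> carrier R" by blast
 from exists_prime_colon[OF noeth N this] obtain h where h: "h \<in> carrier R"
  and p: "primeideal {c \<in> carrier R. h \<otimes> c \<in> ?N} R" by blast
 define p where "p = {c \<in> carrier R. h \<otimes> c \<in> ?N}"
 define y where "y = \<rho> h \<otimes>\<^bsub>S\<^esub> g"
 have yc: "y \<in> carrier S" unfolding y_def using h g by simp
 have prime: "primeideal p R" using p unfolding p_def .
 then have pI: "ideal p R" by (rule primeideal.axioms(1))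
 have p_iff: "c \<in> p \<longleftrightarrow> c \<in> carrier R \<and> \<rho> c \<otimes>\<^bsub>S\<^esub> y \<in> \<rho> ` carrier R" for c
 proof -
  have "\<rho> (h \<otimes> c) \<otimes>\<^bsub>S\<^esub> g = \<rho> c \<otimes>\<^bsub>S\<^esub> y" if "c \<in> carrier R"
   unfolding y_def using that h g by (simp add: S.m_ac)
  then show ?thesis unfolding p_def using h by auto
 qed
 \<comment> \<open>Multiplication by \<open>I^m\<close> brings \<open>g\<close> into the ring, so
   the conductor contains powers of all \<open>f i\<close>; this makes \<open>p\<close> contain
   \<open>I\<close>.\<close>
 have "f i [^] m \<in> p" if i: "i < r" for i
 proof -
  have "f i [^] m \<in> Ip m" by (rule ideal_power_pow[OF I_ideal f_I[OF i]])
  then have "h \<otimes> f i [^] m \<in> Ip m" using ideal_lmult[OF Ip_ideal _ h] by blast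
  then show ?thesis unfolding p_def using cond[of "h \<otimes> f i [^] m"] h f_carr[OF i] by simp
 qed
 then have Isub: "I \<subseteq> p" by (rule I_sub_prime[OF prime])
 have notstable: "\<exists>t\<in>p. \<exists>u\<in>carrier R - p. \<rho> t \<otimes>\<^bsub>S\<^esub> y = \<rho> u"
 proof (rule ccontr)
  assume "\<not> ?thesis"
  then have "\<exists>d\<in>p. \<rho> c \<otimes>\<^bsub>S\<^esub> y = \<rho> d" if "c \<in> p" for c
   using that p_iff[of c] by auto
  then have "\<forall>c. \<exists>d. c \<in> p --> d \<in> p \<and> \<rho> c \<otimes>\<^bsub>S\<^esub> y = \<rho> d" by blast
  from choice[OF this] obtain \<theta> where \<theta>: "\<And>c. c \<in> p ==> \<theta> c \<in> p" "\<And>c. c \<in> p ==> \<rho> c \<otimes>\<^bsub>S\<^esub> y = \<rho> (\<theta> c)"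
   by blast
  obtain i0 where i0: "i0 < r" "\<not> loc_zero p (f i0)" using nz[OF prime Isub] by blast
  \<comment> \<open>If multiplication by \<open>y\<close> mapped \<open>p\<close> into itself, all
    \<open>f i0 y^i\<close> would lie in the ring. The ascending chain of ideals spanned by the
    first of them is stationary, which yields an equation of integral dependence for
    \<open>y = e 1 / e 0\<close>.\<close>
  define e where "e = (\<lambda>i::nat. (\<theta> ^^ i) (f i0))"
  have e0: "e 0 = f i0" and eS: "e (Suc i) = \<theta> (e i)" for i unfolding e_def by simp_all
  have ep: "e i \<in> p" for i by (induction i) (use e0 eS f_I[OF i0(1)] Isub \<theta> in auto)
  have ec: "e i \<in> carrier R" for i using ideal_carr[OF pI ep] .
  have er: "\<rho> (e (Suc i)) = \<rho> (e i) \<otimes>\<^bsub>S\<^esub> y" for i using \<theta>(2)[OF ep] eS by simp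
  have rel: "e i \<otimes> e 1 = e (Suc i) \<otimes> e 0" for i
  proof (rule inj_onD[OF inj])
   show "\<rho> (e i \<otimes> e 1) = \<rho> (e (Suc i) \<otimes> e 0)"
    using er[of i] er[of 0] ec yc by (simp add: S.m_ac)
  qed (use ec in auto)
  let ?L = "\<lambda>n. comb n e (carrier R) {\<zero>}"
  have LI: "ideal (?L n) R" for n by (rule comb_ideal[OF oneideal zeroideal]) (use ec in auto)
  have LS: "?L n \<subseteq> ?L (Suc n)" for n
  proof
   fix x assume x: "x \<in> ?L n"
   have "x = x \<oplus> e n \<otimes> \<zero>" using ideal_carr[OF LI x] ec by simp
   then show "x \<in> ?L (Suc n)" unfolding comb.simps using x by blast
  qed
  obtain n where n: "\<And>j. ?L j \<subseteq> ?L n" using noetherian_stable[OF noeth, of ?L, OF LI LS] by blast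
  define k where "k = Suc n"
  have "e k \<in> ?L (Suc k)"
   using comb_gen[OF oneideal zeroideal, of "Suc k" e k \<one>] ec by simp
  then have "e k \<in> ?L k" using n[of "Suc k"] LS[of n] unfolding k_def by blast
  then obtain c where c: "\<And>i. i < k ==> c i \<in> carrier R" "e k = (\<Oplus>i\<in>{..<k}. c i \<otimes> e i)"
   using comb_sum[of k e "e k"] ec by blast
  obtain s a where sa: "s \<in> carrier R - p" "a \<in> carrier R" "s \<otimes> e 1 = e 0 \<otimes> a"
   using nor[OF prime Isub _ ec c(1) rel c(2)] i0(2) e0 unfolding k_def by auto
  have sc: "s \<in> carrier R" using sa by blast
  \<comment> \<open>Integral closedness gives \<open>s y = a\<close> only after multiplication by
    \<open>e 0\<close>, which may be a zero divisor on \<open>S\<close>. To remove it,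
    \<open>z\<close> is multiplied by \<open>f i^m\<close>: this moves it into the ring, where
    \<open>e 0\<close> is nonzero in a local domain.\<close>
  define z where "z = \<rho> s \<otimes>\<^bsub>S\<^esub> y \<ominus>\<^bsub>S\<^esub> \<rho> a"
  have zc: "z \<in> carrier S" unfolding z_def using sc sa(2) yc by simp
  have bz: "\<rho> (e 0) \<otimes>\<^bsub>S\<^esub> z = \<zero>\<^bsub>S\<^esub>"
  proof -
   have "\<rho> (e 0) \<otimes>\<^bsub>S\<^esub> z = \<rho> s \<otimes>\<^bsub>S\<^esub> (\<rho> (e 0) \<otimes>\<^bsub>S\<^esub> y) \<ominus>\<^bsub>S\<^esub> \<rho> (e 0) \<otimes>\<^bsub>S\<^esub> \<rho> a"
    unfolding z_def using rc[OF sc] rc[OF sa(2)] rc[OF ec] yc by algebra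
   also have "\<rho> s \<otimes>\<^bsub>S\<^esub> (\<rho> (e 0) \<otimes>\<^bsub>S\<^esub> y) = \<rho> (s \<otimes> e 1)" using er[of 0] sc ec by simp
   also have "\<rho> (e 0) \<otimes>\<^bsub>S\<^esub> \<rho> a = \<rho> (s \<otimes> e 1)" using sa ec by simp
   finally show ?thesis using sc ec by (simp add: S.r_right_minus_eq)
  qed
  \<comment> \<open>One factor \<open>s'\<close> outside \<open>p\<close> is collected for all
    indices, by induction over their number.\<close>
  have ex: "\<exists>s'\<in>carrier R - p. \<forall>i<k. \<rho> (s' \<otimes> f i [^] m) \<otimes>\<^bsub>S\<^esub> z = \<zero>\<^bsub>S\<^esub>" if "k \<le> r" for k
   using that
  proof (induction k)
   case 0
   then show ?case using prime_compl_one[OF prime] by auto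
  next
   case (Suc k)
   then obtain s' where s': "s' \<in> carrier R - p" "\<And>i. i < k ==> \<rho> (s' \<otimes> f i [^] m) \<otimes>\<^bsub>S\<^esub> z = \<zero>\<^bsub>S\<^esub>"
    by auto
   have kr: "k < r" using Suc.prems by simp
   have fk: "f k [^] m \<in> carrier R" using f_carr[OF kr] by simp
   have fI: "f k [^] m \<in> Ip m" by (rule ideal_power_pow[OF I_ideal f_I[OF kr]])
   have "\<rho> (f k [^] m \<otimes> h \<otimes> s) \<otimes>\<^bsub>S\<^esub> g \<in> \<rho> ` carrier R"
    by (rule cond) (use ideal_rmult[OF Ip_ideal ideal_rmult[OF Ip_ideal fI h] sc] in blast)
   then obtain w where w: "w \<in> carrier R" "\<rho> (f k [^] m \<otimes> h \<otimes> s) \<otimes>\<^bsub>S\<^esub> g = \<rho> w" by blast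
   define v where "v = w \<ominus> f k [^] m \<otimes> a"
   have vc: "v \<in> carrier R" unfolding v_def using w fk sa(2) by simp
   have rfk: "\<rho> (f k [^] m) \<otimes>\<^bsub>S\<^esub> z = \<rho> v"
   proof -
    have "\<rho> (f k [^] m) \<otimes>\<^bsub>S\<^esub> z = \<rho> (f k [^] m) \<otimes>\<^bsub>S\<^esub> \<rho> h \<otimes>\<^bsub>S\<^esub> \<rho> s \<otimes>\<^bsub>S\<^esub> g \<ominus>\<^bsub>S\<^esub> \<rho> (f k [^] m) \<otimes>\<^bsub>S\<^esub> \<rho> a"
     unfolding z_def y_def using rc[OF sc] rc[OF sa(2)] rc[OF h] rc[OF fk] g by algebra
    also have "\<rho> (f k [^] m) \<otimes>\<^bsub>S\<^esub> \<rho> h \<otimes>\<^bsub>S\<^esub> \<rho> s \<otimes>\<^bsub>S\<^esub> g = \<rho> w"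
     using w(2) fk h sc by (simp only: \<rho>.hom_mult m_closed)
    finally show ?thesis unfolding v_def using w(1) fk sa(2) by (simp only: \<rho>.hom_mult m_closed \<rho>.hom_sub)
   qed
   have "\<rho> (e 0 \<otimes> v) = \<rho> (f k [^] m) \<otimes>\<^bsub>S\<^esub> (\<rho> (e 0) \<otimes>\<^bsub>S\<^esub> z)"
    using rfk[symmetric] ec vc zc rc[OF fk] by (simp add: S.m_ac)
   then have "\<rho> (e 0 \<otimes> v) = \<rho> \<zero>" unfolding bz using rc[OF fk] by simp
   then have "e 0 \<otimes> v = \<zero>" by (rule inj_onD[OF inj]) (use ec vc in auto)
   then have "loc_zero p (e 0 \<otimes> v)"
    unfolding loc_zero_def using prime_compl_one[OF prime] by (intro bexI[of _ \<one>]) auto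
   then have "loc_zero p v" using dom[OF prime Isub ec[of 0] vc] i0(2) unfolding e0 by blast
   then obtain s2 where s2: "s2 \<in> carrier R - p" "s2 \<otimes> v = \<zero>" unfolding loc_zero_def by blast
   show ?case
   proof (intro bexI[of _ "s' \<otimes> s2"] allI impI)
    show ss: "s' \<otimes> s2 \<in> carrier R - p" by (rule prime_compl_mult[OF prime s'(1) s2(1)])
    fix i assume "i < Suc k"
    have cs: "s' \<in> carrier R" "s2 \<in> carrier R" using s' s2 by auto
    show "\<rho> (s' \<otimes> s2 \<otimes> f i [^] m) \<otimes>\<^bsub>S\<^esub> z = \<zero>\<^bsub>S\<^esub>"
    proof (cases "i = k")
     case True
     have "\<rho> (s' \<otimes> s2 \<otimes> f k [^] m) \<otimes>\<^bsub>S\<^esub> z = \<rho> s' \<otimes>\<^bsub>S\<^esub> (\<rho> s2 \<otimes>\<^bsub>S\<^esub> (\<rho> (f k [^] m) \<otimes>\<^bsub>S\<^esub> z))"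
      using cs fk zc rc by (simp add: S.m_assoc)
     also have "\<dots> = \<rho> s' \<otimes>\<^bsub>S\<^esub> \<rho> (s2 \<otimes> v)" unfolding rfk using cs vc by simp
     finally show ?thesis unfolding s2(2) True using cs by simp
    next
     case False
     then have i: "i < k" "i < r" using \<open>i < Suc k\<close> kr by auto
     have "f i [^] m \<in> carrier R" using f_carr[OF i(2)] by simp
     then have "\<rho> (s' \<otimes> s2 \<otimes> f i [^] m) \<otimes>\<^bsub>S\<^esub> z = \<rho> s2 \<otimes>\<^bsub>S\<^esub> (\<rho> (s' \<otimes> f i [^] m) \<otimes>\<^bsub>S\<^esub> z)"
      using cs zc rc by (simp add: S.m_ac)
     then show ?thesis using s'(2)[OF i(1)] cs by simp
    qed
   qed
  qed
  obtain s' where s': "s' \<in> carrier R - p" "\<And>i. i < r ==> \<rho> (s' \<otimes> f i [^] m) \<otimes>\<^bsub>S\<^esub> z = \<zero>\<^bsub>S\<^esub>"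
   using ex[of r] by auto
  have s'c: "s' \<in> carrier R" using s' by blast
  have "\<rho> s' \<otimes>\<^bsub>S\<^esub> z = \<zero>\<^bsub>S\<^esub>"
  proof (rule tf[of _ m])
   show "\<rho> s' \<otimes>\<^bsub>S\<^esub> z \<in> carrier S" using s'c zc by simp
   fix i assume i: "i < r"
   have "f i [^] m \<in> carrier R" using f_carr[OF i] by simp
   then have "\<rho> (f i [^] m) \<otimes>\<^bsub>S\<^esub> (\<rho> s' \<otimes>\<^bsub>S\<^esub> z) = \<rho> (s' \<otimes> f i [^] m) \<otimes>\<^bsub>S\<^esub> z"
    using s'c zc rc by (simp add: S.m_ac)
   then show "\<rho> (f i) [^]\<^bsub>S\<^esub> m \<otimes>\<^bsub>S\<^esub> (\<rho> s' \<otimes>\<^bsub>S\<^esub> z) = \<zero>\<^bsub>S\<^esub>"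
    using s'(2)[OF i] hpow[OF f_carr[OF i]] by simp
  qed
  moreover have "\<rho> s' \<otimes>\<^bsub>S\<^esub> z = \<rho> (s' \<otimes> s) \<otimes>\<^bsub>S\<^esub> y \<ominus>\<^bsub>S\<^esub> \<rho> (s' \<otimes> a)"
   unfolding \<rho>.hom_mult[OF s'c sc] \<rho>.hom_mult[OF s'c sa(2)] z_def
   using rc[OF s'c] rc[OF sc] rc[OF sa(2)] yc by algebra
  ultimately have "\<rho> (s' \<otimes> s) \<otimes>\<^bsub>S\<^esub> y = \<rho> (s' \<otimes> a)"
   using s'c sc sa(2) yc S.r_right_minus_eq[of "\<rho> (s' \<otimes> s) \<otimes>\<^bsub>S\<^esub> y" "\<rho> (s' \<otimes> a)"] by auto
  then have "\<rho> (s' \<otimes> s) \<otimes>\<^bsub>S\<^esub> y \<in> \<rho> ` carrier R" using s'c sa(2) by (simp only: imageI m_closed)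
  then have "s' \<otimes> s \<in> p" unfolding p_iff using s'c sc by blast
  then show False using prime_compl_mult[OF prime s'(1) sa(1)] by blast
 qed
 then obtain t u where tu: "t \<in> p" "u \<in> carrier R - p" "\<rho> t \<otimes>\<^bsub>S\<^esub> y = \<rho> u" by blast
 have tc: "t \<in> carrier R" using ideal_carr[OF pI tu(1)] .
 \<comment> \<open>From \<open>t y = u\<close> follows \<open>u c = t (c y)\<close>, and
   \<open>c y\<close> lies in the ring for \<open>c\<close> in \<open>p\<close>. So \<open>t\<close>
   generates the maximal ideal once \<open>u\<close> is inverted.\<close>
 have "\<exists>d\<in>carrier R. u \<otimes> c = t \<otimes> d" if c: "c \<in> p" for c
 proof -
  obtain d where d: "d \<in> carrier R" "\<rho> c \<otimes>\<^bsub>S\<^esub> y = \<rho> d" using c p_iff by auto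
  have cc: "c \<in> carrier R" using ideal_carr[OF pI c] .
  have "\<rho> (u \<otimes> c) = \<rho> t \<otimes>\<^bsub>S\<^esub> (\<rho> c \<otimes>\<^bsub>S\<^esub> y)"
   using tu(2) tu(3)[symmetric] tc cc yc by (simp add: S.m_ac)
  then have "\<rho> (u \<otimes> c) = \<rho> (t \<otimes> d)" using d tc by simp
  then have "u \<otimes> c = t \<otimes> d" by (rule inj_onD[OF inj]) (use tu cc tc d in auto)
  then show ?thesis using d by blast
 qed
 then show ?thesis using prime Isub tu h unfolding y_def by blast
qed

end

subsection \<open>Localization\<close>

locale mult_subset = cring R for R :: "('a, 'm) ring_scheme" (structure) +
 fixes S :: "'a set"
 assumes S_sub: "S \<subseteq> carrier R" and S_one: "\<one> \<in> S"
  and S_mult: "s \<in> S ==> t \<in> S ==> s \<otimes> t \<in> S"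
begin

abbreviation L where "L \<equiv> localization R S"
abbreviation fr where "fr \<equiv> mk_frac R S"

lemma S_carr: "s \<in> S ==> s \<in> carrier R"
 using S_sub by blast

lemma mk_frac_mem:
 assumes "a \<in> carrier R" "s \<in> S"
 shows "(b, t) \<in> fr a s \<longleftrightarrow> b \<in> carrier R \<and> t \<in> S \<and> (\<exists>u\<in>S. u \<otimes> (t \<otimes> a) = u \<otimes> (s \<otimes> b))"
proof -
 have "u \<otimes> (t \<otimes> a \<ominus> s \<otimes> b) = \<zero> \<longleftrightarrow> u \<otimes> (t \<otimes> a) = u \<otimes> (s \<otimes> b)"
  if "u \<in> S" "t \<in> S" "b \<in> carrier R" for u
 proof -
  note c = that(1,2)[THEN S_carr] that(3) assms(1) S_carr[OF assms(2)]
  have "u \<otimes> (t \<otimes> a \<ominus> s \<otimes> b) = u \<otimes> (t \<otimes> a) \<ominus> u \<otimes> (s \<otimes> b)" using c by algebra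
  then show ?thesis using c r_right_minus_eq[of "u \<otimes> (t \<otimes> a)" "u \<otimes> (s \<otimes> b)"] by simp
 qed
 then show ?thesis unfolding mk_frac_def by auto
qed

lemma mk_frac_self: "a \<in> carrier R ==> s \<in> S ==> (a, s) \<in> fr a s"
 unfolding mk_frac_mem using S_one by auto

lemma mk_frac_eq:
 assumes "a \<in> carrier R" "s \<in> S" "b \<in> carrier R" "t \<in> S"
 shows "fr a s = fr b t \<longleftrightarrow> (\<exists>u\<in>S. u \<otimes> (t \<otimes> a) = u \<otimes> (s \<otimes> b))"
proof
 assume "fr a s = fr b t"
 then have "(b, t) \<in> fr a s" using mk_frac_self[OF assms(3,4)] by simp
 then show "\<exists>u\<in>S. u \<otimes> (t \<otimes> a) = u \<otimes> (s \<otimes> b)" using mk_frac_mem[OF assms(1,2)] by blast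
next
 assume "\<exists>u\<in>S. u \<otimes> (t \<otimes> a) = u \<otimes> (s \<otimes> b)"
 then obtain u where u: "u \<in> S" "u \<otimes> (t \<otimes> a) = u \<otimes> (s \<otimes> b)" by blast
 have sub: "fr b t \<subseteq> fr a s"
  if hyp: "u \<in> S" "u \<otimes> (t \<otimes> a) = u \<otimes> (s \<otimes> b)" "a \<in> carrier R" "s \<in> S" "b \<in> carrier R" "t \<in> S"
  for u a s b t
 proof
  fix z assume z: "z \<in> fr b t"
  obtain c v where cv: "z = (c, v)" by (cases z)
  obtain w where w: "c \<in> carrier R" "v \<in> S" "w \<in> S" "w \<otimes> (v \<otimes> b) = w \<otimes> (t \<otimes> c)"
   using z mk_frac_mem[OF hyp(5,6)] unfolding cv by blast
  note cc = hyp(3,5) w(1) S_carr[OF hyp(1)] S_carr[OF hyp(4)] S_carr[OF hyp(6)] S_carr[OF w(2)] S_carr[OF w(3)]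
  have "(u \<otimes> w \<otimes> t) \<otimes> (v \<otimes> a) = (w \<otimes> v) \<otimes> (u \<otimes> (t \<otimes> a))" using cc by (simp add: m_ac)
  also have "\<dots> = (u \<otimes> s) \<otimes> (w \<otimes> (v \<otimes> b))" unfolding hyp(2) using cc by (simp add: m_ac)
  also have "\<dots> = (u \<otimes> w \<otimes> t) \<otimes> (s \<otimes> c)" unfolding w(4) using cc by (simp add: m_ac)
  finally show "z \<in> fr a s" unfolding cv mk_frac_mem[OF hyp(3,4)]
   using w hyp S_mult by blast
 qed
 show "fr a s = fr b t"
  using sub[OF u assms] sub[OF u(1) u(2)[symmetric] assms(3,4,1,2)] by blast
qed

lemma L_carrier: "carrier L = {fr a s | a s. a \<in> carrier R \<and> s \<in> S}"
 by (simp add: localization_def)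

lemma fr_carrier [intro, simp]: "a \<in> carrier R ==> s \<in> S ==> fr a s \<in> carrier L"
 unfolding L_carrier by blast

lemma L_one: "\<one>\<^bsub>L\<^esub> = fr \<one> \<one>" and L_zero: "\<zero>\<^bsub>L\<^esub> = fr \<zero> \<one>"
 by (simp_all add: localization_def)

lemma L_mult:
 assumes "a \<in> carrier R" "s \<in> S" "b \<in> carrier R" "t \<in> S"
 shows "fr a s \<otimes>\<^bsub>L\<^esub> fr b t = fr (a \<otimes> b) (s \<otimes> t)"
proof -
 \<comment> \<open>Independence of the representatives; it makes the union in the definition of the
   product a union of equal sets.\<close>
 have key: "fr (a' \<otimes> b') (s' \<otimes> t') = fr (a \<otimes> b) (s \<otimes> t)"
  if A: "(a', s') \<in> fr a s" and B: "(b', t') \<in> fr b t" for a' s' b' t'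
 proof -
  obtain u where u: "a' \<in> carrier R" "s' \<in> S" "u \<in> S" "u \<otimes> (s' \<otimes> a) = u \<otimes> (s \<otimes> a')"
   using A unfolding mk_frac_mem[OF assms(1,2)] by blast
  obtain v where v: "b' \<in> carrier R" "t' \<in> S" "v \<in> S" "v \<otimes> (t' \<otimes> b) = v \<otimes> (t \<otimes> b')"
   using B unfolding mk_frac_mem[OF assms(3,4)] by blast
  note cc = assms(1,3) u(1) v(1) S_carr[OF assms(2)] S_carr[OF assms(4)]
   u(2,3)[THEN S_carr] v(2,3)[THEN S_carr]
  have "(u \<otimes> v) \<otimes> (s \<otimes> t \<otimes> (a' \<otimes> b')) = (u \<otimes> (s \<otimes> a')) \<otimes> (v \<otimes> (t \<otimes> b'))"
   using cc by (simp add: m_ac)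
  also have "\<dots> = (u \<otimes> v) \<otimes> (s' \<otimes> t' \<otimes> (a \<otimes> b))"
   unfolding u(4)[symmetric] v(4)[symmetric] using cc by (simp add: m_ac)
  finally show ?thesis
   using mk_frac_eq[of "a' \<otimes> b'" "s' \<otimes> t'" "a \<otimes> b" "s \<otimes> t"] assms u v S_mult by auto
 qed
 have "(\<Union>(a', s')\<in>fr a s. \<Union>(b', t')\<in>fr b t. fr (a' \<otimes> b') (s' \<otimes> t')) = fr (a \<otimes> b) (s \<otimes> t)"
 proof (rule SUP_eq_const)
  show "fr a s \<noteq> {}" using mk_frac_self assms by blast
  fix x assume x: "x \<in> fr a s"
  show "(case x of (a', s') => \<Union>(b', t')\<in>fr b t. fr (a' \<otimes> b') (s' \<otimes> t')) = fr (a \<otimes> b) (s \<otimes> t)"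
  proof (cases x)
   case (Pair a' s')
   have "(\<Union>(b', t')\<in>fr b t. fr (a' \<otimes> b') (s' \<otimes> t')) = fr (a \<otimes> b) (s \<otimes> t)"
   proof (rule SUP_eq_const)
    show "fr b t \<noteq> {}" using mk_frac_self assms(3,4) by blast
    show "(case y of (b', t') => fr (a' \<otimes> b') (s' \<otimes> t')) = fr (a \<otimes> b) (s \<otimes> t)" if "y \<in> fr b t" for y
     using key[of a' s' "fst y" "snd y"] x that unfolding Pair by (simp add: case_prod_beta)
   qed
   then show ?thesis using Pair by simp
  qed
 qed
 then show ?thesis by (simp add: localization_def)
qed

lemma L_add:
 assumes "a \<in> carrier R" "s \<in> S" "b \<in> carrier R" "t \<in> S"
 shows "fr a s \<oplus>\<^bsub>L\<^esub> fr b t = fr (t \<otimes> a \<oplus> s \<otimes> b) (s \<otimes> t)"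
proof -
 have key: "fr (t' \<otimes> a' \<oplus> s' \<otimes> b') (s' \<otimes> t') = fr (t \<otimes> a \<oplus> s \<otimes> b) (s \<otimes> t)"
  if A: "(a', s') \<in> fr a s" and B: "(b', t') \<in> fr b t" for a' s' b' t'
 proof -
  obtain u where u: "a' \<in> carrier R" "s' \<in> S" "u \<in> S" "u \<otimes> (s' \<otimes> a) = u \<otimes> (s \<otimes> a')"
   using A unfolding mk_frac_mem[OF assms(1,2)] by blast
  obtain v where v: "b' \<in> carrier R" "t' \<in> S" "v \<in> S" "v \<otimes> (t' \<otimes> b) = v \<otimes> (t \<otimes> b')"
   using B unfolding mk_frac_mem[OF assms(3,4)] by blast
  note cc = assms(1,3) u(1) v(1) S_carr[OF assms(2)] S_carr[OF assms(4)]
   u(2,3)[THEN S_carr] v(2,3)[THEN S_carr]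
  have "(u \<otimes> v) \<otimes> (s \<otimes> t \<otimes> (t' \<otimes> a' \<oplus> s' \<otimes> b'))
   = (v \<otimes> t \<otimes> t') \<otimes> (u \<otimes> (s \<otimes> a')) \<oplus> (u \<otimes> s \<otimes> s') \<otimes> (v \<otimes> (t \<otimes> b'))"
   using cc by algebra
  also have "\<dots> = (u \<otimes> v) \<otimes> (s' \<otimes> t' \<otimes> (t \<otimes> a \<oplus> s \<otimes> b))"
   unfolding u(4)[symmetric] v(4)[symmetric] using cc by algebra
  finally show ?thesis
   using mk_frac_eq[of "t' \<otimes> a' \<oplus> s' \<otimes> b'" "s' \<otimes> t'" "t \<otimes> a \<oplus> s \<otimes> b" "s \<otimes> t"]
    assms u v S_mult S_carr by auto
 qed
 have "(\<Union>(a', s')\<in>fr a s. \<Union>(b', t')\<in>fr b t. fr (t' \<otimes> a' \<oplus> s' \<otimes> b') (s' \<otimes> t'))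
   = fr (t \<otimes> a \<oplus> s \<otimes> b) (s \<otimes> t)"
 proof (rule SUP_eq_const)
  show "fr a s \<noteq> {}" using mk_frac_self assms by blast
  fix x assume x: "x \<in> fr a s"
  show "(case x of (a', s') => \<Union>(b', t')\<in>fr b t. fr (t' \<otimes> a' \<oplus> s' \<otimes> b') (s' \<otimes> t'))
    = fr (t \<otimes> a \<oplus> s \<otimes> b) (s \<otimes> t)"
  proof (cases x)
   case (Pair a' s')
   have "(\<Union>(b', t')\<in>fr b t. fr (t' \<otimes> a' \<oplus> s' \<otimes> b') (s' \<otimes> t')) = fr (t \<otimes> a \<oplus> s \<otimes> b) (s \<otimes> t)"
   proof (rule SUP_eq_const)
    show "fr b t \<noteq> {}" using mk_frac_self assms(3,4) by blast
    show "(case y of (b', t') => fr (t' \<otimes> a' \<oplus> s' \<otimes> b') (s' \<otimes> t')) = fr (t \<otimes> a \<oplus> s \<otimes> b) (s \<otimes> t)" if "y \<in> fr b t" for y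
     using key[of a' s' "fst y" "snd y"] x that unfolding Pair by (simp add: case_prod_beta)
   qed
   then show ?thesis using Pair by simp
  qed
 qed
 then show ?thesis by (simp add: localization_def)
qed

lemma fr_cancel:
 assumes "a \<in> carrier R" "s \<in> S" "u \<in> S"
 shows "fr (u \<otimes> a) (u \<otimes> s) = fr a s"
proof -
 have "\<one> \<otimes> (s \<otimes> (u \<otimes> a)) = \<one> \<otimes> (u \<otimes> s \<otimes> a)" using assms S_carr by (simp add: m_ac)
 then show ?thesis using mk_frac_eq[of "u \<otimes> a" "u \<otimes> s" a s] assms S_carr S_mult S_one by auto
qed

lemma L_ex: "X \<in> carrier L ==> \<exists>a s. a \<in> carrier R \<and> s \<in> S \<and> X = fr a s"
 unfolding L_carrier by blast

lemma L_cring: "cring L"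
proof (rule cringI)
 show "abelian_group L"
 proof (rule abelian_groupI)
  fix X Y assume "X \<in> carrier L" "Y \<in> carrier L"
  then obtain a s b t where x: "a \<in> carrier R" "s \<in> S" "X = fr a s" "b \<in> carrier R" "t \<in> S" "Y = fr b t"
   using L_ex by meson
  then show "X \<oplus>\<^bsub>L\<^esub> Y \<in> carrier L" using L_add S_mult S_carr by simp
  show "X \<oplus>\<^bsub>L\<^esub> Y = Y \<oplus>\<^bsub>L\<^esub> X"
   using x S_carr by (simp add: L_add m_comm a_comm)
  fix Z assume "Z \<in> carrier L"
  then obtain c v where z: "c \<in> carrier R" "v \<in> S" "Z = fr c v" using L_ex by meson
  note cc = x(1,4) z(1) x(2,5)[THEN S_carr] S_carr[OF z(2)]
  have "v \<otimes> (t \<otimes> a \<oplus> s \<otimes> b) \<oplus> s \<otimes> t \<otimes> c = t \<otimes> v \<otimes> a \<oplus> s \<otimes> (v \<otimes> b \<oplus> t \<otimes> c)"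
   using cc by algebra
  then show "X \<oplus>\<^bsub>L\<^esub> Y \<oplus>\<^bsub>L\<^esub> Z = X \<oplus>\<^bsub>L\<^esub> (Y \<oplus>\<^bsub>L\<^esub> Z)"
   using x z cc S_mult by (simp add: L_add m_assoc)
 next
  show "\<zero>\<^bsub>L\<^esub> \<in> carrier L" using L_zero S_one by simp
  fix X assume "X \<in> carrier L"
  then obtain a s where x: "a \<in> carrier R" "s \<in> S" "X = fr a s" using L_ex by meson
  then show "\<zero>\<^bsub>L\<^esub> \<oplus>\<^bsub>L\<^esub> X = X" using S_one S_carr by (simp add: L_add L_zero)
  have "fr (\<ominus> a) s \<oplus>\<^bsub>L\<^esub> fr a s = fr (s \<otimes> (\<ominus> a) \<oplus> s \<otimes> a) (s \<otimes> s)"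
   using L_add x S_carr by simp
  also have "s \<otimes> (\<ominus> a) \<oplus> s \<otimes> a = \<zero>" using x(1) S_carr[OF x(2)] by algebra
  also have "fr \<zero> (s \<otimes> s) = fr \<zero> \<one>"
   using mk_frac_eq[of \<zero> "s \<otimes> s" \<zero> \<one>] x S_one S_mult S_carr by auto
  finally show "\<exists>y\<in>carrier L. y \<oplus>\<^bsub>L\<^esub> X = \<zero>\<^bsub>L\<^esub>"
   unfolding L_zero x(3) using x S_carr by (intro bexI[of _ "fr (\<ominus> a) s"]) auto
 qed
 show "comm_monoid L"
 proof (rule comm_monoidI)
  show "\<one>\<^bsub>L\<^esub> \<in> carrier L" using L_one S_one by simp
  fix X assume "X \<in> carrier L"
  then obtain a s where x: "a \<in> carrier R" "s \<in> S" "X = fr a s" using L_ex by meson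
  then show "\<one>\<^bsub>L\<^esub> \<otimes>\<^bsub>L\<^esub> X = X" using S_one S_carr by (simp add: L_mult L_one)
  fix Y assume "Y \<in> carrier L"
  then obtain b t where y: "b \<in> carrier R" "t \<in> S" "Y = fr b t" using L_ex by meson
  then show "X \<otimes>\<^bsub>L\<^esub> Y \<in> carrier L" using x L_mult S_mult by simp
  show "X \<otimes>\<^bsub>L\<^esub> Y = Y \<otimes>\<^bsub>L\<^esub> X" using x y S_carr by (simp add: L_mult m_comm)
  fix Z assume "Z \<in> carrier L"
  then obtain c v where z: "c \<in> carrier R" "v \<in> S" "Z = fr c v" using L_ex by meson
  show "X \<otimes>\<^bsub>L\<^esub> Y \<otimes>\<^bsub>L\<^esub> Z = X \<otimes>\<^bsub>L\<^esub> (Y \<otimes>\<^bsub>L\<^esub> Z)"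
   using x y z S_carr S_mult by (simp add: L_mult m_assoc)
 qed
 fix X Y Z assume "X \<in> carrier L" "Y \<in> carrier L" "Z \<in> carrier L"
 then obtain a s b t c v where x: "a \<in> carrier R" "s \<in> S" "X = fr a s" "b \<in> carrier R" "t \<in> S" "Y = fr b t"
  "c \<in> carrier R" "v \<in> S" "Z = fr c v"
  using L_ex by meson
 note cc = x(1,4,7) x(2,5,8)[THEN S_carr]
 have e: "fr (v \<otimes> ((t \<otimes> a \<oplus> s \<otimes> b) \<otimes> c)) (v \<otimes> (s \<otimes> t \<otimes> v)) = fr ((t \<otimes> a \<oplus> s \<otimes> b) \<otimes> c) (s \<otimes> t \<otimes> v)"
  by (rule fr_cancel) (use cc x S_mult in auto)
 have "t \<otimes> v \<otimes> (a \<otimes> c) \<oplus> s \<otimes> v \<otimes> (b \<otimes> c) = v \<otimes> ((t \<otimes> a \<oplus> s \<otimes> b) \<otimes> c)"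
  using cc by algebra
 moreover have "s \<otimes> v \<otimes> (t \<otimes> v) = v \<otimes> (s \<otimes> t \<otimes> v)" using cc by (simp add: m_ac)
 ultimately show "(X \<oplus>\<^bsub>L\<^esub> Y) \<otimes>\<^bsub>L\<^esub> Z = X \<otimes>\<^bsub>L\<^esub> Z \<oplus>\<^bsub>L\<^esub> Y \<otimes>\<^bsub>L\<^esub> Z"
  using x cc S_mult e by (simp add: L_mult L_add)
qed

lemma to_L_hom: "(\<lambda>a. fr a \<one>) \<in> ring_hom R L"
 by (rule ring_hom_memI) (use S_one in \<open>auto simp: L_mult L_add L_one\<close>)

lemma fr_mult_denom:
 assumes "a \<in> carrier R" "s \<in> S"
 shows "fr a s \<otimes>\<^bsub>L\<^esub> fr s \<one> = fr a \<one>"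
 using fr_cancel[OF assms(1) S_one assms(2)] assms S_carr[OF assms(2)] S_one
 by (simp add: L_mult m_comm)

lemma fr_eq_zero:
 assumes "a \<in> carrier R" "s \<in> S"
 shows "fr a s = \<zero>\<^bsub>L\<^esub> \<longleftrightarrow> (\<exists>u\<in>S. u \<otimes> a = \<zero>)"
 unfolding L_zero using mk_frac_eq[OF assms zero_closed S_one] assms S_carr by auto

lemma fr_zero: "s \<in> S ==> fr \<zero> s = \<zero>\<^bsub>L\<^esub>"
 using fr_eq_zero[OF zero_closed, of s] S_one by (metis S_carr r_null)

end

lemma (in cring) powers_mult_subset:
 assumes "s \<in> carrier R" shows "mult_subset R (powers R s)"
proof
 show "powers R s \<subseteq> carrier R" using assms by (auto simp: powers_def)
 show "\<one> \<in> powers R s" unfolding powers_def by (rule range_eqI[of _ _ 0]) simp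
 show "x \<otimes> y \<in> powers R s" if "x \<in> powers R s" "y \<in> powers R s" for x y
  using that nat_pow_mult[OF assms] by (auto simp: powers_def)
qed

lemma (in domain) nonzero_mult_subset: "mult_subset R (carrier R - {\<zero>})"
 by unfold_locales (auto simp: integral_iff)

lemma (in domain) fraction_field_domain: "domain (fraction_field R)"
proof -
 interpret M: mult_subset R "carrier R - {\<zero>}" by (rule nonzero_mult_subset)
 show ?thesis unfolding fraction_field_def
 proof (rule domain.intro[OF M.L_cring], unfold_locales)
  show "\<one>\<^bsub>M.L\<^esub> \<noteq> \<zero>\<^bsub>M.L\<^esub>"
   unfolding M.L_one using M.fr_eq_zero[of \<one> \<one>] by auto
  fix X Y assume "X \<otimes>\<^bsub>M.L\<^esub> Y = \<zero>\<^bsub>M.L\<^esub>" "X \<in> carrier M.L" "Y \<in> carrier M.L"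
  then obtain a s b t where x: "a \<in> carrier R" "s \<in> carrier R - {\<zero>}" "X = M.fr a s"
   "b \<in> carrier R" "t \<in> carrier R - {\<zero>}" "Y = M.fr b t"
   using M.L_ex by meson
  have "M.fr (a \<otimes> b) (s \<otimes> t) = \<zero>\<^bsub>M.L\<^esub>" using \<open>X \<otimes>\<^bsub>M.L\<^esub> Y = \<zero>\<^bsub>M.L\<^esub>\<close> x M.L_mult by simp
  then obtain u where u: "u \<in> carrier R - {\<zero>}" "u \<otimes> (a \<otimes> b) = \<zero>"
   using M.fr_eq_zero[of "a \<otimes> b" "s \<otimes> t"] x M.S_mult[OF x(2) x(5)] by auto
  then have "a = \<zero> \<or> b = \<zero>" using x integral_iff by auto
  then show "X = \<zero>\<^bsub>M.L\<^esub> \<or> Y = \<zero>\<^bsub>M.L\<^esub>"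
   using M.fr_zero[OF x(2)] M.fr_zero[OF x(5)] unfolding x(3,6) by (elim disjE) simp_all
 qed
qed

section \<open>Completed rational localizations\<close>

subsection \<open>Topological rings\<close>

lemma (in cring) minus_self: "x \<in> carrier R ==> x \<ominus> x = \<zero>"
 by (simp add: r_right_minus_eq)

lemma closure_meets: "x \<in> X closure_of S ==> openin X V ==> x \<in> V ==> \<exists>y\<in>S. y \<in> V"
 unfolding in_closure_of by blast

locale topring = cring R for R :: "('a, 'm) top_ring_scheme" (structure) +
 assumes topological: "topological_ring R"
begin

abbreviation T where "T \<equiv> topo R"

lemma topspace_T [simp]: "topspace T = carrier R"
 using topological unfolding topological_ring_def by blast

lemma openin_carr: "openin T U ==> U \<subseteq> carrier R"
 using openin_subset topspace_T by fastforce

lemma cont_minus: "continuous_map (prod_topology T T) T (\<lambda>(x, y). x \<ominus> y)"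
proof -
 have a: "continuous_map (prod_topology T T) T (\<lambda>(x, y). x \<oplus> y)"
  and m: "continuous_map T T (\<lambda>x. \<ominus> x)"
  using topological unfolding topological_ring_def by blast+
 have "continuous_map (prod_topology T T) (prod_topology T T) (\<lambda>z. (fst z, \<ominus> (snd z)))"
  unfolding continuous_map_paired
  using continuous_map_compose[OF continuous_map_snd m] continuous_map_fst by (auto simp: o_def)
 from continuous_map_compose[OF this a] show ?thesis
  by (simp add: o_def a_minus_def case_prod_unfold)
qed

lemma cont_const_minus:
 assumes "c \<in> carrier R" shows "continuous_map T T (\<lambda>x. c \<ominus> x)"
proof -
 have "continuous_map T (prod_topology T T) (\<lambda>x. (c, x))"
  unfolding continuous_map_paired using assms by simp
 from continuous_map_compose[OF this cont_minus] show ?thesis by (simp add: o_def)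
qed

lemma cont_minus_const:
 assumes "c \<in> carrier R" shows "continuous_map T T (\<lambda>x. x \<ominus> c)"
proof -
 have "continuous_map T (prod_topology T T) (\<lambda>x. (x, c))"
  unfolding continuous_map_paired using assms by simp
 from continuous_map_compose[OF this cont_minus] show ?thesis by (simp add: o_def)
qed

lemma cont_mult:
 assumes "c \<in> carrier R" shows "continuous_map T T (\<lambda>x. c \<otimes> x)"
proof -
 have m: "continuous_map (prod_topology T T) T (\<lambda>(x, y). x \<otimes> y)"
  using topological unfolding topological_ring_def by blast
 have "continuous_map T (prod_topology T T) (\<lambda>x. (c, x))"
  unfolding continuous_map_paired using assms by simp
 from continuous_map_compose[OF this m] show ?thesis by (simp add: o_def)
qed

lemma open_preimage:
 assumes "continuous_map T T h" "openin T U"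
 shows "openin T {x \<in> carrier R. h x \<in> U}"
 using openin_continuous_map_preimage[OF assms] by simp

lemma open_translate:
 assumes "openin T U" "c \<in> carrier R"
 shows "openin T {x \<in> carrier R. x \<ominus> c \<in> U}" "openin T {x \<in> carrier R. c \<ominus> x \<in> U}"
 using open_preimage[OF cont_minus_const[OF assms(2)] assms(1)]
  open_preimage[OF cont_const_minus[OF assms(2)] assms(1)] by auto

text \<open>Additive subgroups, stated with differences because the topology enters only through the
  continuity of subtraction.\<close>

definition minus_closed :: "'a set => bool" where
 "minus_closed H \<longleftrightarrow> H \<subseteq> carrier R \<and> \<zero> \<in> H \<and> (\<forall>x\<in>H. \<forall>y\<in>H. x \<ominus> y \<in> H)"

lemma minus_closed_add:
 assumes "minus_closed H" "x \<in> H" "y \<in> H" shows "x \<oplus> y \<in> H"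
proof -
 have c: "x \<in> carrier R" "y \<in> carrier R" using assms unfolding minus_closed_def by auto
 have "x \<ominus> (\<zero> \<ominus> y) \<in> H" using assms unfolding minus_closed_def by blast
 moreover have "x \<ominus> (\<zero> \<ominus> y) = x \<oplus> y" using c by algebra
 ultimately show ?thesis by simp
qed

lemma minus_closed_swap:
 assumes "minus_closed H" "x \<ominus> y \<in> H" "x \<in> carrier R" "y \<in> carrier R" shows "y \<ominus> x \<in> H"
proof -
 have "\<zero> \<ominus> (x \<ominus> y) \<in> H" using assms unfolding minus_closed_def by blast
 moreover have "\<zero> \<ominus> (x \<ominus> y) = y \<ominus> x" using assms(3,4) by algebra
 ultimately show ?thesis by simp
qed

lemma minus_closed_trans:
 assumes "minus_closed H" "x \<ominus> y \<in> H" "y \<ominus> z \<in> H"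
  "x \<in> carrier R" "y \<in> carrier R" "z \<in> carrier R" shows "x \<ominus> z \<in> H"
proof -
 have "(x \<ominus> y) \<oplus> (y \<ominus> z) \<in> H" using minus_closed_add assms by blast
 moreover have "(x \<ominus> y) \<oplus> (y \<ominus> z) = x \<ominus> z" using assms(4-6) by algebra
 ultimately show ?thesis by simp
qed

lemma minus_closed_subst:
 assumes "minus_closed H" "x \<ominus> y \<in> H" "y \<in> H" "x \<in> carrier R" shows "x \<in> H"
proof -
 have y: "y \<in> carrier R" using assms unfolding minus_closed_def by blast
 have "(x \<ominus> y) \<oplus> y \<in> H" using minus_closed_add assms by blast
 moreover have "(x \<ominus> y) \<oplus> y = x" using assms(4) y by algebra
 ultimately show ?thesis by simp
qed

lemma minus_closed_open:
 assumes H: "minus_closed H" and U: "openin T U" "\<zero> \<in> U" "U \<subseteq> H"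
 shows "openin T H"
proof (subst openin_subopen, intro ballI)
 fix x assume x: "x \<in> H"
 then have xc: "x \<in> carrier R" using H unfolding minus_closed_def by blast
 show "\<exists>V. openin T V \<and> x \<in> V \<and> V \<subseteq> H"
 proof (intro exI conjI)
  show "openin T {y \<in> carrier R. y \<ominus> x \<in> U}" by (rule open_translate(1)[OF U(1) xc])
  show "x \<in> {y \<in> carrier R. y \<ominus> x \<in> U}" using xc U(2) by (simp add: minus_self)
  show "{y \<in> carrier R. y \<ominus> x \<in> U} \<subseteq> H" using minus_closed_subst[OF H] x U(3) by blast
 qed
qed

lemma minus_closed_closed:
 assumes H: "minus_closed H" and O: "openin T H"
 shows "T closure_of H = H"
proof
 show "H \<subseteq> T closure_of H" using closure_of_subset[of H T] H unfolding minus_closed_def by auto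
 show "T closure_of H \<subseteq> H"
 proof
  fix x assume x: "x \<in> T closure_of H"
  then have xc: "x \<in> carrier R" unfolding in_closure_of by simp
  have "openin T {y \<in> carrier R. x \<ominus> y \<in> H}" by (rule open_translate(2)[OF O xc])
  moreover have "x \<in> {y \<in> carrier R. x \<ominus> y \<in> H}"
   using xc H unfolding minus_closed_def by (simp add: minus_self)
  ultimately obtain y where "y \<in> H" "x \<ominus> y \<in> H" using closure_meets[OF x] by auto
  then show "x \<in> H" using minus_closed_subst[OF H _ _ xc] by blast
 qed
qed

lemma minus_closed_closure:
 assumes H: "minus_closed H" shows "minus_closed (T closure_of H)"
 unfolding minus_closed_def
proof (intro conjI ballI)
 show "T closure_of H \<subseteq> carrier R" using closure_of_subset_topspace[of T H] by simp
 show "\<zero> \<in> T closure_of H" using closure_of_subset[of H T] H unfolding minus_closed_def by auto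
 fix x y assume "x \<in> T closure_of H" "y \<in> T closure_of H"
 then have "(x, y) \<in> prod_topology T T closure_of (H \<times> H)" by (simp add: closure_of_Times)
 then have "x \<ominus> y \<in> T closure_of ((\<lambda>(x, y). x \<ominus> y) ` (H \<times> H))"
  using continuous_map_image_closure_subset[OF cont_minus, of "H \<times> H"] by force
 moreover have "(\<lambda>(x, y). x \<ominus> y) ` (H \<times> H) \<subseteq> H" using H unfolding minus_closed_def by auto
 ultimately show "x \<ominus> y \<in> T closure_of H" using closure_of_mono by blast
qed

text \<open>Regularity of the topology at zero: a point \<open>x\<close> of the closure is
  \<open>y - (y - x)\<close> with \<open>y\<close> in \<open>H\<close> close to \<open>x\<close>, a
  difference of two small elements. It ensures that the closures of a neighbourhood basis form a
  neighbourhood basis again.\<close>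

lemma small_closure:
 assumes U: "openin T U" "\<zero> \<in> U"
 shows "\<exists>V. openin T V \<and> \<zero> \<in> V \<and> (\<forall>H. H \<subseteq> V --> T closure_of H \<subseteq> U)"
proof -
 let ?P = "{z \<in> topspace (prod_topology T T). (case z of (x, y) => x \<ominus> y) \<in> U}"
 have "openin (prod_topology T T) ?P"
  by (rule openin_continuous_map_preimage[OF cont_minus U(1)])
 moreover have "(\<zero>, \<zero>) \<in> ?P" using U(2) by (simp add: minus_self)
 ultimately have "\<exists>A B. openin T A \<and> openin T B \<and> \<zero> \<in> A \<and> \<zero> \<in> B \<and> A \<times> B \<subseteq> ?P"
  unfolding openin_prod_topology_alt by (elim allE impE)
 then obtain A B where AB: "openin T A" "openin T B" "\<zero> \<in> A" "\<zero> \<in> B" "A \<times> B \<subseteq> ?P" by blast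
 have "T closure_of H \<subseteq> U" if H: "H \<subseteq> A" for H
 proof
  fix x assume x: "x \<in> T closure_of H"
  then have xc: "x \<in> carrier R" unfolding in_closure_of by simp
  let ?W = "{y \<in> carrier R. y \<ominus> x \<in> B}"
  have "openin T ?W" by (rule open_translate(1)[OF AB(2) xc])
  moreover have "x \<in> ?W" using xc AB(4) by (simp add: minus_self)
  ultimately obtain y where y: "y \<in> H" "y \<in> ?W" using closure_meets[OF x, of ?W] by auto
  have "y \<in> A" using y(1) H by blast
  then have "y \<ominus> (y \<ominus> x) \<in> U" using AB(5) y(2) by auto
  moreover have yc: "y \<in> carrier R" using y(2) by simp
  then have "y \<ominus> (y \<ominus> x) = x" using xc by algebra
  ultimately show "x \<in> U" by simp
 qed
 then show ?thesis using AB by blast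
qed

end

subsection \<open>Adic rings\<close>

locale adic = fg_ideal R I r f for R :: "('a, 'm) top_ring_scheme" (structure) and I r f +
 assumes open_iff: "openin (topo R) W \<longleftrightarrow> W \<subseteq> carrier R \<and> (\<forall>x\<in>W. \<exists>n. ideal_power R I n +> x \<subseteq> W)"
  and complete: "complete_topological_ring R"

sublocale adic \<subseteq> topring R
 by unfold_locales (use complete complete_topological_ring_def in blast)

context adic
begin

lemma coset_mem: "x \<in> J +> c \<longleftrightarrow> (\<exists>j\<in>J. x = j \<oplus> c)"
 by (auto simp: a_r_coset_def')

lemma ideal_minus_closed: "ideal J R ==> minus_closed J"
 unfolding minus_closed_def using ideal_carr ideal_zero ideal_minus by blast

lemma open_zero:
 assumes "openin T W" "\<zero> \<in> W" shows "\<exists>n. Ip n \<subseteq> W"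
proof -
 obtain n where n: "Ip n +> \<zero> \<subseteq> W" using assms open_iff by blast
 have "Ip n \<subseteq> Ip n +> \<zero>"
 proof
  fix x assume "x \<in> Ip n"
  then show "x \<in> Ip n +> \<zero>" unfolding coset_mem using Ip_carr by (intro bexI[of _ x]) auto
 qed
 then show ?thesis using n by blast
qed

lemma open_ideal:
 assumes J: "ideal J R" "Ip n \<subseteq> J" shows "openin T J"
 unfolding open_iff
proof (intro conjI ballI exI)
 show "J \<subseteq> carrier R" using ideal_carr[OF J(1)] by blast
 fix x assume "x \<in> J"
 then show "Ip n +> x \<subseteq> J" using ideal_add[OF J(1) subsetD[OF J(2)]] by (auto simp: coset_mem)
qed

lemma open_Ip: "openin T (Ip n)"
 by (rule open_ideal[OF Ip_ideal order_refl])

text \<open>Only large \<open>n\<close> are tested, since the cohomological statements are available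
  only there.\<close>

lemma separated:
 assumes a: "a \<in> carrier R" and *: "\<And>n. n \<ge> n0 ==> a \<in> Ip n"
 shows "a = \<zero>"
proof (rule ccontr)
 assume "a \<noteq> \<zero>"
 have "Hausdorff_space T" using complete unfolding complete_topological_ring_def by blast
 from this[unfolded Hausdorff_space_def topspace_T, rule_format, of \<zero> a]
 obtain U V where U: "openin T U" "\<zero> \<in> U" "openin T V" "a \<in> V" "disjnt U V"
  using a \<open>a \<noteq> \<zero>\<close> by auto
 obtain n where n: "Ip n \<subseteq> U" using open_zero U by blast
 have "a \<in> Ip (max n n0)" using * by simp
 then have "a \<in> Ip n" using Ip_antimono[of n "max n n0"] by auto
 then show False using n U unfolding disjnt_def by blast
qed

lemma series_converges:
 assumes b: "\<And>n. b n \<in> carrier R" "\<And>n. b (Suc n) \<ominus> b n \<in> Ip n"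
 shows "\<exists>a\<in>carrier R. \<forall>n. a \<ominus> b n \<in> Ip n"
proof -
 have cau: "b m \<ominus> b n \<in> Ip n" if "n \<le> m" for m n
  using that
 proof (induction m rule: dec_induct)
  case base
  then show ?case using b(1) ideal_zero[OF Ip_ideal] by (simp add: minus_self)
 next
  case (step m)
  have "b (Suc m) \<ominus> b m \<in> Ip n" using b(2)[of m] Ip_antimono[OF step(1)] by blast
  then show ?case
   using ideal_minus_trans[OF Ip_ideal _ step.IH] b(1) by blast
 qed
 \<comment> \<open>Completeness is formulated with Cauchy filters, so the sequence is replaced by
   its image filter.\<close>
 let ?F = "filtermap b sequentially"
 have "cauchy_filter_on R ?F"
  unfolding cauchy_filter_on_def
 proof (intro conjI allI impI)
  show "?F \<noteq> bot" by (simp add: filtermap_bot_iff)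
  show "eventually (\<lambda>x. x \<in> carrier R) ?F" using b by (simp add: eventually_filtermap)
  fix U assume "openin T U \<and> \<zero> \<in> U"
  then obtain n where n: "Ip n \<subseteq> U" using open_zero by blast
  have "b i \<ominus> b j \<in> U" if "i \<ge> n" "j \<ge> n" for i j
  proof -
   have "b i \<ominus> b j \<in> Ip n"
    by (rule minus_closed_trans[OF ideal_minus_closed[OF Ip_ideal] cau[OF that(1)]])
     (use minus_closed_swap[OF ideal_minus_closed[OF Ip_ideal] cau[OF that(2)]] b(1) in auto)
   then show ?thesis using n by blast
  qed
  then show "eventually (\<lambda>(x, y). x \<ominus> y \<in> U) (?F \<times>\<^sub>F ?F)"
   unfolding eventually_prod_filter eventually_filtermap
   by (intro exI[of _ "\<lambda>x. \<exists>i\<ge>n. x = b i"] conjI) (auto simp: eventually_sequentially)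
 qed
 then obtain a where a: "limitin T (\<lambda>x. x) a ?F"
  using complete unfolding complete_topological_ring_def by blast
 then have ac: "a \<in> carrier R" unfolding limitin_def by simp
 have "a \<ominus> b n \<in> Ip n" for n
 proof -
  have "openin T {x \<in> carrier R. a \<ominus> x \<in> Ip n}" by (rule open_translate(2)[OF open_Ip ac])
  moreover have "a \<in> {x \<in> carrier R. a \<ominus> x \<in> Ip n}"
   using ac ideal_zero[OF Ip_ideal] by (simp add: minus_self)
  ultimately have "eventually (\<lambda>x. x \<in> {x \<in> carrier R. a \<ominus> x \<in> Ip n}) ?F"
   using a unfolding limitin_def by blast
  then obtain N where N: "\<And>m. m \<ge> N ==> a \<ominus> b m \<in> Ip n"
   unfolding eventually_filtermap eventually_sequentially by auto
  show ?thesis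
   by (rule ideal_minus_trans[OF Ip_ideal N[of "max N n"] cau[of n "max N n"]]) (use ac b in auto)
 qed
 then show ?thesis using ac by blast
qed

end

subsection \<open>Rational localizations\<close>

lemma (in mult_subset) L_uminus:
 assumes "a \<in> carrier R" "s \<in> S" shows "\<ominus>\<^bsub>L\<^esub> fr a s = fr (\<ominus> a) s"
proof -
 interpret L: cring L by (rule L_cring)
 have "fr (\<ominus> a) s \<oplus>\<^bsub>L\<^esub> fr a s = fr (s \<otimes> (\<ominus> a) \<oplus> s \<otimes> a) (s \<otimes> s)"
  using L_add assms by simp
 also have "s \<otimes> (\<ominus> a) \<oplus> s \<otimes> a = \<zero>" using assms(1) S_carr[OF assms(2)] by algebra
 finally have "fr (\<ominus> a) s \<oplus>\<^bsub>L\<^esub> fr a s = \<zero>\<^bsub>L\<^esub>" using fr_zero[OF S_mult[OF assms(2) assms(2)]] by simp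
 then show ?thesis using L.minus_equality[of "fr (\<ominus> a) s" "fr a s"] assms by simp
qed

lemma (in mult_subset) fr_add_same:
 assumes "a \<in> carrier R" "b \<in> carrier R" "s \<in> S" shows "fr a s \<oplus>\<^bsub>L\<^esub> fr b s = fr (a \<oplus> b) s"
proof -
 have "s \<otimes> a \<oplus> s \<otimes> b = s \<otimes> (a \<oplus> b)" using assms(1,2) S_carr[OF assms(3)] by algebra
 then show ?thesis using L_add[OF assms(1,3,2,3)] fr_cancel[of "a \<oplus> b" s s] assms by simp
qed

text \<open>The fractions \<open>w / s^k\<close> of order at least \<open>n\<close>, where
  \<open>s\<close> counts with order \<open>d\<close>. They are described by an equation in
  \<open>S\<close>, without reference to the localization, so that restriction maps between
  different completions can be applied to them.\<close>

definition frac_elems :: "('a, 'm) top_ring_scheme => 'a set => nat => 'a => ('b, 'n) top_ring_scheme => ('a => 'b) => nat => 'b set" where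
 "frac_elems R I d s S \<phi> n = {e \<in> carrier S. \<exists>(k::nat) w. w \<in> ideal_power R I (n + d * k) \<and>
   e \<otimes>\<^bsub>S\<^esub> \<phi> s [^]\<^bsub>S\<^esub> k = \<phi> w}"

definition filt :: "('a, 'm) top_ring_scheme => 'a set => nat => 'a => ('b, 'n) top_ring_scheme => ('a => 'b) => nat => 'b set" where
 "filt R I d s S \<phi> n = (topo S) closure_of (frac_elems R I d s S \<phi> n)"

text \<open>The case \<open>(T0) = I\<^sup>d\<close>. Then the subring \<open>D\<close> of \<open>R\<^sub>s\<close> consists of the \<open>w / s\<^sup>k\<close> with
 \<open>w \<in> I\<^sup>d\<^sup>k\<close>, and \<open>I\<^sup>n D\<close> of those with \<open>w \<in> I\<^sup>n\<^sup>+\<^sup>d\<^sup>k\<close>.\<close>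

locale rat_completion = adic R I r f for R :: "('a, 'm) top_ring_scheme" (structure) and I r f +
 fixes T0 :: "'a set" and s :: 'a and d :: nat and S :: "('b, 'n) top_ring_scheme"
  and \<phi> :: "'a => 'b" and g :: "('a \<times> 'a) set => 'b"
 assumes T0: "T0 \<subseteq> carrier R" "genideal R T0 = ideal_power R I d"
  and s: "s \<in> ideal_power R I d"
  and completion: "is_completion (rat_loc R T0 s) S g"
  and g_frac: "a \<in> carrier R ==> g (mk_frac R (powers R s) a \<one>) = \<phi> a"

sublocale rat_completion \<subseteq> M: mult_subset R "powers R s"
 by (rule powers_mult_subset) (rule Ip_carr[OF s])

sublocale rat_completion \<subseteq> S: topring S
 using completion unfolding is_completion_def complete_topological_ring_def topological_ring_def
 by (intro topring.intro topring_axioms.intro) (auto simp: topological_ring_def)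

context rat_completion
begin

abbreviation L where "L \<equiv> M.L"
abbreviation fr where "fr \<equiv> M.fr"
abbreviation D where "D \<equiv> generate_ring L ((\<lambda>a. fr a \<one>) ` carrier R \<union> (\<lambda>t. fr t s) ` T0)"
abbreviation LD where "LD \<equiv> L\<lparr>carrier := D\<rparr>"

lemma sc: "s \<in> carrier R" by (rule Ip_carr[OF s])
lemma pow_mem [simp]: "s [^] (k::nat) \<in> powers R s" unfolding powers_def by blast
lemma one_mem [simp]: "\<one> \<in> powers R s" by (rule M.S_one)
lemma s_mem [simp]: "s \<in> powers R s" using pow_mem[of 1] sc by simp
lemma pow_carr [simp]: "s [^] (k::nat) \<in> carrier R" using sc by simp

lemma s_pow_Ip: "s [^] (k::nat) \<in> Ip (d * k)"
proof (induction k)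
 case (Suc k)
 then show ?case using Ip_mult[OF Suc s] by (simp add: add.commute)
qed simp

interpretation L: cring L by (rule M.L_cring)

definition E :: "nat => ('a \<times> 'a) set set" where
 "E n = {fr w (s [^] k) | w k. w \<in> Ip (n + d * k)}"

lemma E_I: "w \<in> Ip (n + d * k) ==> fr w (s [^] (k::nat)) \<in> E n"
 unfolding E_def by blast

lemma E_E: "x \<in> E n ==> \<exists>w k. x = fr w (s [^] (k::nat)) \<and> w \<in> Ip (n + d * k) \<and> w \<in> carrier R"
 unfolding E_def using Ip_carr by blast

lemma E_carr: "E n \<subseteq> carrier L"
 using E_E by fastforce

lemma E_antimono:
 assumes "m \<le> n" shows "E n \<subseteq> E m"
proof
 fix x assume "x \<in> E n"
 then obtain w k where w: "x = fr w (s [^] (k::nat))" "w \<in> Ip (n + d * k)" using E_E by blast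
 then have "w \<in> Ip (m + d * k)" using Ip_antimono[of "m + d * k" "n + d * k"] assms by auto
 then show "x \<in> E m" unfolding w(1) by (rule E_I)
qed

lemma E_mult:
 assumes "x \<in> E n" "y \<in> E m" shows "x \<otimes>\<^bsub>L\<^esub> y \<in> E (n + m)"
proof -
 obtain w k where w: "x = fr w (s [^] (k::nat))" "w \<in> Ip (n + d * k)" "w \<in> carrier R" using E_E[OF assms(1)] by blast
 obtain v l where v: "y = fr v (s [^] (l::nat))" "v \<in> Ip (m + d * l)" "v \<in> carrier R" using E_E[OF assms(2)] by blast
 have "w \<otimes> v \<in> Ip (n + m + d * (k + l))"
  using Ip_mult[OF w(2) v(2)] by (simp add: algebra_simps)
 then show ?thesis using E_I[of "w \<otimes> v" "n + m" "k + l"] w v by (simp add: M.L_mult nat_pow_mult sc)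
qed

lemma E_add:
 assumes "x \<in> E n" "y \<in> E n" shows "x \<oplus>\<^bsub>L\<^esub> y \<in> E n"
proof -
 obtain w k where w: "x = fr w (s [^] (k::nat))" "w \<in> Ip (n + d * k)" "w \<in> carrier R" using E_E[OF assms(1)] by blast
 obtain v l where v: "y = fr v (s [^] (l::nat))" "v \<in> Ip (n + d * l)" "v \<in> carrier R" using E_E[OF assms(2)] by blast
 have "s [^] l \<otimes> w \<in> Ip (n + d * (k + l))"
  using Ip_mult[OF s_pow_Ip w(2), of l] by (simp add: algebra_simps)
 moreover have "s [^] k \<otimes> v \<in> Ip (n + d * (k + l))"
  using Ip_mult[OF s_pow_Ip v(2), of k] by (simp add: algebra_simps)
 ultimately have "s [^] l \<otimes> w \<oplus> s [^] k \<otimes> v \<in> Ip (n + d * (k + l))"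
  by (rule ideal_add[OF Ip_ideal])
 from E_I[OF this] show ?thesis using w v by (simp add: M.L_add nat_pow_mult sc)
qed

lemma E_uminus:
 assumes "x \<in> E n" shows "\<ominus>\<^bsub>L\<^esub> x \<in> E n"
proof -
 obtain w k where w: "x = fr w (s [^] (k::nat))" "w \<in> Ip (n + d * k)" "w \<in> carrier R" using E_E[OF assms(1)] by blast
 show ?thesis using E_I[OF ideal_uminus[OF Ip_ideal w(2)]] w by (simp add: M.L_uminus)
qed

lemma E_zero: "\<zero>\<^bsub>L\<^esub> \<in> E n"
 using E_I[of \<zero> n 0] ideal_zero[OF Ip_ideal] M.fr_zero by simp

lemma D_gens: "(\<lambda>a. fr a \<one>) ` carrier R \<union> (\<lambda>t. fr t s) ` T0 \<subseteq> carrier L"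
 using T0(1) by auto

lemma D_E: "D \<subseteq> E 0"
proof
 fix x assume "x \<in> D"
 then show "x \<in> E 0"
 proof (induction rule: generate_ring.induct)
  case one
  show ?case using E_I[of \<one> 0 0] M.L_one by simp
 next
  case (incl h)
  then consider a where "a \<in> carrier R" "h = fr a \<one>" | t where "t \<in> T0" "h = fr t s" by blast
  then show ?case
  proof cases
   case 1
   then show ?thesis using E_I[of a 0 0] by simp
  next
   case 2
   have "t \<in> Ip d" using genideal_self[OF T0(1)] 2 unfolding T0(2) by blast
   then show ?thesis using E_I[of t 0 1] 2 sc by simp
  qed
 qed (use E_uminus E_add E_mult[of _ 0 _ 0] in auto)
qed

lemma LD_ring: "ring LD"
 by (rule L.generate_ring_is_ring[OF D_gens])

lemma D_carr: "D \<subseteq> carrier L"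
 using D_E E_carr by blast

interpretation LD: ring LD by (rule LD_ring)

abbreviation G where "G J \<equiv> genideal LD ((\<lambda>a. fr a \<one>) ` J)"

lemma frac_D: "a \<in> carrier R ==> fr a \<one> \<in> D"
 by (rule generate_ring.incl) blast

lemma T0_D: "t \<in> T0 ==> fr t s \<in> D"
 by (rule generate_ring.incl) blast

lemma G_ideal: "J \<subseteq> carrier R ==> ideal (G J) LD"
 by (rule LD.genideal_ideal) (use frac_D in auto)

lemma G_add: "J \<subseteq> carrier R ==> x \<in> G J ==> y \<in> G J ==> x \<oplus>\<^bsub>L\<^esub> y \<in> G J"
 using additive_subgroup.a_closed[OF ideal.axioms(1)[OF G_ideal]] by fastforce

lemma G_mult: "J \<subseteq> carrier R ==> x \<in> G J ==> y \<in> D ==> y \<otimes>\<^bsub>L\<^esub> x \<in> G J"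
 using ideal.I_l_closed[OF G_ideal] by fastforce

lemma G_zero: "J \<subseteq> carrier R ==> \<zero>\<^bsub>L\<^esub> \<in> G J"
 using additive_subgroup.zero_closed[OF ideal.axioms(1)[OF G_ideal]] by fastforce

lemma G_D: "J \<subseteq> carrier R ==> G J \<subseteq> D"
 using ideal.Icarr[OF G_ideal] by fastforce

lemma G_gen: "J \<subseteq> carrier R ==> a \<in> J ==> fr a \<one> \<in> G J"
 using LD.genideal_self[of "(\<lambda>a. fr a \<one>) ` J"] frac_D by auto

text \<open>One denominator is removed at a time: \<open>I^(n+d(k+1))\<close> is the product of
  \<open>I^(n+dk)\<close> and \<open>I^d\<close>, and \<open>I^d\<close> is generated by
  \<open>T0\<close>, whose elements have quotients \<open>t / s\<close> in \<open>D\<close>.\<close>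

lemma E_sub_G:
 shows "w \<in> Ip (n + d * k) ==> fr w (s [^] k) \<in> G (Ip n)"
proof (induction k arbitrary: w)
 case 0
 then show ?case using G_gen[of "Ip n" w] Ip_carr by auto
next
 case (Suc k)
 have J: "Ip n \<subseteq> carrier R" using Ip_carr by blast
 have "w \<in> Ip (n + d * k + d)" using Suc.prems by (simp add: algebra_simps)
 then have "w \<in> Ip (n + d * k) \<cdot> Ip d" unfolding ideal_power_add[OF I_ideal] by simp
 then show ?case
 proof (induction rule: ideal_prod.induct)
  case (prod a b)
  have ac: "a \<in> carrier R" using Ip_carr[OF prod(1)] .
  have ind: "fr a (s [^] k) \<in> G (Ip n)" by (rule Suc.IH[OF prod(1)])
  let ?B = "{b \<in> carrier R. fr (a \<otimes> b) (s [^] Suc k) \<in> G (Ip n)}"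
  have "ideal ?B R"
  proof (rule idealI')
   show "\<zero> \<in> ?B" using ac G_zero[OF J] M.fr_zero[OF pow_mem[of "Suc k"]] by simp
   show "b \<oplus> c \<in> ?B" if "b \<in> ?B" "c \<in> ?B" for b c
   proof -
    have bc: "b \<in> carrier R" "c \<in> carrier R" "fr (a \<otimes> b) (s [^] Suc k) \<in> G (Ip n)" "fr (a \<otimes> c) (s [^] Suc k) \<in> G (Ip n)"
     using that by auto
    have "fr (a \<otimes> (b \<oplus> c)) (s [^] Suc k) = fr (a \<otimes> b) (s [^] Suc k) \<oplus>\<^bsub>L\<^esub> fr (a \<otimes> c) (s [^] Suc k)"
     using M.fr_add_same[OF _ _ pow_mem[of "Suc k"], of "a \<otimes> b" "a \<otimes> c"] ac bc(1,2) by (simp add: r_distr)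
    then show ?thesis using bc G_add[OF J bc(3,4)] by simp
   qed
   show "z \<otimes> b \<in> ?B" if "b \<in> ?B" "z \<in> carrier R" for b z
   proof -
    have b: "b \<in> carrier R" "fr (a \<otimes> b) (s [^] Suc k) \<in> G (Ip n)" using that by auto
    have "fr z \<one> \<otimes>\<^bsub>L\<^esub> fr (a \<otimes> b) (s [^] Suc k) = fr (z \<otimes> (a \<otimes> b)) (\<one> \<otimes> s [^] Suc k)"
     by (rule M.L_mult) (use ac b that pow_mem[of "Suc k"] in auto)
    also have "z \<otimes> (a \<otimes> b) = a \<otimes> (z \<otimes> b)" using ac b that by (simp add: m_ac)
    also have "\<one> \<otimes> s [^] Suc k = s [^] Suc k" using sc by simp
    finally have "fr (a \<otimes> (z \<otimes> b)) (s [^] Suc k) = fr z \<one> \<otimes>\<^bsub>L\<^esub> fr (a \<otimes> b) (s [^] Suc k)" by simp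
    then show ?thesis using G_mult[OF J b(2) frac_D[OF that(2)]] b(1) that(2) by simp
   qed
  qed auto
  moreover have "t \<in> ?B" if t: "t \<in> T0" for t
  proof -
   have tc: "t \<in> carrier R" using t T0 by blast
   have "fr t s \<otimes>\<^bsub>L\<^esub> fr a (s [^] k) = fr (t \<otimes> a) (s \<otimes> s [^] k)"
    by (rule M.L_mult) (use ac tc in auto)
   also have "\<dots> = fr (a \<otimes> t) (s [^] Suc k)" using ac tc sc by (simp add: m_comm)
   finally show ?thesis using G_mult[OF J ind T0_D[OF t]] tc by simp
  qed
  ultimately have "genideal R T0 \<subseteq> ?B" by (intro genideal_minimal) auto
  then show ?case using prod(2) unfolding T0(2) by blast
 next
  case (sum x y)
  have "x \<in> carrier R" "y \<in> carrier R"
   using ideal_prod_in_carrier[OF Ip_ideal Ip_ideal] sum(1,2) by blast+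
  then show ?case using G_add[OF J sum(3,4)] M.fr_add_same[OF _ _ pow_mem[of "Suc k"], of x y] by simp
 qed
qed

lemma E_ideal: "ideal (E n) LD"
proof (rule idealI)
 show "ring LD" by (rule LD_ring)
 have ED: "E n \<subseteq> D"
  using E_sub_G G_D[of "Ip n"] Ip_carr unfolding E_def by blast
 show "subgroup (E n) (add_monoid LD)"
 proof (rule LD.add.subgroupI)
  show "E n \<subseteq> carrier LD" using ED by simp
  show "E n \<noteq> {}" using E_zero by blast
  show "a \<oplus>\<^bsub>LD\<^esub> b \<in> E n" if "a \<in> E n" "b \<in> E n" for a b using E_add[OF that] by simp
  show "\<ominus>\<^bsub>LD\<^esub> a \<in> E n" if a: "a \<in> E n" for a
  proof -
   have "\<ominus>\<^bsub>L\<^esub> a \<oplus>\<^bsub>L\<^esub> a = \<zero>\<^bsub>L\<^esub>" using a E_carr L.l_neg by blast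
   then have "\<ominus>\<^bsub>LD\<^esub> a = \<ominus>\<^bsub>L\<^esub> a"
    using LD.minus_equality[of "\<ominus>\<^bsub>L\<^esub> a" a] E_uminus[OF a] a ED by auto
   then show ?thesis using E_uminus[OF a] by simp
  qed
 qed
 show "x \<otimes>\<^bsub>LD\<^esub> a \<in> E n" "a \<otimes>\<^bsub>LD\<^esub> x \<in> E n" if "a \<in> E n" "x \<in> carrier LD" for a x
  using E_mult[of x 0 a n] E_mult[of a n x 0] that D_E by auto
qed

lemma G_Ip: "G (Ip n) = E n"
proof
 show "G (Ip n) \<subseteq> E n"
  by (rule LD.genideal_minimal[OF E_ideal]) (use E_I[of _ n 0] in auto)
 show "E n \<subseteq> G (Ip n)" using E_sub_G unfolding E_def by blast
qed

lemma rat_loc_simps: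
 "carrier (rat_loc R T0 s) = carrier L" "mult (rat_loc R T0 s) = mult L" "add (rat_loc R T0 s) = add L"
 "one (rat_loc R T0 s) = one L" "zero (rat_loc R T0 s) = zero L"
 "topo (rat_loc R T0 s) = topology_generated_by
  {G J +>\<^bsub>L\<^esub> x | J x. ideal J R \<and> openin T J \<and> x \<in> carrier L}"
 by (simp_all add: rat_loc_def ring.extend_def top_ring.fields_def Let_def)

lemma E_open: "openin (topo (rat_loc R T0 s)) (E n)"
proof -
 have "E n +>\<^bsub>L\<^esub> \<zero>\<^bsub>L\<^esub> = E n"
  using E_carr by (force simp: a_r_coset_def')
 then have "E n \<in> {G J +>\<^bsub>L\<^esub> x | J x. ideal J R \<and> openin T J \<and> x \<in> carrier L}"
  by (intro CollectI exI[of _ "Ip n"] exI[of _ "\<zero>\<^bsub>L\<^esub>"] conjI Ip_ideal open_Ip L.zero_closed)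
   (simp only: G_Ip)
 then show ?thesis unfolding rat_loc_simps by (rule topology_generated_by_Basis)
qed

text \<open>A coset that contains zero is the subgroup itself, and every open ideal \<open>J\<close>
  contains some \<open>I^n\<close>, so the ideal generated by \<open>J\<close> contains
  \<open>E n\<close>.\<close>

lemma E_basis:
 assumes "openin (topo (rat_loc R T0 s)) U" "\<zero>\<^bsub>L\<^esub> \<in> U"
 shows "\<exists>n. E n \<subseteq> U"
proof -
 have "generate_topology_on {G J +>\<^bsub>L\<^esub> x | J x. ideal J R \<and> openin T J \<and> x \<in> carrier L} U"
  using assms(1) unfolding rat_loc_simps openin_topology_generated_by_iff .
 then show ?thesis using assms(2)
 proof (induction rule: generate_topology_on.induct)
  case (Int a b)
  then obtain n m where nm: "E n \<subseteq> a" "E m \<subseteq> b" by blast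
  then have "E (max n m) \<subseteq> a \<inter> b" using E_antimono[of n "max n m"] E_antimono[of m "max n m"] by auto
  then show ?case by blast
 next
  case (UN K)
  then show ?case by blast
 next
  case (Basis u)
  then obtain J x where J: "u = G J +>\<^bsub>L\<^esub> x" "ideal J R" "openin T J" "x \<in> carrier L" by blast
  have Jc: "J \<subseteq> carrier R" using ideal_carr[OF J(2)] by blast
  obtain n where n: "Ip n \<subseteq> J" using open_zero[OF J(3)] ideal_zero[OF J(2)] by blast
  obtain j where j: "j \<in> G J" "\<zero>\<^bsub>L\<^esub> = j \<oplus>\<^bsub>L\<^esub> x" using Basis(2) unfolding J(1) by (auto simp: a_r_coset_def')
  have jc: "j \<in> carrier L" using j G_D[OF Jc] D_carr by blast
  have "y \<in> u" if y: "y \<in> E n" for y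
  proof -
   have yG: "y \<in> G J"
   proof -
    have "G (Ip n) \<subseteq> G J"
     by (rule LD.genideal_minimal[OF G_ideal[OF Jc]]) (use n G_gen[OF Jc] in auto)
    then show ?thesis using y unfolding G_Ip by blast
   qed
   have yc: "y \<in> carrier L" using y E_carr by blast
   have "y = (y \<oplus>\<^bsub>L\<^esub> j) \<oplus>\<^bsub>L\<^esub> x" using j(2)[symmetric] yc jc J(4) by (simp add: L.a_assoc)
   then show ?thesis unfolding J(1) a_r_coset_def' using G_add[OF Jc yG j(1)] by blast
  qed
  then show ?case by blast
 qed simp
qed

end

section \<open>The filtration on the completion\<close>

context rat_completion
begin

interpretation L: cring L by (rule M.L_cring)

abbreviation Fe where "Fe n \<equiv> frac_elems R I d s S \<phi> n"
abbreviation F where "F n \<equiv> filt R I d s S \<phi> n"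

lemma g_hom: "g \<in> ring_hom L S"
 using completion unfolding is_completion_def ring_hom_def rat_loc_simps by auto

interpretation g: ring_hom_cring L S g
 by (intro ring_hom_cring.intro ring_hom_cring_axioms.intro L.cring_axioms S.cring_axioms g_hom)

lemma phi_eq: "a \<in> carrier R ==> \<phi> a = g (fr a \<one>)"
 using g_frac by simp

lemma phi_hom: "\<phi> \<in> ring_hom R S"
proof (rule ring_hom_memI)
 fix a b assume a: "a \<in> carrier R" and b: "b \<in> carrier R"
 show "\<phi> a \<in> carrier S" using a by (simp add: phi_eq)
 have "fr (a \<otimes> b) \<one> = fr a \<one> \<otimes>\<^bsub>L\<^esub> fr b \<one>" using a b by (simp add: M.L_mult)
 then show "\<phi> (a \<otimes> b) = \<phi> a \<otimes>\<^bsub>S\<^esub> \<phi> b" using a b by (simp add: phi_eq)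
 have "fr (a \<oplus> b) \<one> = fr a \<one> \<oplus>\<^bsub>L\<^esub> fr b \<one>" using a b by (simp add: M.fr_add_same)
 then show "\<phi> (a \<oplus> b) = \<phi> a \<oplus>\<^bsub>S\<^esub> \<phi> b" using a b by (simp add: phi_eq)
next
 show "\<phi> \<one> = \<one>\<^bsub>S\<^esub>" using g.hom_one by (simp add: phi_eq M.L_one)
qed

lemma phi_carr: "a \<in> carrier R ==> \<phi> a \<in> carrier S"
 using phi_hom ring_hom_closed by fast

lemma phi_s_inverse: "\<exists>v\<in>carrier S. \<phi> s \<otimes>\<^bsub>S\<^esub> v = \<one>\<^bsub>S\<^esub>"
proof (intro bexI)
 have "fr s \<one> \<otimes>\<^bsub>L\<^esub> fr \<one> s = fr s s" using M.L_mult[of s \<one> \<one> s] sc by simp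
 also have "\<dots> = \<one>\<^bsub>L\<^esub>" using M.fr_cancel[of \<one> \<one> s] sc by (simp add: M.L_one)
 finally have "g (fr s \<one>) \<otimes>\<^bsub>S\<^esub> g (fr \<one> s) = g \<one>\<^bsub>L\<^esub>" using sc by (simp flip: g.hom_mult)
 then show "\<phi> s \<otimes>\<^bsub>S\<^esub> g (fr \<one> s) = \<one>\<^bsub>S\<^esub>" using sc by (simp add: phi_eq)
 show "g (fr \<one> s) \<in> carrier S" by simp
qed

lemma phi_s_pow_inverse: "\<exists>v\<in>carrier S. \<phi> s [^]\<^bsub>S\<^esub> (k::nat) \<otimes>\<^bsub>S\<^esub> v = \<one>\<^bsub>S\<^esub>"
proof -
 obtain v where v: "v \<in> carrier S" "\<phi> s \<otimes>\<^bsub>S\<^esub> v = \<one>\<^bsub>S\<^esub>" using phi_s_inverse by blast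
 have "\<phi> s [^]\<^bsub>S\<^esub> k \<otimes>\<^bsub>S\<^esub> v [^]\<^bsub>S\<^esub> k = \<one>\<^bsub>S\<^esub>"
  using S.nat_pow_distrib[OF phi_carr[OF sc] v(1), of k] v(2) by simp
 then show ?thesis using v(1) by blast
qed

lemma cancel_s:
 assumes "x \<in> carrier S" "y \<in> carrier S" "x \<otimes>\<^bsub>S\<^esub> \<phi> s [^]\<^bsub>S\<^esub> (k::nat) = y \<otimes>\<^bsub>S\<^esub> \<phi> s [^]\<^bsub>S\<^esub> k"
 shows "x = y"
proof -
 obtain v where v: "v \<in> carrier S" "\<phi> s [^]\<^bsub>S\<^esub> k \<otimes>\<^bsub>S\<^esub> v = \<one>\<^bsub>S\<^esub>" using phi_s_pow_inverse by blast
 have p: "\<phi> s [^]\<^bsub>S\<^esub> k \<in> carrier S" using phi_carr[OF sc] by simp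
 have "x \<otimes>\<^bsub>S\<^esub> \<phi> s [^]\<^bsub>S\<^esub> k \<otimes>\<^bsub>S\<^esub> v = y \<otimes>\<^bsub>S\<^esub> \<phi> s [^]\<^bsub>S\<^esub> k \<otimes>\<^bsub>S\<^esub> v" using assms(3) by simp
 then show ?thesis using v p assms(1,2) by (simp add: S.m_assoc)
qed

lemma g_pow: "x \<in> carrier L ==> g (x [^]\<^bsub>L\<^esub> (k::nat)) = g x [^]\<^bsub>S\<^esub> k"
 by (induction k) auto

lemma fr_pow: "a \<in> carrier R ==> fr a \<one> [^]\<^bsub>L\<^esub> (k::nat) = fr (a [^] k) \<one>"
 by (induction k) (auto simp: M.L_one M.L_mult)

lemma g_frac_denom:
 assumes "w \<in> carrier R"
 shows "g (fr w (s [^] (k::nat))) \<otimes>\<^bsub>S\<^esub> \<phi> s [^]\<^bsub>S\<^esub> k = \<phi> w"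
proof -
 have "g (fr w (s [^] k)) \<otimes>\<^bsub>S\<^esub> g (fr (s [^] k) \<one>) = g (fr w (s [^] k) \<otimes>\<^bsub>L\<^esub> fr (s [^] k) \<one>)"
  using assms by simp
 also have "fr w (s [^] k) \<otimes>\<^bsub>L\<^esub> fr (s [^] k) \<one> = fr w \<one>" by (rule M.fr_mult_denom[OF assms pow_mem])
 finally show ?thesis
  using g_pow[of "fr s \<one>" k] fr_pow[of s k] assms sc by (simp add: phi_eq)
qed

lemma frac_unique:
 assumes "e \<in> carrier S" "w \<in> carrier R" "e \<otimes>\<^bsub>S\<^esub> \<phi> s [^]\<^bsub>S\<^esub> (k::nat) = \<phi> w"
 shows "e = g (fr w (s [^] k))"
 using cancel_s[of e "g (fr w (s [^] k))" k] g_frac_denom[OF assms(2)] assms by simp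

lemma Fe_eq: "Fe n = g ` E n"
proof
 show "Fe n \<subseteq> g ` E n"
  using frac_unique Ip_carr E_I unfolding frac_elems_def by blast
 show "g ` E n \<subseteq> Fe n"
 proof
  fix x assume "x \<in> g ` E n"
  then obtain w k where w: "x = g (fr w (s [^] (k::nat)))" "w \<in> Ip (n + d * k)" "w \<in> carrier R" using E_E by blast
  then show "x \<in> Fe n" using g_frac_denom[OF w(3), of k] unfolding frac_elems_def by auto
 qed
qed

lemma pull_open:
 assumes "openin (topo (rat_loc R T0 s)) U"
 shows "\<exists>W. openin S.T W \<and> (\<forall>x\<in>carrier L. x \<in> U \<longleftrightarrow> g x \<in> W)"
proof -
 have "topo (rat_loc R T0 s) = pullback_topology (carrier L) g S.T"
  using completion unfolding is_completion_def rat_loc_simps by blast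
 then obtain W where "openin S.T W" "U = g -` W \<inter> carrier L"
  using assms by (auto simp: openin_pullback_topology)
 then show ?thesis by auto
qed

lemma pull_open':
 assumes "openin S.T W" shows "openin (topo (rat_loc R T0 s)) (g -` W \<inter> carrier L)"
proof -
 have "topo (rat_loc R T0 s) = pullback_topology (carrier L) g S.T"
  using completion unfolding is_completion_def rat_loc_simps by blast
 then show ?thesis using assms by (auto simp: openin_pullback_topology)
qed

lemma dense: "openin S.T W ==> b \<in> W ==> \<exists>x\<in>carrier L. g x \<in> W"
proof -
 assume W: "openin S.T W" "b \<in> W"
 have "S.T closure_of (g ` carrier L) = carrier S"
  using completion unfolding is_completion_def rat_loc_simps by blast
 then have "b \<in> S.T closure_of (g ` carrier L)" using S.openin_carr[OF W(1)] W(2) by blast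
 then show ?thesis using closure_meets[OF _ W] by blast
qed

lemma gE_minus_closed: "S.minus_closed (g ` E n)"
 unfolding S.minus_closed_def
proof (intro conjI ballI)
 show "g ` E n \<subseteq> carrier S" using E_carr by auto
 show "\<zero>\<^bsub>S\<^esub> \<in> g ` E n" using E_zero g.hom_zero by force
 fix x y assume "x \<in> g ` E n" "y \<in> g ` E n"
 then obtain u v where uv: "u \<in> E n" "v \<in> E n" "x = g u" "y = g v" by blast
 have c: "u \<in> carrier L" "v \<in> carrier L" using uv E_carr by auto
 have "x \<ominus>\<^bsub>S\<^esub> y = g (u \<oplus>\<^bsub>L\<^esub> \<ominus>\<^bsub>L\<^esub> v)" using uv c by (simp add: a_minus_def)
 then show "x \<ominus>\<^bsub>S\<^esub> y \<in> g ` E n" using E_add[OF uv(1) E_uminus[OF uv(2)]] by blast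
qed

lemma Fe_F: "Fe n \<subseteq> F n"
 unfolding filt_def using closure_of_subset[of "Fe n" S.T] by (auto simp: frac_elems_def)

lemma F_minus_closed: "S.minus_closed (F n)"
 unfolding filt_def Fe_eq by (rule S.minus_closed_closure[OF gE_minus_closed])

lemma F_carr: "F n \<subseteq> carrier S"
 using F_minus_closed unfolding S.minus_closed_def by blast

text \<open>The topology of the localization is induced along \<open>g\<close>, so
  \<open>E n\<close> is the trace of an open set \<open>W\<close>; by density of the image of
  \<open>g\<close>, this \<open>W\<close> lies in the closure of the image of
  \<open>E n\<close>.\<close>

lemma F_open: "openin S.T (F n)"
proof -
 obtain W where W0: "openin S.T W" "\<forall>x\<in>carrier L. x \<in> E n \<longleftrightarrow> g x \<in> W"
  using pull_open[OF E_open[of n]] by (elim exE conjE)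
 note W = W0(1) W0(2)[rule_format]
 have "W \<subseteq> F n"
 proof
  fix y assume y: "y \<in> W"
  show "y \<in> F n" unfolding filt_def Fe_eq in_closure_of
  proof (intro conjI allI impI)
   show "y \<in> topspace S.T" using y S.openin_carr[OF W(1)] by auto
   fix V assume V: "y \<in> V \<and> openin S.T V"
   then have "openin S.T (V \<inter> W)" "y \<in> V \<inter> W" using y W(1) by auto
   then obtain x where "x \<in> carrier L" "g x \<in> V \<inter> W" using dense by blast
   then show "\<exists>z. z \<in> g ` E n \<and> z \<in> V" using W(2) by blast
  qed
 qed
 moreover have "\<zero>\<^bsub>S\<^esub> \<in> W" using W(2)[OF L.zero_closed] E_zero by simp
 ultimately show ?thesis using S.minus_closed_open[OF F_minus_closed W(1)] by blast
qed

text \<open>No fraction is added to a step of the filtration by taking closures: a fraction in the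
  closure differs from an element of \<open>E n\<close> by something in the open trace set of
  \<open>E n\<close>.\<close>

lemma g_F: "x \<in> carrier L ==> g x \<in> F n ==> x \<in> E n"
proof -
 assume x: "x \<in> carrier L" and gx: "g x \<in> F n"
 obtain W where W0: "openin S.T W" "\<forall>x\<in>carrier L. x \<in> E n \<longleftrightarrow> g x \<in> W"
  using pull_open[OF E_open[of n]] by (elim exE conjE)
 note W = W0(1) W0(2)[rule_format]
 have "openin S.T {y \<in> carrier S. g x \<ominus>\<^bsub>S\<^esub> y \<in> W}"
  by (rule S.open_translate(2)[OF W(1)]) (use x in simp)
 moreover have "g x \<in> {y \<in> carrier S. g x \<ominus>\<^bsub>S\<^esub> y \<in> W}"
  using W(2)[OF L.zero_closed] E_zero x by (simp add: S.minus_self)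
 ultimately obtain e where e: "e \<in> E n" "g x \<ominus>\<^bsub>S\<^esub> g e \<in> W"
  using closure_meets[OF gx[unfolded filt_def Fe_eq]] by blast
 have ec: "e \<in> carrier L" using e E_carr by blast
 have "g (x \<oplus>\<^bsub>L\<^esub> \<ominus>\<^bsub>L\<^esub> e) \<in> W" using e(2) x ec by (simp add: a_minus_def)
 then have "x \<oplus>\<^bsub>L\<^esub> \<ominus>\<^bsub>L\<^esub> e \<in> E n" using W(2)[of "x \<oplus>\<^bsub>L\<^esub> \<ominus>\<^bsub>L\<^esub> e"] x ec by simp
 then have "(x \<oplus>\<^bsub>L\<^esub> \<ominus>\<^bsub>L\<^esub> e) \<oplus>\<^bsub>L\<^esub> e \<in> E n" using E_add e(1) by blast
 then show "x \<in> E n" using x ec by (simp add: L.a_assoc L.l_neg)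
qed

lemma F_antimono: "m \<le> n ==> F n \<subseteq> F m"
 unfolding filt_def Fe_eq by (rule closure_of_mono[OF image_mono[OF E_antimono]])

lemma F_basis:
 assumes "openin S.T U" "\<zero>\<^bsub>S\<^esub> \<in> U" shows "\<exists>n. F n \<subseteq> U"
proof -
 obtain V where V: "openin S.T V" "\<zero>\<^bsub>S\<^esub> \<in> V" "\<And>H. H \<subseteq> V ==> S.T closure_of H \<subseteq> U"
  using S.small_closure[OF assms] by blast
 have "\<zero>\<^bsub>L\<^esub> \<in> g -` V \<inter> carrier L" using V(2) by simp
 then obtain n where "E n \<subseteq> g -` V \<inter> carrier L" using E_basis[OF pull_open'[OF V(1)]] by blast
 then have "g ` E n \<subseteq> V" by blast
 then show ?thesis using V(3) unfolding filt_def Fe_eq by blast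
qed

lemma F_separated:
 assumes b: "b \<in> carrier S" "\<And>n. n \<ge> n0 ==> b \<in> F n" shows "b = \<zero>\<^bsub>S\<^esub>"
proof (rule ccontr)
 assume "b \<noteq> \<zero>\<^bsub>S\<^esub>"
 have "Hausdorff_space S.T"
  using completion unfolding is_completion_def complete_topological_ring_def by blast
 from this[unfolded Hausdorff_space_def S.topspace_T, rule_format, of "\<zero>\<^bsub>S\<^esub>" b]
 obtain U V where U: "openin S.T U" "\<zero>\<^bsub>S\<^esub> \<in> U" "openin S.T V" "b \<in> V" "disjnt U V"
  using b(1) \<open>b \<noteq> \<zero>\<^bsub>S\<^esub>\<close> by auto
 obtain n where n: "F n \<subseteq> U" using F_basis[OF U(1,2)] by blast
 have "b \<in> F (max n n0)" using b(2) by simp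
 then have "b \<in> F n" using F_antimono[of n "max n n0"] by auto
 then show False using n U unfolding disjnt_def by blast
qed

lemma approx:
 assumes b: "b \<in> carrier S"
 shows "\<exists>e\<in>carrier S. \<exists>(k::nat) w. w \<in> carrier R \<and> e \<otimes>\<^bsub>S\<^esub> \<phi> s [^]\<^bsub>S\<^esub> k = \<phi> w \<and> b \<ominus>\<^bsub>S\<^esub> e \<in> F n"
proof -
 have "openin S.T {y \<in> carrier S. b \<ominus>\<^bsub>S\<^esub> y \<in> F n}" by (rule S.open_translate(2)[OF F_open b])
 moreover have "b \<in> {y \<in> carrier S. b \<ominus>\<^bsub>S\<^esub> y \<in> F n}"
  using b F_minus_closed[of n] unfolding S.minus_closed_def by (simp add: S.minus_self)
 ultimately obtain x where x: "x \<in> carrier L" "b \<ominus>\<^bsub>S\<^esub> g x \<in> F n" using dense by blast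
 obtain w k where w: "w \<in> carrier R" "x = fr w (s [^] (k::nat))"
  using M.L_ex[OF x(1)] unfolding powers_def by blast
 show ?thesis using x w g_frac_denom[OF w(1), of k] by (intro bexI[of _ "g x"]) auto
qed

lemma frac_in_F:
 assumes "e \<in> carrier S" "w \<in> Ip (n + d * k)" "e \<otimes>\<^bsub>S\<^esub> \<phi> s [^]\<^bsub>S\<^esub> (k::nat) = \<phi> w"
 shows "e \<in> F n"
 using Fe_F assms unfolding frac_elems_def by blast

lemma F_frac:
 assumes "e \<in> F n" "w \<in> carrier R" "e \<otimes>\<^bsub>S\<^esub> \<phi> s [^]\<^bsub>S\<^esub> (k::nat) = \<phi> w"
 shows "\<exists>K::nat. s [^] K \<otimes> w \<in> Ip (n + d * (k + K))"
proof -
 have e: "e = g (fr w (s [^] k))" using frac_unique assms F_carr by blast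
 then have "fr w (s [^] k) \<in> E n" using g_F assms(1,2) by simp
 then obtain v l where v: "fr w (s [^] k) = fr v (s [^] (l::nat))" "v \<in> Ip (n + d * l)" "v \<in> carrier R"
  using E_E by blast
 obtain u where "u \<in> powers R s" "u \<otimes> (s [^] l \<otimes> w) = u \<otimes> (s [^] k \<otimes> v)"
  using v(1) M.mk_frac_eq[OF assms(2) pow_mem v(3) pow_mem] by blast
 then obtain m where m: "s [^] (m::nat) \<otimes> (s [^] l \<otimes> w) = s [^] m \<otimes> (s [^] k \<otimes> v)"
  unfolding powers_def by blast
 have "s [^] (m + l) \<otimes> w = s [^] (m + k) \<otimes> v"
  using m assms(2) v(3) sc by (simp add: m_assoc nat_pow_mult[symmetric])
 moreover have "s [^] (m + k) \<otimes> v \<in> Ip (n + d * (k + (m + l)))"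
  using Ip_mult[OF s_pow_Ip v(2), of "m + k"] by (simp add: algebra_simps)
 ultimately show ?thesis by (intro exI[of _ "m + l"]) simp
qed

lemma approx_F:
 assumes b: "b \<in> F n"
 shows "\<exists>e\<in>carrier S. \<exists>(k::nat) w. w \<in> Ip (n + d * k) \<and> e \<otimes>\<^bsub>S\<^esub> \<phi> s [^]\<^bsub>S\<^esub> k = \<phi> w \<and> b \<ominus>\<^bsub>S\<^esub> e \<in> F m"
proof -
 have bc: "b \<in> carrier S" using b F_carr by blast
 obtain e k w where e: "e \<in> carrier S" "w \<in> carrier R" "e \<otimes>\<^bsub>S\<^esub> \<phi> s [^]\<^bsub>S\<^esub> (k::nat) = \<phi> w"
  "b \<ominus>\<^bsub>S\<^esub> e \<in> F (max n m)" using approx[OF bc, of "max n m"] by blast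
 have em: "b \<ominus>\<^bsub>S\<^esub> e \<in> F m" and en: "b \<ominus>\<^bsub>S\<^esub> e \<in> F n"
  using e(4) F_antimono[of m "max n m"] F_antimono[of n "max n m"] by auto
 have "b \<ominus>\<^bsub>S\<^esub> (b \<ominus>\<^bsub>S\<^esub> e) \<in> F n" using F_minus_closed[of n] b en unfolding S.minus_closed_def by blast
 moreover have "b \<ominus>\<^bsub>S\<^esub> (b \<ominus>\<^bsub>S\<^esub> e) = e" using bc e(1) by algebra
 ultimately have "e \<in> F n" by simp
 then have "g (fr w (s [^] k)) \<in> F n" using frac_unique[OF e(1,2,3)] by simp
 then have "fr w (s [^] k) \<in> E n" using g_F e(2) by simp
 then obtain v l where v: "fr w (s [^] k) = fr v (s [^] (l::nat))" "v \<in> Ip (n + d * l)" "v \<in> carrier R"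
  using E_E by blast
 have "e \<otimes>\<^bsub>S\<^esub> \<phi> s [^]\<^bsub>S\<^esub> l = \<phi> v"
  using frac_unique[OF e(1,2,3)] v(1) g_frac_denom[OF v(3)] by simp
 then show ?thesis using e(1) v(2) em by blast
qed

lemma phi_mult_F:
 assumes "a \<in> carrier R" "b \<in> F n" shows "\<phi> a \<otimes>\<^bsub>S\<^esub> b \<in> F n"
proof -
 have "(\<lambda>x. \<phi> a \<otimes>\<^bsub>S\<^esub> x) ` F n \<subseteq> S.T closure_of ((\<lambda>x. \<phi> a \<otimes>\<^bsub>S\<^esub> x) ` Fe n)"
  unfolding filt_def by (rule continuous_map_image_closure_subset[OF S.cont_mult[OF phi_carr[OF assms(1)]]])
 moreover have "(\<lambda>x. \<phi> a \<otimes>\<^bsub>S\<^esub> x) ` Fe n \<subseteq> Fe n"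
 proof clarify
  fix x assume x: "x \<in> Fe n"
  then obtain k w where w: "x \<in> carrier S" "w \<in> Ip (n + d * k)" "x \<otimes>\<^bsub>S\<^esub> \<phi> s [^]\<^bsub>S\<^esub> (k::nat) = \<phi> w"
   unfolding frac_elems_def by blast
  have "a \<otimes> w \<in> Ip (n + d * k)" by (rule ideal_lmult[OF Ip_ideal w(2) assms(1)])
  moreover have "\<phi> a \<otimes>\<^bsub>S\<^esub> x \<otimes>\<^bsub>S\<^esub> \<phi> s [^]\<^bsub>S\<^esub> k = \<phi> (a \<otimes> w)"
   using w phi_carr[OF assms(1)] phi_carr[OF sc] ring_hom_mult[OF phi_hom assms(1) Ip_carr[OF w(2)]]
   by (simp add: S.m_assoc)
  ultimately show "\<phi> a \<otimes>\<^bsub>S\<^esub> x \<in> Fe n" unfolding frac_elems_def using w(1) phi_carr[OF assms(1)] by auto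
 qed
 ultimately show ?thesis unfolding filt_def using closure_of_mono assms(2)[unfolded filt_def] by blast
qed

lemma phi_Ip_F: "a \<in> Ip n ==> \<phi> a \<in> F n"
 using frac_in_F[of "\<phi> a" a n 0] phi_carr Ip_carr by simp

lemma phi_F: "a \<in> carrier R ==> \<phi> a \<in> F n ==> \<exists>K::nat. s [^] K \<otimes> a \<in> Ip (n + d * K)"
 using F_frac[of "\<phi> a" n a 0] phi_carr by simp

end

lemma rat_completionI:
 assumes "adic R I r f" "T0 \<subseteq> carrier R" "genideal R T0 = ideal_power R I d" "s \<in> ideal_power R I d"
  "completed_rat_loc R T0 s S \<phi>"
 shows "\<exists>g. rat_completion R I r f T0 s d S \<phi> g"
 using assms unfolding completed_rat_loc_def rat_completion_def rat_completion_axioms_def by blast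

text \<open>A continuous map carries closures into closures, so compatibility with the filtrations
  has to be checked on fractions only.\<close>

lemma restriction_filt:
 assumes h: "top_ring_hom S S' h"
  and step: "\<And>k w e. w \<in> ideal_power R I (n + d * k) ==> e \<in> carrier S ==>
   e \<otimes>\<^bsub>S\<^esub> \<phi> s [^]\<^bsub>S\<^esub> (k::nat) = \<phi> w ==> h e \<in> frac_elems R I d' s' S' \<phi>' n"
  and b: "b \<in> filt R I d s S \<phi> n"
 shows "h b \<in> filt R I d' s' S' \<phi>' n"
proof -
 have "h ` filt R I d s S \<phi> n \<subseteq> topo S' closure_of (h ` frac_elems R I d s S \<phi> n)"
  unfolding filt_def
  by (rule continuous_map_image_closure_subset) (use h in \<open>simp add: top_ring_hom_def\<close>)
 moreover have "h ` frac_elems R I d s S \<phi> n \<subseteq> frac_elems R I d' s' S' \<phi>' n"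
  using step unfolding frac_elems_def[of R I d s] by blast
 ultimately show ?thesis unfolding filt_def using closure_of_mono b[unfolded filt_def] by blast
qed

section \<open>Sheaves of topological rings\<close>

locale trspace =
 fixes X :: "('x, 'a, 'm) trspace_scheme"
 assumes ringed: "topologically_ringed_space X"
begin

abbreviation op where "op U \<equiv> openin (under X) U"
abbreviation Sec where "Sec \<equiv> sect X"
abbreviation res where "res \<equiv> restr X"

lemma presheaf: "presheaf_of_complete_top_rings X"
 using ringed unfolding topologically_ringed_space_def by blast

lemma sec_complete: "op U ==> complete_topological_ring (Sec U)"
 using presheaf[unfolded presheaf_of_complete_top_rings_def, THEN conjunct1, rule_format] by blast

lemma sec_topring: "op U ==> topring (Sec U)"
 using sec_complete[of U] unfolding complete_topological_ring_def
 by (intro topring.intro topring_axioms.intro) (auto simp: topological_ring_def)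

lemma sec_cring: "op U ==> cring (Sec U)"
 using sec_topring topring.axioms(1) by blast

lemma res_top_hom: "op U ==> op V ==> V \<subseteq> U ==> top_ring_hom (Sec U) (Sec V) (res U V)"
 using presheaf[unfolded presheaf_of_complete_top_rings_def, THEN conjunct2, THEN conjunct1, rule_format] by blast

lemma res_hom: "op U ==> op V ==> V \<subseteq> U ==> res U V \<in> ring_hom (Sec U) (Sec V)"
 using res_top_hom unfolding top_ring_hom_def by blast

lemma res_ring_hom_cring: "op U ==> op V ==> V \<subseteq> U ==> ring_hom_cring (Sec U) (Sec V) (res U V)"
 by (intro ring_hom_cring.intro ring_hom_cring_axioms.intro res_hom sec_cring)

lemma res_carr [simp]:
 "op U ==> op V ==> V \<subseteq> U ==> a \<in> carrier (Sec U) ==> res U V a \<in> carrier (Sec V)"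
 using ring_hom_closed[OF res_hom] by blast

lemma res_id [simp]: "op U ==> a \<in> carrier (Sec U) ==> res U U a = a"
 using presheaf[unfolded presheaf_of_complete_top_rings_def, THEN conjunct2, THEN conjunct2, THEN conjunct1, rule_format] by blast

lemma res_res [simp]:
 "op U ==> op V ==> op W ==> W \<subseteq> V ==> V \<subseteq> U ==> a \<in> carrier (Sec U) ==>
  res V W (res U V a) = res U W a"
 using presheaf[unfolded presheaf_of_complete_top_rings_def, THEN conjunct2, THEN conjunct2, THEN conjunct2, rule_format] by blast

lemma glue:
 assumes "\<And>V. V \<in> C ==> op V" "\<And>V. V \<in> C ==> s V \<in> carrier (Sec V)"
  "\<And>V W. V \<in> C ==> W \<in> C ==> res V (V \<inter> W) (s V) = res W (V \<inter> W) (s W)"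
 shows "\<exists>!a. a \<in> carrier (Sec (\<Union>C)) \<and> (\<forall>V\<in>C. res (\<Union>C) V a = s V)"
proof -
 have "\<forall>V\<in>C. op V" using assms(1) by blast
 from ringed[unfolded topologically_ringed_space_def, THEN conjunct2, THEN spec[of _ C], THEN mp, OF this]
 have "\<forall>s. (\<forall>V\<in>C. s V \<in> carrier (Sec V)) \<and>
   (\<forall>V\<in>C. \<forall>W\<in>C. res V (V \<inter> W) (s V) = res W (V \<inter> W) (s W)) -->
   (\<exists>!a. a \<in> carrier (Sec (\<Union>C)) \<and> (\<forall>V\<in>C. res (\<Union>C) V a = s V))" by (rule conjunct1)
 from spec[OF this, of s] show ?thesis by (rule mp) (intro conjI ballI assms(2,3))
qed

lemma embedding:
 assumes "\<And>V. V \<in> C ==> op V"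
 shows "embedding_map (topo (Sec (\<Union>C))) (product_topology (\<lambda>V. topo (Sec V)) C)
     (\<lambda>a. \<lambda>V\<in>C. res (\<Union>C) V a)"
proof -
 have "\<forall>V\<in>C. op V" using assms(1) by blast
 from ringed[unfolded topologically_ringed_space_def, THEN conjunct2, THEN spec[of _ C], THEN mp, OF this]
 show ?thesis by (rule conjunct2)
qed

text \<open>The uniqueness part of gluing, applied to the family of restrictions of
  \<open>a\<close>.\<close>

lemma sections_eq:
 assumes op: "\<And>V. V \<in> C ==> op V" and U: "U = \<Union>C"
  and ab: "a \<in> carrier (Sec U)" "b \<in> carrier (Sec U)" "\<And>V. V \<in> C ==> res U V a = res U V b"
 shows "a = b"
proof -
 have opU: "op U" using op unfolding U by blast
 have VU: "V \<subseteq> U" if "V \<in> C" for V using that U by blast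
 let ?s = "\<lambda>V. res U V a"
 have "\<exists>!c. c \<in> carrier (Sec (\<Union>C)) \<and> (\<forall>V\<in>C. res (\<Union>C) V c = ?s V)"
 proof (rule glue)
  show "res V (V \<inter> W) (?s V) = res W (V \<inter> W) (?s W)" if "V \<in> C" "W \<in> C" for V W
  proof -
   have "op (V \<inter> W)" by (rule openin_Int[OF op[OF that(1)] op[OF that(2)]])
   then show ?thesis
    using res_res[OF opU op[OF that(1)] _ _ VU[OF that(1)] ab(1), of "V \<inter> W"]
     res_res[OF opU op[OF that(2)] _ _ VU[OF that(2)] ab(1), of "V \<inter> W"] by simp
  qed
 qed (use op opU VU ab in auto)
 then show ?thesis using ab unfolding U[symmetric] by metis
qed

lemma germ_mem:
 "(V, b) \<in> germ X x U a \<longleftrightarrow> op V \<and> x \<in> V \<and> b \<in> carrier (Sec V) \<and>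
  (\<exists>W. op W \<and> x \<in> W \<and> W \<subseteq> U \<inter> V \<and> res U W a = res V W b)"
 unfolding germ_def by simp

lemma germ_self: "op U ==> x \<in> U ==> a \<in> carrier (Sec U) ==> (U, a) \<in> germ X x U a"
 unfolding germ_mem by blast

lemma res_eq_smaller:
 assumes "op U" "op V" "op W" "op W'" "W' \<subseteq> W" "W \<subseteq> U" "W \<subseteq> V"
  "a \<in> carrier (Sec U)" "b \<in> carrier (Sec V)" "res U W a = res V W b"
 shows "res U W' a = res V W' b"
 using res_res[OF assms(1,3,4,5,6,8)] res_res[OF assms(2,3,4,5,7,9)] assms(10) by simp

lemma germ_sub:
 assumes U: "op U" "x \<in> U" "a \<in> carrier (Sec U)" and V: "op V" "x \<in> V" "b \<in> carrier (Sec V)"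
  and W: "op W" "x \<in> W" "W \<subseteq> U \<inter> V" "res U W a = res V W b"
 shows "germ X x U a \<subseteq> germ X x V b"
proof
 fix z assume z: "z \<in> germ X x U a"
 obtain Z c where zc: "z = (Z, c)" by (cases z)
 obtain W' where W': "op Z" "x \<in> Z" "c \<in> carrier (Sec Z)" "op W'" "x \<in> W'" "W' \<subseteq> U \<inter> Z" "res U W' a = res Z W' c"
  using z unfolding zc germ_mem by blast
 have o: "op (W \<inter> W')" using W W' by blast
 have "res U (W \<inter> W') a = res V (W \<inter> W') b"
  by (rule res_eq_smaller[OF U(1) V(1) W(1) o]) (use U V W in auto)
 moreover have "res U (W \<inter> W') a = res Z (W \<inter> W') c"
  by (rule res_eq_smaller[OF U(1) W'(1,4) o]) (use U W' in auto)
 ultimately show "z \<in> germ X x V b" unfolding zc germ_mem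
  using W' W o by (intro conjI exI[of _ "W \<inter> W'"]) auto
qed

lemma germ_eqI:
 assumes U: "op U" "x \<in> U" "a \<in> carrier (Sec U)" and V: "op V" "x \<in> V" "b \<in> carrier (Sec V)"
  and W: "op W" "x \<in> W" "W \<subseteq> U" "W \<subseteq> V" "res U W a = res V W b"
 shows "germ X x U a = germ X x V b"
 using germ_sub[OF U V W(1,2) _ W(5)] germ_sub[OF V U W(1,2) _ W(5)[symmetric]] W(3,4) by blast

lemma germ_eqD:
 assumes "op U" "x \<in> U" "a \<in> carrier (Sec U)" "germ X x U a = germ X x V b"
 shows "\<exists>W. op W \<and> x \<in> W \<and> W \<subseteq> U \<and> W \<subseteq> V \<and> res U W a = res V W b"
 using germ_self[OF assms(1-3)] unfolding assms(4) germ_mem by (metis le_inf_iff)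

lemma germ_res:
 assumes "op U" "x \<in> V" "a \<in> carrier (Sec U)" "op V" "V \<subseteq> U"
 shows "germ X x V (res U V a) = germ X x U a"
 by (rule germ_eqI[of V x _ U _ V]) (use assms in auto)

lemma stalk_carr: "op U ==> x \<in> U ==> a \<in> carrier (Sec U) ==> germ X x U a \<in> carrier (stalk X x)"
 unfolding stalk_def by auto

lemma stalk_ex:
 "P \<in> carrier (stalk X x) ==> \<exists>U a. op U \<and> x \<in> U \<and> a \<in> carrier (Sec U) \<and> P = germ X x U a"
 unfolding stalk_def by auto

text \<open>Sum and product of germs are treated at once: all that is used of the operation
  \<open>F\<close> is that it commutes with restriction, so any two choices of representatives can
  be compared on a smaller neighbourhood.\<close>

lemma stalk_op:
 fixes F :: "'x set => 'a => 'a => 'a"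
 assumes F: "\<And>U a b. op U ==> a \<in> carrier (Sec U) ==> b \<in> carrier (Sec U) ==> F U a b \<in> carrier (Sec U)"
  and F_res: "\<And>U V a b. op U ==> op V ==> V \<subseteq> U ==> a \<in> carrier (Sec U) ==> b \<in> carrier (Sec U) ==>
   res U V (F U a b) = F V (res U V a) (res U V b)"
  and U: "op U" "x \<in> U" "a \<in> carrier (Sec U)" "b \<in> carrier (Sec U)"
 shows "(\<Union>(V, c)\<in>germ X x U a. \<Union>(W, d)\<in>germ X x U b.
   germ X x (V \<inter> W) (F (V \<inter> W) (res V (V \<inter> W) c) (res W (V \<inter> W) d))) = germ X x U (F U a b)"
proof -
 have key: "germ X x (V \<inter> W) (F (V \<inter> W) (res V (V \<inter> W) c) (res W (V \<inter> W) d)) = germ X x U (F U a b)"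
  if A: "(V, c) \<in> germ X x U a" and B: "(W, d) \<in> germ X x U b" for V c W d
 proof -
  obtain V' where V: "op V" "x \<in> V" "c \<in> carrier (Sec V)" "op V'" "x \<in> V'" "V' \<subseteq> U \<inter> V" "res U V' a = res V V' c"
   using A unfolding germ_mem by blast
  obtain W' where W: "op W" "x \<in> W" "d \<in> carrier (Sec W)" "op W'" "x \<in> W'" "W' \<subseteq> U \<inter> W" "res U W' b = res W W' d"
   using B unfolding germ_mem by blast
  have o: "op (V' \<inter> W')" "op (V \<inter> W)" using V W by auto
  have cc: "res V (V \<inter> W) c \<in> carrier (Sec (V \<inter> W))" "res W (V \<inter> W) d \<in> carrier (Sec (V \<inter> W))"
   using V W o by auto
  have 1: "res U (V' \<inter> W') a = res V (V' \<inter> W') c"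
   by (rule res_eq_smaller[OF U(1) V(1,4) o(1)]) (use U V in auto)
  have 2: "res U (V' \<inter> W') b = res W (V' \<inter> W') d"
   by (rule res_eq_smaller[OF U(1) W(1,4) o(1)]) (use U W in auto)
  have sub: "V' \<inter> W' \<subseteq> V \<inter> W" "V' \<inter> W' \<subseteq> U" using V W by auto
  have "res (V \<inter> W) (V' \<inter> W') (F (V \<inter> W) (res V (V \<inter> W) c) (res W (V \<inter> W) d))
    = F (V' \<inter> W') (res (V \<inter> W) (V' \<inter> W') (res V (V \<inter> W) c)) (res (V \<inter> W) (V' \<inter> W') (res W (V \<inter> W) d))"
   by (rule F_res[OF o(2,1) sub(1) cc])
  also have "\<dots> = F (V' \<inter> W') (res V (V' \<inter> W') c) (res W (V' \<inter> W') d)"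
   using res_res[OF V(1) o(2,1) sub(1) _ V(3)] res_res[OF W(1) o(2,1) sub(1) _ W(3)] by simp
  also have "\<dots> = res U (V' \<inter> W') (F U a b)" using F_res[OF U(1) o(1) sub(2) U(3,4)] 1 2 by simp
  finally show ?thesis
   using germ_eqI[OF o(2) _ F[OF o(2) cc] U(1,2) F[OF U(1,3,4)] o(1) _ sub] V W by blast
 qed
 show ?thesis
 proof (rule SUP_eq_const)
  show "germ X x U a \<noteq> {}" using germ_self[OF U(1,2,3)] by blast
  fix z assume z: "z \<in> germ X x U a"
  show "(case z of (V, c) => \<Union>(W, d)\<in>germ X x U b.
   germ X x (V \<inter> W) (F (V \<inter> W) (res V (V \<inter> W) c) (res W (V \<inter> W) d))) = germ X x U (F U a b)"
  proof (cases z)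
   case (Pair V c)
   have "(\<Union>(W, d)\<in>germ X x U b.
    germ X x (V \<inter> W) (F (V \<inter> W) (res V (V \<inter> W) c) (res W (V \<inter> W) d))) = germ X x U (F U a b)"
   proof (rule SUP_eq_const)
    show "germ X x U b \<noteq> {}" using germ_self[OF U(1,2,4)] by blast
    show "(case y of (W, d) => germ X x (V \<inter> W) (F (V \<inter> W) (res V (V \<inter> W) c) (res W (V \<inter> W) d)))
      = germ X x U (F U a b)" if "y \<in> germ X x U b" for y
     using key[of V c "fst y" "snd y"] z that unfolding Pair by (simp add: case_prod_beta)
   qed
   then show ?thesis using Pair by simp
  qed
 qed
qed

lemma stalk_mult:
 assumes "op U" "x \<in> U" "a \<in> carrier (Sec U)" "b \<in> carrier (Sec U)"
 shows "germ X x U a \<otimes>\<^bsub>stalk X x\<^esub> germ X x U b = germ X x U (a \<otimes>\<^bsub>Sec U\<^esub> b)"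
proof -
 have "(\<Union>(V, c)\<in>germ X x U a. \<Union>(W, d)\<in>germ X x U b.
   germ X x (V \<inter> W) (res V (V \<inter> W) c \<otimes>\<^bsub>Sec (V \<inter> W)\<^esub> res W (V \<inter> W) d)) = germ X x U (a \<otimes>\<^bsub>Sec U\<^esub> b)"
  by (rule stalk_op[where F = "\<lambda>U a b. a \<otimes>\<^bsub>Sec U\<^esub> b"])
   (use assms sec_cring ring_hom_mult[OF res_hom] in \<open>auto simp: cring.cring_simprules(5)\<close>)
 then show ?thesis by (simp add: stalk_def)
qed

lemma stalk_add:
 assumes "op U" "x \<in> U" "a \<in> carrier (Sec U)" "b \<in> carrier (Sec U)"
 shows "germ X x U a \<oplus>\<^bsub>stalk X x\<^esub> germ X x U b = germ X x U (a \<oplus>\<^bsub>Sec U\<^esub> b)"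
proof -
 have "(\<Union>(V, c)\<in>germ X x U a. \<Union>(W, d)\<in>germ X x U b.
   germ X x (V \<inter> W) (res V (V \<inter> W) c \<oplus>\<^bsub>Sec (V \<inter> W)\<^esub> res W (V \<inter> W) d)) = germ X x U (a \<oplus>\<^bsub>Sec U\<^esub> b)"
  by (rule stalk_op[where F = "\<lambda>U a b. a \<oplus>\<^bsub>Sec U\<^esub> b"])
   (use assms sec_cring ring_hom_add[OF res_hom] in \<open>auto simp: cring.cring_simprules(1)\<close>)
 then show ?thesis by (simp add: stalk_def)
qed

lemma op_sub: "op U ==> U \<subseteq> topspace (under X)"
 by (rule openin_subset)

lemma op_top: "op (topspace (under X))"
 by simp

lemma stalk_one:
 assumes "op U" "x \<in> U" shows "\<one>\<^bsub>stalk X x\<^esub> = germ X x U \<one>\<^bsub>Sec U\<^esub>"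
proof -
 have t: "\<one>\<^bsub>Sec (topspace (under X))\<^esub> \<in> carrier (Sec (topspace (under X)))"
  using cring.cring_simprules(6)[OF sec_cring[OF op_top]] .
 have "germ X x U (res (topspace (under X)) U \<one>\<^bsub>Sec (topspace (under X))\<^esub>) = germ X x (topspace (under X)) \<one>\<^bsub>Sec (topspace (under X))\<^esub>"
  by (rule germ_res[OF op_top assms(2) t assms(1) op_sub[OF assms(1)]])
 moreover have "res (topspace (under X)) U \<one>\<^bsub>Sec (topspace (under X))\<^esub> = \<one>\<^bsub>Sec U\<^esub>"
  by (rule ring_hom_one[OF res_hom[OF op_top assms(1) op_sub[OF assms(1)]]])
 ultimately show ?thesis by (simp add: stalk_def)
qed

lemma stalk_zero:
 assumes "op U" "x \<in> U" shows "\<zero>\<^bsub>stalk X x\<^esub> = germ X x U \<zero>\<^bsub>Sec U\<^esub>"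
proof -
 have t: "\<zero>\<^bsub>Sec (topspace (under X))\<^esub> \<in> carrier (Sec (topspace (under X)))"
  using cring.cring_simprules(2)[OF sec_cring[OF op_top]] .
 have "germ X x U (res (topspace (under X)) U \<zero>\<^bsub>Sec (topspace (under X))\<^esub>) = germ X x (topspace (under X)) \<zero>\<^bsub>Sec (topspace (under X))\<^esub>"
  by (rule germ_res[OF op_top assms(2) t assms(1) op_sub[OF assms(1)]])
 moreover have "res (topspace (under X)) U \<zero>\<^bsub>Sec (topspace (under X))\<^esub> = \<zero>\<^bsub>Sec U\<^esub>"
  by (rule ring_hom_cring.hom_zero[OF res_ring_hom_cring[OF op_top assms(1) op_sub[OF assms(1)]]])
 ultimately show ?thesis by (simp add: stalk_def)
qed

lemma germ_hom: "op U ==> x \<in> U ==> germ X x U \<in> ring_hom (Sec U) (stalk X x)"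
 by (rule ring_hom_memI) (simp_all add: stalk_carr stalk_mult stalk_add stalk_one)

end

section \<open>Charts of a normal formal scheme\<close>

text \<open>The element \<open>0\<close> is added to the generators so that there is at least one;
  later a generator of largest value will be chosen at each point.\<close>

lemma adic_exists:
 assumes "complete_noetherian_adic_ring A"
 shows "\<exists>I r f. adic A I r f \<and> 0 < r"
proof -
 have ad: "adic_ring A" and co: "complete_topological_ring A" and no: "noetherian_ring A"
  using assms unfolding complete_noetherian_adic_ring_def by auto
 interpret cring A using ad unfolding adic_ring_def topological_ring_def by blast
 obtain I where I: "ideal I A" "\<And>W. openin (topo A) W \<longleftrightarrow>
    W \<subseteq> carrier A \<and> (\<forall>x\<in>W. \<exists>n. ideal_power A I n +>\<^bsub>A\<^esub> x \<subseteq> W)"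
  using ad unfolding adic_ring_def by blast
 obtain S where S: "S \<subseteq> carrier A" "finite S" "I = genideal A S"
  using noetherian_ring.finetely_gen[OF no I(1)] by blast
 let ?S = "insert \<zero>\<^bsub>A\<^esub> S"
 obtain f and r :: nat where f: "?S = f ` {i. i < r}"
  using S(2) finite_conv_nat_seg_image[of ?S] by auto
 have sub: "?S \<subseteq> carrier A" using S(1) by simp
 have gen: "I = genideal A ?S"
 proof
  have "S \<subseteq> I" unfolding S(3) by (rule genideal_self[OF S(1)])
  then show "genideal A ?S \<subseteq> I" using ideal_zero[OF I(1)] by (intro genideal_minimal[OF I(1)]) auto
  have "S \<subseteq> genideal A ?S" using genideal_self[OF sub] by blast
  then show "I \<subseteq> genideal A ?S" unfolding S(3) by (intro genideal_minimal[OF genideal_ideal[OF sub]])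
 qed
 have "adic A I r f"
 proof (intro adic.intro fg_ideal.intro fg_ideal_axioms.intro adic_axioms.intro)
  show "cring A" by (rule is_cring)
  show "noetherian_ring A" by (rule no)
  show "f i \<in> carrier A" if "i < r" for i using that f sub by auto
  show "I = genideal A (f ` {..<r})" using gen f by (simp add: lessThan_def)
 qed (use I(2) co in auto)
 moreover have "0 < r" using f by (cases r) auto
 ultimately show ?thesis by blast
qed

context cring begin

lemma frac_diff_identity:
 assumes "b \<in> carrier R" "y \<in> carrier R" "e \<in> carrier R" "q \<in> carrier R"
 shows "b \<otimes> (y \<ominus> e) \<otimes> q = q \<otimes> (b \<otimes> y) \<ominus> b \<otimes> (e \<otimes> q)"
 using assms by algebra

lemma pow_diff_identity:
 assumes "q \<in> carrier R" "a \<in> carrier R" "b \<in> carrier R" "w \<in> carrier R"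
 shows "q [^] (K::nat) \<otimes> (q [^] (k::nat) \<otimes> a \<ominus> b \<otimes> w) = q [^] (K + k) \<otimes> a \<ominus> (q [^] K \<otimes> w) \<otimes> b"
 unfolding nat_pow_mult[OF assms(1), symmetric]
 using nat_pow_closed[OF assms(1), of K] nat_pow_closed[OF assms(1), of k] assms(2-4) by algebra

end

locale spf_chart = trspace X + A: adic "sect X U" I r f
 for X :: "('x, 'a, 'm) trspace_scheme" and U and I r f +
 fixes h :: "'x => 'a set"
 assumes chart: "Spf_chart X U h" and r_pos: "0 < r"
begin

abbreviation A where "A \<equiv> sect X U"
abbreviation D where "D a \<equiv> {y \<in> U. a \<notin> h y}"
abbreviation mult_A (infixl "\<otimes>\<^sub>A" 70) where "a \<otimes>\<^sub>A b \<equiv> a \<otimes>\<^bsub>A\<^esub> b"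
abbreviation add_A (infixl "\<oplus>\<^sub>A" 65) where "a \<oplus>\<^sub>A b \<equiv> a \<oplus>\<^bsub>A\<^esub> b"
abbreviation minus_A (infixl "\<ominus>\<^sub>A" 65) where "a \<ominus>\<^sub>A b \<equiv> a \<ominus>\<^bsub>A\<^esub> b"
abbreviation pow_A (infixl "[^]\<^sub>A" 75) where "a [^]\<^sub>A (n::nat) \<equiv> a [^]\<^bsub>A\<^esub> n"
abbreviation zero_A ("\<zero>\<^sub>A") where "\<zero>\<^sub>A \<equiv> \<zero>\<^bsub>A\<^esub>"
abbreviation one_A ("\<one>\<^sub>A") where "\<one>\<^sub>A \<equiv> \<one>\<^bsub>A\<^esub>"

lemma opU: "op U"
 using chart unfolding Spf_chart_def by blast

lemma homeo: "homeomorphic_map (subtopology (under X) U) (Spf_topology A) h"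
 using chart unfolding Spf_chart_def by blast

lemma topspace_U: "topspace (subtopology (under X) U) = U"
 using op_sub[OF opU] by auto

lemma topspace_Spf: "topspace (Spf_topology A) = Spf A"
proof -
 have "p \<in> \<Union>{{p \<in> Spf A. a \<notin> p} | a. a \<in> carrier A}" if p: "p \<in> Spf A" for p
 proof -
  have "primeideal p A" using p unfolding Spf_def by blast
  then have "\<one>\<^sub>A \<notin> p" using A.prime_compl_one by blast
  then show ?thesis using p by blast
 qed
 then show ?thesis unfolding Spf_topology_def topology_generated_by_topspace by blast
qed

lemma h_image: "h ` U = Spf A"
 using homeomorphic_imp_surjective_map[OF homeo] unfolding topspace_U topspace_Spf .

lemma h_prime: "x \<in> U ==> primeideal (h x) A"
 and h_open: "x \<in> U ==> openin (topo A) (h x)"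
 using h_image unfolding Spf_def by blast+

lemma h_I: "x \<in> U ==> I \<subseteq> h x"
proof -
 assume x: "x \<in> U"
 note p = h_prime[OF x]
 have "\<zero>\<^sub>A \<in> h x" using A.ideal_zero[OF primeideal.axioms(1)[OF p]] .
 then obtain n where n: "A.Ip n \<subseteq> h x" using A.open_zero[OF h_open[OF x]] by blast
 have "f i \<in> h x" if i: "i < r" for i
 proof -
  have "f i [^]\<^sub>A n \<in> h x" using n A.ideal_power_pow[OF A.I_ideal A.f_I[OF i]] by blast
  then show ?thesis using A.prime_pow[OF p A.f_carr[OF i]] by blast
 qed
 then show "I \<subseteq> h x" unfolding A.I_gen
  by (intro A.genideal_minimal[OF primeideal.axioms(1)[OF p]]) auto
qed

lemma h_surj:
 assumes "primeideal p A" "I \<subseteq> p" shows "\<exists>x\<in>U. h x = p"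
proof -
 have "A.Ip (Suc 0) \<subseteq> p" using assms(2) A.ideal_power_1[OF A.I_ideal] by simp
 then have "openin (topo A) p" by (rule A.open_ideal[OF primeideal.axioms(1)[OF assms(1)]])
 then have "p \<in> h ` U" using assms(1) unfolding h_image Spf_def by blast
 then show ?thesis by blast
qed

lemma op_D: assumes "a \<in> carrier A" shows "op (D a)"
proof -
 have "openin (Spf_topology A) {p \<in> Spf A. a \<notin> p}"
  unfolding Spf_topology_def by (rule topology_generated_by_Basis) (use assms in blast)
 then have "openin (subtopology (under X) U) {x \<in> topspace (subtopology (under X) U). h x \<in> {p \<in> Spf A. a \<notin> p}}"
  by (rule openin_continuous_map_preimage[OF homeomorphic_imp_continuous_map[OF homeo]])
 moreover have "{x \<in> topspace (subtopology (under X) U). h x \<in> {p \<in> Spf A. a \<notin> p}} = D a"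
  unfolding topspace_U using h_image by blast
 ultimately show ?thesis using openin_open_subtopology[OF opU] by simp
qed

text \<open>The topology of the formal spectrum is generated by the \<open>D a\<close> as a
  subbasis. They form a basis because the intersection of \<open>D a\<close> and \<open>D b\<close>
  belongs to the product of \<open>a\<close> and \<open>b\<close>.\<close>

lemma D_basis:
 assumes W: "op W" "x \<in> W" and x: "x \<in> U"
 shows "\<exists>a\<in>carrier A. x \<in> D a \<and> D a \<subseteq> W"
proof -
 have gen: "\<exists>a\<in>carrier A. a \<notin> p \<and> (\<forall>q\<in>Spf A. a \<notin> q --> q \<in> S)"
  if "generate_topology_on {{p \<in> Spf A. a \<notin> p} | a. a \<in> carrier A} S" "p \<in> S" "p \<in> Spf A" for S p
  using that
 proof (induction rule: generate_topology_on.induct)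
  case (Int S1 S2)
  then obtain a b where a: "a \<in> carrier A" "a \<notin> p" "\<forall>q\<in>Spf A. a \<notin> q --> q \<in> S1"
   and b: "b \<in> carrier A" "b \<notin> p" "\<forall>q\<in>Spf A. b \<notin> q --> q \<in> S2" by blast
  have ab: "a \<otimes>\<^sub>A b \<notin> q \<longleftrightarrow> a \<notin> q \<and> b \<notin> q" if "q \<in> Spf A" for q
  proof -
   have q: "primeideal q A" using that unfolding Spf_def by blast
   show ?thesis
    using primeideal.I_prime[OF q a(1) b(1)] A.ideal_lmult[OF primeideal.axioms(1)[OF q] _ a(1)]
     A.ideal_rmult[OF primeideal.axioms(1)[OF q] _ b(1)] by blast
  qed
  show ?case
   by (rule bexI[of _ "a \<otimes>\<^sub>A b"]) (use ab a b Int.prems in auto)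
 next
  case (UN K)
  then show ?case by blast
 next
  case (Basis s)
  then show ?case by blast
 qed simp
 have oUW: "openin (subtopology (under X) U) (U \<inter> W)"
  using W openin_subtopology_Int2 by (metis inf_commute)
 have "openin (Spf_topology A) (h ` (U \<inter> W))"
  by (rule homeomorphic_map_openness[OF homeo, THEN iffD2, OF _ oUW]) (use op_sub[OF opU] in auto)
 then have g: "generate_topology_on {{p \<in> Spf A. a \<notin> p} | a. a \<in> carrier A} (h ` (U \<inter> W))"
  unfolding Spf_topology_def openin_topology_generated_by_iff .
 have "h x \<in> h ` (U \<inter> W)" "h x \<in> Spf A" using W x h_image by auto
 from gen[OF g this] obtain a where a: "a \<in> carrier A" "a \<notin> h x" "\<forall>q\<in>Spf A. a \<notin> q --> q \<in> h ` (U \<inter> W)"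
  by blast
 have inj: "inj_on h U" using homeomorphic_imp_injective_map[OF homeo] unfolding topspace_U .
 have "D a \<subseteq> W"
 proof
  fix y assume y: "y \<in> D a"
  then have "h y \<in> h ` (U \<inter> W)" using a(3) h_image by blast
  then obtain z where "z \<in> U \<inter> W" "h y = h z" by blast
  then show "y \<in> W" using inj_onD[OF inj, of y z] y by auto
 qed
 then show ?thesis using a x by blast
qed

text \<open>Inverting \<open>a\<close> is the rational localization whose denominators have order
  \<open>d = 0\<close>.\<close>

lemma D_completion:
 assumes "a \<in> carrier A"
 shows "\<exists>g. rat_completion A I r f {\<one>\<^sub>A} a 0 (Sec (D a)) (res U (D a)) g"
proof (rule rat_completionI)
 show "adic A I r f" by (rule A.adic_axioms)
 show "genideal A {\<one>\<^sub>A} = ideal_power A I 0"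
  using A.genideal_self[of "{\<one>\<^sub>A}"] ideal.one_imp_carrier[OF A.genideal_ideal[of "{\<one>\<^sub>A}"]] by simp
 show "completed_rat_loc A {\<one>\<^sub>A} a (Sec (D a)) (res U (D a))"
  using chart assms unfolding Spf_chart_def by blast
qed (use assms in auto)

lemma D_zero:
 assumes "a \<in> carrier A" "b \<in> carrier A" "res U (D a) b = \<zero>\<^bsub>Sec (D a)\<^esub>"
 shows "\<exists>K::nat. a [^]\<^sub>A K \<otimes>\<^sub>A b \<in> A.Ip n"
proof -
 obtain g where "rat_completion A I r f {\<one>\<^sub>A} a 0 (Sec (D a)) (res U (D a)) g"
  using D_completion[OF assms(1)] by blast
 then interpret C: rat_completion A I r f "{\<one>\<^sub>A}" a 0 "Sec (D a)" "res U (D a)" g .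
 have "res U (D a) b \<in> C.F n"
  unfolding assms(3) using C.F_minus_closed unfolding C.S.minus_closed_def by blast
 from C.phi_F[OF assms(2) this] show ?thesis by simp
qed

text \<open>A section that dies in a completed localization is only known to lie in every
  \<open>I^n\<close> after multiplication by powers of \<open>a\<close>, with exponents depending on
  \<open>n\<close>. Krull's intersection theorem turns this into vanishing in the local ring at
  \<open>h x\<close>. Conversely \<open>a\<close> is invertible on \<open>D a\<close>.\<close>

lemma germ_zero_iff:
 assumes x: "x \<in> U" and b: "b \<in> carrier A"
 shows "germ X x U b = \<zero>\<^bsub>stalk X x\<^esub> \<longleftrightarrow> A.loc_zero (h x) b"
proof
 note p = h_prime[OF x]
 assume "germ X x U b = \<zero>\<^bsub>stalk X x\<^esub>"
 then have "germ X x U b = germ X x U \<zero>\<^sub>A" using stalk_zero[OF opU x] by simp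
 from germ_eqD[OF opU x b this] obtain W where W: "op W" "x \<in> W" "W \<subseteq> U" "res U W b = res U W \<zero>\<^sub>A"
  by blast
 obtain a where a: "a \<in> carrier A" "x \<in> D a" "D a \<subseteq> W" using D_basis[OF W(1,2) x] by blast
 have "res U (D a) b = res U (D a) \<zero>\<^sub>A"
  by (rule res_eq_smaller[OF opU opU W(1) op_D[OF a(1)]]) (use a W b in auto)
 then have z: "res U (D a) b = \<zero>\<^bsub>Sec (D a)\<^esub>"
  using ring_hom_cring.hom_zero[OF res_ring_hom_cring[OF opU op_D[OF a(1)]]] by auto
 have "\<exists>s\<in>carrier A - h x. s \<otimes>\<^sub>A b \<in> {\<zero>\<^sub>A}"
 proof (rule A.krull_intersection[OF p h_I[OF x] A.zeroideal b])
  fix n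
  obtain K :: nat where K: "a [^]\<^sub>A K \<otimes>\<^sub>A b \<in> A.Ip n" using D_zero[OF a(1) b z] by blast
  have "a [^]\<^sub>A K \<in> carrier A - h x" using A.prime_compl_pow[OF p, of a K] a by auto
  moreover have "a [^]\<^sub>A K \<otimes>\<^sub>A b \<ominus>\<^sub>A \<zero>\<^sub>A \<in> A.Ip n"
   using K a b by (simp add: a_minus_def)
  ultimately show "\<exists>s\<in>carrier A - h x. \<exists>j\<in>{\<zero>\<^sub>A}. s \<otimes>\<^sub>A b \<ominus>\<^sub>A j \<in> A.Ip n" by blast
 qed
 then show "A.loc_zero (h x) b" unfolding A.loc_zero_def by blast
next
 assume "A.loc_zero (h x) b"
 then obtain a where a: "a \<in> carrier A" "a \<notin> h x" "a \<otimes>\<^sub>A b = \<zero>\<^sub>A" unfolding A.loc_zero_def by blast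
 obtain g where "rat_completion A I r f {\<one>\<^sub>A} a 0 (Sec (D a)) (res U (D a)) g"
  using D_completion[OF a(1)] by blast
 then interpret C: rat_completion A I r f "{\<one>\<^sub>A}" a 0 "Sec (D a)" "res U (D a)" g .
 have oD: "op (D a)" by (rule op_D[OF a(1)])
 have xD: "x \<in> D a" using x a by blast
 interpret \<rho>: ring_hom_cring A "Sec (D a)" "res U (D a)" by (rule res_ring_hom_cring[OF opU oD]) blast
 have rc: "res U (D a) b \<in> carrier (Sec (D a))" using b by simp
 have "res U (D a) a \<otimes>\<^bsub>Sec (D a)\<^esub> res U (D a) b = \<zero>\<^bsub>Sec (D a)\<^esub>"
  using a b by (simp flip: \<rho>.hom_mult)
 then have "res U (D a) b \<otimes>\<^bsub>Sec (D a)\<^esub> res U (D a) a [^]\<^bsub>Sec (D a)\<^esub> (1::nat)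
   = \<zero>\<^bsub>Sec (D a)\<^esub> \<otimes>\<^bsub>Sec (D a)\<^esub> res U (D a) a [^]\<^bsub>Sec (D a)\<^esub> (1::nat)"
  using rc a(1) by (simp add: C.S.m_comm)
 then have "res U (D a) b = \<zero>\<^bsub>Sec (D a)\<^esub>" using C.cancel_s rc C.S.zero_closed by blast
 then have "germ X x U b = germ X x (D a) \<zero>\<^bsub>Sec (D a)\<^esub>"
  using germ_res[OF opU xD b oD] by auto
 then show "germ X x U b = \<zero>\<^bsub>stalk X x\<^esub>" using stalk_zero[OF oD xD] by simp
qed

lemma locally_dom:
 assumes x: "x \<in> U" and dom: "domain (stalk X x)" and ab: "a \<in> carrier A" "b \<in> carrier A"
  and z: "A.loc_zero (h x) (a \<otimes>\<^sub>A b)"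
 shows "A.loc_zero (h x) a \<or> A.loc_zero (h x) b"
proof -
 have "germ X x U a \<otimes>\<^bsub>stalk X x\<^esub> germ X x U b = \<zero>\<^bsub>stalk X x\<^esub>"
  using z stalk_mult[OF opU x ab] germ_zero_iff[OF x A.m_closed[OF ab]] by simp
 then have "germ X x U a = \<zero>\<^bsub>stalk X x\<^esub> \<or> germ X x U b = \<zero>\<^bsub>stalk X x\<^esub>"
  using domain.integral[OF dom] stalk_carr[OF opU x] ab by blast
 then show ?thesis using germ_zero_iff[OF x] ab by blast
qed

text \<open>A quotient in the stalk is approximated, up to each step of the filtration, by a
  fraction \<open>w / q^k\<close>. Clearing denominators puts \<open>a\<close> locally into
  \<open>(b) + I^n\<close> for every \<open>n\<close>, hence into \<open>(b)\<close> by Krull's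
  theorem.\<close>

lemma stalk_divides:
 assumes x: "x \<in> U" and ab: "a \<in> carrier A" "b \<in> carrier A"
  and \<tau>: "\<tau> \<in> carrier (stalk X x)" and eq: "germ X x U a = germ X x U b \<otimes>\<^bsub>stalk X x\<^esub> \<tau>"
 shows "\<exists>s\<in>carrier A - h x. \<exists>c\<in>carrier A. s \<otimes>\<^sub>A a = b \<otimes>\<^sub>A c"
proof -
 note p = h_prime[OF x]
 obtain V \<sigma> where V: "op V" "x \<in> V" "\<sigma> \<in> carrier (Sec V)" "\<tau> = germ X x V \<sigma>" using stalk_ex[OF \<tau>] by blast
 define W where "W = U \<inter> V"
 have W: "op W" "x \<in> W" "W \<subseteq> U" "W \<subseteq> V" unfolding W_def using V opU x by auto
 define a' where "a' = res U W a"
 define c where "c = res U W b \<otimes>\<^bsub>Sec W\<^esub> res V W \<sigma>"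
 interpret SW: cring "Sec W" by (rule sec_cring[OF W(1)])
 have rc: "res U W b \<in> carrier (Sec W)" "res V W \<sigma> \<in> carrier (Sec W)" "a' \<in> carrier (Sec W)"
  unfolding a'_def using W V ab opU by auto
 have cc: "c \<in> carrier (Sec W)" unfolding c_def using rc by simp
 have "germ X x W c = germ X x W (res U W b) \<otimes>\<^bsub>stalk X x\<^esub> germ X x W (res V W \<sigma>)"
  unfolding c_def by (rule stalk_mult[OF W(1,2) rc(1,2), symmetric])
 also have "\<dots> = germ X x W a'"
  unfolding a'_def using germ_res[OF opU W(2) _ W(1,3)] germ_res[OF V(1) W(2) V(3) W(1,4)] ab V(4) eq by simp
 finally have "germ X x W a' = germ X x W c" by simp
 from germ_eqD[OF W(1,2) rc(3) this] obtain Z where Z: "op Z" "x \<in> Z" "Z \<subseteq> W" "res W Z a' = res W Z c" by blast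
 obtain q where q: "q \<in> carrier A" "x \<in> D q" "D q \<subseteq> Z" using D_basis[OF Z(1,2) x] by blast
 have oD: "op (D q)" by (rule op_D[OF q(1)])
 have DW: "D q \<subseteq> W" using q Z by blast
 define \<sigma>' where "\<sigma>' = res V (D q) \<sigma>"
 have DV: "D q \<subseteq> V" using DW W(4) by blast
 have \<sigma>': "\<sigma>' \<in> carrier (Sec (D q))" unfolding \<sigma>'_def using V DV oD by simp
 have "res W (D q) a' = res W (D q) c"
  by (rule res_eq_smaller[OF W(1,1) Z(1) oD]) (use q Z rc cc in auto)
 moreover have "res W (D q) a' = res U (D q) a"
  unfolding a'_def by (rule res_res[OF opU W(1) oD DW W(3) ab(1)])
 moreover have "res W (D q) c = res U (D q) b \<otimes>\<^bsub>Sec (D q)\<^esub> \<sigma>'"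
  unfolding c_def \<sigma>'_def using ring_hom_mult[OF res_hom[OF W(1) oD DW] rc(1,2)]
   res_res[OF opU W(1) oD DW W(3) ab(2)] res_res[OF V(1) W(1) oD DW W(4) V(3)] by simp
 ultimately have key: "res U (D q) a = res U (D q) b \<otimes>\<^bsub>Sec (D q)\<^esub> \<sigma>'" by simp
 obtain g where "rat_completion A I r f {\<one>\<^sub>A} q 0 (Sec (D q)) (res U (D q)) g"
  using D_completion[OF q(1)] by blast
 then interpret C: rat_completion A I r f "{\<one>\<^sub>A}" q 0 "Sec (D q)" "res U (D q)" g .
 interpret \<rho>: ring_hom_cring A "Sec (D q)" "res U (D q)" by (rule res_ring_hom_cring[OF opU oD]) blast
 have hpow: "res U (D q) (z [^]\<^sub>A n) = res U (D q) z [^]\<^bsub>Sec (D q)\<^esub> n" if "z \<in> carrier A" for z and n :: nat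
  by (induction n) (use that in auto)
 have J: "ideal (PIdl\<^bsub>A\<^esub> b) A" by (rule A.cgenideal_ideal[OF ab(2)])
 have "\<exists>s\<in>carrier A - h x. s \<otimes>\<^sub>A a \<in> PIdl\<^bsub>A\<^esub> b"
 proof (rule A.krull_intersection[OF p h_I[OF x] J ab(1)])
  fix n
  obtain e k w where e: "e \<in> carrier (Sec (D q))" "w \<in> carrier A"
   "e \<otimes>\<^bsub>Sec (D q)\<^esub> res U (D q) q [^]\<^bsub>Sec (D q)\<^esub> (k::nat) = res U (D q) w" "\<sigma>' \<ominus>\<^bsub>Sec (D q)\<^esub> e \<in> C.F n"
   using C.approx[OF \<sigma>', of n] by blast
  let ?d = "res U (D q) b \<otimes>\<^bsub>Sec (D q)\<^esub> (\<sigma>' \<ominus>\<^bsub>Sec (D q)\<^esub> e)"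
  have dF: "?d \<in> C.F n" by (rule C.phi_mult_F[OF ab(2) e(4)])
  have wc: "q [^]\<^sub>A k \<otimes>\<^sub>A a \<ominus>\<^sub>A b \<otimes>\<^sub>A w \<in> carrier A" using q(1) ab e(2) by simp
  have rb: "res U (D q) b \<in> carrier (Sec (D q))" and rq: "res U (D q) q [^]\<^bsub>Sec (D q)\<^esub> k \<in> carrier (Sec (D q))"
   using ab q(1) by auto
  have "?d \<otimes>\<^bsub>Sec (D q)\<^esub> res U (D q) q [^]\<^bsub>Sec (D q)\<^esub> k
   = res U (D q) q [^]\<^bsub>Sec (D q)\<^esub> k \<otimes>\<^bsub>Sec (D q)\<^esub> (res U (D q) b \<otimes>\<^bsub>Sec (D q)\<^esub> \<sigma>')
    \<ominus>\<^bsub>Sec (D q)\<^esub> res U (D q) b \<otimes>\<^bsub>Sec (D q)\<^esub> (e \<otimes>\<^bsub>Sec (D q)\<^esub> res U (D q) q [^]\<^bsub>Sec (D q)\<^esub> k)"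
   by (rule C.S.frac_diff_identity[OF rb \<sigma>' e(1) rq])
  also have "\<dots> = res U (D q) (q [^]\<^sub>A k \<otimes>\<^sub>A a \<ominus>\<^sub>A b \<otimes>\<^sub>A w)"
   unfolding key[symmetric] e(3) using q(1) ab e(2) hpow[OF q(1), of k] by (simp add: a_minus_def)
  finally obtain K where "q [^]\<^sub>A (K::nat) \<otimes>\<^sub>A (q [^]\<^sub>A k \<otimes>\<^sub>A a \<ominus>\<^sub>A b \<otimes>\<^sub>A w) \<in> A.Ip (n + 0 * (k + K))"
   using C.F_frac[OF dF wc] by blast
  moreover have "q [^]\<^sub>A K \<otimes>\<^sub>A (q [^]\<^sub>A k \<otimes>\<^sub>A a \<ominus>\<^sub>A b \<otimes>\<^sub>A w)
    = q [^]\<^sub>A (K + k) \<otimes>\<^sub>A a \<ominus>\<^sub>A (q [^]\<^sub>A K \<otimes>\<^sub>A w) \<otimes>\<^sub>A b"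
   by (rule A.pow_diff_identity[OF q(1) ab e(2)])
  ultimately have "q [^]\<^sub>A (K + k) \<otimes>\<^sub>A a \<ominus>\<^sub>A (q [^]\<^sub>A K \<otimes>\<^sub>A w) \<otimes>\<^sub>A b \<in> A.Ip n" by simp
  moreover have "q [^]\<^sub>A (K + k) \<in> carrier A - h x" using A.prime_compl_pow[OF p, of q] q by auto
  moreover have "(q [^]\<^sub>A K \<otimes>\<^sub>A w) \<otimes>\<^sub>A b \<in> PIdl\<^bsub>A\<^esub> b"
   unfolding cgenideal_def using q(1) e(2) by blast
  ultimately show "\<exists>s\<in>carrier A - h x. \<exists>j\<in>PIdl\<^bsub>A\<^esub> b. s \<otimes>\<^sub>A a \<ominus>\<^sub>A j \<in> A.Ip n" by blast
 qed
 then obtain s c where "s \<in> carrier A - h x" "c \<in> carrier A" "s \<otimes>\<^sub>A a = c \<otimes>\<^sub>A b"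
  unfolding cgenideal_def by blast
 then show ?thesis using A.m_comm[OF _ ab(2)] by metis
qed

text \<open>The germ of \<open>e 0\<close> is nonzero, so the relations can be divided by it in the
  fraction field of the stalk: there the germ of \<open>e i\<close> is the germ of
  \<open>e 0\<close> times \<open>\<xi> ^ i\<close>, and \<open>\<xi>\<close> becomes integral.
  Normality puts it into the stalk, and divisibility there descends to \<open>A\<close>.\<close>

lemma locally_integrally_closed:
 assumes x: "x \<in> U" and nd: "normal_domain (stalk X x)" and n: "0 < (n::nat)"
  and e: "\<And>i. i \<le> n ==> e i \<in> carrier A" and c: "\<And>i. i < n ==> c i \<in> carrier A"
  and rel: "\<And>i. i < n ==> e i \<otimes>\<^sub>A e 1 = e (Suc i) \<otimes>\<^sub>A e 0"
  and top: "e n = (\<Oplus>\<^bsub>A\<^esub>i\<in>{..<n}. c i \<otimes>\<^sub>A e i)" and e0: "\<not> A.loc_zero (h x) (e 0)"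
 shows "\<exists>s\<in>carrier A - h x. \<exists>a\<in>carrier A. s \<otimes>\<^sub>A e 1 = e 0 \<otimes>\<^sub>A a"
proof -
 define R where "R = stalk X x"
 interpret R: domain R using nd unfolding R_def normal_domain_def by blast
 interpret M: mult_subset R "carrier R - {\<zero>\<^bsub>R\<^esub>}" by (rule R.nonzero_mult_subset)
 define K where "K = fraction_field R"
 have K_L: "K = M.L" unfolding K_def fraction_field_def ..
 interpret K: domain K unfolding K_def by (rule R.fraction_field_domain)
 define \<theta> where "\<theta> = germ X x U"
 define \<Theta> where "\<Theta> = (\<lambda>a. M.fr (\<theta> a) \<one>\<^bsub>R\<^esub>)"
 have \<theta>: "\<theta> \<in> ring_hom A R" unfolding \<theta>_def R_def by (rule germ_hom[OF opU x])
 have \<Theta>: "\<Theta> \<in> ring_hom A K"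
  unfolding \<Theta>_def K_L using ring_hom_trans[OF \<theta> M.to_L_hom] by (simp add: o_def)
 interpret \<Theta>: ring_hom_cring A K \<Theta>
  by (intro ring_hom_cring.intro ring_hom_cring_axioms.intro A.is_cring K.is_cring \<Theta>)
 have e0c: "e 0 \<in> carrier A" and e1c: "e 1 \<in> carrier A" using e n by auto
 have \<theta>c: "\<theta> a \<in> carrier R" if "a \<in> carrier A" for a using ring_hom_closed[OF \<theta> that] .
 have \<theta>0: "\<theta> (e 0) \<in> carrier R - {\<zero>\<^bsub>R\<^esub>}"
  using e0 germ_zero_iff[OF x e0c] \<theta>c[OF e0c] unfolding \<theta>_def R_def by blast
 define \<xi> where "\<xi> = M.fr (\<theta> (e 1)) (\<theta> (e 0))"
 have \<xi>c: "\<xi> \<in> carrier K" unfolding \<xi>_def K_L using \<theta>c[OF e1c] \<theta>0 by simp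
 have \<xi>0: "\<Theta> (e 0) \<otimes>\<^bsub>K\<^esub> \<xi> = \<Theta> (e 1)"
 proof -
  have "\<xi> \<otimes>\<^bsub>K\<^esub> \<Theta> (e 0) = \<Theta> (e 1)"
   using M.fr_mult_denom[OF \<theta>c[OF e1c] \<theta>0] unfolding \<xi>_def \<Theta>_def K_L .
  then show ?thesis using K.m_comm[OF \<xi>c \<Theta>.hom_closed[OF e0c]] by simp
 qed
 have nz: "\<Theta> (e 0) \<noteq> \<zero>\<^bsub>K\<^esub>"
 proof
  assume "\<Theta> (e 0) = \<zero>\<^bsub>K\<^esub>"
  then obtain u where u: "u \<in> carrier R - {\<zero>\<^bsub>R\<^esub>}" "u \<otimes>\<^bsub>R\<^esub> \<theta> (e 0) = \<zero>\<^bsub>R\<^esub>"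
   using M.fr_eq_zero[OF \<theta>c[OF e0c] M.S_one] unfolding \<Theta>_def K_L by blast
  then show False using R.integral_iff \<theta>0 by auto
 qed
 have pow: "\<Theta> (e i) = \<Theta> (e 0) \<otimes>\<^bsub>K\<^esub> \<xi> [^]\<^bsub>K\<^esub> i" if "i \<le> n" for i
  using that
 proof (induction i)
  case 0
  then show ?case using e0c by simp
 next
  case (Suc i)
  have ci: "e i \<in> carrier A" "e (Suc i) \<in> carrier A" using e Suc.prems by auto
  have "\<Theta> (e 0) \<otimes>\<^bsub>K\<^esub> \<Theta> (e (Suc i)) = \<Theta> (e i \<otimes>\<^sub>A e 1)"
   using rel[of i] Suc.prems ci e0c by (simp add: K.m_comm)
  also have "\<dots> = \<Theta> (e 0) \<otimes>\<^bsub>K\<^esub> (\<Theta> (e 0) \<otimes>\<^bsub>K\<^esub> \<xi> [^]\<^bsub>K\<^esub> Suc i)"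
   using Suc.IH Suc.prems ci e0c e1c \<xi>c \<xi>0[symmetric] by (simp add: K.m_ac)
  finally show ?case
   using K.m_lcancel[OF nz, of "\<Theta> (e (Suc i))"] ci e0c \<xi>c by simp
 qed
 \<comment> \<open>The coefficients change sign because \<open>integral_over\<close> asks for a
   monic expression that equals zero.\<close>
 define c' where "c' = (\<lambda>i. \<Theta> (\<ominus>\<^bsub>A\<^esub> c i))"
 have cK: "c' i \<otimes>\<^bsub>K\<^esub> \<xi> [^]\<^bsub>K\<^esub> i \<in> carrier K" if "i < n" for i
  unfolding c'_def using c[OF that] \<xi>c by simp
 have "\<Theta> (e 0) \<otimes>\<^bsub>K\<^esub> (\<Oplus>\<^bsub>K\<^esub>i\<in>{..<n}. c' i \<otimes>\<^bsub>K\<^esub> \<xi> [^]\<^bsub>K\<^esub> i)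
   = (\<Oplus>\<^bsub>K\<^esub>i\<in>{..<n}. \<Theta> (e 0) \<otimes>\<^bsub>K\<^esub> (c' i \<otimes>\<^bsub>K\<^esub> \<xi> [^]\<^bsub>K\<^esub> i))"
  by (rule K.finsum_rdistr) (use cK e0c in auto)
 also have "\<dots> = (\<Oplus>\<^bsub>K\<^esub>i\<in>{..<n}. \<Theta> (\<ominus>\<^bsub>A\<^esub> \<one>\<^sub>A \<otimes>\<^sub>A (c i \<otimes>\<^sub>A e i)))"
 proof (rule K.finsum_cong')
  fix i assume "i \<in> {..<n}"
  then have i: "i < n" by simp
  have "\<ominus>\<^bsub>A\<^esub> \<one>\<^sub>A \<otimes>\<^sub>A (c i \<otimes>\<^sub>A e i) = \<ominus>\<^bsub>A\<^esub> c i \<otimes>\<^sub>A e i"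
   using c[OF i] e[of i] i by (simp add: A.l_minus)
  then show "\<Theta> (e 0) \<otimes>\<^bsub>K\<^esub> (c' i \<otimes>\<^bsub>K\<^esub> \<xi> [^]\<^bsub>K\<^esub> i) = \<Theta> (\<ominus>\<^bsub>A\<^esub> \<one>\<^sub>A \<otimes>\<^sub>A (c i \<otimes>\<^sub>A e i))"
   unfolding c'_def using pow[of i] c[OF i] e[of i] i e0c \<xi>c
   by (simp add: K.m_lcomm del: \<Theta>.hom_a_inv)
 qed (use c e in auto)
 also have "\<dots> = \<Theta> (\<Oplus>\<^bsub>A\<^esub>i\<in>{..<n}. \<ominus>\<^bsub>A\<^esub> \<one>\<^sub>A \<otimes>\<^sub>A (c i \<otimes>\<^sub>A e i))"
  by (subst \<Theta>.hom_finsum) (use c e in \<open>auto simp: o_def\<close>)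
 also have "(\<Oplus>\<^bsub>A\<^esub>i\<in>{..<n}. \<ominus>\<^bsub>A\<^esub> \<one>\<^sub>A \<otimes>\<^sub>A (c i \<otimes>\<^sub>A e i)) = \<ominus>\<^bsub>A\<^esub> \<one>\<^sub>A \<otimes>\<^sub>A e n"
  unfolding top by (rule A.finsum_rdistr[symmetric]) (use c e in auto)
 also have "\<Theta> (\<ominus>\<^bsub>A\<^esub> \<one>\<^sub>A \<otimes>\<^sub>A e n) = \<ominus>\<^bsub>K\<^esub> \<Theta> (e n)" using e[of n] by (simp add: A.l_minus)
 finally have sum: "\<Theta> (e 0) \<otimes>\<^bsub>K\<^esub> (\<Oplus>\<^bsub>K\<^esub>i\<in>{..<n}. c' i \<otimes>\<^bsub>K\<^esub> \<xi> [^]\<^bsub>K\<^esub> i) = \<ominus>\<^bsub>K\<^esub> \<Theta> (e n)" .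
 have sc: "(\<Oplus>\<^bsub>K\<^esub>i\<in>{..<n}. c' i \<otimes>\<^bsub>K\<^esub> \<xi> [^]\<^bsub>K\<^esub> i) \<in> carrier K"
  by (rule K.finsum_closed) (use cK in auto)
 have "\<Theta> (e 0) \<otimes>\<^bsub>K\<^esub> (\<xi> [^]\<^bsub>K\<^esub> n \<oplus>\<^bsub>K\<^esub> (\<Oplus>\<^bsub>K\<^esub>i\<in>{..<n}. c' i \<otimes>\<^bsub>K\<^esub> \<xi> [^]\<^bsub>K\<^esub> i)) = \<zero>\<^bsub>K\<^esub>"
  using sum pow[of n] sc \<xi>c e0c e[of n] by (simp add: K.r_distr K.r_neg)
 then have "\<xi> [^]\<^bsub>K\<^esub> n \<oplus>\<^bsub>K\<^esub> (\<Oplus>\<^bsub>K\<^esub>i\<in>{..<n}. c' i \<otimes>\<^bsub>K\<^esub> \<xi> [^]\<^bsub>K\<^esub> i) = \<zero>\<^bsub>K\<^esub>"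
  using K.integral[of "\<Theta> (e 0)"] nz sc \<xi>c e0c by blast
 moreover have "c' i \<in> (\<lambda>a. M.fr a \<one>\<^bsub>R\<^esub>) ` carrier R" if "i < n" for i
  unfolding c'_def \<Theta>_def using \<theta>c[of "\<ominus>\<^bsub>A\<^esub> c i"] c[OF that] by auto
 ultimately have "integral_over K ((\<lambda>a. M.fr a \<one>\<^bsub>R\<^esub>) ` carrier R) \<xi>"
  unfolding integral_over_def by blast
 then have "\<xi> \<in> (\<lambda>a. M.fr a \<one>\<^bsub>R\<^esub>) ` carrier R"
  using nd \<xi>c unfolding normal_domain_def Let_def K_def R_def by blast
 then obtain \<tau> where \<tau>: "\<tau> \<in> carrier R" "\<xi> = M.fr \<tau> \<one>\<^bsub>R\<^esub>" by blast
 obtain u where u: "u \<in> carrier R - {\<zero>\<^bsub>R\<^esub>}" "u \<otimes>\<^bsub>R\<^esub> (\<one>\<^bsub>R\<^esub> \<otimes>\<^bsub>R\<^esub> \<theta> (e 1)) = u \<otimes>\<^bsub>R\<^esub> (\<theta> (e 0) \<otimes>\<^bsub>R\<^esub> \<tau>)"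
  using \<tau>(2) M.mk_frac_eq[OF \<theta>c[OF e1c] \<theta>0 \<tau>(1) M.S_one] unfolding \<xi>_def by blast
 have "\<theta> (e 1) = \<theta> (e 0) \<otimes>\<^bsub>R\<^esub> \<tau>"
  using u \<theta>c[OF e1c] \<theta>0 \<tau>(1) R.m_lcancel[of u "\<theta> (e 1)" "\<theta> (e 0) \<otimes>\<^bsub>R\<^esub> \<tau>"] by auto
 then show ?thesis
  using stalk_divides[OF x e1c e0c] \<tau>(1) unfolding \<theta>_def R_def by blast
qed

end

subsection \<open>Localizations with discrete topology\<close>

lemma discrete_if_zero_open:
 assumes "topring R" "openin (topo R) {\<zero>\<^bsub>R\<^esub>}"
 shows "topo R = discrete_topology (carrier R)"
proof -
 interpret topring R by fact
 have "openin T {x}" if x: "x \<in> carrier R" for x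
 proof -
  have "openin T {y \<in> carrier R. y \<ominus>\<^bsub>R\<^esub> x \<in> {\<zero>\<^bsub>R\<^esub>}}" by (rule open_translate(1)[OF assms(2) x])
  moreover have "{y \<in> carrier R. y \<ominus>\<^bsub>R\<^esub> x \<in> {\<zero>\<^bsub>R\<^esub>}} = {x}" using x r_right_minus_eq by auto
  ultimately show ?thesis by simp
 qed
 then show ?thesis using discrete_topology_unique[of "carrier R" T] by (metis topspace_T)
qed

lemma (in cring) unit_cancel:
 assumes "u \<in> carrier R" "v \<in> carrier R" "u \<otimes> v = \<one>" "x \<in> carrier R" "y \<in> carrier R" "x \<otimes> u = y \<otimes> u"
 shows "x = y"
proof -
 have "x \<otimes> u \<otimes> v = y \<otimes> u \<otimes> v" using assms(6) by simp
 then show ?thesis using assms(1-5) by (simp add: m_assoc)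
qed

lemma (in cring) pow_inverse:
 assumes "u \<in> carrier R" "v \<in> carrier R" "u \<otimes> v = \<one>"
 shows "u [^] (k::nat) \<otimes> v [^] k = \<one>"
 using nat_pow_distrib[OF assms(1,2), of k] assms(3) by simp

text \<open>A converse of \<open>rat_completion\<close>: for discrete rings, completed localizations are just
 localizations, recognized by their elements and by the kernel.\<close>

lemma completed_rat_loc_discrete:
 fixes B :: "('b, 'm) top_ring_scheme" (structure) and S :: "('c, 'n) top_ring_scheme"
 assumes B: "topring B" "openin (topo B) {\<zero>}" and S: "complete_topological_ring S" "openin (topo S) {\<zero>\<^bsub>S\<^esub>}"
  and \<rho>: "\<rho> \<in> ring_hom B S" and b: "b \<in> carrier B"
  and v: "v \<in> carrier S" "\<rho> b \<otimes>\<^bsub>S\<^esub> v = \<one>\<^bsub>S\<^esub>"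
  and frac: "\<And>x. x \<in> carrier S ==> \<exists>(k::nat). \<exists>w\<in>carrier B. x \<otimes>\<^bsub>S\<^esub> \<rho> b [^]\<^bsub>S\<^esub> k = \<rho> w"
  and ker: "\<And>w. w \<in> carrier B ==> \<rho> w = \<zero>\<^bsub>S\<^esub> ==> \<exists>K::nat. b [^] K \<otimes> w = \<zero>"
 shows "completed_rat_loc B {\<one>} b S \<rho>"
proof -
 interpret B: topring B by fact
 have S': "topring S" using S(1) unfolding complete_topological_ring_def
  by (intro topring.intro topring_axioms.intro) (auto simp: topological_ring_def)
 interpret S: topring S by fact
 interpret \<rho>: ring_hom_cring B S \<rho>
  by (intro ring_hom_cring.intro ring_hom_cring_axioms.intro B.is_cring S.is_cring \<rho>)
 interpret M: mult_subset B "powers B b" by (rule B.powers_mult_subset[OF b])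
 interpret L: cring M.L by (rule M.L_cring)
 have pw: "b [^] (k::nat) \<in> powers B b" for k unfolding powers_def by blast
 have bp: "b [^] (k::nat) \<in> carrier B" for k using b by simp
 have rb: "\<rho> b \<in> carrier S" using b by simp
 have rbk: "\<rho> b [^]\<^bsub>S\<^esub> (k::nat) \<in> carrier S" for k using rb by simp
 have hpow: "\<rho> (b [^] k) = \<rho> b [^]\<^bsub>S\<^esub> k" for k :: nat
  by (induction k) (use b in auto)
 have cancel: "x = y" if "x \<in> carrier S" "y \<in> carrier S" "x \<otimes>\<^bsub>S\<^esub> \<rho> b [^]\<^bsub>S\<^esub> (k::nat) = y \<otimes>\<^bsub>S\<^esub> \<rho> b [^]\<^bsub>S\<^esub> k" for x y k
  by (rule S.unit_cancel[OF rbk[of k] _ S.pow_inverse[OF rb v] that]) (use v in simp)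
 \<comment> \<open>\<open>val w k\<close> is the element \<open>w / b^k\<close> of \<open>S\<close>.
   By \<open>val_eq\<close> it depends only on the fraction and determines it, so it defines an
   injective map \<open>g\<close>.\<close>
 define val where "val = (\<lambda>w (k::nat). \<rho> w \<otimes>\<^bsub>S\<^esub> v [^]\<^bsub>S\<^esub> k)"
 have valc: "val w k \<in> carrier S" if "w \<in> carrier B" for w k unfolding val_def using that v by simp
 have val: "val w k \<otimes>\<^bsub>S\<^esub> \<rho> b [^]\<^bsub>S\<^esub> k = \<rho> w" if "w \<in> carrier B" for w k
  unfolding val_def using S.pow_inverse[OF rb v, of k] that v rbk[of k]
  by (simp add: S.m_assoc S.m_comm[of "v [^]\<^bsub>S\<^esub> k"])
 have val_eq: "M.fr w (b [^] k) = M.fr w' (b [^] k') \<longleftrightarrow> val w k = val w' k'"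
  if w: "w \<in> carrier B" "w' \<in> carrier B" for w w' and k k' :: nat
 proof -
  have "M.fr w (b [^] k) = M.fr w' (b [^] k')
    \<longleftrightarrow> (\<exists>m::nat. b [^] m \<otimes> (b [^] k' \<otimes> w) = b [^] m \<otimes> (b [^] k \<otimes> w'))"
   using M.mk_frac_eq[OF w(1) pw[of k] w(2) pw[of k']] by (simp add: powers_def)
  also have "\<dots> \<longleftrightarrow> val w k = val w' k'"
  proof
   let ?e = "b [^] k' \<otimes> w \<ominus> b [^] k \<otimes> w'"
   have ec: "?e \<in> carrier B" using w bp by simp
   have prod: "val w k \<otimes>\<^bsub>S\<^esub> \<rho> b [^]\<^bsub>S\<^esub> (k + k') = \<rho> (b [^] k' \<otimes> w)"
    if "w \<in> carrier B" for w and k k' :: nat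
   proof -
    have "val w k \<otimes>\<^bsub>S\<^esub> \<rho> b [^]\<^bsub>S\<^esub> (k + k') = (val w k \<otimes>\<^bsub>S\<^esub> \<rho> b [^]\<^bsub>S\<^esub> k) \<otimes>\<^bsub>S\<^esub> \<rho> b [^]\<^bsub>S\<^esub> k'"
     using valc[OF that] rbk rb by (simp add: S.m_assoc S.nat_pow_mult)
    then show ?thesis using val[OF that] that bp rbk[of k'] by (simp add: hpow S.m_comm)
   qed
   show "val w k = val w' k'" if ex: "\<exists>m::nat. b [^] m \<otimes> (b [^] k' \<otimes> w) = b [^] m \<otimes> (b [^] k \<otimes> w')"
   proof -
    obtain m :: nat where "b [^] m \<otimes> (b [^] k' \<otimes> w) = b [^] m \<otimes> (b [^] k \<otimes> w')"
     using ex by blast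
    then have "\<rho> (b [^] k' \<otimes> w) \<otimes>\<^bsub>S\<^esub> \<rho> b [^]\<^bsub>S\<^esub> m = \<rho> (b [^] k \<otimes> w') \<otimes>\<^bsub>S\<^esub> \<rho> b [^]\<^bsub>S\<^esub> m"
     using w bp by (metis \<rho>.hom_mult B.m_closed B.m_comm hpow)
    then have "\<rho> (b [^] k' \<otimes> w) = \<rho> (b [^] k \<otimes> w')"
     by (rule cancel[rotated 2]) (use w bp in auto)
    then have "val w k \<otimes>\<^bsub>S\<^esub> \<rho> b [^]\<^bsub>S\<^esub> (k + k') = val w' k' \<otimes>\<^bsub>S\<^esub> \<rho> b [^]\<^bsub>S\<^esub> (k + k')"
     using prod[OF w(1), of k k'] prod[OF w(2), of k' k] by (simp add: add.commute)
    then show ?thesis by (rule cancel[OF valc[OF w(1)] valc[OF w(2)]])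
   qed
   assume "val w k = val w' k'"
   then have "\<rho> (b [^] k' \<otimes> w) = \<rho> (b [^] k \<otimes> w')"
    using prod[OF w(1), of k k'] prod[OF w(2), of k' k] by (simp add: add.commute)
   then have "\<rho> ?e = \<zero>\<^bsub>S\<^esub>" using w bp rbk by (simp add: a_minus_def S.r_neg)
   then obtain m :: nat where m: "b [^] m \<otimes> ?e = \<zero>" using ker[OF ec] by blast
   have "b [^] m \<otimes> (b [^] k' \<otimes> w) \<ominus> b [^] m \<otimes> (b [^] k \<otimes> w') = \<zero>"
    using m w bp by (simp add: a_minus_def B.r_distr B.r_minus)
   then have "b [^] m \<otimes> (b [^] k' \<otimes> w) = b [^] m \<otimes> (b [^] k \<otimes> w')"
    using w bp B.r_right_minus_eq[of "b [^] m \<otimes> (b [^] k' \<otimes> w)" "b [^] m \<otimes> (b [^] k \<otimes> w')"]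
    by simp
   then show "\<exists>m::nat. b [^] m \<otimes> (b [^] k' \<otimes> w) = b [^] m \<otimes> (b [^] k \<otimes> w')" by blast
  qed
  finally show ?thesis .
 qed
 define g where "g = (\<lambda>X. THE y. \<exists>w (k::nat). w \<in> carrier B \<and> X = M.fr w (b [^] k) \<and> y = val w k)"
 have g: "g (M.fr w (b [^] k)) = val w k" if "w \<in> carrier B" for w and k :: nat
  unfolding g_def by (rule the_equality) (use that val_eq in blast)+
 have g1: "g (M.fr w \<one>) = \<rho> w" if "w \<in> carrier B" for w
  using g[OF that, of 0] that by (simp add: val_def)
 have Lex: "\<exists>w (k::nat). w \<in> carrier B \<and> X = M.fr w (b [^] k)" if "X \<in> carrier M.L" for X
  using M.L_ex[OF that] unfolding powers_def by blast
 have ghom: "g \<in> ring_hom M.L S"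
 proof (rule ring_hom_memI)
  fix X Y assume X: "X \<in> carrier M.L" and Y: "Y \<in> carrier M.L"
  obtain w k where w: "w \<in> carrier B" "X = M.fr w (b [^] (k::nat))" using Lex[OF X] by blast
  show "g X \<in> carrier S" unfolding w(2) g[OF w(1)] by (rule valc[OF w(1)])
  obtain z l where z: "z \<in> carrier B" "Y = M.fr z (b [^] (l::nat))" using Lex[OF Y] by blast
  have "X \<otimes>\<^bsub>M.L\<^esub> Y = M.fr (w \<otimes> z) (b [^] (k + l))"
   unfolding w z using M.L_mult[OF w(1) pw z(1) pw] b by (simp add: B.nat_pow_mult)
  then have gXY: "g (X \<otimes>\<^bsub>M.L\<^esub> Y) = val (w \<otimes> z) (k + l)" using g[OF B.m_closed[OF w(1) z(1)], of "k + l"] by simp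
  show "g (X \<otimes>\<^bsub>M.L\<^esub> Y) = g X \<otimes>\<^bsub>S\<^esub> g Y"
   unfolding gXY unfolding w(2) z(2) g[OF w(1)] g[OF z(1)] val_def
   using w z v by (simp add: S.nat_pow_mult[symmetric] S.m_ac)
  have "X \<oplus>\<^bsub>M.L\<^esub> Y = M.fr (b [^] l \<otimes> w \<oplus> b [^] k \<otimes> z) (b [^] (k + l))"
   unfolding w z using M.L_add[OF w(1) pw z(1) pw] b by (simp add: B.nat_pow_mult)
  moreover have cc: "b [^] l \<otimes> w \<oplus> b [^] k \<otimes> z \<in> carrier B" using w z bp by simp
  ultimately have gXY': "g (X \<oplus>\<^bsub>M.L\<^esub> Y) = val (b [^] l \<otimes> w \<oplus> b [^] k \<otimes> z) (k + l)"
   using g[OF cc, of "k + l"] by simp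
  show "g (X \<oplus>\<^bsub>M.L\<^esub> Y) = g X \<oplus>\<^bsub>S\<^esub> g Y"
  proof (rule cancel[of _ _ "k + l"])
   show "g (X \<oplus>\<^bsub>M.L\<^esub> Y) \<in> carrier S" "g X \<oplus>\<^bsub>S\<^esub> g Y \<in> carrier S"
    unfolding gXY' unfolding w(2) z(2) g[OF w(1)] g[OF z(1)] using valc cc w z by auto
   have 1: "val w k \<otimes>\<^bsub>S\<^esub> \<rho> b [^]\<^bsub>S\<^esub> (k + l) = \<rho> w \<otimes>\<^bsub>S\<^esub> \<rho> b [^]\<^bsub>S\<^esub> l"
    using val[OF w(1), of k] valc[OF w(1)] rbk rb by (simp add: S.m_assoc[symmetric] S.nat_pow_mult[symmetric])
   have 2: "val z l \<otimes>\<^bsub>S\<^esub> \<rho> b [^]\<^bsub>S\<^esub> (k + l) = \<rho> z \<otimes>\<^bsub>S\<^esub> \<rho> b [^]\<^bsub>S\<^esub> k"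
    using val[OF z(1), of l] valc[OF z(1)] rbk rb
    by (simp add: S.m_assoc[symmetric] S.nat_pow_mult[symmetric] add.commute[of k])
   show "g (X \<oplus>\<^bsub>M.L\<^esub> Y) \<otimes>\<^bsub>S\<^esub> \<rho> b [^]\<^bsub>S\<^esub> (k + l) = (g X \<oplus>\<^bsub>S\<^esub> g Y) \<otimes>\<^bsub>S\<^esub> \<rho> b [^]\<^bsub>S\<^esub> (k + l)"
    unfolding gXY' val[OF cc] unfolding w(2) z(2) g[OF w(1)] g[OF z(1)]
     S.l_distr[OF valc[OF w(1)] valc[OF z(1)] rbk] 1 2
    using w z bp rbk by (simp add: hpow S.m_comm)
  qed
 next
  show "g \<one>\<^bsub>M.L\<^esub> = \<one>\<^bsub>S\<^esub>" using g1[of "\<one>"] M.L_one by simp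
 qed
 have ginj: "inj_on g (carrier M.L)"
 proof (rule inj_onI)
  fix X Y assume X: "X \<in> carrier M.L" and Y: "Y \<in> carrier M.L" and eq: "g X = g Y"
  obtain w k where w: "w \<in> carrier B" "X = M.fr w (b [^] (k::nat))" using Lex[OF X] by blast
  obtain z l where z: "z \<in> carrier B" "Y = M.fr z (b [^] (l::nat))" using Lex[OF Y] by blast
  show "X = Y" using eq val_eq[OF w(1) z(1), of k l] unfolding w(2) z(2) g[OF w(1)] g[OF z(1)] by blast
 qed
 have gsurj: "x \<in> g ` carrier M.L" if x: "x \<in> carrier S" for x
 proof -
  obtain k w where kw: "w \<in> carrier B" "x \<otimes>\<^bsub>S\<^esub> \<rho> b [^]\<^bsub>S\<^esub> (k::nat) = \<rho> w" using frac[OF x] by blast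
  have "x = val w k" by (rule cancel[OF x valc[OF kw(1)], of k]) (use kw val in simp)
  then show ?thesis using g[OF kw(1), of k] M.fr_carrier[OF kw(1) pw[of k]] by (metis imageI)
 qed
 let ?R = "rat_loc B {\<one>} b"
 let ?D = "generate_ring M.L ((\<lambda>a. M.fr a \<one>) ` carrier B \<union> (\<lambda>t. M.fr t b) ` {\<one>})"
 let ?LD = "M.L\<lparr>carrier := ?D\<rparr>"
 let ?G = "\<lambda>J. genideal ?LD ((\<lambda>a. M.fr a \<one>) ` J)"
 have simps: "carrier ?R = carrier M.L" "mult ?R = mult M.L" "add ?R = add M.L" "one ?R = one M.L" "zero ?R = zero M.L"
  "topo ?R = topology_generated_by {?G J +>\<^bsub>M.L\<^esub> x | J x. ideal J B \<and> openin (topo B) J \<and> x \<in> carrier M.L}"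
  by (simp_all add: rat_loc_def ring.extend_def top_ring.fields_def Let_def)
 have b_pow: "b \<in> powers B b" using pw[of 1] b by simp
 have gens: "(\<lambda>a. M.fr a \<one>) ` carrier B \<union> (\<lambda>t. M.fr t b) ` {\<one>} \<subseteq> carrier M.L"
  using M.S_one b_pow by auto
 interpret LD: ring ?LD by (rule L.generate_ring_is_ring[OF gens])
 have Dsub: "?D \<subseteq> carrier M.L" using L.generate_ring_incl[OF gens] .
 \<comment> \<open>The zero ideal of \<open>B\<close> is open, and the cosets of the ideal it
   generates are single points.\<close>
 have "topo ?R = discrete_topology (carrier M.L)"
 proof -
  have tops: "topspace (topo ?R) \<subseteq> carrier M.L"
  proof -
   have "?G J +>\<^bsub>M.L\<^esub> x \<subseteq> carrier M.L" if J: "ideal J B" and x: "x \<in> carrier M.L" for J x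
   proof -
    have "(\<lambda>a. M.fr a \<one>) ` J \<subseteq> ?D"
     using ideal.Icarr[OF J] by (auto intro!: generate_ring.incl)
    then have "ideal (?G J) ?LD" by (intro LD.genideal_ideal) simp
    then have "?G J \<subseteq> ?D" using ideal.Icarr by fastforce
    then show ?thesis using Dsub x by (auto simp: a_r_coset_def')
   qed
   then show ?thesis unfolding simps topology_generated_by_topspace by blast
  qed
  have "openin (topo ?R) {x}" if x: "x \<in> carrier M.L" for x
  proof -
   have "?G {\<zero>} = {\<zero>\<^bsub>M.L\<^esub>}" using LD.genideal_zero by (simp add: M.L_zero)
   then have "?G {\<zero>} +>\<^bsub>M.L\<^esub> x = {x}" using x by (simp add: a_r_coset_def')
   then have "{x} \<in> {?G J +>\<^bsub>M.L\<^esub> x | J x. ideal J B \<and> openin (topo B) J \<and> x \<in> carrier M.L}"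
    using B.zeroideal B(2) x by (intro CollectI exI[of _ "{\<zero>}"] exI[of _ x]) simp
   then show ?thesis unfolding simps by (rule topology_generated_by_Basis)
  qed
  then have "discrete_topology (carrier M.L) = topo ?R"
   unfolding discrete_topology_unique_alt using tops by blast
  then show ?thesis by (rule sym)
 qed
 moreover have "pullback_topology (carrier M.L) g (topo S) = discrete_topology (carrier M.L)"
  unfolding discrete_if_zero_open[OF S' S(2)]
 proof (subst topology_eq, intro allI iffI)
  fix W assume "openin (discrete_topology (carrier M.L)) W"
  then have W: "W \<subseteq> carrier M.L" by simp
  then have "W = g -` (g ` W) \<inter> carrier M.L" using inj_onD[OF ginj] by blast
  then show "openin (pullback_topology (carrier M.L) g (discrete_topology (carrier S))) W"
   unfolding openin_pullback_topology using W ring_hom_closed[OF ghom]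
   by (intro exI[of _ "g ` W"]) auto
 qed (auto simp: openin_pullback_topology)
 moreover have "g \<in> ring_hom ?R S"
  using ghom unfolding ring_hom_def simps by simp
 moreover have "topo S closure_of (g ` carrier M.L) = carrier S"
 proof -
  have "g ` carrier M.L = topspace (topo S)" using gsurj ring_hom_closed[OF ghom] by auto
  then show ?thesis using closure_of_topspace[of "topo S"] S.topspace_T by metis
 qed
 ultimately have "is_completion ?R S g" unfolding is_completion_def simps using S(1) by simp
 then show ?thesis unfolding completed_rat_loc_def using g1 by blast
qed

context rat_completion
begin

text \<open>If \<open>s\<close> annihilates \<open>I\<close>, then \<open>I\<close> becomes zero
  once \<open>s\<close> is inverted, so the first step of the filtration is zero: the completion is
  discrete and is the plain localization. The three claims are the data by which
  \<open>completed_rat_loc_discrete\<close> recognizes such a ring.\<close>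

lemma killed:
 assumes d: "d = 0" and kill: "\<And>c. c \<in> I ==> s \<otimes> c = \<zero>"
 shows "openin S.T {\<zero>\<^bsub>S\<^esub>}"
  and "b \<in> carrier S ==> \<exists>(k::nat) w. w \<in> carrier R \<and> b \<otimes>\<^bsub>S\<^esub> \<phi> s [^]\<^bsub>S\<^esub> k = \<phi> w"
  and "a \<in> carrier R ==> \<phi> a = \<zero>\<^bsub>S\<^esub> \<longleftrightarrow> (\<exists>K::nat. s [^] K \<otimes> a = \<zero>)"
proof -
 have I1: "Ip (Suc 0) = I" by (rule ideal_power_1[OF I_ideal])
 have z: "\<phi> \<zero> = \<zero>\<^bsub>S\<^esub>"
  by (rule ring_hom_cring.hom_zero) (intro ring_hom_cring.intro ring_hom_cring_axioms.intro is_cring S.is_cring phi_hom)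
 have ann: "a \<in> carrier R ==> s [^] (K::nat) \<otimes> a = \<zero> ==> \<phi> a = \<zero>\<^bsub>S\<^esub>" for a K
 proof -
  assume a: "a \<in> carrier R" "s [^] K \<otimes> a = \<zero>"
  have hpow: "\<phi> (s [^] K) = \<phi> s [^]\<^bsub>S\<^esub> K"
   by (induction K) (use ring_hom_one[OF phi_hom] ring_hom_mult[OF phi_hom _ sc] in auto)
  have "\<phi> s [^]\<^bsub>S\<^esub> K \<otimes>\<^bsub>S\<^esub> \<phi> a = \<zero>\<^bsub>S\<^esub>"
   using ring_hom_mult[OF phi_hom pow_carr[of K] a(1)] unfolding a(2) z hpow by (rule sym)
  then have "\<phi> a \<otimes>\<^bsub>S\<^esub> \<phi> s [^]\<^bsub>S\<^esub> K = \<zero>\<^bsub>S\<^esub> \<otimes>\<^bsub>S\<^esub> \<phi> s [^]\<^bsub>S\<^esub> K"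
   using phi_carr[OF a(1)] phi_carr[OF sc] S.m_comm[of "\<phi> a" "\<phi> s [^]\<^bsub>S\<^esub> K"] by simp
  then show "\<phi> a = \<zero>\<^bsub>S\<^esub>" using cancel_s[OF phi_carr[OF a(1)] S.zero_closed] by blast
 qed
 have Fe: "e = \<zero>\<^bsub>S\<^esub>" if e: "e \<in> carrier S" and w: "w \<in> Ip (Suc 0 + d * k)" and ew: "e \<otimes>\<^bsub>S\<^esub> \<phi> s [^]\<^bsub>S\<^esub> (k::nat) = \<phi> w" for e w k
 proof -
  have wI: "w \<in> I" using w I1 d by simp
  then have "\<phi> w = \<zero>\<^bsub>S\<^esub>" using ann[of w 1] kill[OF wI] sc ideal_carr[OF I_ideal] by simp
  then have "e \<otimes>\<^bsub>S\<^esub> \<phi> s [^]\<^bsub>S\<^esub> k = \<zero>\<^bsub>S\<^esub> \<otimes>\<^bsub>S\<^esub> \<phi> s [^]\<^bsub>S\<^esub> k" using ew phi_carr[OF sc] by simp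
  then show ?thesis using cancel_s[OF e S.zero_closed] by blast
 qed
 have F1: "F (Suc 0) = {\<zero>\<^bsub>S\<^esub>}"
 proof
  show "{\<zero>\<^bsub>S\<^esub>} \<subseteq> F (Suc 0)" using F_minus_closed unfolding S.minus_closed_def by blast
  show "F (Suc 0) \<subseteq> {\<zero>\<^bsub>S\<^esub>}"
  proof
   fix b assume b: "b \<in> F (Suc 0)"
   have bc: "b \<in> carrier S" using b F_carr by blast
   have "b \<in> F m" for m
   proof -
    obtain e k w where e: "e \<in> carrier S" "w \<in> Ip (Suc 0 + d * k)" "e \<otimes>\<^bsub>S\<^esub> \<phi> s [^]\<^bsub>S\<^esub> (k::nat) = \<phi> w"
     "b \<ominus>\<^bsub>S\<^esub> e \<in> F m" using approx_F[OF b, of m] by blast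
    then show ?thesis using Fe[OF e(1-3)] bc by (simp add: a_minus_def)
   qed
   then show "b \<in> {\<zero>\<^bsub>S\<^esub>}" using F_separated[OF bc, of 0] by simp
  qed
 qed
 show "openin S.T {\<zero>\<^bsub>S\<^esub>}" using F_open[of "Suc 0"] unfolding F1 .
 show "\<exists>(k::nat) w. w \<in> carrier R \<and> b \<otimes>\<^bsub>S\<^esub> \<phi> s [^]\<^bsub>S\<^esub> k = \<phi> w" if b: "b \<in> carrier S"
 proof -
  obtain e k w where e: "e \<in> carrier S" "w \<in> carrier R" "e \<otimes>\<^bsub>S\<^esub> \<phi> s [^]\<^bsub>S\<^esub> (k::nat) = \<phi> w" "b \<ominus>\<^bsub>S\<^esub> e \<in> F (Suc 0)"
   using approx[OF b, of "Suc 0"] by blast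
  then have "b = e" unfolding F1 using b S.r_right_minus_eq[OF b e(1)] by simp
  then show ?thesis using e by blast
 qed
 show "\<phi> a = \<zero>\<^bsub>S\<^esub> \<longleftrightarrow> (\<exists>K::nat. s [^] K \<otimes> a = \<zero>)" if a: "a \<in> carrier R"
 proof
  assume "\<phi> a = \<zero>\<^bsub>S\<^esub>"
  then have "\<phi> a \<in> F (Suc 0)" unfolding F1 by simp
  then obtain K :: nat where "s [^] K \<otimes> a \<in> I" using phi_F[OF a, of "Suc 0"] I1 d by auto
  then have "s \<otimes> (s [^] K \<otimes> a) = \<zero>" by (rule kill)
  then have "s [^] (Suc K) \<otimes> a = \<zero>" using sc a by (simp add: m_ac)
  then show "\<exists>K::nat. s [^] K \<otimes> a = \<zero>" by blast
 qed (use ann[OF a] in blast)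
qed

end

text \<open>An ideal of definition that vanishes at a point of a locally integral formal spectrum vanishes
 on a connected component: with \<open>J = Ann I\<close> and \<open>K = Ann J\<close>, no prime contains \<open>J + K + I\<close>, and
 if \<open>1 = j + k + i\<close> accordingly, then \<open>j\<close> is idempotent.\<close>

lemma (in cring) common_annihilator:
 assumes p: "primeideal p R" and T: "finite T" "T \<subseteq> carrier R" "\<And>t. t \<in> T ==> loc_zero p t"
 shows "\<exists>s\<in>carrier R - p. \<forall>c\<in>genideal R T. s \<otimes> c = \<zero>"
proof -
 have "\<exists>s\<in>carrier R - p. \<forall>t\<in>T. s \<otimes> t = \<zero>"
  using T
 proof (induction rule: finite_induct)
  case empty
  then show ?case using prime_compl_one[OF p] by blast
 next
  case (insert x F)
  then obtain s where s: "s \<in> carrier R - p" "\<And>t. t \<in> F ==> s \<otimes> t = \<zero>" by auto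
  obtain s' where s': "s' \<in> carrier R - p" "s' \<otimes> x = \<zero>" using insert.prems(2)[of x] unfolding loc_zero_def by auto
  have "s \<otimes> s' \<otimes> t = \<zero>" if t: "t \<in> insert x F" for t
  proof (cases "t = x")
   case True
   then show ?thesis using s'(2) s(1) s'(1) insert.prems(1) by (simp add: m_assoc)
  next
   case False
   then have "s \<otimes> s' \<otimes> t = s' \<otimes> (s \<otimes> t)" using t s(1) s'(1) insert.prems(1) by (simp add: m_ac subset_iff)
   then show ?thesis using s(2)[of t] t False s'(1) by auto
  qed
  then show ?case using prime_compl_mult[OF p s(1) s'(1)] by blast
 qed
 then obtain s where s: "s \<in> carrier R - p" "\<And>t. t \<in> T ==> s \<otimes> t = \<zero>" by blast
 have "genideal R T \<subseteq> {c \<in> carrier R. s \<otimes> c \<in> {\<zero>}}"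
  by (rule genideal_minimal[OF colon_ideal[OF zeroideal]]) (use s T(2) in auto)
 then show ?thesis using s(1) by blast
qed

lemma (in cring) annihilator_ideal: "ideal {a \<in> carrier R. \<forall>c\<in>M. c \<otimes> a = \<zero>} R" if "M \<subseteq> carrier R"
 by (rule idealI') (use that in \<open>auto simp: r_distr subset_iff m_lcomm\<close>)

lemma (in fg_ideal) discrete_idempotent:
 assumes dom: "\<And>p a b. primeideal p R ==> I \<subseteq> p ==> a \<in> carrier R ==> b \<in> carrier R ==>
   loc_zero p (a \<otimes> b) ==> loc_zero p a \<or> loc_zero p b"
  and p: "primeideal p R" and z: "\<And>i. i < r ==> loc_zero p (f i)"
 shows "\<exists>e\<in>carrier R - p. e \<otimes> e = e \<and> (\<forall>c\<in>I. c \<otimes> e = \<zero>)"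
proof -
 define J where "J = {a \<in> carrier R. \<forall>c\<in>I. c \<otimes> a = \<zero>}"
 define K where "K = {a \<in> carrier R. \<forall>c\<in>J. c \<otimes> a = \<zero>}"
 have JI: "ideal J R" unfolding J_def by (rule annihilator_ideal) (use ideal_carr[OF I_ideal] in blast)
 have KI: "ideal K R" unfolding K_def by (rule annihilator_ideal) (use ideal_carr[OF JI] in blast)
 have f: "finite (f ` {..<r})" "f ` {..<r} \<subseteq> carrier R" using f_carr by auto
 \<comment> \<open>At a prime where \<open>I\<close> vanishes locally, finitely many generators of
   \<open>I\<close> have a common annihilator outside the prime.\<close>
 have sJ: "\<exists>s\<in>carrier R - q. s \<in> J" if q: "primeideal q R" "\<And>i. i < r ==> loc_zero q (f i)" for q
 proof -
  obtain s where s: "s \<in> carrier R - q" "\<forall>c\<in>I. s \<otimes> c = \<zero>"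
   using common_annihilator[OF q(1) f] q(2) unfolding I_gen by auto
  then have "s \<in> J" unfolding J_def using ideal_carr[OF I_ideal] by (auto simp: m_comm)
  then show ?thesis using s(1) by blast
 qed
 let ?M = "set_add R (set_add R J K) I"
 have M: "ideal ?M R" by (intro add_ideals JI KI I_ideal)
 have z0: "\<zero> \<in> J" "\<zero> \<in> K" "\<zero> \<in> I" using ideal_zero JI KI I_ideal by auto
 have sub: "x \<in> ?M" if "x \<in> J \<or> x \<in> K \<or> x \<in> I" for x
 proof -
  have c: "x \<in> carrier R" using that ideal_carr JI KI I_ideal by blast
  have "x = x \<oplus> \<zero> \<oplus> \<zero>" "x = \<zero> \<oplus> x \<oplus> \<zero>" "x = \<zero> \<oplus> \<zero> \<oplus> x" using c by auto
  then show ?thesis using that z0 unfolding set_add_def' by blast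
 qed
 have "\<one> \<in> ?M"
 proof (rule ccontr)
  assume n1: "\<one> \<notin> ?M"
  let ?C = "{Q. ideal Q R \<and> \<one> \<notin> Q}"
  have "\<exists>Q\<in>?C. ?M \<subseteq> Q \<and> (\<forall>J\<in>?C. Q \<subseteq> J --> J = Q)"
   by (rule noetherian_maximal[OF noeth]) (use M n1 in auto)
  then obtain Q where Q: "ideal Q R" "\<one> \<notin> Q" "?M \<subseteq> Q" "\<And>J. ideal J R ==> \<one> \<notin> J ==> Q \<subseteq> J ==> J = Q" by auto
  have "maximalideal Q R"
   by (rule maximalidealI[OF Q(1)]) (use Q(2,4) ideal.one_imp_carrier in blast)+
  then have q: "primeideal Q R" by (rule maximalideal_prime)
  show False
  proof (cases "\<forall>i<r. loc_zero Q (f i)")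
   case True
   then show False using sJ[OF q] sub Q(3) by blast
  next
   case False
   then obtain i where i: "i < r" "\<not> loc_zero Q (f i)" by blast
   \<comment> \<open>At a prime \<open>Q\<close> above \<open>I\<close> where some
     \<open>f i\<close> survives, the domain property makes all of \<open>J\<close> vanish locally;
     so \<open>K\<close> is not contained in \<open>Q\<close>.\<close>
   have "I \<subseteq> Q" using sub Q(3) by blast
   then have "loc_zero Q j" if j: "j \<in> J" for j
    using dom[OF q _ f_carr[OF i(1)], of j] i(2) j f_I[OF i(1)] prime_compl_one[OF q]
    unfolding J_def loc_zero_def[of Q "f i \<otimes> j"] by force
   moreover obtain T where T: "T \<subseteq> carrier R" "finite T" "J = genideal R T"
    using noetherian_ring.finetely_gen[OF noeth JI] by blast
   ultimately obtain t where t: "t \<in> carrier R - Q" "\<forall>c\<in>J. t \<otimes> c = \<zero>"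
    using common_annihilator[OF q T(2,1)] genideal_self[OF T(1)] by blast
   then have "t \<in> K" unfolding K_def using ideal_carr[OF JI] by (auto simp: m_comm)
   then show False using sub Q(3) t(1) by blast
  qed
 qed
 then obtain j k i where jk: "j \<in> J" "k \<in> K" "i \<in> I" "\<one> = j \<oplus> k \<oplus> i" unfolding set_add_def' by blast
 have c: "j \<in> carrier R" "k \<in> carrier R" "i \<in> carrier R"
  using jk ideal_carr[OF JI] ideal_carr[OF KI] ideal_carr[OF I_ideal] by auto
 \<comment> \<open>Elements of \<open>J\<close> kill the components of \<open>1\<close> in
   \<open>K\<close> and in \<open>I\<close>, so \<open>j\<close> acts as the identity on
   \<open>J\<close>; in particular it is idempotent.\<close>
 have jki: "x \<otimes> j = x" if x: "x \<in> J" for x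
 proof -
  have xc: "x \<in> carrier R" by (rule ideal_carr[OF JI x])
  have "x \<otimes> k = \<zero>" "x \<otimes> i = \<zero>" using x jk(2,3) c xc unfolding K_def J_def by (auto simp: m_comm)
  then have "x \<otimes> (j \<oplus> k \<oplus> i) = x \<otimes> j" using xc c by (simp add: r_distr)
  then show ?thesis unfolding jk(4)[symmetric] using xc by simp
 qed
 obtain s where s: "s \<in> carrier R - p" "s \<in> J" using sJ[OF p z] by blast
 have "j \<notin> p" using jki[OF s(2)] s(1) ideal_lmult[OF primeideal.axioms(1)[OF p], of j s] by auto
 then show ?thesis using jki[OF jk(1)] jk(1) c(1) unfolding J_def by blast
qed

context spf_chart
begin

text \<open>Since \<open>e\<close> is idempotent and annihilates \<open>I\<close>, the functions on
  \<open>D e\<close> are the quotient of \<open>A\<close> by the annihilator of \<open>e\<close>,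
  with discrete topology. To contradict \<open>nowhere_discrete\<close>, the set has to be exhibited
  as a chart in every respect, including the completed localizations on all its basic open
  subsets.\<close>

lemma discrete_chart:
 fixes B :: "'a top_ring" (structure)
 assumes B_def: "B = Sec (D e)" and e: "e \<in> carrier A" "e \<otimes>\<^sub>A e = e" and kill: "\<And>c. c \<in> I ==> e \<otimes>\<^sub>A c = \<zero>\<^sub>A"
 shows "\<exists>h'. Spf_chart X (D e) h' \<and> topo B = discrete_topology (carrier B)"
proof -
 define \<psi> where "\<psi> = res U (D e)"
 have oD: "op (D e)" by (rule op_D[OF e(1)])
 obtain g where "rat_completion A I r f {\<one>\<^sub>A} e 0 B \<psi> g"
  using D_completion[OF e(1)] unfolding B_def \<psi>_def by blast
 then interpret C: rat_completion A I r f "{\<one>\<^sub>A}" e 0 B \<psi> g .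
 have B0: "openin (topo B) {\<zero>}" by (rule C.killed(1)[OF refl kill])
 have disc: "topo B = discrete_topology (carrier B)" by (rule discrete_if_zero_open[OF C.S.topring_axioms B0])
 interpret \<psi>: ring_hom_cring A B \<psi>
  by (intro ring_hom_cring.intro ring_hom_cring_axioms.intro A.is_cring C.S.is_cring C.phi_hom)
 have hom: "ring_hom_ring A B \<psi>" by (rule ring_hom_ringI2[OF A.ring_axioms C.S.ring_axioms C.phi_hom])
 have epow: "e [^]\<^sub>A (Suc n) = e" for n by (induction n) (use e in auto)
 obtain v where v: "v \<in> carrier B" "\<psi> e \<otimes> v = \<one>" using C.phi_s_inverse by blast
 \<comment> \<open>The image of \<open>e\<close> is an idempotent unit, hence \<open>1\<close>.
   Denominators therefore disappear and \<open>\<psi>\<close> is surjective.\<close>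
 have "\<psi> e = \<psi> e \<otimes> (\<psi> e \<otimes> v)" using v(2) e(1) by simp
 also have "\<dots> = \<psi> (e \<otimes>\<^sub>A e) \<otimes> v" using v(1) e(1) by (simp add: C.S.m_assoc)
 finally have pe: "\<psi> e = \<one>" unfolding e(2) v(2) .
 have ker: "\<psi> a = \<zero> \<longleftrightarrow> e \<otimes>\<^sub>A a = \<zero>\<^sub>A" if a: "a \<in> carrier A" for a
 proof
  assume "\<psi> a = \<zero>"
  then obtain K :: nat where K: "e [^]\<^sub>A K \<otimes>\<^sub>A a = \<zero>\<^sub>A" using C.killed(3)[OF refl kill a] by blast
  have "e [^]\<^sub>A Suc K \<otimes>\<^sub>A a = e \<otimes>\<^sub>A (e [^]\<^sub>A K \<otimes>\<^sub>A a)" using e(1) a by (simp add: A.m_ac)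
  then have "e [^]\<^sub>A Suc K \<otimes>\<^sub>A a = \<zero>\<^sub>A" unfolding K using e(1) by simp
  then show "e \<otimes>\<^sub>A a = \<zero>\<^sub>A" unfolding epow .
 next
  assume "e \<otimes>\<^sub>A a = \<zero>\<^sub>A"
  then have "\<psi> (e \<otimes>\<^sub>A a) = \<zero>" by simp
  then show "\<psi> a = \<zero>" using e(1) a pe by simp
 qed
 have surj: "\<exists>a\<in>carrier A. b = \<psi> a" if b: "b \<in> carrier B" for b
  using C.killed(2)[OF refl kill b] b unfolding pe by auto
 \<comment> \<open>The primes of \<open>B\<close> correspond to the primes of \<open>A\<close> that
   do not contain \<open>e\<close>; such a prime contains the kernel of \<open>\<psi>\<close>, so it
   is recovered from its image.\<close>
 define h' where "h' = (\<lambda>y. \<psi> ` h y)"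
 have hp: "primeideal (h y) A" "e \<notin> h y" if "y \<in> D e" for y using that h_prime by auto
 have hI: "ideal (h y) A" if "y \<in> D e" for y using hp(1)[OF that] by (rule primeideal.axioms(1))
 have h'_mem: "\<psi> a \<in> h' y \<longleftrightarrow> a \<in> h y" if y: "y \<in> D e" and a: "a \<in> carrier A" for y a
 proof
  assume "\<psi> a \<in> h' y"
  then obtain a' where a': "a' \<in> h y" "\<psi> a = \<psi> a'" unfolding h'_def by blast
  have a'c: "a' \<in> carrier A" by (rule A.ideal_carr[OF hI[OF y] a'(1)])
  have "\<psi> (a \<ominus>\<^sub>A a') = \<zero>" using a a'c a'(2) by (simp add: C.S.minus_self)
  then have "e \<otimes>\<^sub>A (a \<ominus>\<^sub>A a') \<in> h y" using ker[of "a \<ominus>\<^sub>A a'"] a a'c A.ideal_zero[OF hI[OF y]] by simp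
  then have "a \<ominus>\<^sub>A a' \<in> h y" using primeideal.I_prime[OF hp(1)[OF y] e(1)] hp(2)[OF y] a a'c by auto
  then show "a \<in> h y" using A.ideal_subst[OF hI[OF y] _ a'(1) a] by blast
 qed (auto simp: h'_def)
 have h'_carr: "h' y \<subseteq> carrier B" if "y \<in> D e" for y unfolding h'_def using A.ideal_carr[OF hI[OF that]] by auto
 have h'_D: "{y \<in> D e. \<psi> a \<notin> h' y} = D (a \<otimes>\<^sub>A e)" if a: "a \<in> carrier A" for a
 proof -
  have "a \<otimes>\<^sub>A e \<in> h y \<longleftrightarrow> a \<in> h y \<or> e \<in> h y" if y: "y \<in> U" for y
   using primeideal.I_prime[OF h_prime[OF y] a e(1)] A.ideal_lmult[OF primeideal.axioms(1)[OF h_prime[OF y]] _ a]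
    A.ideal_rmult[OF primeideal.axioms(1)[OF h_prime[OF y]] _ e(1)] by blast
  then show ?thesis using h'_mem[OF _ a] by blast
 qed
 have h'_prime: "primeideal (h' y) B" if y: "y \<in> D e" for y
 proof (rule primeidealI[OF _ C.S.is_cring])
  show "ideal (h' y) B"
  proof (rule C.S.idealI'[OF h'_carr[OF y]])
   show "\<zero> \<in> h' y" using h'_mem[OF y, of "\<zero>\<^sub>A"] A.ideal_zero[OF hI[OF y]] by simp
   fix b assume "b \<in> h' y"
   then obtain a where a: "a \<in> h y" "b = \<psi> a" "a \<in> carrier A" unfolding h'_def using A.ideal_carr[OF hI[OF y]] by blast
   show "z \<otimes> b \<in> h' y" if z: "z \<in> carrier B" for z
   proof -
    obtain c where c: "c \<in> carrier A" "z = \<psi> c" using surj[OF z] by blast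
    show ?thesis using h'_mem[OF y, of "c \<otimes>\<^sub>A a"] A.ideal_lmult[OF hI[OF y] a(1) c(1)] a c by simp
   qed
   fix b' assume "b' \<in> h' y"
   then obtain c where c: "c \<in> h y" "b' = \<psi> c" "c \<in> carrier A" unfolding h'_def using A.ideal_carr[OF hI[OF y]] by blast
   show "b \<oplus> b' \<in> h' y" using h'_mem[OF y, of "a \<oplus>\<^sub>A c"] A.ideal_add[OF hI[OF y] a(1) c(1)] a c by simp
  qed
  have "\<one>\<^sub>A \<notin> h y" using A.prime_compl_one[OF hp(1)[OF y]] by blast
  then have "\<one> \<notin> h' y" using h'_mem[OF y, of "\<one>\<^sub>A"] by simp
  then show "carrier B \<noteq> h' y" by blast
  fix b z assume b: "b \<in> carrier B" and z: "z \<in> carrier B" and bz: "b \<otimes> z \<in> h' y"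
  obtain a c where ac: "a \<in> carrier A" "b = \<psi> a" "c \<in> carrier A" "z = \<psi> c" using surj[OF b] surj[OF z] by blast
  have "a \<otimes>\<^sub>A c \<in> h y" using h'_mem[OF y, of "a \<otimes>\<^sub>A c"] bz ac by simp
  then show "b \<in> h' y \<or> z \<in> h' y" using primeideal.I_prime[OF hp(1)[OF y] ac(1,3)] h'_mem[OF y] ac by blast
 qed
 have SpfB: "Spf B = {q. primeideal q B}"
  using ideal.Icarr[OF primeideal.axioms(1)] unfolding Spf_def disc by auto
 have topB: "topspace (Spf_topology B) = Spf B"
 proof -
  have "q \<in> \<Union>{{p \<in> Spf B. a \<notin> p} | a. a \<in> carrier B}" if q: "q \<in> Spf B" for q
  proof -
   have "\<one> \<notin> q" using q C.S.prime_compl_one unfolding SpfB by blast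
   then show ?thesis using q by blast
  qed
  then show ?thesis unfolding Spf_topology_def topology_generated_by_topspace by blast
 qed
 have psurj: "\<exists>y\<in>D e. h' y = q" if q: "primeideal q B" for q
 proof -
  have qI: "ideal q B" by (rule primeideal.axioms(1)[OF q])
  let ?p = "{a \<in> carrier A. \<psi> a \<in> q}"
  have "primeideal ?p A" by (rule ring_hom_ring.primeideal_vimage[OF hom A.is_cring q])
  moreover have "\<psi> c = \<zero>" if "c \<in> I" for c using ker kill A.ideal_carr[OF A.I_ideal] that by blast
  then have "I \<subseteq> ?p" using A.ideal_carr[OF A.I_ideal] C.S.ideal_zero[OF qI] by (simp add: subset_iff)
  ultimately obtain y where y: "y \<in> U" "h y = ?p" using h_surj by blast
  have yD: "y \<in> D e" using y C.S.prime_compl_one[OF q] pe by simp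
  have "q \<subseteq> \<psi> ` ?p" using surj C.S.ideal_carr[OF qI] by blast
  then have "h' y = q" unfolding h'_def y(2) by blast
  then show ?thesis using yD by blast
 qed
 have topD: "topspace (subtopology (under X) (D e)) = D e"
  using op_sub[OF oD] by auto
 have D_image: "h' ` D a = {q \<in> Spf B. \<psi> a \<notin> q}" if a: "a \<in> carrier A" and sub: "D a \<subseteq> D e" for a
 proof
  show "h' ` D a \<subseteq> {q \<in> Spf B. \<psi> a \<notin> q}" using h'_prime h'_mem a sub unfolding SpfB by blast
  show "{q \<in> Spf B. \<psi> a \<notin> q} \<subseteq> h' ` D a"
  proof
   fix q assume q: "q \<in> {q \<in> Spf B. \<psi> a \<notin> q}"
   then obtain y where y: "y \<in> D e" "h' y = q" using psurj unfolding SpfB by blast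
   then have "y \<in> D a" using h'_mem[OF y(1) a] q by auto
   then show "q \<in> h' ` D a" using y(2) by blast
  qed
 qed
 have homeo': "homeomorphic_map (subtopology (under X) (D e)) (Spf_topology B) h'"
 proof (rule bijective_open_imp_homeomorphic_map)
  show "continuous_map (subtopology (under X) (D e)) (Spf_topology B) h'"
   unfolding Spf_topology_def
  proof (rule continuous_on_generated_topo)
   fix V assume "V \<in> {{p \<in> Spf B. b \<notin> p} | b. b \<in> carrier B}"
   then obtain a where a: "a \<in> carrier A" "V = {p \<in> Spf B. \<psi> a \<notin> p}" using surj by blast
   have "h' -` V \<inter> topspace (subtopology (under X) (D e)) = {y \<in> D e. \<psi> a \<notin> h' y}"
    unfolding topD a(2) using h'_prime unfolding SpfB by auto
   then have E: "h' -` V \<inter> topspace (subtopology (under X) (D e)) = D (a \<otimes>\<^sub>A e)" unfolding h'_D[OF a(1)] .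
   have "D (a \<otimes>\<^sub>A e) \<subseteq> D e" using h'_D[OF a(1)] by blast
   then show "openin (subtopology (under X) (D e)) (h' -` V \<inter> topspace (subtopology (under X) (D e)))"
    unfolding E openin_open_subtopology[OF oD] using op_D[of "a \<otimes>\<^sub>A e"] a(1) e(1) by simp
  next
   show "h' ` topspace (subtopology (under X) (D e)) \<subseteq> \<Union>{{p \<in> Spf B. b \<notin> p} | b. b \<in> carrier B}"
    using h'_prime topB unfolding topD SpfB Spf_topology_def topology_generated_by_topspace by blast
  qed
  show "open_map (subtopology (under X) (D e)) (Spf_topology B) h'"
   unfolding open_map_def openin_open_subtopology[OF oD]
  proof (intro allI impI)
   fix W assume W: "op W \<and> W \<subseteq> D e"
   show "openin (Spf_topology B) (h' ` W)"
   proof (subst openin_subopen, intro ballI)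
    fix q assume "q \<in> h' ` W"
    then obtain y where y: "y \<in> W" "q = h' y" by blast
    obtain a where a: "a \<in> carrier A" "y \<in> D a" "D a \<subseteq> W" using D_basis[of W y] W y by blast
    have sub: "D a \<subseteq> D e" using a W by blast
    have "openin (Spf_topology B) (h' ` D a)"
     unfolding D_image[OF a(1) sub] Spf_topology_def
     by (rule topology_generated_by_Basis) (use a(1) in auto)
    then show "\<exists>V. openin (Spf_topology B) V \<and> q \<in> V \<and> V \<subseteq> h' ` W" using y a by blast
   qed
  qed
  show "h' ` topspace (subtopology (under X) (D e)) = topspace (Spf_topology B)"
   unfolding topD topB using psurj h'_prime unfolding SpfB by blast
  show "inj_on h' (topspace (subtopology (under X) (D e)))"
   unfolding topD
  proof (rule inj_onI)
   fix y z assume y: "y \<in> D e" and z: "z \<in> D e" and eq: "h' y = h' z"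
   have "h y \<subseteq> carrier A" "h z \<subseteq> carrier A" using A.ideal_carr[OF hI[OF y]] A.ideal_carr[OF hI[OF z]] by auto
   then have "h y = h z" using h'_mem[OF y] h'_mem[OF z] eq by blast
   moreover have "inj_on h U" using homeomorphic_imp_injective_map[OF homeo] unfolding topspace_U .
   ultimately show "y = z" using inj_onD[of h U y z] y z by blast
  qed
 qed
 have noeth: "noetherian_ring B"
 proof (rule C.S.noetherian_ringI)
  fix J assume J: "ideal J B"
  let ?p = "{a \<in> carrier A. \<psi> a \<in> J}"
  obtain T where T: "T \<subseteq> carrier A" "finite T" "?p = genideal A T"
   using noetherian_ring.finetely_gen[OF A.noeth ring_hom_ring.ideal_vimage[OF hom J]] by blast
  have Tc: "\<psi> ` T \<subseteq> carrier B" using T by auto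
  note G = C.S.genideal_ideal[OF Tc]
  have "T \<subseteq> ?p" unfolding T(3) by (rule A.genideal_self[OF T(1)])
  then have "genideal B (\<psi> ` T) \<subseteq> J" by (intro C.S.genideal_minimal[OF J]) blast
  moreover have "?p \<subseteq> {a \<in> carrier A. \<psi> a \<in> genideal B (\<psi> ` T)}"
   unfolding T(3) by (rule A.genideal_minimal[OF ring_hom_ring.ideal_vimage[OF hom G]])
    (use T C.S.genideal_self[OF Tc] in blast)
  then have "J \<subseteq> genideal B (\<psi> ` T)" using surj C.S.ideal_carr[OF J] by blast
  ultimately show "\<exists>T\<subseteq>carrier B. finite T \<and> J = genideal B T" using Tc T(2) by blast
 qed
 have "adic_ring B"
  unfolding adic_ring_def
 proof (intro conjI exI[of _ "{\<zero>}"] allI)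
  show "topological_ring B" by (rule C.S.topological)
  show "ideal {\<zero>} B" by (rule C.S.zeroideal)
  have p1: "ideal_power B {\<zero>} (Suc 0) = {\<zero>}" by (rule C.S.ideal_power_1[OF C.S.zeroideal])
  fix W
  \<comment> \<open>The first power serves here, as the zeroth power of the zero ideal is the whole
    ring.\<close>
  have "\<exists>n. ideal_power B {\<zero>} n +> x \<subseteq> W" if "W \<subseteq> carrier B" "x \<in> W" for x
   using that p1 by (intro exI[of _ "Suc 0"]) (auto simp: a_r_coset_def' simp del: ideal_power.simps)
  then show "openin (topo B) W \<longleftrightarrow> W \<subseteq> carrier B \<and> (\<forall>x\<in>W. \<exists>n. ideal_power B {\<zero>} n +> x \<subseteq> W)"
   unfolding disc by auto
 qed
 then have cna: "complete_noetherian_adic_ring B"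
  unfolding complete_noetherian_adic_ring_def using noeth sec_complete[OF oD] B_def by simp
 \<comment> \<open>A function \<open>b\<close> on \<open>D e\<close> lifts to some \<open>a\<close>,
   and its basic open set is the one of \<open>q\<close>, the product of \<open>a\<close> and
   \<open>e\<close>. As \<open>q\<close> annihilates \<open>I\<close> too, the sections there are
   again a plain discrete localization.\<close>
 have loc: "completed_rat_loc B {\<one>} b (Sec {y \<in> D e. b \<notin> h' y}) (res (D e) {y \<in> D e. b \<notin> h' y})"
  if b: "b \<in> carrier B" for b
 proof -
  obtain a where a: "a \<in> carrier A" "b = \<psi> a" using surj[OF b] by blast
  define q where "q = a \<otimes>\<^sub>A e"
  have q: "q \<in> carrier A" "\<psi> q = b" unfolding q_def using a e(1) pe by auto
  have E: "{y \<in> D e. b \<notin> h' y} = D q" unfolding q_def a(2) by (rule h'_D[OF a(1)])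
  have Esub: "D q \<subseteq> D e" using E by blast
  have oE: "op (D q)" by (rule op_D[OF q(1)])
  have kill': "q \<otimes>\<^sub>A c = \<zero>\<^sub>A" if c: "c \<in> I" for c
   unfolding q_def using kill[OF c] a(1) e(1) A.ideal_carr[OF A.I_ideal c] by (simp add: A.m_assoc)
  define \<rho> where "\<rho> = res (D e) (D q)"
  define \<phi> where "\<phi> = res U (D q)"
  obtain g' where "rat_completion A I r f {\<one>\<^sub>A} q 0 (Sec (D q)) \<phi> g'"
   using D_completion[OF q(1)] unfolding \<phi>_def by blast
  then interpret C': rat_completion A I r f "{\<one>\<^sub>A}" q 0 "Sec (D q)" \<phi> g' .
  have \<rho>\<psi>: "\<rho> (\<psi> c) = \<phi> c" if "c \<in> carrier A" for c
   unfolding \<rho>_def \<psi>_def \<phi>_def by (rule res_res[OF opU oD oE Esub _ that]) blast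
  have \<rho>: "\<rho> \<in> ring_hom B (Sec (D q))" unfolding \<rho>_def B_def by (rule res_hom[OF oD oE Esub])
  have \<rho>b: "\<rho> b = \<phi> q" using \<rho>\<psi>[OF q(1)] q(2) by simp
  obtain v' where v': "v' \<in> carrier (Sec (D q))" "\<phi> q \<otimes>\<^bsub>Sec (D q)\<^esub> v' = \<one>\<^bsub>Sec (D q)\<^esub>"
   using C'.phi_s_inverse by blast
  have "completed_rat_loc B {\<one>} b (Sec (D q)) \<rho>"
  proof (rule completed_rat_loc_discrete[OF C.S.topring_axioms B0 sec_complete[OF oE] _ \<rho> b v'(1) v'(2)[folded \<rho>b]])
   show "openin (topo (Sec (D q))) {\<zero>\<^bsub>Sec (D q)\<^esub>}" by (rule C'.killed(1)[OF refl kill'])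
  next
   fix x assume x: "x \<in> carrier (Sec (D q))"
   obtain n w where w: "w \<in> carrier A" "x \<otimes>\<^bsub>Sec (D q)\<^esub> \<phi> q [^]\<^bsub>Sec (D q)\<^esub> (n::nat) = \<phi> w"
    using C'.killed(2)[OF refl kill' x] by blast
   then show "\<exists>n::nat. \<exists>w\<in>carrier B. x \<otimes>\<^bsub>Sec (D q)\<^esub> \<rho> b [^]\<^bsub>Sec (D q)\<^esub> n = \<rho> w"
    unfolding \<rho>b using \<rho>\<psi>[OF w(1)] by (intro exI[of _ n] bexI[of _ "\<psi> w"]) simp_all
  next
   fix w assume w: "w \<in> carrier B" "\<rho> w = \<zero>\<^bsub>Sec (D q)\<^esub>"
   obtain c where c: "c \<in> carrier A" "w = \<psi> c" using surj[OF w(1)] by blast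
   have "\<phi> c = \<zero>\<^bsub>Sec (D q)\<^esub>" using w(2) \<rho>\<psi>[OF c(1)] c(2) by simp
   then obtain n :: nat where n: "q [^]\<^sub>A n \<otimes>\<^sub>A c = \<zero>\<^sub>A"
    using C'.killed(3)[OF refl kill' c(1)] by blast
   have "b [^] n \<otimes> w = \<psi> (q [^]\<^sub>A n \<otimes>\<^sub>A c)" using q c by simp
   then show "\<exists>K::nat. b [^] K \<otimes> w = \<zero>" unfolding n by auto
  qed
  then show ?thesis unfolding E \<rho>_def .
 qed
 have "Spf_chart X (D e) h'"
  unfolding Spf_chart_def B_def[symmetric] using oD cna homeo' loc by blast
 then show ?thesis using disc by blast
qed

text \<open>If all \<open>f i\<close> vanished at \<open>x\<close>, the idempotent of
  \<open>discrete_idempotent\<close> would cut out a discrete chart around \<open>x\<close>.\<close>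

lemma I_nonzero:
 assumes nd: "nowhere_discrete X" and x: "x \<in> U" and dom: "\<And>y. y \<in> U ==> domain (stalk X y)"
 shows "\<exists>i<r. \<not> A.loc_zero (h x) (f i)"
proof (rule ccontr)
 assume "\<not> ?thesis"
 then have z: "\<And>i. i < r ==> A.loc_zero (h x) (f i)" by blast
 have "\<exists>e\<in>carrier A - h x. e \<otimes>\<^sub>A e = e \<and> (\<forall>c\<in>I. c \<otimes>\<^sub>A e = \<zero>\<^sub>A)"
 proof (rule A.discrete_idempotent[OF _ h_prime[OF x] z])
  fix p a b assume p: "primeideal p A" "I \<subseteq> p" and ab: "a \<in> carrier A" "b \<in> carrier A" "A.loc_zero p (a \<otimes>\<^sub>A b)"
  obtain y where y: "y \<in> U" "h y = p" using h_surj[OF p] by blast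
  show "A.loc_zero p a \<or> A.loc_zero p b" using locally_dom[OF y(1) dom[OF y(1)]] ab y(2) by blast
 qed
 then obtain e where e: "e \<in> carrier A" "e \<notin> h x" "e \<otimes>\<^sub>A e = e" "\<And>c. c \<in> I ==> c \<otimes>\<^sub>A e = \<zero>\<^sub>A" by blast
 have "\<exists>h'. Spf_chart X (D e) h' \<and> topo (Sec (D e)) = discrete_topology (carrier (Sec (D e)))"
  by (rule discrete_chart[OF refl e(1,3)]) (use e A.ideal_carr[OF A.I_ideal] A.m_comm in simp)
 then obtain h' where "Spf_chart X (D e) h'" "topo (Sec (D e)) = discrete_topology (carrier (Sec (D e)))"
  by (elim exE conjE)
 moreover have "D e \<noteq> {}" using x e(2) by blast
 ultimately have "D e \<noteq> {} \<and> Spf_chart X (D e) h'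
   \<and> topo (Sec (D e)) = discrete_topology (carrier (Sec (D e)))" by (intro conjI)
 then have "\<exists>U h. U \<noteq> {} \<and> Spf_chart X U h \<and> topo (Sec U) = discrete_topology (carrier (Sec U))"
  by (intro exI[of _ "D e"] exI[of _ h'])
 then show False by (rule notE[OF nd[unfolded nowhere_discrete_def]])
qed

end

context spf_chart
begin

lemma locally_normal:
 assumes "nowhere_discrete X" and nd: "\<And>x. x \<in> U ==> normal_domain (stalk X x)"
 shows "locally_normal A I r f"
proof (intro locally_normal.intro A.fg_ideal_axioms locally_normal_axioms.intro)
 fix p assume p: "primeideal p A" "I \<subseteq> p"
 obtain x where x: "x \<in> U" "h x = p" using h_surj[OF p] by blast
 have dm: "\<And>y. y \<in> U ==> domain (stalk X y)" using nd unfolding normal_domain_def by blast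
 note dom = dm[OF x(1)]
 show "A.loc_zero p a \<or> A.loc_zero p b"
  if "a \<in> carrier A" "b \<in> carrier A" "A.loc_zero p (a \<otimes>\<^sub>A b)" for a b
  using locally_dom[OF x(1) dom] that x(2) by blast
 show "\<exists>i<r. \<not> A.loc_zero p (f i)" using I_nonzero[OF assms(1) x(1) dm] x(2) by simp
 show "\<exists>s\<in>carrier A - p. \<exists>a\<in>carrier A. s \<otimes>\<^sub>A e 1 = e 0 \<otimes>\<^sub>A a"
  if "0 < n" "\<And>i. i \<le> n ==> e i \<in> carrier A" "\<And>i. i < n ==> c i \<in> carrier A"
   "\<And>i. i < n ==> e i \<otimes>\<^sub>A e 1 = e (Suc i) \<otimes>\<^sub>A e 0"
   "e n = (\<Oplus>\<^bsub>A\<^esub>i\<in>{..<n}. c i \<otimes>\<^sub>A e i)" "\<not> A.loc_zero p (e 0)" for n e c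
  using locally_integrally_closed[OF x(1) nd[OF x(1)] that(1-5)] that(6) x(2) by simp
qed

end

section \<open>Valuations\<close>

text \<open>A point of a valuation spectrum is given only as the relation \<open>v a <= v b\<close>.
  The axioms are the rules for computing with values that can be read off from it, so that the value
  group can be forgotten.\<close>

locale vrel = cring R for R :: "('a, 'm) ring_scheme" (structure) +
 fixes v :: "'a rel"
 assumes v_carr: "(a, b) \<in> v ==> a \<in> carrier R \<and> b \<in> carrier R"
  and v_total: "a \<in> carrier R ==> b \<in> carrier R ==> (a, b) \<in> v \<or> (b, a) \<in> v"
  and v_trans: "(a, b) \<in> v ==> (b, c) \<in> v ==> (a, c) \<in> v"
  and v_mult: "(a, b) \<in> v ==> c \<in> carrier R ==> (a \<otimes> c, b \<otimes> c) \<in> v"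
  and v_cancel: "(a \<otimes> c, b \<otimes> c) \<in> v ==> (c, \<zero>) \<notin> v ==> a \<in> carrier R ==> b \<in> carrier R ==>
   c \<in> carrier R ==> (a, b) \<in> v"
  and v_add: "(a, c) \<in> v ==> (b, c) \<in> v ==> (a \<oplus> b, c) \<in> v"
  and v_zero: "a \<in> carrier R ==> (\<zero>, a) \<in> v"
  and v_one: "(\<one>, \<zero>) \<notin> v"
begin

lemma v_refl: "a \<in> carrier R ==> (a, a) \<in> v"
 using v_total by blast

lemma v_lmult: "(a, b) \<in> v ==> c \<in> carrier R ==> (c \<otimes> a, c \<otimes> b) \<in> v"
 using v_mult[of a b c] v_carr[of a b] by (simp add: m_comm)

lemma v_zero_mult: "(a, \<zero>) \<in> v ==> c \<in> carrier R ==> (c \<otimes> a, \<zero>) \<in> v"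
 using v_lmult[of a \<zero> c] by simp

lemma v_zero_prime:
 assumes "(a \<otimes> c, \<zero>) \<in> v" "a \<in> carrier R" "c \<in> carrier R" shows "(a, \<zero>) \<in> v \<or> (c, \<zero>) \<in> v"
 using v_cancel[of a c \<zero>] assms by auto

lemma v_pow_zero: "(a [^] (n::nat), \<zero>) \<in> v ==> a \<in> carrier R ==> (a, \<zero>) \<in> v"
proof (induction n)
 case 0
 then show ?case using v_one by simp
next
 case (Suc n)
 then show ?case using v_zero_prime[of "a [^] n" a] by auto
qed

lemma supp_ideal: "ideal {a \<in> carrier R. (a, \<zero>) \<in> v} R"
 by (rule idealI') (use v_zero v_add v_zero_mult in auto)

lemma le_ideal:
 assumes "\<And>a. a \<in> carrier R ==> (a, \<one>) \<in> v" "s \<in> carrier R"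
 shows "ideal {a \<in> carrier R. (a, s) \<in> v} R"
proof (rule idealI')
 show "x \<otimes> a \<in> {a \<in> carrier R. (a, s) \<in> v}" if "a \<in> {a \<in> carrier R. (a, s) \<in> v}" "x \<in> carrier R" for a x
 proof -
  have "(x \<otimes> a, \<one> \<otimes> a) \<in> v" using v_mult[OF assms(1)[OF that(2)], of a] that by blast
  then have "(x \<otimes> a, a) \<in> v" using that by simp
  then show ?thesis using that v_trans by auto
 qed
qed (use v_zero v_add assms(2) in auto)

lemma exists_max:
 assumes "finite T" "T \<noteq> {}" "T \<subseteq> carrier R" shows "\<exists>m\<in>T. \<forall>t\<in>T. (t, m) \<in> v"
 using assms
proof (induction rule: finite_ne_induct)
 case (singleton x)
 then show ?case using v_refl by auto
next
 case (insert x F)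
 then obtain m where m: "m \<in> F" "\<forall>t\<in>F. (t, m) \<in> v" by auto
 show ?case
 proof (cases "(x, m) \<in> v")
  case True
  then show ?thesis using m by auto
 next
  case False
  then have mx: "(m, x) \<in> v" using v_total[of x m] m(1) insert.prems by auto
  then have "\<forall>t\<in>insert x F. (t, x) \<in> v" using m(2) v_trans[OF _ mx] v_refl[of x] insert.prems by auto
  then show ?thesis by blast
 qed
qed

end

lemma val_rel_vrel:
 fixes R :: "('a, 'm) ring_scheme" (structure) and G :: "('g, 'n) value_group_scheme"
 assumes "cring R" and val: "valuation R G w"
 shows "vrel R (val_rel R G w)"
proof -
 interpret cring R by fact
 have G: "ordered_comm_group G" using val unfolding valuation_def by blast
 then interpret G: comm_group G unfolding ordered_comm_group_def by blast
 have tot: "leq G x y \<or> leq G y x" if "x \<in> carrier G" "y \<in> carrier G" for x y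
  using G that unfolding ordered_comm_group_def by blast
 have tr: "leq G x z" if "leq G x y" "leq G y z" "x \<in> carrier G" "y \<in> carrier G" "z \<in> carrier G" for x y z
  using G that unfolding ordered_comm_group_def by blast
 have mo: "leq G (x \<otimes>\<^bsub>G\<^esub> z) (y \<otimes>\<^bsub>G\<^esub> z)" if "leq G x y" "x \<in> carrier G" "y \<in> carrier G" "z \<in> carrier G" for x y z
  using G that unfolding ordered_comm_group_def by blast
 have w: "w a = None \<or> (\<exists>x\<in>carrier G. w a = Some x)" if "a \<in> carrier R" for a
  using val that unfolding valuation_def by blast
 have w0: "w \<zero> = None" and w1: "w \<one> = Some \<one>\<^bsub>G\<^esub>" using val unfolding valuation_def by auto
 have wm: "w (a \<otimes> b) = mult0 G (w a) (w b)" if "a \<in> carrier R" "b \<in> carrier R" for a b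
  using val that unfolding valuation_def by blast
 have wa: "leq0 G (w (a \<oplus> b)) (w a) \<or> leq0 G (w (a \<oplus> b)) (w b)" if "a \<in> carrier R" "b \<in> carrier R" for a b
  using val that unfolding valuation_def by blast
 have tr0: "leq0 G (w a) (w c)" if "leq0 G (w a) (w b)" "leq0 G (w b) (w c)" "a \<in> carrier R" "b \<in> carrier R" "c \<in> carrier R" for a b c
  using w[OF that(3)] w[OF that(4)] w[OF that(5)] that(1,2) tr by auto
 show ?thesis
 proof (unfold_locales)
  fix a b assume ab: "a \<in> carrier R" "b \<in> carrier R"
  show "(a, b) \<in> val_rel R G w \<or> (b, a) \<in> val_rel R G w"
  proof (cases "w a = None \<or> w b = None")
   case False
   then obtain x y where "x \<in> carrier G" "w a = Some x" "y \<in> carrier G" "w b = Some y"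
    using w[OF ab(1)] w[OF ab(2)] by auto
   then show ?thesis using tot[of x y] ab unfolding val_rel_def by auto
  qed (use ab in \<open>auto simp: val_rel_def\<close>)
 next
  fix a b c assume "(a, b) \<in> val_rel R G w" "(b, c) \<in> val_rel R G w"
  then show "(a, c) \<in> val_rel R G w" using tr0 unfolding val_rel_def by blast
 next
  fix a b c assume "(a, b) \<in> val_rel R G w" and c: "c \<in> carrier R"
  then have ab: "a \<in> carrier R" "b \<in> carrier R" "leq0 G (w a) (w b)" unfolding val_rel_def by auto
  have "leq0 G (mult0 G (w a) (w c)) (mult0 G (w b) (w c))"
   using w[OF ab(1)] w[OF ab(2)] w[OF c] ab(3) mo by auto
  then show "(a \<otimes> c, b \<otimes> c) \<in> val_rel R G w" unfolding val_rel_def using ab c wm by auto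
 next
  fix a b c assume ac: "(a \<otimes> c, b \<otimes> c) \<in> val_rel R G w" and c0: "(c, \<zero>) \<notin> val_rel R G w"
   and c: "a \<in> carrier R" "b \<in> carrier R" "c \<in> carrier R"
  have "w c \<noteq> None" using c0 c w0 unfolding val_rel_def by (cases "w c") auto
  then obtain z where z: "z \<in> carrier G" "w c = Some z" using w[OF c(3)] by auto
  have le: "leq0 G (mult0 G (w a) (w c)) (mult0 G (w b) (w c))"
   using ac c wm unfolding val_rel_def by auto
  have "leq0 G (w a) (w b)"
  proof (cases "w a")
   case (Some x)
   then obtain y where xy: "x \<in> carrier G" "y \<in> carrier G" "w b = Some y" "leq G (x \<otimes>\<^bsub>G\<^esub> z) (y \<otimes>\<^bsub>G\<^esub> z)"
    using w[OF c(1)] w[OF c(2)] le z by auto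
   have "leq G (x \<otimes>\<^bsub>G\<^esub> z \<otimes>\<^bsub>G\<^esub> inv\<^bsub>G\<^esub> z) (y \<otimes>\<^bsub>G\<^esub> z \<otimes>\<^bsub>G\<^esub> inv\<^bsub>G\<^esub> z)"
    by (rule mo[OF xy(4)]) (use xy z in auto)
   then show ?thesis using xy z Some by (simp add: G.m_assoc)
  qed simp
  then show "(a, b) \<in> val_rel R G w" unfolding val_rel_def using c by blast
 next
  fix a b c assume "(a, c) \<in> val_rel R G w" "(b, c) \<in> val_rel R G w"
  then have abc: "a \<in> carrier R" "b \<in> carrier R" "c \<in> carrier R" "leq0 G (w a) (w c)" "leq0 G (w b) (w c)"
   unfolding val_rel_def by auto
  then have "leq0 G (w (a \<oplus> b)) (w c)" using wa[OF abc(1,2)] tr0[of "a \<oplus> b" a c] tr0[of "a \<oplus> b" b c] by auto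
  then show "(a \<oplus> b, c) \<in> val_rel R G w" unfolding val_rel_def using abc by auto
 qed (use w0 w1 in \<open>auto simp: val_rel_def\<close>)
qed

lemma valuation_pullback:
 assumes "valuation S G w" "\<theta> \<in> ring_hom R S" "\<theta> \<zero>\<^bsub>R\<^esub> = \<zero>\<^bsub>S\<^esub>"
 shows "valuation R G (w \<circ> \<theta>)"
proof -
 have \<theta>: "\<And>a. a \<in> carrier R ==> \<theta> a \<in> carrier S" using ring_hom_closed[OF assms(2)] by blast
 show ?thesis using assms(1) \<theta> ring_hom_mult[OF assms(2)] ring_hom_add[OF assms(2)] ring_hom_one[OF assms(2)] assms(3)
  unfolding valuation_def by auto
qed

lemma continuous_val_rel:
 fixes R :: "('a, 'm) top_ring_scheme" (structure) and G :: "('g, 'n) value_group_scheme"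
 assumes R: "cring R" and c: "continuous_valuation R G w" and b: "b \<in> carrier R" "(b, \<zero>\<^bsub>R\<^esub>) \<notin> val_rel R G w"
 shows "openin (topo R) {a \<in> carrier R. (b, a) \<notin> val_rel R G w}"
proof -
 interpret cring R by fact
 have val: "valuation R G w" using c unfolding continuous_valuation_def by blast
 have w: "w a = None \<or> (\<exists>x\<in>carrier G. w a = Some x)" if "a \<in> carrier R" for a
  using val that unfolding valuation_def by blast
 have "w \<zero> = None" using val unfolding valuation_def by blast
 then have "w b \<noteq> None" using b unfolding val_rel_def by (cases "w b") auto
 then obtain \<gamma> where \<gamma>: "\<gamma> \<in> carrier G" "w b = Some \<gamma>" using w[OF b(1)] by auto
 have "\<gamma> \<in> generate G {\<gamma>. \<exists>a\<in>carrier R. w a = Some \<gamma>}" using \<gamma> b by (auto intro: generate.incl)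
 then have "openin (topo R) {a\<in>carrier R. leq0 G (w a) (Some \<gamma>) \<and> w a \<noteq> Some \<gamma>}"
  using c unfolding continuous_valuation_def by blast
 moreover have "leq0 G (w a) (Some \<gamma>) \<and> w a \<noteq> Some \<gamma> \<longleftrightarrow> (b, a) \<notin> val_rel R G w" if a: "a \<in> carrier R" for a
 proof -
  have G: "ordered_comm_group G" using val unfolding valuation_def by blast
  have rf: "leq G x x" if "x \<in> carrier G" for x using G that unfolding ordered_comm_group_def by blast
  have tot: "leq G x y \<or> leq G y x" if "x \<in> carrier G" "y \<in> carrier G" for x y
   using G that unfolding ordered_comm_group_def by blast
  have anti: "x = y" if "leq G x y" "leq G y x" "x \<in> carrier G" "y \<in> carrier G" for x y
   using G that unfolding ordered_comm_group_def by blast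
  from w[OF a] show ?thesis
  proof
   assume "\<exists>x\<in>carrier G. w a = Some x"
   then obtain x where x: "x \<in> carrier G" "w a = Some x" by blast
   show ?thesis using rf[OF x(1)] tot[OF x(1) \<gamma>(1)] anti[OF _ _ x(1) \<gamma>(1)] x \<gamma> a b
    unfolding val_rel_def by auto
  qed (use \<gamma> a b in \<open>auto simp: val_rel_def\<close>)
 qed
 ultimately show ?thesis by (smt (verit, best) Collect_cong)
qed

locale cont_vrel = topring R + vrel R v for R :: "('a, 'm) top_ring_scheme" (structure) and v +
 assumes v_cont: "b \<in> carrier R ==> (b, \<zero>) \<notin> v ==> openin (topo R) {a \<in> carrier R. (b, a) \<notin> v}"
begin

lemma lt_minus_closed:
 assumes b: "b \<in> carrier R" "(b, \<zero>) \<notin> v" shows "minus_closed {a \<in> carrier R. (b, a) \<notin> v}"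
 unfolding minus_closed_def
proof (intro conjI ballI)
 show "\<zero> \<in> {a \<in> carrier R. (b, a) \<notin> v}" using b by simp
 fix x y assume xy: "x \<in> {a \<in> carrier R. (b, a) \<notin> v}" "y \<in> {a \<in> carrier R. (b, a) \<notin> v}"
 then have c: "x \<in> carrier R" "y \<in> carrier R" by auto
 have "(x \<ominus> y, x) \<in> v \<or> (x \<ominus> y, y) \<in> v"
 proof -
  have neg: "(\<ominus> y, y) \<in> v"
  proof -
   have "(\<ominus> \<one>, \<one>) \<in> v"
   proof (rule ccontr)
    assume n: "(\<ominus> \<one>, \<one>) \<notin> v"
    then have "(\<one>, \<ominus> \<one>) \<in> v" using v_total[of \<one> "\<ominus> \<one>"] by auto
    then have "(\<one> \<otimes> \<ominus> \<one>, \<ominus> \<one> \<otimes> \<ominus> \<one>) \<in> v" by (rule v_mult) simp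
    then show False using n by (simp add: l_minus r_minus)
   qed
   from v_mult[OF this c(2)] show ?thesis using c by (simp add: l_minus)
  qed
  show ?thesis
  proof (cases "(x, y) \<in> v")
   case True
   then show ?thesis using v_add[OF True neg] by (simp add: a_minus_def)
  next
   case False
   then have "(y, x) \<in> v" using v_total c by blast
   then have "(\<ominus> y, x) \<in> v" using v_trans[OF neg] by blast
   then show ?thesis using v_add[OF v_refl[OF c(1)]] by (simp add: a_minus_def)
  qed
 qed
 then show "x \<ominus> y \<in> {a \<in> carrier R. (b, a) \<notin> v}" using xy c v_trans by auto
qed auto

text \<open>If \<open>a\<close> is outside the support, then the open subgroup of the elements
  smaller than \<open>a\<close> contains the support, is closed, and misses
  \<open>a\<close>.\<close>

lemma supp_closed: "T closure_of {a \<in> carrier R. (a, \<zero>) \<in> v} \<subseteq> {a \<in> carrier R. (a, \<zero>) \<in> v}"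
proof
 fix a assume a: "a \<in> T closure_of {a \<in> carrier R. (a, \<zero>) \<in> v}"
 then have ac: "a \<in> carrier R" unfolding in_closure_of by simp
 have "(a, \<zero>) \<in> v"
 proof (rule ccontr)
  assume n: "(a, \<zero>) \<notin> v"
  let ?H = "{x \<in> carrier R. (a, x) \<notin> v}"
  have "{x \<in> carrier R. (x, \<zero>) \<in> v} \<subseteq> ?H" using n v_trans by blast
  then have "a \<in> T closure_of ?H" using a closure_of_mono by blast
  then have "a \<in> ?H" using minus_closed_closed[OF lt_minus_closed[OF ac n] v_cont[OF ac n]] by simp
  then show False using v_refl[OF ac] by simp
 qed
 then show "a \<in> {a \<in> carrier R. (a, \<zero>) \<in> v}" using ac by simp
qed

end

lemma Cont_cont_vrel:
 assumes "topring R" "v \<in> Cont R" shows "cont_vrel R v"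
proof -
 interpret topring R by fact
 obtain G :: "('a \<times> 'a) set value_group" and w where v: "v = val_rel R G w" "continuous_valuation R G w"
  using assms(2) unfolding Cont_def by blast
 have "valuation R G w" using v(2) unfolding continuous_valuation_def by blast
 then interpret vrel R v unfolding v(1) by (rule val_rel_vrel[OF is_cring])
 show ?thesis
  by unfold_locales (use continuous_val_rel[OF is_cring v(2)] v(1) in auto)
qed

subsection \<open>The valuation of a discrete valuation ring\<close>

context locally_normal
begin

text \<open>Here \<open>t\<close> generates the maximal ideal of \<open>R\<^sub>p\<close>. In \<open>tord p t n\<close> are the elements of
 \<open>t\<^sup>n R\<^sub>p\<close>.\<close>

definition tord :: "'a set => 'a => nat => 'a set" where
 "tord p t n = {a \<in> carrier R. \<exists>s\<in>carrier R - p. \<exists>b\<in>carrier R. s \<otimes> a = t [^] n \<otimes> b}"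

lemma tord_ideal:
 assumes p: "primeideal p R" and t: "t \<in> carrier R" shows "ideal (tord p t n) R"
proof (rule idealI')
 have tn: "t [^] n \<in> carrier R" using t by simp
 show "tord p t n \<subseteq> carrier R" unfolding tord_def by blast
 show "\<zero> \<in> tord p t n" unfolding tord_def using prime_compl_one[OF p] tn by (auto intro!: bexI[of _ \<one>] bexI[of _ \<zero>])
 fix a assume "a \<in> tord p t n"
 then obtain s b where a: "a \<in> carrier R" "s \<in> carrier R - p" "b \<in> carrier R" "s \<otimes> a = t [^] n \<otimes> b"
  unfolding tord_def by blast
 have sc: "s \<in> carrier R" using a by blast
 {
  fix a' assume "a' \<in> tord p t n"
  then obtain s' b' where a': "a' \<in> carrier R" "s' \<in> carrier R - p" "b' \<in> carrier R" "s' \<otimes> a' = t [^] n \<otimes> b'"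
   unfolding tord_def by blast
  have sc': "s' \<in> carrier R" using a' by blast
  have "(s \<otimes> s') \<otimes> (a \<oplus> a') = s' \<otimes> (s \<otimes> a) \<oplus> s \<otimes> (s' \<otimes> a')" using a(1) a'(1) sc sc' by algebra
  also have "\<dots> = t [^] n \<otimes> (s' \<otimes> b \<oplus> s \<otimes> b')" unfolding a(4) a'(4) using a(3) a'(3) sc sc' tn by algebra
  finally show "a \<oplus> a' \<in> tord p t n"
   unfolding tord_def using prime_compl_mult[OF p a(2) a'(2)] a(1,3) a'(1,3) sc sc'
   by (intro CollectI conjI bexI[of _ "s \<otimes> s'"] bexI[of _ "s' \<otimes> b \<oplus> s \<otimes> b'"]) simp_all
 }
 fix z assume z: "z \<in> carrier R"
 have "s \<otimes> (z \<otimes> a) = z \<otimes> (s \<otimes> a)" using a(1) sc z by algebra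
 also have "\<dots> = t [^] n \<otimes> (z \<otimes> b)" unfolding a(4) using a(3) z tn by algebra
 finally show "z \<otimes> a \<in> tord p t n" unfolding tord_def using a z by (intro CollectI conjI bexI[of _ s] bexI[of _ "z \<otimes> b"]) auto
qed

lemma tord_0: "primeideal p R ==> tord p t 0 = carrier R"
 unfolding tord_def using prime_compl_one by (auto intro!: bexI[of _ \<one>])

lemma tord_Suc:
 assumes t: "t \<in> carrier R" shows "tord p t (Suc n) \<subseteq> tord p t n"
proof
 fix a assume "a \<in> tord p t (Suc n)"
 then obtain s b where a: "a \<in> carrier R" "s \<in> carrier R - p" "b \<in> carrier R" "s \<otimes> a = t [^] Suc n \<otimes> b"
  unfolding tord_def by blast
 have "s \<otimes> a = t [^] n \<otimes> (t \<otimes> b)" using a t by (simp add: m_assoc)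
 then show "a \<in> tord p t n" unfolding tord_def using a t by blast
qed

lemma tord_antimono: "t \<in> carrier R ==> m \<le> n ==> tord p t n \<subseteq> tord p t m"
 by (rule lift_Suc_antimono_le[of "tord p t"]) (use tord_Suc in auto)

end

text \<open>The data delivered by \<open>pole_divisor\<close>: up to the factor \<open>u\<close>,
  invertible at \<open>p\<close>, every element of \<open>p\<close> is a multiple of
  \<open>t\<close>.\<close>

locale dvr_prime = locally_normal +
 fixes p :: "'a set" and t u :: 'a
 assumes p: "primeideal p R" "I \<subseteq> p" and t: "t \<in> p" and u: "u \<in> carrier R - p"
  and unif: "\<And>c. c \<in> p ==> \<exists>d\<in>carrier R. u \<otimes> c = t \<otimes> d"
begin

abbreviation N where "N \<equiv> tord p t"

lemma pI: "ideal p R" by (rule primeideal.axioms(1)[OF p(1)])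
lemma tc: "t \<in> carrier R" by (rule ideal_carr[OF pI t])
lemma tpow: "t [^] (n::nat) \<in> carrier R" using tc by simp
lemma uc: "u \<in> carrier R" using u by blast
lemma NI: "ideal (N n) R" by (rule tord_ideal[OF p(1) tc])

lemma loc_zero_mult: "loc_zero p a ==> a \<in> carrier R ==> c \<in> carrier R ==> loc_zero p (a \<otimes> c)"
proof -
 assume a: "loc_zero p a" "a \<in> carrier R" and c: "c \<in> carrier R"
 then obtain s where s: "s \<in> carrier R - p" "s \<otimes> a = \<zero>" unfolding loc_zero_def by blast
 have "s \<otimes> (a \<otimes> c) = (s \<otimes> a) \<otimes> c" using s(1) a(2) c by (simp add: m_assoc)
 then have "s \<otimes> (a \<otimes> c) = \<zero>" unfolding s(2) using c by simp
 then show ?thesis using s unfolding loc_zero_def by blast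
qed

lemma loc_zero_unit: "s \<in> carrier R - p ==> \<not> loc_zero p s"
proof
 assume s: "s \<in> carrier R - p" and "loc_zero p s"
 then obtain s' where "s' \<in> carrier R - p" "s' \<otimes> s = \<zero>" unfolding loc_zero_def by blast
 then show False using prime_compl_mult[OF p(1), of s' s] s ideal_zero[OF pI] by auto
qed

text \<open>If \<open>t\<close> vanished at \<open>p\<close>, so would all of \<open>p\<close>,
  including the \<open>f i\<close> that does not.\<close>

lemma t_nonzero: "\<not> loc_zero p (t [^] (n::nat))"
proof
 assume "loc_zero p (t [^] n)"
 then have z: "loc_zero p t" by (rule loc_zero_pow[OF p tc])
 obtain i where i: "i < r" "\<not> loc_zero p (f i)" using nz[OF p] by blast
 have fp: "f i \<in> p" using f_I[OF i(1)] p(2) by blast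
 obtain d where d: "d \<in> carrier R" "u \<otimes> f i = t \<otimes> d" using unif[OF fp] by blast
 have "loc_zero p (u \<otimes> f i)" unfolding d(2) by (rule loc_zero_mult[OF z tc d(1)])
 then show False using dom[OF p uc f_carr[OF i(1)]] loc_zero_unit[OF u] i(2) by blast
qed

lemma N_1: "p \<subseteq> N (Suc 0)"
proof
 fix c assume c: "c \<in> p"
 obtain d where "d \<in> carrier R" "u \<otimes> c = t \<otimes> d" using unif[OF c] by blast
 then show "c \<in> N (Suc 0)" unfolding tord_def using u tc ideal_carr[OF pI c] by auto
qed

lemma N_mult:
 assumes "a \<in> N m" "b \<in> N n" shows "a \<otimes> b \<in> N (m + n)"
proof -
 obtain s c where a: "a \<in> carrier R" "s \<in> carrier R - p" "c \<in> carrier R" "s \<otimes> a = t [^] m \<otimes> c"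
  using assms(1) unfolding tord_def by blast
 obtain s' c' where b: "b \<in> carrier R" "s' \<in> carrier R - p" "c' \<in> carrier R" "s' \<otimes> b = t [^] n \<otimes> c'"
  using assms(2) unfolding tord_def by blast
 have "s \<otimes> s' \<otimes> (a \<otimes> b) = (s \<otimes> a) \<otimes> (s' \<otimes> b)" using a(1,2) b(1,2) by (simp add: m_ac)
 also have "\<dots> = t [^] (m + n) \<otimes> (c \<otimes> c')"
  unfolding a(4) b(4) using a(1,3) b(1,3) tpow tc by (simp add: nat_pow_mult[symmetric] m_ac)
 finally show ?thesis unfolding tord_def using prime_compl_mult[OF p(1) a(2) b(2)] a(1,3) b(1,3)
  by (intro CollectI conjI bexI[of _ "s \<otimes> s'"] bexI[of _ "c \<otimes> c'"]) simp_all
qed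

lemma Ip_N: "Ip n \<subseteq> N n"
proof (induction n)
 case 0
 then show ?case using tord_0[OF p(1)] by simp
next
 case (Suc n)
 show ?case
 proof
  fix x assume "x \<in> Ip (Suc n)"
  then have "x \<in> Ip n \<cdot> I" by simp
  then show "x \<in> N (Suc n)"
  proof (induction rule: ideal_prod.induct)
   case (prod a b)
   then have "a \<in> N n" "b \<in> N (Suc 0)" using Suc p(2) N_1 by auto
   then show ?case using N_mult by fastforce
  next
   case (sum a b)
   then show ?case using ideal_add[OF NI] by blast
  qed
 qed
qed

text \<open>Krull's theorem once more, now for the ideal generated by \<open>t\<close>
  alone.\<close>

lemma N_Inter: "a \<in> carrier R ==> (\<And>n. a \<in> N n) ==> loc_zero p a"
proof -
 assume a: "a \<in> carrier R" "\<And>n. a \<in> N n"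
 define g where "g = (\<lambda>_::nat. t)"
 interpret P: fg_ideal R "PIdl t" 1 g
 proof (intro fg_ideal.intro fg_ideal_axioms.intro is_cring noeth)
  show "g i \<in> carrier R" for i unfolding g_def by (rule tc)
  show "PIdl t = genideal R (g ` {..<1})" unfolding g_def using cgenideal_eq_genideal[OF tc] by (simp add: lessThan_Suc)
 qed
 have tI: "t [^] n \<in> P.Ip n" for n :: nat
  by (rule ideal_power_pow[OF P.I_ideal]) (use cgenideal_self[OF tc] in blast)
 have "\<exists>s\<in>carrier R - p. s \<otimes> a \<in> {\<zero>}"
 proof (rule P.krull_intersection[OF p(1) _ zeroideal a(1)])
  show "PIdl t \<subseteq> p" using t ideal_lmult[OF pI] unfolding cgenideal_def by blast
  fix n :: nat
  obtain s b where s: "s \<in> carrier R - p" "b \<in> carrier R" "s \<otimes> a = t [^] n \<otimes> b"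
   using a(2)[of n] unfolding tord_def by blast
  have "s \<otimes> a \<in> P.Ip n" unfolding s(3) by (rule ideal_rmult[OF P.Ip_ideal tI s(2)])
  moreover have "s \<otimes> a \<ominus> \<zero> = s \<otimes> a" using s(1) a(1) by (simp add: a_minus_def)
  ultimately show "\<exists>s\<in>carrier R - p. \<exists>j\<in>{\<zero>}. s \<otimes> a \<ominus> j \<in> P.Ip n"
   using s(1) by (intro bexI[of _ s] bexI[of _ \<zero>]) simp_all
 qed
 then show ?thesis unfolding loc_zero_def by blast
qed

text \<open>Cancelling \<open>t^n\<close> in the local domain would otherwise exhibit an element
  outside \<open>p\<close> as a multiple of \<open>t\<close>.\<close>

lemma N_strict:
 assumes s: "s \<in> carrier R - p" and b: "b \<in> carrier R - p" and a: "a \<in> carrier R" "s \<otimes> a = t [^] (n::nat) \<otimes> b"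
 shows "a \<notin> N (Suc n)"
proof
 assume "a \<in> N (Suc n)"
 then obtain s' c where c: "s' \<in> carrier R - p" "c \<in> carrier R" "s' \<otimes> a = t [^] Suc n \<otimes> c"
  unfolding tord_def by blast
 have cc: "s \<in> carrier R" "s' \<in> carrier R" "b \<in> carrier R" using s c b by auto
 have "t [^] n \<otimes> (s' \<otimes> b) = s' \<otimes> (s \<otimes> a)" unfolding a(2) using cc tpow[of n] by (simp add: m_ac)
 also have "\<dots> = s \<otimes> (s' \<otimes> a)" using cc a(1) by (simp add: m_ac)
 also have "\<dots> = t [^] n \<otimes> (s \<otimes> t \<otimes> c)" unfolding c(3) using cc c(2) tpow[of n] tc by (simp add: m_ac)
 finally have eq: "t [^] n \<otimes> (s' \<otimes> b) = t [^] n \<otimes> (s \<otimes> t \<otimes> c)" .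
 let ?e = "s' \<otimes> b \<ominus> s \<otimes> t \<otimes> c"
 have ec: "?e \<in> carrier R" using cc c(2) tc by simp
 have "t [^] n \<otimes> ?e = t [^] n \<otimes> (s' \<otimes> b) \<ominus> t [^] n \<otimes> (s \<otimes> t \<otimes> c)"
  using cc c(2) tc tpow[of n] by algebra
 then have "t [^] n \<otimes> ?e = \<zero>" unfolding eq using cc c(2) tc tpow[of n] by (simp add: minus_self)
 then have "loc_zero p (t [^] n \<otimes> ?e)" unfolding loc_zero_def using prime_compl_one[OF p(1)] by (intro bexI[of _ \<one>]) auto
 then have "loc_zero p ?e" using dom[OF p tpow ec] t_nonzero by blast
 moreover have "?e \<in> carrier R - p"
 proof -
  have "s \<otimes> t \<otimes> c \<in> p" using ideal_rmult[OF pI ideal_lmult[OF pI t cc(1)] c(2)] .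
  then have "?e \<in> p ==> s' \<otimes> b \<in> p" using ideal_subst[OF pI] cc by blast
  then show ?thesis using prime_compl_mult[OF p(1) c(1) b] ec by blast
 qed
 ultimately show False using loc_zero_unit by blast
qed

text \<open>The order of vanishing along \<open>p\<close>; it carries no meaning where
  \<open>infin\<close> holds.\<close>

definition od :: "'a => nat" where
 "od a = (LEAST n. a \<notin> N (Suc n))"

definition infin :: "'a => bool" where "infin a \<longleftrightarrow> (\<forall>n. a \<in> N n)"

lemma od_frac:
 assumes a: "a \<in> carrier R" and n: "a \<in> N n" "a \<notin> N (Suc n)"
 shows "\<exists>s\<in>carrier R - p. \<exists>b\<in>carrier R - p. s \<otimes> a = t [^] n \<otimes> b"
proof -
 obtain s b where s: "s \<in> carrier R - p" "b \<in> carrier R" "s \<otimes> a = t [^] n \<otimes> b"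
  using n(1) unfolding tord_def by blast
 have "b \<notin> p"
 proof
  assume "b \<in> p"
  then obtain d where d: "d \<in> carrier R" "u \<otimes> b = t \<otimes> d" using unif by blast
  have "u \<otimes> s \<otimes> a = u \<otimes> (s \<otimes> a)" using s(1) a uc by (simp add: m_assoc)
  also have "\<dots> = t [^] n \<otimes> (u \<otimes> b)" unfolding s(3) using s(2) uc tpow[of n] by (simp add: m_ac)
  also have "\<dots> = t [^] Suc n \<otimes> d" unfolding d(2) using d tc tpow[of n] by (simp add: m_assoc)
  finally show False using n(2) prime_compl_mult[OF p(1) u s(1)] d(1) a unfolding tord_def by blast
 qed
 then show ?thesis using s by blast
qed

lemma od_mem:
 assumes a: "a \<in> carrier R" and fin: "\<not> infin a"
 shows "a \<in> N (od a)" "a \<notin> N (Suc (od a))"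
proof -
 have ex: "\<exists>n. a \<notin> N (Suc n)"
 proof (rule ccontr)
  assume "\<not> ?thesis"
  then have "a \<in> N n" for n using tord_0[OF p(1)] a by (cases n) auto
  then show False using fin unfolding infin_def by blast
 qed
 show "a \<notin> N (Suc (od a))" unfolding od_def by (rule LeastI_ex[OF ex])
 show "a \<in> N (od a)"
 proof (cases "od a")
  case 0
  then show ?thesis using tord_0[OF p(1)] a by simp
 next
  case (Suc m)
  then have "m < od a" by simp
  then show ?thesis using not_less_Least[of m "\<lambda>n. a \<notin> N (Suc n)"] Suc unfolding od_def by auto
 qed
qed

lemma od_ge: "a \<in> carrier R ==> \<not> infin a ==> a \<in> N n \<longleftrightarrow> n \<le> od a"
proof -
 assume a: "a \<in> carrier R" "\<not> infin a"
 note m = od_mem[OF a]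
 show ?thesis
 proof
  assume "a \<in> N n"
  then show "n \<le> od a" using m(2) tord_antimono[OF tc, of "Suc (od a)" n] by (meson not_less_eq_eq subsetD)
 next
  assume "n \<le> od a"
  then show "a \<in> N n" using m(1) tord_antimono[OF tc] by blast
 qed
qed

lemma od_eq:
 assumes "a \<in> carrier R" "s \<in> carrier R - p" "b \<in> carrier R - p" "s \<otimes> a = t [^] n \<otimes> b"
 shows "\<not> infin a" "od a = n"
proof -
 have ns: "a \<notin> N (Suc n)" by (rule N_strict[OF assms(2,3,1,4)])
 then show fin: "\<not> infin a" unfolding infin_def by blast
 have "a \<in> N n" unfolding tord_def using assms by blast
 then show "od a = n" using od_ge[OF assms(1) fin, of n] od_ge[OF assms(1) fin, of "Suc n"] ns by simp
qed

lemma od_mult: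
 assumes a: "a \<in> carrier R" "b \<in> carrier R"
 shows "infin (a \<otimes> b) \<longleftrightarrow> infin a \<or> infin b" "\<not> infin a ==> \<not> infin b ==> od (a \<otimes> b) = od a + od b"
proof -
 have *: "\<not> infin (a \<otimes> b) \<and> od (a \<otimes> b) = od a + od b" if fin: "\<not> infin a" "\<not> infin b"
 proof -
  obtain s c where s: "s \<in> carrier R - p" "c \<in> carrier R - p" "s \<otimes> a = t [^] od a \<otimes> c"
   using od_frac[OF a(1) od_mem[OF a(1) fin(1)]] by blast
  obtain s' c' where s': "s' \<in> carrier R - p" "c' \<in> carrier R - p" "s' \<otimes> b = t [^] od b \<otimes> c'"
   using od_frac[OF a(2) od_mem[OF a(2) fin(2)]] by blast
  have cc: "s \<in> carrier R" "s' \<in> carrier R" "c \<in> carrier R" "c' \<in> carrier R" using s s' by auto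
  have "s \<otimes> s' \<otimes> (a \<otimes> b) = (s \<otimes> a) \<otimes> (s' \<otimes> b)" using cc a by (simp add: m_ac)
  also have "\<dots> = t [^] (od a + od b) \<otimes> (c \<otimes> c')"
   unfolding s(3) s'(3) using cc tpow tc by (simp add: nat_pow_mult[symmetric] m_ac)
  finally show ?thesis
   using od_eq[of "a \<otimes> b" "s \<otimes> s'" "c \<otimes> c'" "od a + od b"] a
    prime_compl_mult[OF p(1) s(1) s'(1)] prime_compl_mult[OF p(1) s(2) s'(2)] by simp
 qed
 have "infin (a \<otimes> b)" if "infin a \<or> infin b"
  using that ideal_rmult[OF NI _ a(2)] ideal_lmult[OF NI _ a(1)] unfolding infin_def by blast
 then show "infin (a \<otimes> b) \<longleftrightarrow> infin a \<or> infin b" using * by blast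
 show "\<not> infin a ==> \<not> infin b ==> od (a \<otimes> b) = od a + od b" using * by blast
qed

lemma od_one: "\<not> infin \<one>" "od \<one> = 0"
 using od_eq[of \<one> \<one> \<one> 0] prime_compl_one[OF p(1)] by auto

lemma od_u: "\<not> infin u" "od u = 0"
 using od_eq[of u \<one> u 0] prime_compl_one[OF p(1)] u by auto

lemma od_t_pow: "\<not> infin (t [^] n)" "od (t [^] (n::nat)) = n"
 using od_eq[of "t [^] n" \<one> \<one> n] prime_compl_one[OF p(1)] tpow[of n] by auto

lemma infin_zero: "infin \<zero>"
 unfolding infin_def using ideal_zero[OF NI] by blast

text \<open>The value group is the additive group of integers, encoded by pairs of powers of \<open>t\<close>.\<close>

definition enc :: "int => ('a \<times> 'a) set" where
 "enc k = {(t [^] nat k, t [^] nat (- k))}"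

lemma enc_inj: "inj enc"
proof (rule injI)
 fix k l assume "enc k = enc l"
 then have "t [^] nat k = t [^] nat l" "t [^] nat (- k) = t [^] nat (- l)" unfolding enc_def by auto
 then have "nat k = nat l" "nat (- k) = nat (- l)" using od_t_pow(2) by metis+
 then show "k = l" by linarith
qed

definition dec :: "('a \<times> 'a) set => int" where "dec = the_inv enc"

lemma dec_enc [simp]: "dec (enc k) = k"
 unfolding dec_def by (rule the_inv_f_f[OF enc_inj])

definition vgroup :: "('a \<times> 'a) set value_group" where
 "vgroup = \<lparr>carrier = range enc, mult = (\<lambda>x y. enc (dec x + dec y)), one = enc 0, leq = (\<lambda>x y. dec x \<le> dec y)\<rparr>"

text \<open>The sign makes high order mean small value. The elements of infinite order, which are
  those that vanish at \<open>p\<close>, form the support.\<close>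

definition dval :: "'a => ('a \<times> 'a) set option" where
 "dval a = (if infin a then None else Some (enc (- int (od a))))"

lemma vgroup_ordered: "ordered_comm_group vgroup"
proof -
 have "comm_group vgroup"
 proof (rule comm_groupI)
  show "\<exists>y\<in>carrier vgroup. y \<otimes>\<^bsub>vgroup\<^esub> x = \<one>\<^bsub>vgroup\<^esub>" if "x \<in> carrier vgroup" for x
   using that by (auto simp: vgroup_def intro!: exI[of _ "- dec x"])
 qed (auto simp: vgroup_def add.commute add.left_commute simp del: ex_simps)
 then show ?thesis unfolding ordered_comm_group_def by (auto simp: vgroup_def)
qed

lemma dval_valuation: "valuation R vgroup dval"
 unfolding valuation_def
proof (intro conjI ballI)
 show "ordered_comm_group vgroup" by (rule vgroup_ordered)
 show "dval \<zero> = None" unfolding dval_def using infin_zero by simp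
 show "dval \<one> = Some \<one>\<^bsub>vgroup\<^esub>" unfolding dval_def using od_one by (simp add: vgroup_def)
 fix a assume a: "a \<in> carrier R"
 show "dval a \<in> insert None (Some ` carrier vgroup)" unfolding dval_def by (auto simp: vgroup_def)
 fix b assume b: "b \<in> carrier R"
 show "dval (a \<otimes> b) = mult0 vgroup (dval a) (dval b)"
  unfolding dval_def using od_mult[OF a b]
  by (simp add: vgroup_def) (intro impI arg_cong[of _ _ enc], simp)
 have 1: "infin (a \<oplus> b)" if "infin a" "infin b"
  unfolding infin_def using that ideal_add[OF NI, of a _ b] by (simp add: infin_def)
 have 2: "od a \<le> od (a \<oplus> b) \<or> infin b \<or> od b < od a" if "\<not> infin a" "\<not> infin (a \<oplus> b)"
 proof (cases "infin b \<or> od b < od a")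
  case False
  then have "b \<in> N (od a)" using od_ge[OF b] by simp
  then have "a \<oplus> b \<in> N (od a)" using ideal_add[OF NI od_mem(1)[OF a that(1)]] by blast
  then show ?thesis using od_ge[of "a \<oplus> b"] a b that by simp
 qed auto
 have 3: "od a \<le> od (a \<oplus> b)" if "\<not> infin a" "infin b" "\<not> infin (a \<oplus> b)"
 proof -
  have "b \<in> N (od a)" using that unfolding infin_def by blast
  then have "a \<oplus> b \<in> N (od a)" using ideal_add[OF NI od_mem(1)[OF a that(1)]] by blast
  then show ?thesis using od_ge[of "a \<oplus> b"] a b that by simp
 qed
 have 4: "od b \<le> od (a \<oplus> b)" if "\<not> infin b" "infin a \<or> od b < od a" "\<not> infin (a \<oplus> b)"
 proof -
  have "a \<in> N (od b)" using that od_ge[OF a, of "od b"] by (cases "infin a") (auto simp: infin_def)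
  then have "a \<oplus> b \<in> N (od b)" using ideal_add[OF NI _ od_mem(1)[OF b that(1)]] by blast
  then show ?thesis using od_ge[of "a \<oplus> b"] a b that by simp
 qed
 show "leq0 vgroup (dval (a \<oplus> b)) (dval a) \<or> leq0 vgroup (dval (a \<oplus> b)) (dval b)"
  using 1 2 3 4 by (cases "infin (a \<oplus> b)"; cases "infin a"; cases "infin b") (auto simp: dval_def vgroup_def)
qed

end

locale dvr_point = adic R I r f + dvr_prime R I r f p t u
 for R :: "('a, 'm) top_ring_scheme" (structure) and I r f p t u
begin

lemma dval_continuous: "continuous_valuation R vgroup dval"
 unfolding continuous_valuation_def
proof (intro conjI ballI dval_valuation)
 fix \<gamma> assume g: "\<gamma> \<in> generate vgroup {\<gamma>. \<exists>a\<in>carrier R. dval a = Some \<gamma>}"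
 have sub: "{\<gamma>. \<exists>a\<in>carrier R. dval a = Some \<gamma>} \<subseteq> carrier vgroup"
  unfolding dval_def vgroup_def by auto
 have "comm_group vgroup" using vgroup_ordered unfolding ordered_comm_group_def by (rule conjunct1)
 then have "\<gamma> \<in> carrier vgroup"
  by (intro group.generate_in_carrier[OF _ sub g] comm_group.axioms(2))
 then obtain k where k: "\<gamma> = enc k" unfolding vgroup_def by auto
 \<comment> \<open>A value below \<open>enc k\<close> means order above \<open>- k\<close>, that is,
   at least \<open>1 - k\<close>. For positive \<open>k\<close> the truncation by \<open>nat\<close>
   yields \<open>N 0\<close>, the whole ring, as it should.\<close>
 have "leq0 vgroup (dval a) (Some \<gamma>) \<and> dval a \<noteq> Some \<gamma> \<longleftrightarrow> a \<in> N (nat (1 - k))" if a: "a \<in> carrier R" for a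
 proof (cases "infin a")
  case True
  then show ?thesis unfolding dval_def infin_def by simp
 next
  case False
  have "enc (- int (od a)) = enc k \<longleftrightarrow> - int (od a) = k" using enc_inj by (simp add: inj_eq)
  then show ?thesis unfolding od_ge[OF a False] k using False by (auto simp: dval_def vgroup_def)
 qed
 moreover have "N n \<subseteq> carrier R" for n unfolding tord_def by blast
 ultimately have "{a\<in>carrier R. leq0 vgroup (dval a) (Some \<gamma>) \<and> dval a \<noteq> Some \<gamma>} = N (nat (1 - k))"
  by blast
 then show "openin (topo R) {a\<in>carrier R. leq0 vgroup (dval a) (Some \<gamma>) \<and> dval a \<noteq> Some \<gamma>}"
  using open_ideal[OF NI Ip_N] by simp
qed

lemma dval_Spa: "val_rel R vgroup dval \<in> Spa R (carrier R)"
proof -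
 have "(a, \<one>) \<in> val_rel R vgroup dval" if "a \<in> carrier R" for a
  using that od_one unfolding val_rel_def dval_def by (auto simp: vgroup_def)
 then show ?thesis unfolding Spa_def Cont_def using dval_continuous by blast
qed

lemma dval_u_t: "(u, t) \<notin> val_rel R vgroup dval"
 using od_u od_t_pow[of 1] tc unfolding val_rel_def dval_def by (auto simp: vgroup_def)

lemma dval_nonzero: "\<exists>i<r. (f i, \<zero>) \<notin> val_rel R vgroup dval"
proof -
 obtain i where i: "i < r" "\<not> loc_zero p (f i)" using nz[OF p] by blast
 have "\<not> infin (f i)" using N_Inter[OF f_carr[OF i(1)]] i(2) unfolding infin_def by blast
 then have "(f i, \<zero>) \<notin> val_rel R vgroup dval" using infin_zero unfolding val_rel_def dval_def by simp
 then show ?thesis using i(1) by blast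
qed

end

section \<open>Adic spectra\<close>

locale valued = trspace Y for Y :: "('y, 'b, 'm) vspace_scheme" +
 assumes valued: "valued_space Y"
begin

abbreviation val where "val \<equiv> val_at Y"

lemma val_at_valuation:
 assumes "op V" "y \<in> V"
 shows "\<exists>(G :: (('y set \<times> 'b) set \<times> ('y set \<times> 'b) set) set value_group) w.
  valuation (Sec V) G w \<and> val V y = val_rel (Sec V) G w"
proof -
 have "y \<in> topspace (under Y)" using op_sub assms by blast
 then have "stalk_val Y y \<in> Spv (stalk Y y)" using valued unfolding valued_space_def by blast
 then obtain G :: "(('y set \<times> 'b) set \<times> ('y set \<times> 'b) set) set value_group" and w
  where w: "stalk_val Y y = val_rel (stalk Y y) G w" "valuation (stalk Y y) G w"
  unfolding Spv_def by blast
 have "valuation (Sec V) G (w \<circ> germ Y y V)"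
  by (rule valuation_pullback[OF w(2) germ_hom[OF assms]]) (simp add: stalk_zero[OF assms])
 moreover have "val V y = val_rel (Sec V) G (w \<circ> germ Y y V)"
  unfolding val_at_def val_rel_def w(1) using stalk_carr[OF assms] by auto
 ultimately show ?thesis by blast
qed

lemma val_vrel: "op V ==> y \<in> V ==> vrel (Sec V) (val V y)"
 using val_at_valuation[of V y] val_rel_vrel[OF sec_cring] by fastforce

lemma val_res:
 assumes "op V" "op W" "W \<subseteq> V" "y \<in> W" "a \<in> carrier (Sec V)" "b \<in> carrier (Sec V)"
 shows "(res V W a, res V W b) \<in> val W y \<longleftrightarrow> (a, b) \<in> val V y"
proof -
 have "germ Y y W (res V W c) = germ Y y V c" if "c \<in> carrier (Sec V)" for c
  by (rule germ_res[OF assms(1,4) that assms(2,3)])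
 then show ?thesis unfolding val_at_def using assms by simp
qed

end

locale spa_chart = A: adic A I r f + valued Y
 for A :: "('a, 'n) top_ring_scheme" (structure) and I r f and Y :: "('y, 'b, 'm) vspace_scheme" +
 fixes V :: "'y set" and \<psi> :: "'a => 'b"
 assumes chart: "Spa_chart Y V A \<psi>" and r_pos: "0 < r"
begin

definition pt :: "'y => 'a rel" where
 "pt y = {(a, b). a \<in> carrier A \<and> b \<in> carrier A \<and> (\<psi> a, \<psi> b) \<in> val V y}"

definition Rt :: "'a set => 'a => 'y set" where
 "Rt T s = {y \<in> V. pt y \<in> rational_subset A (carrier A) T s}"

lemma opV: "op V" and psi_hom: "\<psi> \<in> ring_hom A (Sec V)"
 and homeo: "homeomorphic_map (subtopology (under Y) V) (Spa_topology A (carrier A)) pt"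
 and Rt_completion: "rational_datum A T s ==>
  completed_rat_loc A T s (Sec (Rt T s)) (\<lambda>a. res V (Rt T s) (\<psi> a))"
 and Rt_Cont: "rational_datum A T s ==> y \<in> Rt T s ==> val (Rt T s) y \<in> Cont (Sec (Rt T s))"
 using chart unfolding Spa_chart_def Let_def pt_def Rt_def by auto

lemma topspace_V: "topspace (subtopology (under Y) V) = V"
 using op_sub[OF opV] by auto

lemma psi_carr [simp]: "a \<in> carrier A ==> \<psi> a \<in> carrier (Sec V)"
 using ring_hom_closed[OF psi_hom] .

lemma Spa_cont: "v \<in> Spa A (carrier A) ==> cont_vrel A v"
 using Cont_cont_vrel[OF A.topring_axioms] unfolding Spa_def by blast

lemma topspace_Spa: "topspace (Spa_topology A (carrier A)) = Spa A (carrier A)"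
proof -
 have "v \<in> \<Union>{{v \<in> Spa A (carrier A). (a, b) \<in> v \<and> (b, \<zero>) \<notin> v} | a b. a \<in> carrier A \<and> b \<in> carrier A}"
  if v: "v \<in> Spa A (carrier A)" for v
 proof -
  interpret v: cont_vrel A v by (rule Spa_cont[OF v])
  show ?thesis using v v.v_one v.v_refl[OF A.one_closed] by blast
 qed
 then show ?thesis unfolding Spa_topology_def topology_generated_by_topspace by blast
qed

lemma pt_image: "pt ` V = Spa A (carrier A)"
 using homeomorphic_imp_surjective_map[OF homeo] unfolding topspace_V topspace_Spa .

lemma pt_Spa: "y \<in> V ==> pt y \<in> Spa A (carrier A)"
 using pt_image by blast

lemma pt_cont: "y \<in> V ==> cont_vrel A (pt y)"
 by (rule Spa_cont[OF pt_Spa])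

lemma pt_le_one: "y \<in> V ==> a \<in> carrier A ==> (a, \<one>) \<in> pt y"
 using pt_Spa unfolding Spa_def by blast

lemma Rt_mem: "y \<in> Rt T s \<longleftrightarrow> y \<in> V \<and> (\<forall>t\<in>T. (t, s) \<in> pt y) \<and> (s, \<zero>) \<notin> pt y"
 unfolding Rt_def rational_subset_def using pt_Spa by blast

lemma Rt_V: "Rt T s \<subseteq> V"
 unfolding Rt_def by blast

lemma open_pt:
 assumes "openin (Spa_topology A (carrier A)) B" shows "op {y \<in> V. pt y \<in> B}"
 using openin_continuous_map_preimage[OF homeomorphic_imp_continuous_map[OF homeo] assms]
 unfolding topspace_V openin_open_subtopology[OF opV] by blast

lemma op_Rt:
 assumes T: "finite T" "T \<noteq> {}" "T \<subseteq> carrier A" and s: "s \<in> carrier A" shows "op (Rt T s)"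
proof -
 have "op {y \<in> V. pt y \<in> {v \<in> Spa A (carrier A). (t, s) \<in> v \<and> (s, \<zero>) \<notin> v}}" if "t \<in> T" for t
  by (rule open_pt, unfold Spa_topology_def, rule topology_generated_by_Basis) (use T(3) that s in blast)
 then have "op (\<Inter>t\<in>T. {y \<in> V. pt y \<in> {v \<in> Spa A (carrier A). (t, s) \<in> v \<and> (s, \<zero>) \<notin> v}})"
  using T(1,2) by (intro openin_Inter) auto
 moreover have "(\<Inter>t\<in>T. {y \<in> V. pt y \<in> {v \<in> Spa A (carrier A). (t, s) \<in> v \<and> (s, \<zero>) \<notin> v}}) = Rt T s"
  unfolding set_eq_iff Rt_mem using pt_Spa T(2) by blast
 ultimately show ?thesis by simp
qed

section \<open>Rational subsets cut out by powers of the ideal of definition\<close>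

definition gens :: "nat => 'a set" where
 "gens d = (SOME T. finite T \<and> T \<noteq> {} \<and> T \<subseteq> carrier A \<and> genideal A T = A.Ip d)"

text \<open>The element \<open>0\<close> is adjoined because the numerators of a rational datum must
  not be empty.\<close>

lemma gens: "finite (gens d)" "gens d \<noteq> {}" "gens d \<subseteq> carrier A" "genideal A (gens d) = A.Ip d"
proof -
 obtain T where T: "T \<subseteq> carrier A" "finite T" "A.Ip d = genideal A T"
  using noetherian_ring.finetely_gen[OF A.noeth A.Ip_ideal] by blast
 have sub: "insert \<zero> T \<subseteq> carrier A" using T(1) by simp
 have "genideal A (insert \<zero> T) = genideal A T"
 proof
  have J: "ideal (genideal A T) A" by (rule A.genideal_ideal[OF T(1)])
  show "genideal A (insert \<zero> T) \<subseteq> genideal A T"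
   using A.genideal_self[OF T(1)] A.ideal_zero[OF J] by (intro A.genideal_minimal[OF J]) blast
  show "genideal A T \<subseteq> genideal A (insert \<zero> T)"
   using A.genideal_self[OF sub] by (intro A.genideal_minimal[OF A.genideal_ideal[OF sub]]) blast
 qed
 then have "\<exists>T. finite T \<and> T \<noteq> {} \<and> T \<subseteq> carrier A \<and> genideal A T = A.Ip d"
  using T sub by (intro exI[of _ "insert \<zero> T"]) simp
 from someI_ex[OF this] show "finite (gens d)" "gens d \<noteq> {}" "gens d \<subseteq> carrier A" "genideal A (gens d) = A.Ip d"
  unfolding gens_def by auto
qed

text \<open>The locus where \<open>s\<close> is nonzero and dominates \<open>I^d\<close>. For
  \<open>d = 0\<close> these are the preimages of the basic open sets of the formal spectrum, for
  \<open>d = 1\<close> and \<open>s = f i\<close> the charts of the blowup. Under intersection the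
  \<open>d\<close> add up and the \<open>s\<close> multiply, so one family serves for all of them
  and their overlaps.\<close>

abbreviation Q where "Q d s \<equiv> Rt (gens d) s"
abbreviation ph where "ph d s a \<equiv> res V (Q d s) (\<psi> a)"
abbreviation Fl where "Fl d s \<equiv> filt A I d s (Sec (Q d s)) (ph d s)"

lemma gens_datum: "s \<in> carrier A ==> rational_datum A (gens d) s"
 unfolding rational_datum_def gens(4) using gens(1-3) A.open_Ip by blast

lemma Q_mem:
 assumes s: "s \<in> carrier A"
 shows "y \<in> Q d s \<longleftrightarrow> y \<in> V \<and> (\<forall>x\<in>A.Ip d. (x, s) \<in> pt y) \<and> (s, \<zero>) \<notin> pt y"
proof -
 have "(\<forall>x\<in>gens d. (x, s) \<in> pt y) \<longleftrightarrow> (\<forall>x\<in>A.Ip d. (x, s) \<in> pt y)" if y: "y \<in> V"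
 proof
  interpret v: cont_vrel A "pt y" by (rule pt_cont[OF y])
  assume "\<forall>x\<in>gens d. (x, s) \<in> pt y"
  then have "genideal A (gens d) \<subseteq> {a \<in> carrier A. (a, s) \<in> pt y}"
   using gens(3)[of d] by (intro A.genideal_minimal v.le_ideal s pt_le_one y) auto
  then show "\<forall>x\<in>A.Ip d. (x, s) \<in> pt y" unfolding gens(4) by blast
 next
  assume "\<forall>x\<in>A.Ip d. (x, s) \<in> pt y"
  then show "\<forall>x\<in>gens d. (x, s) \<in> pt y" using A.genideal_self[OF gens(3)[of d]] unfolding gens(4) by blast
 qed
 then show ?thesis unfolding Rt_mem by blast
qed

lemma op_Q: "s \<in> carrier A ==> op (Q d s)"
 by (rule op_Rt[OF gens(1-3)])

lemma ph_hom: "s \<in> carrier A ==> ph d s \<in> ring_hom A (Sec (Q d s))"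
 using ring_hom_trans[OF psi_hom res_hom[OF opV op_Q Rt_V]] by (simp add: o_def)

lemma Q_completion:
 assumes "s \<in> A.Ip d" shows "\<exists>g. rat_completion A I r f (gens d) s d (Sec (Q d s)) (ph d s) g"
 by (rule rat_completionI[OF A.adic_axioms gens(3,4) assms Rt_completion[OF gens_datum]])
  (rule A.Ip_carr[OF assms])

definition comp where
 "comp d s = (SOME g. rat_completion A I r f (gens d) s d (Sec (Q d s)) (ph d s) g)"

lemma Q_comp: "s \<in> A.Ip d ==> rat_completion A I r f (gens d) s d (Sec (Q d s)) (ph d s) (comp d s)"
 unfolding comp_def by (rule someI_ex[OF Q_completion])

text \<open>Values on \<open>I^(d+d')\<close> are bounded by products of values on
  \<open>I^d\<close> and \<open>I^d'\<close>. Conversely an element of \<open>I^d\<close> can be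
  compared with \<open>s\<close> after multiplication by \<open>s'\<close>, which lies in
  \<open>I^d'\<close> and has nonzero value.\<close>

lemma Q_Int:
 assumes s: "s \<in> A.Ip d" and s': "s' \<in> A.Ip d'"
 shows "Q d s \<inter> Q d' s' = Q (d + d') (s \<otimes> s')"
proof -
 have c: "s \<in> carrier A" "s' \<in> carrier A" using s s' A.Ip_carr by auto
 have ss: "s \<otimes> s' \<in> carrier A" using c by simp
 have sub: "y \<in> Q d s" if s: "s \<in> A.Ip d" and s': "s' \<in> A.Ip d'" and y: "y \<in> Q (d + d') (s \<otimes> s')" for s s' d d' y
 proof -
  have c: "s \<in> carrier A" "s' \<in> carrier A" using s s' A.Ip_carr by auto
  have ss: "s \<otimes> s' \<in> carrier A" using c by simp
  have y': "y \<in> V" "\<forall>x\<in>A.Ip (d + d'). (x, s \<otimes> s') \<in> pt y" "(s \<otimes> s', \<zero>) \<notin> pt y"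
   using y unfolding Q_mem[OF ss] by auto
  interpret v: cont_vrel A "pt y" by (rule pt_cont[OF y'(1)])
  have nz: "(s, \<zero>) \<notin> pt y" "(s', \<zero>) \<notin> pt y"
   using y'(3) v.v_zero_mult[of s' s] v.v_zero_mult[of s s'] c by (auto simp: A.m_comm)
  have "(x, s) \<in> pt y" if x: "x \<in> A.Ip d" for x
   using v.v_cancel[of x s' s] y'(2) A.Ip_mult[OF x s'] nz(2) c A.Ip_carr[OF x] by blast
  then show ?thesis unfolding Q_mem[OF c(1)] using y'(1) nz(1) by blast
 qed
 have "y \<in> Q (d + d') (s \<otimes> s')" if y: "y \<in> Q d s" "y \<in> Q d' s'" for y
 proof -
  have y': "y \<in> V" "\<And>x. x \<in> A.Ip d ==> (x, s) \<in> pt y" "\<And>x. x \<in> A.Ip d' ==> (x, s') \<in> pt y"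
   "(s, \<zero>) \<notin> pt y" "(s', \<zero>) \<notin> pt y"
   using y unfolding Q_mem[OF c(1)] Q_mem[OF c(2)] by auto
  interpret v: cont_vrel A "pt y" by (rule pt_cont[OF y'(1)])
  have "(x, s \<otimes> s') \<in> pt y" if "x \<in> A.Ip (d + d')" for x
  proof -
   have "x \<in> A.Ip d \<cdot> A.Ip d'" using that unfolding A.ideal_power_add[OF A.I_ideal] .
   then show ?thesis
   proof (induction rule: ideal_prod.induct)
    case (prod a b)
    have "(a \<otimes> b, s \<otimes> b) \<in> pt y" using v.v_mult[OF y'(2)[OF prod(1)] A.Ip_carr[OF prod(2)]] .
    moreover have "(s \<otimes> b, s \<otimes> s') \<in> pt y" by (rule v.v_lmult[OF y'(3)[OF prod(2)] c(1)])
    ultimately show ?case by (rule v.v_trans)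
   next
    case (sum a b)
    show ?case by (rule v.v_add[OF sum(3,4)])
   qed
  qed
  moreover have "(s \<otimes> s', \<zero>) \<notin> pt y" using v.v_zero_prime[OF _ c] y'(4,5) by blast
  ultimately show ?thesis unfolding Q_mem[OF ss] using y'(1) by blast
 qed
 moreover have "Q (d' + d) (s' \<otimes> s) = Q (d + d') (s \<otimes> s')" using c by (simp add: add.commute A.m_comm)
 ultimately show ?thesis using sub[OF s s'] sub[OF s' s] by blast
qed

lemma Q_0: "s \<in> carrier A ==> Q 0 s = {y \<in> V. (\<one>, s) \<in> pt y}"
proof -
 assume s: "s \<in> carrier A"
 have "y \<in> Q 0 s \<longleftrightarrow> (\<one>, s) \<in> pt y" if y: "y \<in> V" for y
 proof -
  interpret v: cont_vrel A "pt y" by (rule pt_cont[OF y])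
  show ?thesis unfolding Q_mem[OF s] using y v.v_one v.v_trans pt_le_one[OF y]
   by (metis A.one_closed ideal_power.simps(1))
 qed
 then show ?thesis using Rt_V by blast
qed

lemma Q_0_1: "Q 0 \<one> = V"
 unfolding Q_0[OF A.one_closed] using pt_le_one[OF _ A.one_closed] by blast

lemma res_ph:
 assumes "s \<in> carrier A" "s' \<in> carrier A" "Q d' s' \<subseteq> Q d s" "a \<in> carrier A"
 shows "res (Q d s) (Q d' s') (ph d s a) = ph d' s' a"
 by (rule res_res[OF opV op_Q[OF assms(1)] op_Q[OF assms(2)] assms(3) Rt_V psi_carr[OF assms(4)]])

text \<open>Numerator and denominator are multiplied by \<open>s'^k\<close>, so that the denominator
  becomes a power of the product of \<open>s\<close> and \<open>s'\<close>. Both orders rise by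
  \<open>d' k\<close>, which is why the filtrations are compatible.\<close>

lemma res_frac:
 assumes s: "s \<in> A.Ip d" and s': "s' \<in> A.Ip d'" and w: "w \<in> carrier A" and e: "e \<in> carrier (Sec (Q d s))"
  and eq: "e \<otimes>\<^bsub>Sec (Q d s)\<^esub> ph d s s [^]\<^bsub>Sec (Q d s)\<^esub> (k::nat) = ph d s w"
 defines "W' \<equiv> Q (d + d') (s \<otimes> s')"
 shows "res (Q d s) W' e \<otimes>\<^bsub>Sec W'\<^esub> res V W' (\<psi> (s \<otimes> s')) [^]\<^bsub>Sec W'\<^esub> k = res V W' (\<psi> (w \<otimes> s' [^] k))"
proof -
 let ?W = "Q d s"
 have c: "s \<in> carrier A" "s' \<in> carrier A" "s \<otimes> s' \<in> carrier A" using s s' A.Ip_carr by auto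
 have sub: "W' \<subseteq> ?W" using Q_Int[OF s s'] unfolding W'_def by blast
 note o = op_Q[OF c(1), of d] op_Q[OF c(3), of "d + d'", folded W'_def]
 interpret h: ring_hom_cring "Sec ?W" "Sec W'" "res ?W W'" by (rule res_ring_hom_cring[OF o sub])
 interpret p: ring_hom_cring A "Sec W'" "\<lambda>a. res V W' (\<psi> a)"
  unfolding W'_def by (intro ring_hom_cring.intro ring_hom_cring_axioms.intro ph_hom c(3) A.is_cring sec_cring op_Q)
 have pc: "ph d s s \<in> carrier (Sec ?W)" using ring_hom_closed[OF ph_hom[OF c(1)] c(1)] .
 have "res ?W W' e \<otimes>\<^bsub>Sec W'\<^esub> res V W' (\<psi> s) [^]\<^bsub>Sec W'\<^esub> k = res V W' (\<psi> w)"
  using arg_cong[OF eq, of "res ?W W'"] e pc res_ph[OF c(1,3) sub[unfolded W'_def] w]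
   res_ph[OF c(1,3) sub[unfolded W'_def] c(1)] by (simp add: W'_def[symmetric])
 then show ?thesis using c(1,2) w e by (simp add: h.S.nat_pow_distrib h.S.m_assoc[symmetric])
qed

lemma pow_Ip: "s \<in> A.Ip d ==> s [^] (k::nat) \<in> A.Ip (d * k)"
proof (induction k)
 case (Suc k)
 then show ?case using A.Ip_mult[of "s [^] k" "d * k" s d] by (simp add: add.commute)
qed simp

lemma res_Fl:
 assumes s: "s \<in> A.Ip d" and s': "s' \<in> A.Ip d'" and b: "b \<in> Fl d s n"
 shows "res (Q d s) (Q (d + d') (s \<otimes> s')) b \<in> Fl (d + d') (s \<otimes> s') n"
proof -
 let ?W = "Q d s" and ?W' = "Q (d + d') (s \<otimes> s')"
 have c: "s \<in> carrier A" "s \<otimes> s' \<in> carrier A" using s s' A.Ip_carr by auto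
 have sub: "?W' \<subseteq> ?W" using Q_Int[OF s s'] by blast
 note o = op_Q[OF c(1), of d] op_Q[OF c(2), of "d + d'"]
 show ?thesis
 proof (rule restriction_filt[OF res_top_hom[OF o sub] _ b])
  fix k w e assume w: "w \<in> A.Ip (n + d * k)" and e: "e \<in> carrier (Sec ?W)"
   and eq: "e \<otimes>\<^bsub>Sec ?W\<^esub> ph d s s [^]\<^bsub>Sec ?W\<^esub> (k::nat) = ph d s w"
  have "w \<otimes> s' [^] k \<in> A.Ip (n + (d + d') * k)"
   using A.Ip_mult[OF w pow_Ip[OF s', of k]] by (simp add: algebra_simps)
  then show "res ?W ?W' e \<in> frac_elems A I (d + d') (s \<otimes> s') (Sec ?W') (ph (d + d') (s \<otimes> s')) n"
   unfolding frac_elems_def using res_frac[OF s s' A.Ip_carr[OF w] e eq] res_carr[OF o sub e] by blast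
 qed
qed

end

subsection \<open>Analytic points\<close>

text \<open>In \<open>R\<langle>T/s\<rangle>\<close> the ideal generated by \<open>I\<close> is dense in an open set.\<close>

lemma (in adic) closed_ideal_open:
 assumes s: "s \<in> carrier R" and T0: "T0 \<subseteq> carrier R" and compl: "completed_rat_loc R T0 s S \<phi>"
  and P: "ideal P S" "topo S closure_of P \<subseteq> P" "\<phi> ` I \<subseteq> P"
 shows "openin (topo S) P"
proof -
 obtain g where g: "is_completion (rat_loc R T0 s) S g" "\<And>a. a \<in> carrier R ==> g (mk_frac R (powers R s) a \<one>) = \<phi> a"
  using compl unfolding completed_rat_loc_def by blast
 interpret M: mult_subset R "powers R s" by (rule powers_mult_subset[OF s])
 interpret L: cring M.L by (rule M.L_cring)
 interpret S: topring S
  using g(1) unfolding is_completion_def complete_topological_ring_def topological_ring_def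
  by (intro topring.intro topring_axioms.intro) (auto simp: topological_ring_def)
 let ?B = "(\<lambda>a. M.fr a \<one>) ` carrier R \<union> (\<lambda>t. M.fr t s) ` T0"
 let ?D = "generate_ring M.L ?B"
 let ?LD = "M.L\<lparr>carrier := ?D\<rparr>"
 let ?G = "\<lambda>J. genideal ?LD ((\<lambda>a. M.fr a \<one>) ` J)"
 have "s \<in> powers R s" using s unfolding powers_def by (auto intro: image_eqI[of _ _ 1])
 then have B: "?B \<subseteq> carrier M.L" using T0 M.S_one by auto
 have DL: "?D \<subseteq> carrier M.L" by (rule L.generate_ring_incl[OF B])
 have rl: "carrier (rat_loc R T0 s) = carrier M.L" "mult (rat_loc R T0 s) = mult M.L"
  "add (rat_loc R T0 s) = add M.L" "one (rat_loc R T0 s) = one M.L"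
  "topo (rat_loc R T0 s) = topology_generated_by
   {?G J +>\<^bsub>M.L\<^esub> x | J x. ideal J R \<and> openin T J \<and> x \<in> carrier M.L}"
  by (simp_all add: rat_loc_def ring.extend_def top_ring.fields_def Let_def)
 have "g \<in> ring_hom M.L S" using g(1) unfolding is_completion_def ring_hom_def rl by auto
 then interpret g: ring_hom_cring M.L S g
  by (intro ring_hom_cring.intro ring_hom_cring_axioms.intro L.cring_axioms S.cring_axioms)
 interpret LD: cring ?LD
 proof (intro cring.intro L.generate_ring_is_ring[OF B] comm_monoid.intro comm_monoid_axioms.intro)
  show "Group.monoid ?LD" using L.generate_ring_is_ring[OF B] by (rule ring.is_monoid)
 qed (use DL L.m_comm in auto)
 have ID: "(\<lambda>a. M.fr a \<one>) ` I \<subseteq> carrier ?LD"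
  using f_I ideal_carr[OF I_ideal] by (auto intro: generate_ring.incl)
 have GI: "ideal (?G I) ?LD" by (rule LD.genideal_ideal[OF ID])
 have GL: "?G I \<subseteq> carrier M.L" using LD.ideal_carr[OF GI] DL by auto
 have "ideal {x \<in> ?D. g x \<in> P} ?LD"
 proof (rule LD.idealI')
  fix a x assume "a \<in> {x \<in> ?D. g x \<in> P}" and x: "x \<in> carrier ?LD"
  then have a: "a \<in> carrier ?LD" "g a \<in> P" by auto
  have c: "a \<in> carrier M.L" "x \<in> carrier M.L" using a x DL by auto
  have "x \<otimes>\<^bsub>?LD\<^esub> a \<in> carrier ?LD" by (rule LD.m_closed[OF x a(1)])
  then show "x \<otimes>\<^bsub>?LD\<^esub> a \<in> {x \<in> ?D. g x \<in> P}" using c S.ideal_lmult[OF P(1) a(2), of "g x"] by simp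
 next
  fix a b assume "a \<in> {x \<in> ?D. g x \<in> P}" "b \<in> {x \<in> ?D. g x \<in> P}"
  then have a: "a \<in> carrier ?LD" "b \<in> carrier ?LD" "g a \<in> P" "g b \<in> P" by auto
  have c: "a \<in> carrier M.L" "b \<in> carrier M.L" using a DL by auto
  have "a \<oplus>\<^bsub>?LD\<^esub> b \<in> carrier ?LD" by (rule LD.a_closed[OF a(1,2)])
  then show "a \<oplus>\<^bsub>?LD\<^esub> b \<in> {x \<in> ?D. g x \<in> P}" using c S.ideal_add[OF P(1) a(3,4)] by simp
 qed (use LD.zero_closed S.ideal_zero[OF P(1)] in auto)
 moreover have "(\<lambda>a. M.fr a \<one>) ` I \<subseteq> {x \<in> ?D. g x \<in> P}" using ID P(3) g(2) ideal_carr[OF I_ideal] by auto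
 ultimately have GP: "g ` ?G I \<subseteq> P" using LD.genideal_minimal by blast
 have "openin (topo (rat_loc R T0 s)) (?G I)"
 proof -
  have "?G I +>\<^bsub>M.L\<^esub> \<zero>\<^bsub>M.L\<^esub> = ?G I"
   using GL by (force simp: a_r_coset_def')
  moreover have "openin T I" using open_Ip[of "Suc 0"] unfolding ideal_power_1[OF I_ideal] .
  ultimately have "?G I \<in> {?G J +>\<^bsub>M.L\<^esub> x | J x. ideal J R \<and> openin T J \<and> x \<in> carrier M.L}"
   by (intro CollectI exI[of _ I] exI[of _ "\<zero>\<^bsub>M.L\<^esub>"] conjI I_ideal L.zero_closed) simp_all
  then show ?thesis unfolding rl by (rule topology_generated_by_Basis)
 qed
 moreover have "topo (rat_loc R T0 s) = pullback_topology (carrier M.L) g S.T"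
  using g(1) unfolding is_completion_def rl by blast
 ultimately obtain Z where Z: "openin S.T Z" "?G I = g -` Z \<inter> carrier M.L"
  by (auto simp: openin_pullback_topology)
 have "\<zero>\<^bsub>M.L\<^esub> \<in> ?G I" using LD.ideal_zero[OF GI] by simp
 then have Z0: "\<zero>\<^bsub>S\<^esub> \<in> Z" using Z(2) g.hom_zero by auto
 \<comment> \<open>Close to any point of \<open>Z\<close> there is an image of a fraction, which may
   be taken in \<open>Z\<close>; it then comes from \<open>?G I\<close> and lies in
   \<open>P\<close>. So \<open>Z\<close> is contained in the closure of \<open>P\<close>.\<close>
 have "Z \<subseteq> P"
 proof
  fix x assume x: "x \<in> Z"
  have "S.T closure_of (g ` carrier M.L) = carrier S" using g(1) unfolding is_completion_def rl by blast
  then have cl: "x \<in> S.T closure_of (g ` carrier M.L)" using S.openin_carr[OF Z(1)] x by blast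
  have "x \<in> S.T closure_of P" unfolding in_closure_of
  proof (intro conjI allI impI)
   show "x \<in> topspace S.T" using S.openin_carr[OF Z(1)] x by auto
   fix N assume N: "x \<in> N \<and> openin S.T N"
   then have "openin S.T (N \<inter> Z)" "x \<in> N \<inter> Z" using Z(1) x by auto
   from closure_meets[OF cl this] obtain y where "y \<in> carrier M.L" "g y \<in> N \<inter> Z" by blast
   then show "\<exists>y. y \<in> P \<and> y \<in> N" using GP Z(2) by blast
  qed
  then show "x \<in> P" using P(2) by blast
 qed
 moreover have "S.minus_closed P"
  unfolding S.minus_closed_def using S.ideal_carr[OF P(1)] S.ideal_zero[OF P(1)] S.ideal_minus[OF P(1)] by blast
 ultimately show ?thesis using S.minus_closed_open Z(1) Z0 by blast
qed

context spa_chart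
begin

abbreviation W where "W i \<equiv> Q (Suc 0) (f i)"

lemma f_Ip1: "i < r ==> f i \<in> A.Ip (Suc 0)"
 using A.f_I unfolding A.ideal_power_1[OF A.I_ideal] .

lemma W_mem:
 assumes i: "i < r"
 shows "y \<in> W i \<longleftrightarrow> y \<in> V \<and> (\<forall>j<r. (f j, f i) \<in> pt y) \<and> (f i, \<zero>) \<notin> pt y"
proof -
 note fc = A.f_carr[OF i]
 have "(\<forall>x\<in>I. (x, f i) \<in> pt y) \<longleftrightarrow> (\<forall>j<r. (f j, f i) \<in> pt y)" if y: "y \<in> V"
 proof
  interpret v: cont_vrel A "pt y" by (rule pt_cont[OF y])
  assume "\<forall>j<r. (f j, f i) \<in> pt y"
  then have "I \<subseteq> {a \<in> carrier A. (a, f i) \<in> pt y}" unfolding A.I_gen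
   using A.f_carr by (intro A.genideal_minimal v.le_ideal fc pt_le_one y) auto
  then show "\<forall>x\<in>I. (x, f i) \<in> pt y" by blast
 qed (use A.f_I in blast)
 then show ?thesis unfolding Q_mem[OF fc] A.ideal_power_1[OF A.I_ideal] by blast
qed

text \<open>The index is one for which \<open>f j\<close> has the largest value at
  \<open>y\<close>.\<close>

lemma exists_W:
 assumes y: "y \<in> V" and nz: "i < r" "(f i, \<zero>) \<notin> pt y" shows "\<exists>j<r. y \<in> W j"
proof -
 interpret v: cont_vrel A "pt y" by (rule pt_cont[OF y])
 obtain j where j: "j < r" "\<forall>t\<in>f ` {..<r}. (t, f j) \<in> pt y"
  using v.exists_max[of "f ` {..<r}"] r_pos A.f_carr by fastforce
 have "(f j, \<zero>) \<notin> pt y" using j(2) nz v.v_trans by blast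
 then show ?thesis using j y W_mem[OF j(1)] by auto
qed

lemma supp_res:
 assumes "op Z" "op Z'" "Z' \<subseteq> Z" "y \<in> Z'" and o: "openin (topo (Sec Z')) {a \<in> carrier (Sec Z'). (a, \<zero>\<^bsub>Sec Z'\<^esub>) \<in> val Z' y}"
 shows "openin (topo (Sec Z)) {a \<in> carrier (Sec Z). (a, \<zero>\<^bsub>Sec Z\<^esub>) \<in> val Z y}"
proof -
 interpret h: ring_hom_cring "Sec Z" "Sec Z'" "res Z Z'" by (rule res_ring_hom_cring[OF assms(1-3)])
 interpret Z: topring "Sec Z" by (rule sec_topring[OF assms(1)])
 have "continuous_map Z.T (topo (Sec Z')) (res Z Z')"
  using res_top_hom[OF assms(1-3)] unfolding top_ring_hom_def by blast
 from openin_continuous_map_preimage[OF this o]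
 have "openin Z.T {a \<in> topspace Z.T. res Z Z' a \<in> {a \<in> carrier (Sec Z'). (a, \<zero>\<^bsub>Sec Z'\<^esub>) \<in> val Z' y}}" .
 moreover have "(res Z Z' a, \<zero>\<^bsub>Sec Z'\<^esub>) \<in> val Z' y \<longleftrightarrow> (a, \<zero>\<^bsub>Sec Z\<^esub>) \<in> val Z y" if "a \<in> carrier (Sec Z)" for a
  using val_res[OF assms(1-4) that h.R.zero_closed] by simp
 then have "{a \<in> topspace Z.T. res Z Z' a \<in> {a \<in> carrier (Sec Z'). (a, \<zero>\<^bsub>Sec Z'\<^esub>) \<in> val Z' y}}
   = {a \<in> carrier (Sec Z). (a, \<zero>\<^bsub>Sec Z\<^esub>) \<in> val Z y}" by auto
 ultimately show ?thesis by simp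
qed

lemma pt_res:
 assumes "op Z" "Z \<subseteq> V" "y \<in> Z" "a \<in> carrier A" "b \<in> carrier A"
 shows "(res V Z (\<psi> a), res V Z (\<psi> b)) \<in> val Z y \<longleftrightarrow> (a, b) \<in> pt y"
 using val_res[OF opV assms(1-3) psi_carr[OF assms(4)] psi_carr[OF assms(5)]] assms(4,5)
 unfolding pt_def by simp

text \<open>A subbasic condition \<open>|a| <= |b|\<close> need not have numerators that generate an
  open ideal. But at the given point continuity makes \<open>I^N\<close> smaller than
  \<open>s\<close> for some \<open>N\<close>, so generators of \<open>I^N\<close> can be added to
  the numerators without losing the point.\<close>

lemma Rt_basis:
 assumes S: "op S" "y \<in> S" and y: "y \<in> V"
 shows "\<exists>T s. rational_datum A T s \<and> y \<in> Rt T s \<and> Rt T s \<subseteq> S"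
proof -
 have basis: "\<exists>T s. finite T \<and> T \<subseteq> carrier A \<and> s \<in> carrier A \<and> y \<in> Rt T s \<and> (\<forall>x\<in>Rt T s. pt x \<in> B)"
  if "generate_topology_on {{v \<in> Spa A (carrier A). (a, b) \<in> v \<and> (b, \<zero>) \<notin> v} | a b. a \<in> carrier A \<and> b \<in> carrier A} B"
   "pt y \<in> B" for B
  using that
 proof (induction rule: generate_topology_on.induct)
  case (Int B1 B2)
  obtain T1 s1 where 1: "finite T1" "T1 \<subseteq> carrier A" "s1 \<in> carrier A" "y \<in> Rt T1 s1" "\<forall>x\<in>Rt T1 s1. pt x \<in> B1"
   using Int by blast
  obtain T2 s2 where 2: "finite T2" "T2 \<subseteq> carrier A" "s2 \<in> carrier A" "y \<in> Rt T2 s2" "\<forall>x\<in>Rt T2 s2. pt x \<in> B2"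
   using Int by blast
  \<comment> \<open>Both conditions are brought to the common denominator
    \<open>s1 s2\<close>.\<close>
  let ?T = "(\<lambda>t. t \<otimes> s2) ` T1 \<union> (\<lambda>t. s1 \<otimes> t) ` T2"
  have eq: "x \<in> Rt ?T (s1 \<otimes> s2) \<longleftrightarrow> x \<in> Rt T1 s1 \<and> x \<in> Rt T2 s2" if x: "x \<in> V" for x
  proof -
   interpret v: cont_vrel A "pt x" by (rule pt_cont[OF x])
   have nz: "(s1 \<otimes> s2, \<zero>) \<in> pt x \<longleftrightarrow> (s1, \<zero>) \<in> pt x \<or> (s2, \<zero>) \<in> pt x"
    using v.v_zero_mult[of s2 s1] v.v_zero_mult[of s1 s2] v.v_zero_prime[of s1 s2] 1(3) 2(3) by (auto simp: A.m_comm)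
   have "(t \<otimes> s2, s1 \<otimes> s2) \<in> pt x \<longleftrightarrow> (t, s1) \<in> pt x" if "(s2, \<zero>) \<notin> pt x" "t \<in> T1" for t
   proof -
    have "t \<in> carrier A" using that 1(2) by blast
    then show ?thesis using v.v_mult[of t s1 s2] v.v_cancel[of t s2 s1] that(1) 1(3) 2(3) by auto
   qed
   moreover have "(s1 \<otimes> t, s1 \<otimes> s2) \<in> pt x \<longleftrightarrow> (t, s2) \<in> pt x" if "(s1, \<zero>) \<notin> pt x" "t \<in> T2" for t
   proof -
    have "t \<in> carrier A" using that 2(2) by blast
    then show ?thesis using v.v_mult[of t s2 s1] v.v_cancel[of t s1 s2] that(1) 1(3) 2(3) by (auto simp: A.m_comm)
   qed
   ultimately show ?thesis unfolding Rt_mem nz using x by (auto simp: ball_Un)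
  qed
  have yT: "y \<in> Rt ?T (s1 \<otimes> s2)" using eq[OF y] 1(4) 2(4) by blast
  have "\<forall>x\<in>Rt ?T (s1 \<otimes> s2). pt x \<in> B1 \<inter> B2" using eq Rt_V 1(5) 2(5) by blast
  then show ?case using yT 1(1-3) 2(1-3) by (intro exI[of _ ?T] exI[of _ "s1 \<otimes> s2"]) auto
 next
  case (UN K)
  obtain B where B: "B \<in> K" "pt y \<in> B" using UN.prems by blast
  from UN.IH[OF B] obtain T s where "finite T" "T \<subseteq> carrier A" "s \<in> carrier A" "y \<in> Rt T s" "\<forall>x\<in>Rt T s. pt x \<in> B"
   by (elim exE conjE)
  then show ?case using B(1) by (intro exI[of _ T] exI[of _ s]) auto
 next
  case (Basis B)
  then obtain a b where ab: "B = {v \<in> Spa A (carrier A). (a, b) \<in> v \<and> (b, \<zero>) \<notin> v}" "a \<in> carrier A" "b \<in> carrier A"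
   by blast
  have "y \<in> Rt {a} b" "\<forall>x\<in>Rt {a} b. pt x \<in> B" using Basis(2) y pt_Spa unfolding ab(1) by (auto simp: Rt_mem)
  then show ?case using ab by (intro exI[of _ "{a}"] exI[of _ b]) auto
 qed simp
 have "openin (subtopology (under Y) V) (V \<inter> S)"
  unfolding openin_open_subtopology[OF opV] using opV S(1) by blast
 then have "openin (Spa_topology A (carrier A)) (pt ` (V \<inter> S))"
  using homeomorphic_imp_open_map[OF homeo] unfolding open_map_def by blast
 then have "generate_topology_on {{v \<in> Spa A (carrier A). (a, b) \<in> v \<and> (b, \<zero>) \<notin> v} | a b. a \<in> carrier A \<and> b \<in> carrier A} (pt ` (V \<inter> S))"
  unfolding Spa_topology_def openin_topology_generated_by_iff .
 from basis[OF this] obtain T s where T: "finite T" "T \<subseteq> carrier A" "s \<in> carrier A" "y \<in> Rt T s" "\<forall>x\<in>Rt T s. pt x \<in> pt ` (V \<inter> S)"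
  using y S(2) by blast
 have inj: "inj_on pt V" using homeomorphic_imp_injective_map[OF homeo] unfolding topspace_V .
 have TS: "Rt T s \<subseteq> S"
 proof
  fix x assume x: "x \<in> Rt T s"
  then obtain z where "z \<in> V \<inter> S" "pt x = pt z" using T(5) by blast
  then show "x \<in> S" using inj_onD[OF inj] x Rt_V by blast
 qed
 interpret v: cont_vrel A "pt y" by (rule pt_cont[OF y])
 have sz: "(s, \<zero>) \<notin> pt y" using T(4) unfolding Rt_mem by blast
 obtain N where N: "A.Ip N \<subseteq> {x \<in> carrier A. (s, x) \<notin> pt y}"
  using A.open_zero[OF v.v_cont[OF T(3) sz]] sz by auto
 let ?T = "T \<union> gens N"
 have sub: "?T \<subseteq> carrier A" using T(2) gens(3) by blast
 have "genideal A (gens N) \<subseteq> genideal A ?T"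
  using A.genideal_self[OF sub] by (intro A.genideal_minimal A.genideal_ideal[OF sub]) blast
 then have "openin (topo A) (genideal A ?T)"
  unfolding gens(4) by (rule A.open_ideal[OF A.genideal_ideal[OF sub]])
 then have "rational_datum A ?T s" unfolding rational_datum_def using T(1,3) gens(1,2) sub by simp
 moreover have "(t, s) \<in> pt y" if "t \<in> gens N" for t
  using that N A.genideal_self[OF gens(3)[of N]] v.v_total[OF T(3), of t] gens(3) unfolding gens(4) by blast
 then have "y \<in> Rt ?T s" using T(4) unfolding Rt_mem by blast
 moreover have "Rt ?T s \<subseteq> S" using TS unfolding subset_iff Rt_mem by blast
 ultimately show ?thesis by blast
qed

text \<open>On \<open>W i\<close> the support cannot be open, since it would contain a power of
  \<open>f i\<close>. If on the other hand all \<open>f i\<close> lie in the support, pass to a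
  rational neighbourhood, where the valuation is continuous: there the support is a closed ideal
  containing the image of \<open>I\<close>, hence open, and its openness carries over to larger
  neighbourhoods by continuity of restriction.\<close>

lemma analytic_V: "V \<inter> analytic_points Y = (\<Union>i<r. W i)"
proof
 show "(\<Union>i<r. W i) \<subseteq> V \<inter> analytic_points Y"
 proof
  fix y assume "y \<in> (\<Union>i<r. W i)"
  then obtain i where i: "i < r" "y \<in> W i" by blast
  have y: "y \<in> V" using i(2) Rt_V by blast
  note fc = A.f_carr[OF i(1)]
  note o = op_Q[OF fc, of "Suc 0"]
  interpret C: rat_completion A I r f "gens (Suc 0)" "f i" "Suc 0" "Sec (W i)" "ph (Suc 0) (f i)" "comp (Suc 0) (f i)"
   by (rule Q_comp[OF f_Ip1[OF i(1)]])
  interpret v: cont_vrel A "pt y" by (rule pt_cont[OF y])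
  have "\<not> openin (topo (Sec (W i))) {a \<in> carrier (Sec (W i)). (a, \<zero>\<^bsub>Sec (W i)\<^esub>) \<in> val (W i) y}"
  proof
   assume o': "openin (topo (Sec (W i))) {a \<in> carrier (Sec (W i)). (a, \<zero>\<^bsub>Sec (W i)\<^esub>) \<in> val (W i) y}"
   have "\<zero>\<^bsub>Sec (W i)\<^esub> \<in> {a \<in> carrier (Sec (W i)). (a, \<zero>\<^bsub>Sec (W i)\<^esub>) \<in> val (W i) y}"
    using vrel.v_zero[OF val_vrel[OF o i(2)]] by simp
   then obtain n where n: "C.F n \<subseteq> {a \<in> carrier (Sec (W i)). (a, \<zero>\<^bsub>Sec (W i)\<^esub>) \<in> val (W i) y}"
    using C.F_basis[OF o'] by blast
   have "ph (Suc 0) (f i) (f i [^] n) \<in> C.F n"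
    by (rule C.phi_Ip_F[OF A.ideal_power_pow[OF A.I_ideal A.f_I[OF i(1)]]])
   moreover have "ph (Suc 0) (f i) \<zero> = \<zero>\<^bsub>Sec (W i)\<^esub>"
    by (rule ring_hom_zero[OF C.phi_hom A.ring_axioms C.S.ring_axioms])
   ultimately have "(f i [^] n, \<zero>) \<in> pt y"
    using n pt_res[OF o Rt_V i(2), of "f i [^] n" "\<zero>"] fc by auto
   then have "(f i, \<zero>) \<in> pt y" using v.v_pow_zero fc by blast
   then show False using i W_mem[OF i(1)] by blast
  qed
  then show "y \<in> V \<inter> analytic_points Y" unfolding analytic_points_def using y o i(2) op_sub[OF opV] by blast
 qed
 show "V \<inter> analytic_points Y \<subseteq> (\<Union>i<r. W i)"
 proof
  fix y assume "y \<in> V \<inter> analytic_points Y"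
  then obtain Z where y: "y \<in> V" and Z: "op Z" "y \<in> Z"
   "\<not> openin (topo (Sec Z)) {a \<in> carrier (Sec Z). (a, \<zero>\<^bsub>Sec Z\<^esub>) \<in> val Z y}"
   unfolding analytic_points_def by blast
  show "y \<in> (\<Union>i<r. W i)"
  proof (rule ccontr)
   assume "y \<notin> (\<Union>i<r. W i)"
   then have z: "\<And>i. i < r ==> (f i, \<zero>) \<in> pt y" using exists_W[OF y] by blast
   obtain T s where T: "rational_datum A T s" "y \<in> Rt T s" "Rt T s \<subseteq> Z"
    using Rt_basis[OF Z(1,2) y] by blast
   have T': "finite T" "T \<noteq> {}" "T \<subseteq> carrier A" "s \<in> carrier A" using T(1) unfolding rational_datum_def by auto
   note o = op_Rt[OF T']
   interpret v: cont_vrel A "pt y" by (rule pt_cont[OF y])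
   interpret w: cont_vrel "Sec (Rt T s)" "val (Rt T s) y"
    by (rule Cont_cont_vrel[OF sec_topring[OF o] Rt_Cont[OF T(1,2)]])
   have IV: "I \<subseteq> {a \<in> carrier A. (a, \<zero>) \<in> pt y}" unfolding A.I_gen
    using z A.f_carr by (intro A.genideal_minimal v.supp_ideal) auto
   have hom: "(\<lambda>a. res V (Rt T s) (\<psi> a)) \<in> ring_hom A (Sec (Rt T s))"
    using ring_hom_trans[OF psi_hom res_hom[OF opV o Rt_V]] by (simp add: o_def)
   have z0: "res V (Rt T s) (\<psi> \<zero>) = \<zero>\<^bsub>Sec (Rt T s)\<^esub>"
    by (rule ring_hom_zero[OF hom A.ring_axioms w.ring_axioms])
   have "(\<lambda>a. res V (Rt T s) (\<psi> a)) ` I \<subseteq> {a \<in> carrier (Sec (Rt T s)). (a, \<zero>\<^bsub>Sec (Rt T s)\<^esub>) \<in> val (Rt T s) y}"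
    using IV pt_res[OF o Rt_V T(2) _ A.zero_closed] ring_hom_closed[OF hom] unfolding z0 by auto
   from A.closed_ideal_open[OF T'(4,3) Rt_completion[OF T(1)] w.supp_ideal w.supp_closed this]
   show False using supp_res[OF Z(1) o T(3,2)] Z(3) by blast
  qed
 qed
qed

end

subsection \<open>Functions on the analytic locus of a chart\<close>

context cring begin

lemma shift_power_identity:
 assumes "a \<in> carrier R" "b \<in> carrier R" "w \<in> carrier R" "(K::nat) \<le> M"
 shows "b [^] (K + k) \<otimes> (a [^] M \<otimes> w) = a [^] (M - K) \<otimes> ((a \<otimes> b) [^] K \<otimes> (w \<otimes> b [^] (k::nat)))"
proof -
 have "a [^] M = a [^] (M - K) \<otimes> a [^] K" using assms by (simp add: nat_pow_mult)
 then show ?thesis using assms(1-3) by (simp add: nat_pow_mult[symmetric] nat_pow_distrib m_ac)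
qed

lemma minus_mult_distr:
 assumes "x \<in> carrier R" "y \<in> carrier R" "q \<in> carrier R"
 shows "(x \<ominus> y) \<otimes> q = x \<otimes> q \<ominus> y \<otimes> q"
 using assms by algebra

end

locale normal_spa = spa_chart + A: locally_normal A I r f
begin

lemma res_Fl_f:
 assumes "a \<in> carrier A" "i < r" "b \<in> Fl 0 a n"
 shows "res (Q 0 a) (Q (Suc 0) (a \<otimes> f i)) b \<in> Fl (Suc 0) (a \<otimes> f i) n"
 using res_Fl[of a 0 "f i" "Suc 0" b n] f_Ip1[OF assms(2)] assms(1,3) by simp

lemma Q_sub_f:
 assumes "a \<in> carrier A" "i < r"
 shows "Q (Suc 0) (a \<otimes> f i) = Q 0 a \<inter> W i"
 using Q_Int[of a 0 "f i" "Suc 0"] f_Ip1[OF assms(2)] assms(1) by simp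

lemma Fl_carr: "s \<in> A.Ip d ==> Fl d s n \<subseteq> carrier (Sec (Q d s))"
 by (drule Q_completion) (elim exE, rule rat_completion.F_carr)

text \<open>Write \<open>b\<close> as \<open>w / a^k\<close> up to a small error. Smallness on the
  charts says that \<open>f i^(K i + k) a^(K i) w\<close> has the right order. After a common factor
  \<open>a^M\<close>, harmless for a fraction with denominator \<open>a\<close>, the saturation of
  the powers of \<open>I\<close> applies to \<open>a^M w\<close>. Saturation concerns
  \<open>A\<close> only, so one \<open>n0\<close> serves for all \<open>a\<close>.\<close>

lemma Fl_detect:
 "\<exists>n0. \<forall>n\<ge>n0. \<forall>a\<in>carrier A. \<forall>b\<in>carrier (Sec (Q 0 a)).
  (\<forall>i<r. res (Q 0 a) (Q (Suc 0) (a \<otimes> f i)) b \<in> Fl (Suc 0) (a \<otimes> f i) n) --> b \<in> Fl 0 a n"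
proof -
 obtain n0 where n0: "\<And>n a. n \<ge> n0 ==> a \<in> carrier A ==>
   (\<forall>i<r. \<exists>K::nat. f i [^] K \<otimes> a \<in> A.Ip (n + K)) ==> a \<in> A.Ip n"
  using A.I_adic_saturation by blast
 have "b \<in> Fl 0 a n" if n: "n \<ge> n0" and a: "a \<in> carrier A" and b: "b \<in> carrier (Sec (Q 0 a))"
  and *: "\<forall>i<r. res (Q 0 a) (Q (Suc 0) (a \<otimes> f i)) b \<in> Fl (Suc 0) (a \<otimes> f i) n" for n a b
 proof -
  have a0: "a \<in> A.Ip 0" using a by simp
  obtain g where "rat_completion A I r f (gens 0) a 0 (Sec (Q 0 a)) (ph 0 a) g" using Q_completion[OF a0] by blast
  then interpret C: rat_completion A I r f "gens 0" a 0 "Sec (Q 0 a)" "ph 0 a" g .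
  obtain e k w where e: "e \<in> carrier (Sec (Q 0 a))" "w \<in> carrier A"
   "e \<otimes>\<^bsub>Sec (Q 0 a)\<^esub> ph 0 a a [^]\<^bsub>Sec (Q 0 a)\<^esub> (k::nat) = ph 0 a w" "b \<ominus>\<^bsub>Sec (Q 0 a)\<^esub> e \<in> C.F n"
   using C.approx[OF b] by blast
  have "\<forall>i<r. \<exists>K::nat. (a \<otimes> f i) [^] K \<otimes> (w \<otimes> f i [^] k) \<in> A.Ip (n + (k + K))"
  proof (intro allI impI)
   fix i assume i: "i < r"
   let ?s = "a \<otimes> f i" and ?W = "Q (Suc 0) (a \<otimes> f i)"
   let ?h = "res (Q 0 a) ?W"
   have s: "?s \<in> A.Ip (Suc 0)" using A.Ip_mult[OF a0 f_Ip1[OF i]] by simp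
   have sc: "?s \<in> carrier A" by (rule A.Ip_carr[OF s])
   have sub: "?W \<subseteq> Q 0 a" using Q_sub_f[OF a i] by blast
   interpret h: ring_hom_cring "Sec (Q 0 a)" "Sec ?W" ?h
    by (rule res_ring_hom_cring[OF op_Q[OF a] op_Q[OF sc] sub])
   obtain g' where "rat_completion A I r f (gens (Suc 0)) ?s (Suc 0) (Sec ?W) (ph (Suc 0) ?s) g'"
    using Q_completion[OF s] by blast
   then interpret C': rat_completion A I r f "gens (Suc 0)" ?s "Suc 0" "Sec ?W" "ph (Suc 0) ?s" g' .
   have "?h (b \<ominus>\<^bsub>Sec (Q 0 a)\<^esub> e) \<in> C'.F n" by (rule res_Fl_f[OF a i e(4)])
   then have "?h b \<ominus>\<^bsub>Sec ?W\<^esub> ?h e \<in> C'.F n" using b e(1) by simp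
   then have "?h e \<ominus>\<^bsub>Sec ?W\<^esub> ?h b \<in> C'.F n"
    using C'.S.minus_closed_swap[OF C'.F_minus_closed] b e(1) by simp
   then have "?h e \<in> C'.F n"
    using C'.S.minus_closed_subst[OF C'.F_minus_closed] * i e(1) by simp
   moreover have "?h e \<otimes>\<^bsub>Sec ?W\<^esub> ph (Suc 0) ?s ?s [^]\<^bsub>Sec ?W\<^esub> k = ph (Suc 0) ?s (w \<otimes> f i [^] k)"
    using res_frac[OF a0 f_Ip1[OF i] e(2,1,3)] by simp
   moreover have "w \<otimes> f i [^] k \<in> carrier A" using e(2) A.f_carr[OF i] by simp
   ultimately have "\<exists>K::nat. ?s [^] K \<otimes> (w \<otimes> f i [^] k) \<in> A.Ip (n + Suc 0 * (k + K))"
    using C'.F_frac by blast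
   then show "\<exists>K::nat. ?s [^] K \<otimes> (w \<otimes> f i [^] k) \<in> A.Ip (n + (k + K))" by simp
  qed
  then obtain K where K: "\<And>i. i < r ==> (a \<otimes> f i) [^] (K i :: nat) \<otimes> (w \<otimes> f i [^] k) \<in> A.Ip (n + (k + K i))"
   by metis
  define M where "M = (\<Sum>i<r. K i)"
  have aM: "a [^] M \<in> carrier A" using a by simp
  have "a [^] M \<otimes> w \<in> A.Ip n"
  proof (rule n0[OF n])
   show "a [^] M \<otimes> w \<in> carrier A" using aM e(2) by simp
   show "\<forall>i<r. \<exists>K::nat. f i [^] K \<otimes> (a [^] M \<otimes> w) \<in> A.Ip (n + K)"
   proof (intro allI impI exI)
    fix i assume i: "i < r"
    have "K i \<le> M" unfolding M_def by (rule member_le_sum) (use i in auto)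
    have "f i [^] (K i + k) \<otimes> (a [^] M \<otimes> w) \<in> A.Ip (n + (k + K i))"
     unfolding A.shift_power_identity[OF a A.f_carr[OF i] e(2) \<open>K i \<le> M\<close>]
     using A.ideal_lmult[OF A.Ip_ideal K[OF i]] a by simp
    then show "f i [^] (K i + k) \<otimes> (a [^] M \<otimes> w) \<in> A.Ip (n + (K i + k))"
     by (simp add: add.commute)
   qed
  qed
  moreover have "e \<otimes>\<^bsub>Sec (Q 0 a)\<^esub> ph 0 a a [^]\<^bsub>Sec (Q 0 a)\<^esub> (k + M) = ph 0 a (a [^] M \<otimes> w)"
  proof -
   interpret p: ring_hom_cring A "Sec (Q 0 a)" "ph 0 a"
    by (intro ring_hom_cring.intro ring_hom_cring_axioms.intro C.phi_hom A.is_cring C.S.is_cring)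
   have "e \<otimes>\<^bsub>Sec (Q 0 a)\<^esub> ph 0 a a [^]\<^bsub>Sec (Q 0 a)\<^esub> (k + M)
     = e \<otimes>\<^bsub>Sec (Q 0 a)\<^esub> ph 0 a a [^]\<^bsub>Sec (Q 0 a)\<^esub> k \<otimes>\<^bsub>Sec (Q 0 a)\<^esub> ph 0 a a [^]\<^bsub>Sec (Q 0 a)\<^esub> M"
    using e(1) p.hom_closed[OF a] by (simp add: C.S.nat_pow_mult[symmetric] C.S.m_assoc)
   then show ?thesis unfolding e(3) using a e(2) C.S.m_comm p.hom_closed[OF a] p.hom_closed[OF e(2)] by simp
  qed
  ultimately have "e \<in> C.F n" by (intro C.frac_in_F[OF e(1)]) simp_all
  then show ?thesis using C.S.minus_closed_subst[OF C.F_minus_closed e(4)] b by simp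
 qed
 then show ?thesis by blast
qed

text \<open>The \<open>z i\<close> are replaced by fractions \<open>x i / f i^L\<close> with one
  common exponent \<open>L\<close>. On overlaps these agree up to the next step of the filtration,
  which is the hypothesis of \<open>gr_lift\<close>, and the element \<open>a\<close> obtained from
  it has an error of order \<open>n + 1\<close>.\<close>

lemma Fl_lift:
 "\<exists>n0. \<forall>n\<ge>n0. \<forall>z. (\<forall>i<r. z i \<in> Fl (Suc 0) (f i) n) -->
  (\<forall>i<r. \<forall>j<r. res (W i) (W i \<inter> W j) (z i) = res (W j) (W i \<inter> W j) (z j)) -->
  (\<exists>a\<in>A.Ip n. \<forall>i<r. z i \<ominus>\<^bsub>Sec (W i)\<^esub> ph (Suc 0) (f i) a \<in> Fl (Suc 0) (f i) (Suc n))"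
proof -
 obtain n0 where n0: "\<And>n L x. n \<ge> n0 ==> (\<forall>i<r. x i \<in> A.Ip (n + L)) ==>
  (\<forall>i<r. \<forall>j<r. \<exists>K::nat. (f i \<otimes> f j) [^] K \<otimes>
    (f j [^] L \<otimes> x i \<ominus> f i [^] L \<otimes> x j) \<in> A.Ip (Suc n + 2 * (L + K))) ==>
  (\<exists>a\<in>A.Ip n. \<exists>M::nat. \<forall>i<r. f i [^] M \<otimes> (f i [^] L \<otimes> a \<ominus> x i) \<in> A.Ip (Suc n + (L + M)))"
  using A.gr_lift by blast
 have "\<exists>a\<in>A.Ip n. \<forall>i<r. z i \<ominus>\<^bsub>Sec (W i)\<^esub> ph (Suc 0) (f i) a \<in> Fl (Suc 0) (f i) (Suc n)"
  if n: "n \<ge> n0" and z: "\<forall>i<r. z i \<in> Fl (Suc 0) (f i) n"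
   and gl: "\<forall>i<r. \<forall>j<r. res (W i) (W i \<inter> W j) (z i) = res (W j) (W i \<inter> W j) (z j)" for n z
 proof -
  have C: "\<exists>g. rat_completion A I r f (gens (Suc 0)) (f i) (Suc 0) (Sec (W i)) (ph (Suc 0) (f i)) g" if "i < r" for i
   by (rule Q_completion[OF f_Ip1[OF that]])
  have zc: "z i \<in> carrier (Sec (W i))" if i: "i < r" for i
   using Fl_carr[OF f_Ip1[OF i]] z i by blast
  have "\<forall>i. i < r --> (\<exists>e k w. e \<in> carrier (Sec (W i)) \<and> w \<in> A.Ip (n + k) \<and>
    e \<otimes>\<^bsub>Sec (W i)\<^esub> ph (Suc 0) (f i) (f i) [^]\<^bsub>Sec (W i)\<^esub> (k::nat) = ph (Suc 0) (f i) w \<and>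
    z i \<ominus>\<^bsub>Sec (W i)\<^esub> e \<in> Fl (Suc 0) (f i) (Suc n))"
  proof (intro allI impI)
   fix i assume i: "i < r"
   obtain g where "rat_completion A I r f (gens (Suc 0)) (f i) (Suc 0) (Sec (W i)) (ph (Suc 0) (f i)) g"
    using C[OF i] by blast
   from rat_completion.approx_F[OF this z[rule_format, OF i], of "Suc n"]
   show "\<exists>e k w. e \<in> carrier (Sec (W i)) \<and> w \<in> A.Ip (n + k) \<and>
     e \<otimes>\<^bsub>Sec (W i)\<^esub> ph (Suc 0) (f i) (f i) [^]\<^bsub>Sec (W i)\<^esub> (k::nat) = ph (Suc 0) (f i) w \<and>
     z i \<ominus>\<^bsub>Sec (W i)\<^esub> e \<in> Fl (Suc 0) (f i) (Suc n)" by simp blast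
  qed
  then obtain e k w where e': "\<forall>i. i < r --> e i \<in> carrier (Sec (W i)) \<and> w i \<in> A.Ip (n + k i) \<and>
    e i \<otimes>\<^bsub>Sec (W i)\<^esub> ph (Suc 0) (f i) (f i) [^]\<^bsub>Sec (W i)\<^esub> (k i :: nat) = ph (Suc 0) (f i) (w i) \<and>
    z i \<ominus>\<^bsub>Sec (W i)\<^esub> e i \<in> Fl (Suc 0) (f i) (Suc n)"
   by metis
  define L where "L = (\<Sum>i<r. k i)"
  define x where "x i = f i [^] (L - k i) \<otimes> w i" for i
  have kL: "k i \<le> L" if i: "i < r" for i unfolding L_def by (rule member_le_sum) (use i in auto)
  have e1: "e i \<in> carrier (Sec (W i))" and e2: "z i \<ominus>\<^bsub>Sec (W i)\<^esub> e i \<in> Fl (Suc 0) (f i) (Suc n)" if "i < r" for i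
   using e' that by auto
  have xI: "x i \<in> A.Ip (n + L)" if i: "i < r" for i
  proof -
   have "x i \<in> A.Ip ((L - k i) + (n + k i))"
    unfolding x_def using A.Ip_mult[OF A.ideal_power_pow[OF A.I_ideal A.f_I[OF i]]] e' i by blast
   then show ?thesis using kL[OF i] by (simp add: add.commute)
  qed
  have xc: "x i \<in> carrier A" if "i < r" for i by (rule A.Ip_carr[OF xI[OF that]])
  have ex: "e i \<otimes>\<^bsub>Sec (W i)\<^esub> ph (Suc 0) (f i) (f i) [^]\<^bsub>Sec (W i)\<^esub> L = ph (Suc 0) (f i) (x i)" if i: "i < r" for i
  proof -
   interpret p: ring_hom_cring A "Sec (W i)" "ph (Suc 0) (f i)"
    by (intro ring_hom_cring.intro ring_hom_cring_axioms.intro ph_hom A.f_carr[OF i] A.is_cring sec_cring op_Q)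
   note fc = A.f_carr[OF i]
   have wc: "w i \<in> carrier A" using e' i A.Ip_carr by blast
   have L: "L = k i + (L - k i)" using kL[OF i] by simp
   have "e i \<otimes>\<^bsub>Sec (W i)\<^esub> ph (Suc 0) (f i) (f i) [^]\<^bsub>Sec (W i)\<^esub> L
     = e i \<otimes>\<^bsub>Sec (W i)\<^esub> ph (Suc 0) (f i) (f i) [^]\<^bsub>Sec (W i)\<^esub> k i \<otimes>\<^bsub>Sec (W i)\<^esub> ph (Suc 0) (f i) (f i) [^]\<^bsub>Sec (W i)\<^esub> (L - k i)"
    using e1[OF i] p.hom_closed[OF fc] by (subst L) (simp add: p.S.nat_pow_mult[symmetric] p.S.m_assoc)
   also have "\<dots> = ph (Suc 0) (f i) (w i) \<otimes>\<^bsub>Sec (W i)\<^esub> ph (Suc 0) (f i) (f i) [^]\<^bsub>Sec (W i)\<^esub> (L - k i)" using e' i by simp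
   also have "\<dots> = ph (Suc 0) (f i) (x i)"
    unfolding x_def using wc fc p.S.m_comm p.hom_closed[OF fc] p.hom_closed[OF wc] by simp
   finally show ?thesis .
  qed
  have "\<exists>K::nat. (f i \<otimes> f j) [^] K \<otimes>
    (f j [^] L \<otimes> x i \<ominus> f i [^] L \<otimes> x j) \<in> A.Ip (Suc n + 2 * (L + K))"
   if i: "i < r" and j: "j < r" for i j
  proof -
   note fi = A.f_carr[OF i] and fj = A.f_carr[OF j]
   let ?s = "f i \<otimes> f j" and ?d = "Suc 0 + Suc 0"
   define W' where "W' = Q ?d ?s"
   have s: "?s \<in> A.Ip ?d" by (rule A.Ip_mult[OF f_Ip1[OF i] f_Ip1[OF j]])
   have sc: "?s \<in> carrier A" using fi fj by simp
   have WW: "W' = W i \<inter> W j" unfolding W'_def by (rule Q_Int[OF f_Ip1[OF i] f_Ip1[OF j], symmetric])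
   have oW: "op W'" unfolding W'_def by (rule op_Q[OF sc])
   let ?p = "\<lambda>a. res V W' (\<psi> a)"
   obtain g where "rat_completion A I r f (gens ?d) ?s ?d (Sec W') ?p g"
    unfolding W'_def using Q_completion[OF s] by blast
   then interpret C: rat_completion A I r f "gens ?d" ?s ?d "Sec W'" ?p g .
   interpret hi: ring_hom_cring "Sec (W i)" "Sec W'" "res (W i) W'"
    by (rule res_ring_hom_cring[OF op_Q[OF fi] oW]) (simp add: WW)
   interpret hj: ring_hom_cring "Sec (W j)" "Sec W'" "res (W j) W'"
    by (rule res_ring_hom_cring[OF op_Q[OF fj] oW]) (simp add: WW)
   interpret p: ring_hom_cring A "Sec W'" ?p
    by (intro ring_hom_cring.intro ring_hom_cring_axioms.intro C.phi_hom A.is_cring C.S.is_cring)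
   let ?hi = "res (W i) W'" and ?hj = "res (W j) W'"
   note mc = C.F_minus_closed[of "Suc n"]
   have "?hi (z i \<ominus>\<^bsub>Sec (W i)\<^esub> e i) \<in> C.F (Suc n)"
    using res_Fl[OF f_Ip1[OF i] f_Ip1[OF j] e2[OF i]] unfolding W'_def .
   then have 1: "?hi (e i) \<ominus>\<^bsub>Sec W'\<^esub> ?hi (z i) \<in> C.F (Suc n)"
    using C.S.minus_closed_swap[OF mc] zc[OF i] e1[OF i] by simp
   have "?hj (z j \<ominus>\<^bsub>Sec (W j)\<^esub> e j) \<in> C.F (Suc n)"
    using res_Fl[OF f_Ip1[OF j] f_Ip1[OF i] e2[OF j]] unfolding A.m_comm[OF fj fi] W'_def .
   then have 2: "?hj (z j) \<ominus>\<^bsub>Sec W'\<^esub> ?hj (e j) \<in> C.F (Suc n)" using zc[OF j] e1[OF j] by simp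
   have eqz: "?hi (z i) = ?hj (z j)" using gl i j unfolding WW by blast
   \<comment> \<open>Both approximation errors lie in step \<open>n + 1\<close> on the overlap, and
     \<open>z i\<close>, \<open>z j\<close> coincide there.\<close>
   have D: "?hi (e i) \<ominus>\<^bsub>Sec W'\<^esub> ?hj (e j) \<in> C.F (Suc n)"
    by (rule C.S.minus_closed_trans[OF mc 1 2[folded eqz]]) (use zc e1 i j in auto)
   have ei: "?hi (e i) \<otimes>\<^bsub>Sec W'\<^esub> ?p ?s [^]\<^bsub>Sec W'\<^esub> L = ?p (x i \<otimes> f j [^] L)"
    using res_frac[OF f_Ip1[OF i] f_Ip1[OF j] xc[OF i] e1[OF i] ex[OF i]] unfolding W'_def .
   have ej: "?hj (e j) \<otimes>\<^bsub>Sec W'\<^esub> ?p ?s [^]\<^bsub>Sec W'\<^esub> L = ?p (x j \<otimes> f i [^] L)"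
    using res_frac[OF f_Ip1[OF j] f_Ip1[OF i] xc[OF j] e1[OF j] ex[OF j]]
    unfolding A.m_comm[OF fj fi] W'_def .
   have ps: "?p ?s [^]\<^bsub>Sec W'\<^esub> L \<in> carrier (Sec W')" using p.hom_closed[OF sc] by simp
   have "(?hi (e i) \<ominus>\<^bsub>Sec W'\<^esub> ?hj (e j)) \<otimes>\<^bsub>Sec W'\<^esub> ?p ?s [^]\<^bsub>Sec W'\<^esub> L
     = ?p (x i \<otimes> f j [^] L) \<ominus>\<^bsub>Sec W'\<^esub> ?p (x j \<otimes> f i [^] L)"
    unfolding C.S.minus_mult_distr[OF hi.hom_closed[OF e1[OF i]] hj.hom_closed[OF e1[OF j]] ps] ei ej ..
   also have "\<dots> = ?p (x i \<otimes> f j [^] L \<ominus> x j \<otimes> f i [^] L)"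
    using xc i j fi fj by (simp del: p.hom_mult p.hom_pow)
   also have "x i \<otimes> f j [^] L \<ominus> x j \<otimes> f i [^] L = f j [^] L \<otimes> x i \<ominus> f i [^] L \<otimes> x j"
    using xc i j fi fj by (simp add: A.m_comm)
   finally have "\<exists>K::nat. ?s [^] K \<otimes> (f j [^] L \<otimes> x i \<ominus> f i [^] L \<otimes> x j) \<in> A.Ip (Suc n + ?d * (L + K))"
    by (intro C.F_frac[OF D]) (use xc i j fi fj in auto)
   then show ?thesis by (simp add: numeral_2_eq_2)
  qed
  then obtain a M where a: "a \<in> A.Ip n"
   "\<And>i. i < r ==> f i [^] (M::nat) \<otimes> (f i [^] L \<otimes> a \<ominus> x i) \<in> A.Ip (Suc n + (L + M))"
   using n0[OF n, of x L] xI by blast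
  have ac: "a \<in> carrier A" by (rule A.Ip_carr[OF a(1)])
  have "z i \<ominus>\<^bsub>Sec (W i)\<^esub> ph (Suc 0) (f i) a \<in> Fl (Suc 0) (f i) (Suc n)" if i: "i < r" for i
  proof -
   note fi = A.f_carr[OF i]
   interpret C: rat_completion A I r f "gens (Suc 0)" "f i" "Suc 0" "Sec (W i)" "ph (Suc 0) (f i)" "comp (Suc 0) (f i)"
    by (rule Q_comp[OF f_Ip1[OF i]])
   let ?p = "ph (Suc 0) (f i)" and ?S = "Sec (W i)"
   interpret p: ring_hom_cring A ?S ?p
    by (intro ring_hom_cring.intro ring_hom_cring_axioms.intro C.phi_hom A.is_cring C.S.is_cring)
   note mc = C.F_minus_closed[of "Suc n"]
   note c = p.hom_closed[OF fi] p.hom_closed[OF ac] e1[OF i]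
   have pf: "?p (f i) [^]\<^bsub>?S\<^esub> (k::nat) \<in> carrier ?S" for k using c(1) by simp
   have "(?p a \<ominus>\<^bsub>?S\<^esub> e i) \<otimes>\<^bsub>?S\<^esub> ?p (f i) [^]\<^bsub>?S\<^esub> (L + M)
     = (?p a \<ominus>\<^bsub>?S\<^esub> e i) \<otimes>\<^bsub>?S\<^esub> ?p (f i) [^]\<^bsub>?S\<^esub> L \<otimes>\<^bsub>?S\<^esub> ?p (f i) [^]\<^bsub>?S\<^esub> M"
    using c pf by (simp add: C.S.nat_pow_mult[symmetric] C.S.m_assoc)
   also have "(?p a \<ominus>\<^bsub>?S\<^esub> e i) \<otimes>\<^bsub>?S\<^esub> ?p (f i) [^]\<^bsub>?S\<^esub> L = ?p (f i [^] L \<otimes> a \<ominus> x i)"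
    unfolding C.S.minus_mult_distr[OF c(2,3) pf] ex[OF i] using c ac fi xc[OF i] C.S.m_comm[OF c(2) pf] by simp
   also have "\<dots> \<otimes>\<^bsub>?S\<^esub> ?p (f i) [^]\<^bsub>?S\<^esub> M = ?p (f i [^] M \<otimes> (f i [^] L \<otimes> a \<ominus> x i))"
   proof -
    have "f i [^] L \<otimes> a \<ominus> x i \<in> carrier A" using ac fi xc[OF i] by simp
    then show ?thesis using fi C.S.m_comm[OF p.hom_closed pf] by (simp only: p.hom_mult p.hom_pow A.nat_pow_closed)
   qed
   finally have "?p a \<ominus>\<^bsub>?S\<^esub> e i \<in> C.F (Suc n)"
    by (intro C.frac_in_F) (use a(2)[OF i] c in simp_all)
   then have "e i \<ominus>\<^bsub>?S\<^esub> ?p a \<in> C.F (Suc n)" using C.S.minus_closed_swap[OF mc] c by blast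
   then show ?thesis using C.S.minus_closed_trans[OF mc e2[OF i]] zc[OF i] c by blast
  qed
  then show ?thesis using a(1) by blast
 qed
 then show ?thesis by blast
qed

end

context cring begin

lemma minus_minus_assoc: "z \<in> carrier R ==> x \<in> carrier R ==> y \<in> carrier R ==> z \<ominus> (x \<oplus> y) = (z \<ominus> x) \<ominus> y"
 by algebra

lemma minus_minus_cancel:
 "z \<in> carrier R ==> x \<in> carrier R ==> y \<in> carrier R ==> (z \<ominus> x) \<ominus> (y \<ominus> x) = z \<ominus> y"
 by algebra

end

section \<open>Functions on the analytic locus that come from the ring\<close>

context normal_spa
begin

abbreviation Va where "Va \<equiv> \<Union>i<r. W i"
abbreviation \<rho> where "\<rho> a \<equiv> res V Va (\<psi> a)"
abbreviation rW where "rW i \<equiv> res Va (W i)"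
abbreviation FW where "FW i \<equiv> Fl (Suc 0) (f i)"

lemma op_W: "i < r ==> op (W i)"
 by (rule op_Q[OF A.f_carr])

lemma op_Va: "op Va"
 using op_W by blast

lemma Va_V: "Va \<subseteq> V"
 using Rt_V by blast

lemma W_Va: "i < r ==> W i \<subseteq> Va"
 by blast

lemma rho_hom: "\<rho> \<in> ring_hom A (Sec Va)"
 using ring_hom_trans[OF psi_hom res_hom[OF opV op_Va Va_V]] by (simp add: o_def)

lemma rho_ring_hom_cring: "ring_hom_cring A (Sec Va) \<rho>"
 by (intro ring_hom_cring.intro ring_hom_cring_axioms.intro rho_hom A.is_cring sec_cring op_Va)

lemma rW_ring_hom_cring: "i < r ==> ring_hom_cring (Sec Va) (Sec (W i)) (rW i)"
 by (rule res_ring_hom_cring[OF op_Va op_W W_Va])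

lemma rW_rho: "i < r ==> a \<in> carrier A ==> rW i (\<rho> a) = ph (Suc 0) (f i) a"
 by (rule res_res[OF opV op_Va op_W W_Va Va_V psi_carr])

lemma Va_eqI:
 assumes "x \<in> carrier (Sec Va)" "y \<in> carrier (Sec Va)" "\<And>i. i < r ==> rW i x = rW i y" shows "x = y"
 by (rule sections_eq[where C = "W ` {..<r}" and U = Va]) (use assms op_W in auto)

lemma rho_approx_step:
 "\<exists>n0. \<forall>n\<ge>n0. \<forall>z\<in>carrier (Sec Va). (\<forall>i<r. rW i z \<in> FW i n) -->
  (\<exists>a\<in>A.Ip n. \<forall>i<r. rW i (z \<ominus>\<^bsub>Sec Va\<^esub> \<rho> a) \<in> FW i (Suc n))"
proof -
 interpret \<rho>: ring_hom_cring A "Sec Va" \<rho> by (rule rho_ring_hom_cring)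
 obtain n0 where n0: "\<And>n z. n \<ge> n0 ==> (\<forall>i<r. z i \<in> FW i n) ==>
  (\<forall>i<r. \<forall>j<r. res (W i) (W i \<inter> W j) (z i) = res (W j) (W i \<inter> W j) (z j)) ==>
  (\<exists>a\<in>A.Ip n. \<forall>i<r. z i \<ominus>\<^bsub>Sec (W i)\<^esub> ph (Suc 0) (f i) a \<in> FW i (Suc n))"
  using Fl_lift by blast
 have "\<exists>a\<in>A.Ip n. \<forall>i<r. rW i (z \<ominus>\<^bsub>Sec Va\<^esub> \<rho> a) \<in> FW i (Suc n)"
  if n: "n \<ge> n0" and z: "z \<in> carrier (Sec Va)" "\<forall>i<r. rW i z \<in> FW i n" for n z
 proof -
  have "\<forall>i<r. \<forall>j<r. res (W i) (W i \<inter> W j) (rW i z) = res (W j) (W i \<inter> W j) (rW j z)"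
  proof (intro allI impI)
   fix i j assume i: "i < r" and j: "j < r"
   have "op (W i \<inter> W j)" using op_W i j by blast
   then show "res (W i) (W i \<inter> W j) (rW i z) = res (W j) (W i \<inter> W j) (rW j z)"
    using res_res[OF op_Va op_W[OF i] _ _ W_Va[OF i] z(1)] res_res[OF op_Va op_W[OF j] _ _ W_Va[OF j] z(1)] by simp
  qed
  from n0[OF n z(2) this] obtain a where a: "a \<in> A.Ip n"
   "\<forall>i<r. rW i z \<ominus>\<^bsub>Sec (W i)\<^esub> ph (Suc 0) (f i) a \<in> FW i (Suc n)" by (elim bexE)
  have ac: "a \<in> carrier A" by (rule A.Ip_carr[OF a(1)])
  have "rW i (z \<ominus>\<^bsub>Sec Va\<^esub> \<rho> a) \<in> FW i (Suc n)" if i: "i < r" for i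
  proof -
   interpret h: ring_hom_cring "Sec Va" "Sec (W i)" "rW i" by (rule rW_ring_hom_cring[OF i])
   have "rW i (z \<ominus>\<^bsub>Sec Va\<^esub> \<rho> a) = rW i z \<ominus>\<^bsub>Sec (W i)\<^esub> rW i (\<rho> a)"
    using z(1) \<rho>.hom_closed[OF ac] by simp
   then show ?thesis using a(2) i unfolding rW_rho[OF i ac] by simp
  qed
  then show ?thesis using a(1) by blast
 qed
 then show ?thesis by blast
qed

text \<open>Successive corrections of order \<open>n0\<close>, \<open>n0 + 1\<close> and so on are
  subtracted. Their sum converges in \<open>A\<close>, and its difference to \<open>z\<close> lies
  in every step of the filtration over every \<open>W i\<close>, hence is zero.\<close>

lemma rho_image:
 "\<exists>n0. \<forall>z\<in>carrier (Sec Va). (\<forall>i<r. rW i z \<in> FW i n0) --> z \<in> \<rho> ` carrier A"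
proof -
 interpret S: cring "Sec Va" by (rule sec_cring[OF op_Va])
 interpret \<rho>: ring_hom_cring A "Sec Va" \<rho> by (rule rho_ring_hom_cring)
 obtain n0 where n0: "\<And>n z. n \<ge> n0 ==> z \<in> carrier (Sec Va) ==> (\<forall>i<r. rW i z \<in> FW i n) ==>
  (\<exists>a\<in>A.Ip n. \<forall>i<r. rW i (z \<ominus>\<^bsub>Sec Va\<^esub> \<rho> a) \<in> FW i (Suc n))"
  using rho_approx_step by blast
 have "z \<in> \<rho> ` carrier A" if z: "z \<in> carrier (Sec Va)" and zF: "\<forall>i<r. rW i z \<in> FW i n0" for z
 proof -
  \<comment> \<open>The partial sums of the corrections, starting from zero.\<close>
  have "\<exists>b. \<forall>n. (b n \<in> carrier A \<and> (\<forall>i<r. rW i (z \<ominus>\<^bsub>Sec Va\<^esub> \<rho> (b n)) \<in> FW i (n0 + n))) \<and>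
    b (Suc n) \<ominus> b n \<in> A.Ip (n0 + n)"
  proof (rule dependent_nat_choice)
   have "z \<ominus>\<^bsub>Sec Va\<^esub> \<rho> \<zero> = z" using z by (simp add: a_minus_def)
   then show "\<exists>b. b \<in> carrier A \<and> (\<forall>i<r. rW i (z \<ominus>\<^bsub>Sec Va\<^esub> \<rho> b) \<in> FW i (n0 + 0))"
    using zF by (intro exI[of _ "\<zero>"]) simp
  next
   fix b n assume b: "b \<in> carrier A \<and> (\<forall>i<r. rW i (z \<ominus>\<^bsub>Sec Va\<^esub> \<rho> b) \<in> FW i (n0 + n))"
   have bc: "b \<in> carrier A" using b by blast
   have "z \<ominus>\<^bsub>Sec Va\<^esub> \<rho> b \<in> carrier (Sec Va)" using z \<rho>.hom_closed[OF bc] by simp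
   then obtain a where a: "a \<in> A.Ip (n0 + n)"
    "\<forall>i<r. rW i (z \<ominus>\<^bsub>Sec Va\<^esub> \<rho> b \<ominus>\<^bsub>Sec Va\<^esub> \<rho> a) \<in> FW i (Suc (n0 + n))"
    using n0[of "n0 + n"] b by (meson le_add1)
   have ac: "a \<in> carrier A" by (rule A.Ip_carr[OF a(1)])
   have "z \<ominus>\<^bsub>Sec Va\<^esub> \<rho> (b \<oplus> a) = z \<ominus>\<^bsub>Sec Va\<^esub> \<rho> b \<ominus>\<^bsub>Sec Va\<^esub> \<rho> a"
    unfolding \<rho>.hom_add[OF bc ac] by (rule S.minus_minus_assoc[OF z \<rho>.hom_closed[OF bc] \<rho>.hom_closed[OF ac]])
   moreover have "b \<oplus> a \<ominus> b = a" using bc ac by algebra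
   ultimately show "\<exists>c. (c \<in> carrier A \<and> (\<forall>i<r. rW i (z \<ominus>\<^bsub>Sec Va\<^esub> \<rho> c) \<in> FW i (n0 + Suc n))) \<and>
     c \<ominus> b \<in> A.Ip (n0 + n)"
    using a ac bc by (intro exI[of _ "b \<oplus> a"]) simp
  qed
  then obtain b where b0: "\<forall>n. (b n \<in> carrier A \<and> (\<forall>i<r. rW i (z \<ominus>\<^bsub>Sec Va\<^esub> \<rho> (b n)) \<in> FW i (n0 + n))) \<and>
    b (Suc n) \<ominus> b n \<in> A.Ip (n0 + n)" by (elim exE)
  have b: "b n \<in> carrier A" "b (Suc n) \<ominus> b n \<in> A.Ip n" for n
   using b0[rule_format, of n] A.Ip_antimono[of n "n0 + n"] by auto
  obtain a where a: "a \<in> carrier A" "\<And>n. a \<ominus> b n \<in> A.Ip n"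
   using A.series_converges[of b, OF b] by blast
  have "rW i z = rW i (\<rho> a)" if i: "i < r" for i
  proof -
   interpret h: ring_hom_cring "Sec Va" "Sec (W i)" "rW i" by (rule rW_ring_hom_cring[OF i])
   interpret C: rat_completion A I r f "gens (Suc 0)" "f i" "Suc 0" "Sec (W i)" "ph (Suc 0) (f i)" "comp (Suc 0) (f i)"
    by (rule Q_comp[OF f_Ip1[OF i]])
   have ra: "\<rho> a \<in> carrier (Sec Va)" by (rule \<rho>.hom_closed[OF a(1)])
   have "rW i (z \<ominus>\<^bsub>Sec Va\<^esub> \<rho> a) \<in> C.F n" for n
   proof -
    have rb: "\<rho> (b n) \<in> carrier (Sec Va)" by (rule \<rho>.hom_closed[OF b(1)])
    have 1: "rW i (z \<ominus>\<^bsub>Sec Va\<^esub> \<rho> (b n)) \<in> C.F n"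
     using b0[rule_format, of n] i C.F_antimono[of n "n0 + n"] by auto
    have ab: "a \<ominus> b n \<in> carrier A" by (rule A.Ip_carr[OF a(2)])
    have "rW i (\<rho> (a \<ominus> b n)) \<in> C.F n" unfolding rW_rho[OF i ab] by (rule C.phi_Ip_F[OF a(2)])
    then have "rW i (z \<ominus>\<^bsub>Sec Va\<^esub> \<rho> (b n)) \<ominus>\<^bsub>Sec (W i)\<^esub> rW i (\<rho> (a \<ominus> b n)) \<in> C.F n"
     using 1 C.F_minus_closed[of n] unfolding C.S.minus_closed_def by blast
    moreover have "rW i (z \<ominus>\<^bsub>Sec Va\<^esub> \<rho> (b n)) \<ominus>\<^bsub>Sec (W i)\<^esub> rW i (\<rho> (a \<ominus> b n))
      = rW i ((z \<ominus>\<^bsub>Sec Va\<^esub> \<rho> (b n)) \<ominus>\<^bsub>Sec Va\<^esub> (\<rho> a \<ominus>\<^bsub>Sec Va\<^esub> \<rho> (b n)))"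
     using a(1) b(1)[of n] z ra rb by simp
    ultimately show ?thesis unfolding S.minus_minus_cancel[OF z rb ra] by simp
   qed
   then have "rW i (z \<ominus>\<^bsub>Sec Va\<^esub> \<rho> a) = \<zero>\<^bsub>Sec (W i)\<^esub>"
    by (intro C.F_separated) (use z ra in simp_all)
   then show ?thesis using z ra by simp
  qed
  then have "z = \<rho> a" by (rule Va_eqI[OF z \<rho>.hom_closed[OF a(1)]])
  then show ?thesis using a(1) by blast
 qed
 then show ?thesis by blast
qed

text \<open>Over each \<open>W i\<close> vanishing puts \<open>a\<close> into every
  \<open>I^n\<close> up to a power of \<open>f i\<close>; saturation removes these powers for large
  \<open>n\<close>.\<close>

lemma rho_zero:
 assumes a: "a \<in> carrier A" "\<rho> a = \<zero>\<^bsub>Sec Va\<^esub>" shows "a = \<zero>"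
proof -
 obtain n0 where n0: "\<And>n a. n \<ge> n0 ==> a \<in> carrier A ==>
   (\<forall>i<r. \<exists>K::nat. f i [^] K \<otimes> a \<in> A.Ip (n + K)) ==> a \<in> A.Ip n"
  using A.I_adic_saturation by blast
 show ?thesis
 proof (rule A.separated[OF a(1)], rule n0[OF _ a(1)], assumption, intro allI impI)
  fix n i assume i: "i < r"
  interpret h: ring_hom_cring "Sec Va" "Sec (W i)" "rW i" by (rule rW_ring_hom_cring[OF i])
  interpret C: rat_completion A I r f "gens (Suc 0)" "f i" "Suc 0" "Sec (W i)" "ph (Suc 0) (f i)" "comp (Suc 0) (f i)"
   by (rule Q_comp[OF f_Ip1[OF i]])
  have "ph (Suc 0) (f i) a = \<zero>\<^bsub>Sec (W i)\<^esub>" unfolding rW_rho[OF i a(1), symmetric] a(2) by simp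
  then have "ph (Suc 0) (f i) a \<in> C.F n" using C.F_minus_closed[of n] unfolding C.S.minus_closed_def by simp
  from C.phi_F[OF a(1) this] show "\<exists>K::nat. f i [^] K \<otimes> a \<in> A.Ip (n + K)" by simp
 qed
qed

lemma rho_inj: "inj_on \<rho> (carrier A)"
proof (rule inj_onI)
 interpret \<rho>: ring_hom_cring A "Sec Va" \<rho> by (rule rho_ring_hom_cring)
 fix a b assume ab: "a \<in> carrier A" "b \<in> carrier A" "\<rho> a = \<rho> b"
 have "\<rho> (a \<ominus> b) = \<rho> a \<ominus>\<^bsub>Sec Va\<^esub> \<rho> b" using ab(1,2) by simp
 then have "\<rho> (a \<ominus> b) = \<zero>\<^bsub>Sec Va\<^esub>"
  unfolding ab(3) by (simp only: cring.minus_self[OF sec_cring[OF op_Va] \<rho>.hom_closed[OF ab(2)]])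
 then have "a \<ominus> b = \<zero>" using rho_zero[of "a \<ominus> b"] ab by simp
 then show "a = b" using ab by simp
qed

theorem plus_sections_rho:
 assumes g: "g \<in> carrier (Sec Va)" and le: "\<And>y. y \<in> Va ==> (g, \<one>\<^bsub>Sec Va\<^esub>) \<in> val Va y"
 shows "g \<in> \<rho> ` carrier A"
proof (rule ccontr)
 assume notin: "g \<notin> \<rho> ` carrier A"
 interpret \<rho>: ring_hom_cring A "Sec Va" \<rho> by (rule rho_ring_hom_cring)
 obtain n0 where n0: "\<And>z. z \<in> carrier (Sec Va) ==> (\<forall>i<r. rW i z \<in> FW i n0) ==> z \<in> \<rho> ` carrier A"
  using rho_image by blast
 have "\<forall>i. i < r --> (\<exists>m. \<forall>c\<in>A.Ip m. rW i (\<rho> c \<otimes>\<^bsub>Sec Va\<^esub> g) \<in> FW i n0)"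
 proof (intro allI impI)
  fix i assume i: "i < r"
  interpret h: ring_hom_cring "Sec Va" "Sec (W i)" "rW i" by (rule rW_ring_hom_cring[OF i])
  interpret C: rat_completion A I r f "gens (Suc 0)" "f i" "Suc 0" "Sec (W i)" "ph (Suc 0) (f i)" "comp (Suc 0) (f i)"
   by (rule Q_comp[OF f_Ip1[OF i]])
  have gc: "rW i g \<in> carrier (Sec (W i))" using g by simp
  \<comment> \<open>Multiplication by \<open>g\<close> is continuous over each \<open>W i\<close>,
    so it carries some \<open>I^m\<close> into step \<open>n0\<close>, where
    \<open>rho_image\<close> takes over.\<close>
  have o: "openin C.S.T {x \<in> carrier (Sec (W i)). rW i g \<otimes>\<^bsub>Sec (W i)\<^esub> x \<in> C.F n0}"
   by (rule C.S.open_preimage[OF C.S.cont_mult[OF gc] C.F_open])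
  have "\<zero>\<^bsub>Sec (W i)\<^esub> \<in> {x \<in> carrier (Sec (W i)). rW i g \<otimes>\<^bsub>Sec (W i)\<^esub> x \<in> C.F n0}"
   using gc C.F_minus_closed[of n0] unfolding C.S.minus_closed_def by simp
  from C.F_basis[OF o this] obtain m where m: "C.F m \<subseteq> {x \<in> carrier (Sec (W i)). rW i g \<otimes>\<^bsub>Sec (W i)\<^esub> x \<in> C.F n0}"
   by (elim exE)
  have "rW i (\<rho> c \<otimes>\<^bsub>Sec Va\<^esub> g) \<in> C.F n0" if c: "c \<in> A.Ip m" for c
  proof -
   have cc: "c \<in> carrier A" by (rule A.Ip_carr[OF c])
   have "rW i (\<rho> c \<otimes>\<^bsub>Sec Va\<^esub> g) = rW i g \<otimes>\<^bsub>Sec (W i)\<^esub> ph (Suc 0) (f i) c"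
    using h.hom_mult[OF \<rho>.hom_closed[OF cc] g] h.S.m_comm[OF gc C.phi_carr[OF cc]] rW_rho[OF i cc] by simp
   then show ?thesis using m C.phi_Ip_F[OF c] by auto
  qed
  then show "\<exists>m. \<forall>c\<in>A.Ip m. rW i (\<rho> c \<otimes>\<^bsub>Sec Va\<^esub> g) \<in> FW i n0" by blast
 qed
 then obtain m where m: "\<And>i c. i < r ==> c \<in> A.Ip (m i) ==> rW i (\<rho> c \<otimes>\<^bsub>Sec Va\<^esub> g) \<in> FW i n0" by metis
 have cond: "\<rho> c \<otimes>\<^bsub>Sec Va\<^esub> g \<in> \<rho> ` carrier A" if c: "c \<in> A.Ip (\<Sum>i<r. m i)" for c
 proof (rule n0)
  show "\<rho> c \<otimes>\<^bsub>Sec Va\<^esub> g \<in> carrier (Sec Va)" using \<rho>.hom_closed[OF A.Ip_carr[OF c]] g by simp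
  show "\<forall>i<r. rW i (\<rho> c \<otimes>\<^bsub>Sec Va\<^esub> g) \<in> FW i n0"
  proof (intro allI impI)
   fix i assume i: "i < r"
   have "m i \<le> (\<Sum>i<r. m i)" by (rule member_le_sum) (use i in auto)
   then show "rW i (\<rho> c \<otimes>\<^bsub>Sec Va\<^esub> g) \<in> FW i n0" using m[OF i] c A.Ip_antimono by blast
  qed
 qed
 \<comment> \<open>Each \<open>f i\<close> is invertible over \<open>W i\<close>, so nothing over
   the analytic locus is torsion.\<close>
 have tf: "x = \<zero>\<^bsub>Sec Va\<^esub>" if x: "x \<in> carrier (Sec Va)"
  and z: "\<And>i. i < r ==> \<rho> (f i) [^]\<^bsub>Sec Va\<^esub> (N::nat) \<otimes>\<^bsub>Sec Va\<^esub> x = \<zero>\<^bsub>Sec Va\<^esub>" for x N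
 proof (rule Va_eqI[OF x])
  fix i assume i: "i < r"
  interpret h: ring_hom_cring "Sec Va" "Sec (W i)" "rW i" by (rule rW_ring_hom_cring[OF i])
  interpret C: rat_completion A I r f "gens (Suc 0)" "f i" "Suc 0" "Sec (W i)" "ph (Suc 0) (f i)" "comp (Suc 0) (f i)"
   by (rule Q_comp[OF f_Ip1[OF i]])
  note fc = A.f_carr[OF i]
  have xc: "rW i x \<in> carrier (Sec (W i))" using x by simp
  have pc: "ph (Suc 0) (f i) (f i) [^]\<^bsub>Sec (W i)\<^esub> N \<in> carrier (Sec (W i))" using C.phi_carr[OF fc] by simp
  have "rW i (\<rho> (f i) [^]\<^bsub>Sec Va\<^esub> N \<otimes>\<^bsub>Sec Va\<^esub> x) = ph (Suc 0) (f i) (f i) [^]\<^bsub>Sec (W i)\<^esub> N \<otimes>\<^bsub>Sec (W i)\<^esub> rW i x"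
   using x \<rho>.hom_closed[OF fc] rW_rho[OF i fc] by simp
  then have "rW i x \<otimes>\<^bsub>Sec (W i)\<^esub> ph (Suc 0) (f i) (f i) [^]\<^bsub>Sec (W i)\<^esub> N = \<zero>\<^bsub>Sec (W i)\<^esub>"
   unfolding z[OF i] using h.S.m_comm[OF xc pc] by simp
  then show "rW i x = rW i \<zero>\<^bsub>Sec Va\<^esub>" using C.cancel_s[OF xc h.S.zero_closed, of N] pc by simp
 qed simp
 have pole: "\<exists>p t u h. primeideal p A \<and> I \<subseteq> p \<and> t \<in> p \<and> u \<in> carrier A - p \<and> h \<in> carrier A \<and>
   \<rho> t \<otimes>\<^bsub>Sec Va\<^esub> (\<rho> h \<otimes>\<^bsub>Sec Va\<^esub> g) = \<rho> u \<and> (\<forall>c\<in>p. \<exists>d\<in>carrier A. u \<otimes> c = t \<otimes> d)"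
 proof (rule A.pole_divisor[OF sec_cring[OF op_Va] rho_hom rho_inj _ g _ notin])
  show "\<rho> c \<otimes>\<^bsub>Sec Va\<^esub> g \<in> \<rho> ` carrier A" if "c \<in> A.Ip (\<Sum>i<r. m i)" for c by (rule cond[OF that])
  show "x = \<zero>\<^bsub>Sec Va\<^esub>" if "x \<in> carrier (Sec Va)"
   "\<And>i. i < r ==> \<rho> (f i) [^]\<^bsub>Sec Va\<^esub> (N::nat) \<otimes>\<^bsub>Sec Va\<^esub> x = \<zero>\<^bsub>Sec Va\<^esub>" for x N
   by (rule tf[OF that])
 qed
 obtain p t u h where p: "primeideal p A" "I \<subseteq> p" "t \<in> p" "u \<in> carrier A - p" "h \<in> carrier A"
  "\<rho> t \<otimes>\<^bsub>Sec Va\<^esub> (\<rho> h \<otimes>\<^bsub>Sec Va\<^esub> g) = \<rho> u" "\<forall>c\<in>p. \<exists>d\<in>carrier A. u \<otimes> c = t \<otimes> d"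
  using pole by (elim exE conjE)
 interpret P: dvr_point A I r f p t u
  using p by (intro dvr_point.intro dvr_prime.intro dvr_prime_axioms.intro A.adic_axioms A.locally_normal_axioms) auto
 obtain y where y: "y \<in> V" "pt y = val_rel A P.vgroup P.dval" using P.dval_Spa pt_image by (metis imageE)
 obtain i where "i < r" "(f i, \<zero>) \<notin> pt y" using P.dval_nonzero unfolding y(2) by blast
 then have yVa: "y \<in> Va" using exists_W[OF y(1)] by blast
 interpret v: vrel "Sec Va" "val Va y" by (rule val_vrel[OF op_Va yVa])
 have tc: "t \<in> carrier A" and uc: "u \<in> carrier A" using P.tc p(4) by auto
 have rc: "\<rho> h \<in> carrier (Sec Va)" "\<rho> t \<in> carrier (Sec Va)" using p(5) tc by auto
 \<comment> \<open>At the point of the discrete valuation \<open>h\<close> and \<open>g\<close> have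
   value at most \<open>1\<close>, so \<open>t h g = u\<close> forces \<open>|u| <= |t|\<close>; but
   \<open>u\<close> has order \<open>0\<close> and \<open>t\<close> has order
   \<open>1\<close>.\<close>
 have "(\<rho> h, \<rho> \<one>) \<in> val Va y"
  using pt_res[OF op_Va Va_V yVa p(5) A.one_closed] pt_le_one[OF y(1) p(5)] by blast
 then have h1: "(\<rho> h, \<one>\<^bsub>Sec Va\<^esub>) \<in> val Va y" by simp
 have "(\<rho> h \<otimes>\<^bsub>Sec Va\<^esub> g, \<rho> h \<otimes>\<^bsub>Sec Va\<^esub> \<one>\<^bsub>Sec Va\<^esub>) \<in> val Va y" by (rule v.v_lmult[OF le[OF yVa] rc(1)])
 then have "(\<rho> h \<otimes>\<^bsub>Sec Va\<^esub> g, \<one>\<^bsub>Sec Va\<^esub>) \<in> val Va y" using rc(1) v.v_trans[OF _ h1] by simp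
 from v.v_lmult[OF this rc(2)] have "(\<rho> u, \<rho> t) \<in> val Va y" unfolding p(6) using rc(2) by simp
 then have "(u, t) \<in> pt y" using pt_res[OF op_Va Va_V yVa uc tc] by blast
 then show False using P.dval_u_t unfolding y(2) by blast
qed

end

section \<open>Restriction to the analytic locus: injectivity, bounds and topology\<close>

context normal_spa
begin

lemma Q_0_analytic: "a \<in> carrier A ==> Q 0 a \<inter> analytic_points Y = (\<Union>i<r. Q (Suc 0) (a \<otimes> f i))"
 using analytic_V Q_sub_f[of a] Rt_V[of "gens 0" a] by auto

lemma op_Q_analytic: "a \<in> carrier A ==> op (Q 0 a \<inter> analytic_points Y)"
 unfolding Q_0_analytic using op_Q A.f_carr by auto

text \<open>The difference vanishes on all the pieces into which the \<open>W i\<close> cut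
  \<open>Q 0 a\<close>, so by \<open>Fl_detect\<close> it lies in every late step of a separated
  filtration.\<close>

lemma eq_on_analytic:
 assumes a: "a \<in> carrier A" and b: "b \<in> carrier (Sec (Q 0 a))" "b' \<in> carrier (Sec (Q 0 a))"
  and eq: "res (Q 0 a) (Q 0 a \<inter> analytic_points Y) b = res (Q 0 a) (Q 0 a \<inter> analytic_points Y) b'"
 shows "b = b'"
proof -
 have a0: "a \<in> A.Ip 0" using a by simp
 obtain g where "rat_completion A I r f (gens 0) a 0 (Sec (Q 0 a)) (ph 0 a) g" using Q_completion[OF a0] by blast
 then interpret C: rat_completion A I r f "gens 0" a 0 "Sec (Q 0 a)" "ph 0 a" g .
 obtain n0 where n0: "\<And>n b. n \<ge> n0 ==> b \<in> carrier (Sec (Q 0 a)) ==>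
  (\<forall>i<r. res (Q 0 a) (Q (Suc 0) (a \<otimes> f i)) b \<in> Fl (Suc 0) (a \<otimes> f i) n) ==> b \<in> C.F n"
  using Fl_detect a by blast
 have d: "b \<ominus>\<^bsub>Sec (Q 0 a)\<^esub> b' \<in> carrier (Sec (Q 0 a))" using b by simp
 have "b \<ominus>\<^bsub>Sec (Q 0 a)\<^esub> b' = \<zero>\<^bsub>Sec (Q 0 a)\<^esub>"
 proof (rule C.F_separated[OF d], rule n0[OF _ d], assumption, intro allI impI)
  fix n i assume i: "i < r"
  let ?s = "a \<otimes> f i" and ?W = "Q (Suc 0) (a \<otimes> f i)"
  have s: "?s \<in> A.Ip (Suc 0)" using A.Ip_mult[OF a0 f_Ip1[OF i]] by simp
  have oW: "op ?W" by (rule op_Q[OF A.Ip_carr[OF s]])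
  have sub: "?W \<subseteq> Q 0 a \<inter> analytic_points Y" unfolding Q_0_analytic[OF a] using i by blast
  have sub': "?W \<subseteq> Q 0 a" using sub by blast
  obtain g' where "rat_completion A I r f (gens (Suc 0)) ?s (Suc 0) (Sec ?W) (ph (Suc 0) ?s) g'"
   using Q_completion[OF s] by blast
  then interpret C': rat_completion A I r f "gens (Suc 0)" ?s "Suc 0" "Sec ?W" "ph (Suc 0) ?s" g' .
  interpret h: ring_hom_cring "Sec (Q 0 a)" "Sec ?W" "res (Q 0 a) ?W"
   by (rule res_ring_hom_cring[OF op_Q[OF a] oW sub'])
  note rr = res_res[OF op_Q[OF a] op_Q_analytic[OF a] oW sub Int_lower1]
  have "res (Q 0 a) ?W b = res (Q 0 a) ?W b'"
   using rr[OF b(1)] rr[OF b(2)] eq by simp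
  then have "res (Q 0 a) ?W (b \<ominus>\<^bsub>Sec (Q 0 a)\<^esub> b') = \<zero>\<^bsub>Sec ?W\<^esub>"
   using b C'.S.minus_self[of "res (Q 0 a) ?W b'"] by simp
  then show "res (Q 0 a) ?W (b \<ominus>\<^bsub>Sec (Q 0 a)\<^esub> b') \<in> C'.F n"
   using C'.F_minus_closed[of n] unfolding C'.S.minus_closed_def by simp
 qed
 then show ?thesis using b by simp
qed

lemma ph_0_1: "a \<in> carrier A ==> ph 0 \<one> a = \<psi> a"
 unfolding Q_0_1 using opV by simp

lemma V_completion: "\<exists>g. rat_completion A I r f (gens 0) \<one> 0 (Sec V) (ph 0 \<one>) g"
 using Q_completion[of "\<one>" 0] unfolding Q_0_1 by simp

text \<open>\<open>V\<close> is the rational subset with \<open>s = 1\<close>, so a section is the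
  image of an element of \<open>A\<close> up to an error, which can be taken in a neighbourhood of
  zero where the continuous valuation stays below \<open>1\<close>.\<close>

lemma sections_le_one:
 assumes b: "b \<in> carrier (Sec V)" and y: "y \<in> V" shows "(b, \<one>\<^bsub>Sec V\<^esub>) \<in> val V y"
proof -
 obtain g where "rat_completion A I r f (gens 0) \<one> 0 (Sec V) (ph 0 \<one>) g" using V_completion by blast
 then interpret C: rat_completion A I r f "gens 0" "\<one>" 0 "Sec V" "ph 0 \<one>" g .
 have "val V y \<in> Cont (Sec V)" using Rt_Cont[OF gens_datum[OF A.one_closed], of y 0] y unfolding Q_0_1 by simp
 then interpret v: cont_vrel "Sec V" "val V y" by (rule Cont_cont_vrel[OF C.S.topring_axioms])
 have p1: "\<psi> \<one> = \<one>\<^bsub>Sec V\<^esub>" using ring_hom_one[OF psi_hom] .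
 note o = v.v_cont[OF C.S.one_closed v.v_one]
 obtain n where n: "C.F n \<subseteq> {x \<in> carrier (Sec V). (\<one>\<^bsub>Sec V\<^esub>, x) \<notin> val V y}"
  using C.F_basis[OF o] v.v_one by auto
 obtain e k w where e: "e \<in> carrier (Sec V)" "w \<in> carrier A"
  "e \<otimes>\<^bsub>Sec V\<^esub> ph 0 \<one> \<one> [^]\<^bsub>Sec V\<^esub> (k::nat) = ph 0 \<one> w" "b \<ominus>\<^bsub>Sec V\<^esub> e \<in> C.F n"
  using C.approx[OF b] by blast
 have ew: "e = \<psi> w" using e(1) e(3)[unfolded ph_0_1[OF A.one_closed] ph_0_1[OF e(2)]] p1 by simp
 have "(w, \<one>) \<in> pt y" by (rule pt_le_one[OF y e(2)])
 then have 1: "(e, \<one>\<^bsub>Sec V\<^esub>) \<in> val V y" unfolding pt_def ew p1[symmetric] by blast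
 have 2: "(b \<ominus>\<^bsub>Sec V\<^esub> e, \<one>\<^bsub>Sec V\<^esub>) \<in> val V y" using n e(4) v.v_total[OF C.S.one_closed] by blast
 have "b \<ominus>\<^bsub>Sec V\<^esub> e \<oplus>\<^bsub>Sec V\<^esub> e = b" using b e(1) by (simp add: a_minus_def C.S.a_assoc C.S.l_neg)
 then show ?thesis using v.v_add[OF 2 1] by simp
qed

text \<open>Openness of the restriction onto its image, in a form that survives gluing: by
  \<open>Fl_detect\<close>, smallness of \<open>x - b\<close> on every \<open>W i\<close> makes it
  small on \<open>V\<close>.\<close>

lemma analytic_neighbourhood:
 assumes b: "b \<in> carrier (Sec V)" and Z: "openin (topo (Sec V)) Z" "b \<in> Z"
 shows "\<exists>N. openin (topo (Sec Va)) N \<and> res V Va b \<in> N \<and> (\<forall>x\<in>carrier (Sec V). res V Va x \<in> N --> x \<in> Z)"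
proof -
 obtain g where "rat_completion A I r f (gens 0) \<one> 0 (Sec V) (ph 0 \<one>) g" using V_completion by blast
 then interpret C: rat_completion A I r f "gens 0" "\<one>" 0 "Sec V" "ph 0 \<one>" g .
 interpret Va: topring "Sec Va" by (rule sec_topring[OF op_Va])
 obtain n0 where n0': "\<And>n a b. n \<ge> n0 ==> a \<in> carrier A ==> b \<in> carrier (Sec (Q 0 a)) ==>
  (\<forall>i<r. res (Q 0 a) (Q (Suc 0) (a \<otimes> f i)) b \<in> Fl (Suc 0) (a \<otimes> f i) n) ==> b \<in> Fl 0 a n"
  using Fl_detect by blast
 have n0: "b \<in> C.F n" if "n \<ge> n0" "b \<in> carrier (Sec V)" "\<forall>i<r. res V (W i) b \<in> FW i n" for n b
 proof -
  have "res V (Q (Suc 0) (\<one> \<otimes> f i)) b \<in> Fl (Suc 0) (\<one> \<otimes> f i) n" if "i < r" for i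
   unfolding A.l_one[OF A.f_carr[OF that]] using that(1) \<open>\<forall>i<r. res V (W i) b \<in> FW i n\<close> by blast
  then show ?thesis using n0'[OF that(1) A.one_closed, unfolded Q_0_1, OF that(2)] unfolding Q_0_1 by blast
 qed
 let ?b = "\<ominus>\<^bsub>Sec V\<^esub> b"
 have nb: "?b \<in> carrier (Sec V)" using b by simp
 have tr: "x \<ominus>\<^bsub>Sec V\<^esub> b \<ominus>\<^bsub>Sec V\<^esub> ?b = x" if "x \<in> carrier (Sec V)" for x
  using that b by (simp add: a_minus_def C.S.a_assoc C.S.l_neg)
 have "\<zero>\<^bsub>Sec V\<^esub> \<in> {x \<in> carrier (Sec V). x \<ominus>\<^bsub>Sec V\<^esub> ?b \<in> Z}"
  using tr[OF b] Z(2) b by (simp add: C.S.minus_self)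
 from C.F_basis[OF C.S.open_translate(1)[OF Z(1) nb] this] obtain n1 where
  "C.F n1 \<subseteq> {x \<in> carrier (Sec V). x \<ominus>\<^bsub>Sec V\<^esub> ?b \<in> Z}" by (elim exE)
 then have n: "C.F (max n0 n1) \<subseteq> {x \<in> carrier (Sec V). x \<ominus>\<^bsub>Sec V\<^esub> ?b \<in> Z}"
  using C.F_antimono[of n1 "max n0 n1"] by simp
 let ?n = "max n0 n1" and ?rb = "res V Va b"
 have rb: "?rb \<in> carrier (Sec Va)" using res_carr[OF opV op_Va Va_V b] .
 let ?N = "\<lambda>i. {x \<in> carrier (Sec Va). rW i (x \<ominus>\<^bsub>Sec Va\<^esub> ?rb) \<in> FW i ?n}"
 have oN: "openin Va.T (?N i)" and bN: "?rb \<in> ?N i" if i: "i < r" for i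
 proof -
  interpret h: ring_hom_cring "Sec Va" "Sec (W i)" "rW i" by (rule rW_ring_hom_cring[OF i])
  interpret W: rat_completion A I r f "gens (Suc 0)" "f i" "Suc 0" "Sec (W i)" "ph (Suc 0) (f i)" "comp (Suc 0) (f i)"
   by (rule Q_comp[OF f_Ip1[OF i]])
  have "continuous_map Va.T W.S.T (rW i)"
   using res_top_hom[OF op_Va op_W[OF i] W_Va[OF i]] unfolding top_ring_hom_def by blast
  from openin_continuous_map_preimage[OF this W.F_open[of ?n]]
  have "openin Va.T {x \<in> carrier (Sec Va). rW i x \<in> W.F ?n}" by simp
  from Va.open_translate(1)[OF this rb] rb
  show "openin Va.T (?N i)" by (simp cong: conj_cong)
  have "\<zero>\<^bsub>Sec (W i)\<^esub> \<in> W.F ?n" using W.F_minus_closed[of ?n] unfolding W.S.minus_closed_def by blast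
  moreover have "rW i (?rb \<ominus>\<^bsub>Sec Va\<^esub> ?rb) = \<zero>\<^bsub>Sec (W i)\<^esub>"
   unfolding Va.minus_self[OF rb] by (rule h.hom_zero)
  ultimately show "?rb \<in> ?N i" using rb by (simp only: mem_Collect_eq simp_thms)
 qed
 let ?NN = "\<Inter>(insert (carrier (Sec Va)) (?N ` {..<r}))"
 have "openin Va.T (carrier (Sec Va))" using openin_topspace[of Va.T] by simp
 then have "openin Va.T ?NN" using oN by (intro openin_Inter) auto
 moreover have "?rb \<in> ?NN" using bN rb by blast
 moreover have "x \<in> Z" if x: "x \<in> carrier (Sec V)" "res V Va x \<in> ?NN" for x
 proof -
  interpret h: ring_hom_cring "Sec V" "Sec Va" "res V Va" by (rule res_ring_hom_cring[OF opV op_Va Va_V])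
  have d: "x \<ominus>\<^bsub>Sec V\<^esub> b \<in> carrier (Sec V)" using x(1) b by simp
  have "\<forall>i<r. res V (W i) (x \<ominus>\<^bsub>Sec V\<^esub> b) \<in> FW i ?n"
  proof (intro allI impI)
   fix i assume i: "i < r"
   have "rW i (res V Va (x \<ominus>\<^bsub>Sec V\<^esub> b)) \<in> FW i ?n" using x i b by auto
   then show "res V (W i) (x \<ominus>\<^bsub>Sec V\<^esub> b) \<in> FW i ?n"
    using res_res[OF opV op_Va op_W[OF i] W_Va[OF i] Va_V d] by simp
  qed
  from n0[OF _ d this] have "x \<ominus>\<^bsub>Sec V\<^esub> b \<in> C.F ?n" by simp
  then have "x \<ominus>\<^bsub>Sec V\<^esub> b \<ominus>\<^bsub>Sec V\<^esub> ?b \<in> Z" using n by blast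
  then show ?thesis using tr[OF x(1)] by simp
 qed
 ultimately show ?thesis by blast
qed

end

section \<open>Gluing\<close>

locale attached_normal = X: trspace X + valued Y
 for X :: "('x, 'a, 'm) trspace_scheme" and Y :: "('y, 'b, 'n) vspace_scheme" +
 fixes \<pi> :: "'y => 'x" and \<phi> :: "'x set => 'a => 'b"
 assumes normal: "normal_formal_scheme X" and nd: "nowhere_discrete X"
  and att: "attached_adic_space X Y \<pi> \<phi>"
begin

abbreviation Top where "Top \<equiv> topspace (under Y)"
abbreviation Ya where "Ya \<equiv> analytic_points Y"
abbreviation pre where "pre U \<equiv> {y \<in> Top. \<pi> y \<in> U}"

lemma pi_cont: "continuous_map (under Y) (under X) \<pi>"
 using att unfolding attached_adic_space_def trspace_morphism_def by blast

lemma op_pre: "X.op U ==> op (pre U)"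
 by (rule openin_continuous_map_preimage[OF pi_cont])

lemma chart_spa:
 assumes "Spf_chart X U h"
 shows "Spa_chart Y (pre U) (X.Sec U) (\<phi> U)"
  "y \<in> pre U ==> h (\<pi> y) = {a \<in> carrier (X.Sec U). (\<one>\<^bsub>Sec (pre U)\<^esub>, \<phi> U a) \<notin> val (pre U) y}"
 using att[unfolded attached_adic_space_def, THEN conjunct2, THEN conjunct2, rule_format, OF assms]
 unfolding Let_def by blast+

lemma chart_normal:
 assumes c: "Spf_chart X U h"
 shows "\<exists>I r f. spf_chart X U I r f h \<and> normal_spa (X.Sec U) I r f Y (pre U) (\<phi> U)"
proof -
 have "complete_noetherian_adic_ring (X.Sec U)" using c unfolding Spf_chart_def by blast
 then obtain I r f where ad: "adic (X.Sec U) I r f" "0 < r" using adic_exists by blast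
 have C: "spf_chart X U I r f h"
  by (intro spf_chart.intro spf_chart_axioms.intro X.trspace_axioms ad c)
 have "X.op U" using c unfolding Spf_chart_def by blast
 then have "U \<subseteq> topspace (under X)" by (rule openin_subset)
 then have "normal_domain (stalk X x)" if "x \<in> U" for x
  using normal that unfolding normal_formal_scheme_def by blast
 from spf_chart.locally_normal[OF C nd this]
 have "normal_spa (X.Sec U) I r f Y (pre U) (\<phi> U)"
  by (intro normal_spa.intro spa_chart.intro spa_chart_axioms.intro ad valued_axioms chart_spa(1)[OF c])
 then show ?thesis using C by blast
qed

lemma chart_ex: "x \<in> topspace (under X) ==> \<exists>U h. x \<in> U \<and> Spf_chart X U h"
 using normal unfolding normal_formal_scheme_def formal_scheme_def by blast

lemma pi_top: "y \<in> Top ==> \<pi> y \<in> topspace (under X)"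
 using continuous_map_image_subset_topspace[OF pi_cont] by blast

lemma op_chart_analytic:
 assumes "Spf_chart X U h" shows "op (pre U \<inter> Ya)"
proof -
 obtain I r f where "normal_spa (X.Sec U) I r f Y (pre U) (\<phi> U)" using chart_normal[OF assms] by blast
 then interpret C: normal_spa "X.Sec U" I r f Y "pre U" "\<phi> U" .
 show ?thesis unfolding C.analytic_V by (rule C.op_Va)
qed

lemma Ya_Top: "Ya \<subseteq> Top"
 unfolding analytic_points_def by blast

lemma op_Ya: "op Ya"
proof (subst openin_subopen, intro ballI)
 fix y assume y: "y \<in> Ya"
 then have yT: "y \<in> Top" using Ya_Top by blast
 obtain U h where "\<pi> y \<in> U" "Spf_chart X U h" using chart_ex[OF pi_top[OF yT]] by blast
 then show "\<exists>T. op T \<and> y \<in> T \<and> T \<subseteq> Ya" using op_chart_analytic y yT by blast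
qed

text \<open>Here \<open>U\<close> is an arbitrary open set, because intersections of charts, on
  which gluing is tested, need not be charts. Inside a chart the preimage of \<open>D a\<close> is
  the rational subset \<open>Q 0 a\<close>, for which the claim is known, and these subsets
  cover.\<close>

lemma eq_on_analytic:
 assumes U: "X.op U" and b: "b \<in> carrier (Sec (pre U))" "b' \<in> carrier (Sec (pre U))"
  and eq: "res (pre U) (pre U \<inter> Ya) b = res (pre U) (pre U \<inter> Ya) b'"
 shows "b = b'"
proof (rule sections_eq[where C = "{Z. op Z \<and> Z \<subseteq> pre U \<and> res (pre U) Z b = res (pre U) Z b'}", OF _ _ b])
 have "\<exists>Z. op Z \<and> Z \<subseteq> pre U \<and> y \<in> Z \<and> res (pre U) Z b = res (pre U) Z b'" if y: "y \<in> pre U" for y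
 proof -
  have yT: "y \<in> Top" using y by blast
  obtain U' h where c: "\<pi> y \<in> U'" "Spf_chart X U' h" using chart_ex[OF pi_top[OF yT]] by blast
  obtain I r f where "spf_chart X U' I r f h" and n: "normal_spa (X.Sec U') I r f Y (pre U') (\<phi> U')"
   using chart_normal[OF c(2)] by blast
  then interpret S: spf_chart X U' I r f h by blast
  interpret C: normal_spa "X.Sec U'" I r f Y "pre U'" "\<phi> U'" by (rule n)
  have "\<pi> y \<in> U" using y by blast
  then obtain a where a: "a \<in> carrier (X.Sec U')" "\<pi> y \<in> S.D a" "S.D a \<subseteq> U"
   using S.D_basis[OF U _ c(1)] by blast
  \<comment> \<open>The point \<open>\<pi> z\<close> is the prime of the elements of value below
    \<open>1\<close>; so \<open>a\<close> lies outside it exactly if \<open>|a| >= 1\<close> at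
    \<open>z\<close>, which is the condition for \<open>d = 0\<close>.\<close>
  have "z \<in> C.Q 0 a \<longleftrightarrow> \<pi> z \<in> S.D a" if z: "z \<in> pre U'" for z
  proof -
   have "a \<notin> h (\<pi> z) \<longleftrightarrow> (\<one>\<^bsub>Sec (pre U')\<^esub>, \<phi> U' a) \<in> val (pre U') z"
    using chart_spa(2)[OF c(2) z] a(1) by blast
   moreover have "\<phi> U' \<one>\<^bsub>X.Sec U'\<^esub> = \<one>\<^bsub>Sec (pre U')\<^esub>" by (rule ring_hom_one[OF C.psi_hom])
   ultimately show ?thesis unfolding C.Q_0[OF a(1)] C.pt_def using z a(1) S.A.one_closed by simp
  qed
  moreover have "C.Q 0 a \<subseteq> pre U'" by (rule C.Rt_V)
  ultimately have QU: "C.Q 0 a \<subseteq> pre U" and yQ: "y \<in> C.Q 0 a" using a(2,3) yT c(1) by auto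
  have oQ: "op (C.Q 0 a)" by (rule C.op_Q[OF a(1)])
  have oQa: "op (C.Q 0 a \<inter> Ya)" using oQ op_Ya by blast
  have opa: "op (pre U \<inter> Ya)" using op_pre[OF U] op_Ya by blast
  have QUa: "C.Q 0 a \<inter> Ya \<subseteq> pre U \<inter> Ya" using QU by blast
  note r1 = res_res[OF op_pre[OF U] oQ oQa Int_lower1 QU]
  note r2 = res_res[OF op_pre[OF U] opa oQa QUa Int_lower1]
  have "res (pre U) (C.Q 0 a) b = res (pre U) (C.Q 0 a) b'"
  proof (rule C.eq_on_analytic[OF a(1)])
   show "res (C.Q 0 a) (C.Q 0 a \<inter> Ya) (res (pre U) (C.Q 0 a) b) = res (C.Q 0 a) (C.Q 0 a \<inter> Ya) (res (pre U) (C.Q 0 a) b')"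
    unfolding r1[OF b(1)] r1[OF b(2)] using r2[OF b(1)] r2[OF b(2)] eq by simp
  qed (use res_carr[OF op_pre[OF U] oQ QU] b in auto)
  then show ?thesis using oQ QU yQ by blast
 qed
 then show "pre U = \<Union>{Z. op Z \<and> Z \<subseteq> pre U \<and> res (pre U) Z b = res (pre U) Z b'}" by blast
qed auto

definition charts :: "'y set set" where
 "charts = {pre U | U. \<exists>h. Spf_chart X U h}"

lemma op_charts: "V \<in> charts ==> op V"
 unfolding charts_def Spf_chart_def using op_pre by blast

lemma charts_sub: "V \<in> charts ==> V \<subseteq> Top"
 unfolding charts_def by blast

lemma Union_charts: "\<Union>charts = Top"
proof
 show "\<Union>charts \<subseteq> Top" using charts_sub by blast
 show "Top \<subseteq> \<Union>charts"
 proof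
  fix y assume y: "y \<in> Top"
  obtain U h where "\<pi> y \<in> U" "Spf_chart X U h" using chart_ex[OF pi_top[OF y]] by (elim exE conjE)
  then show "y \<in> \<Union>charts" using y unfolding charts_def by blast
 qed
qed

lemma op_charts_Ya: "V \<in> charts ==> op (V \<inter> Ya)"
 using op_charts op_Ya by blast

definition plus :: "'b set" where
 "plus = {g \<in> carrier (Sec Ya). \<forall>y\<in>Ya. (g, \<one>\<^bsub>Sec Ya\<^esub>) \<in> val Ya y}"

text \<open>Values do not change under restriction, so the bound can be checked at each point inside
  a chart, where it is \<open>sections_le_one\<close>.\<close>

lemma res_plus:
 assumes b: "b \<in> carrier (Sec Top)" shows "res Top Ya b \<in> plus"
proof -
 have "(res Top Ya b, \<one>\<^bsub>Sec Ya\<^esub>) \<in> val Ya y" if y: "y \<in> Ya" for y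
 proof -
  have yT: "y \<in> Top" using y Ya_Top by blast
  obtain U h where c: "\<pi> y \<in> U" "Spf_chart X U h" using chart_ex[OF pi_top[OF yT]] by blast
  obtain I r f where "normal_spa (X.Sec U) I r f Y (pre U) (\<phi> U)" using chart_normal[OF c(2)] by blast
  then interpret C: normal_spa "X.Sec U" I r f Y "pre U" "\<phi> U" .
  have yU: "y \<in> pre U" using yT c(1) by blast
  have sub: "pre U \<subseteq> Top" by blast
  have o: "\<one>\<^bsub>Sec Top\<^esub> \<in> carrier (Sec Top)" using cring.cring_simprules(6)[OF sec_cring[OF op_top]] .
  have "(res Top (pre U) b, res Top (pre U) \<one>\<^bsub>Sec Top\<^esub>) \<in> val (pre U) y"
   using C.sections_le_one[OF res_carr[OF op_top C.opV sub b] yU] ring_hom_one[OF res_hom[OF op_top C.opV sub]] by simp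
  then have "(b, \<one>\<^bsub>Sec Top\<^esub>) \<in> val Top y" using val_res[OF op_top C.opV sub yU b o] by blast
  then show ?thesis using val_res[OF op_top op_Ya Ya_Top y b o] ring_hom_one[OF res_hom[OF op_top op_Ya Ya_Top]] by simp
 qed
 then show ?thesis unfolding plus_def using res_carr[OF op_top op_Ya Ya_Top b] by blast
qed

lemma res_inj: "inj_on (res Top Ya) (carrier (Sec Top))"
proof (rule inj_onI)
 have T: "Top = pre (topspace (under X))" using pi_top by blast
 have TY: "Top \<inter> Ya = Ya" using Ya_Top by blast
 fix b b' assume "b \<in> carrier (Sec Top)" "b' \<in> carrier (Sec Top)" "res Top Ya b = res Top Ya b'"
 then show "b = b'" using eq_on_analytic[of "topspace (under X)" b b'] unfolding T[symmetric] TY by simp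
qed

text \<open>On every chart the function extends, and two extensions agree on an overlap because they
  agree on its analytic part, where both restrict to \<open>g\<close>. So they glue along the cover
  by charts.\<close>

lemma plus_extends:
 assumes g: "g \<in> plus" shows "\<exists>b\<in>carrier (Sec Top). res Top Ya b = g"
proof -
 have gc: "g \<in> carrier (Sec Ya)" using g unfolding plus_def by blast
 have "\<exists>s. s \<in> carrier (Sec V) \<and> res V (V \<inter> Ya) s = res Ya (V \<inter> Ya) g" if V: "V \<in> charts" for V
 proof -
  obtain U h where c: "V = pre U" "Spf_chart X U h" using V unfolding charts_def by blast
  obtain I r f where "normal_spa (X.Sec U) I r f Y (pre U) (\<phi> U)" using chart_normal[OF c(2)] by blast
  then interpret C: normal_spa "X.Sec U" I r f Y V "\<phi> U" unfolding c(1) .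
  have sub: "V \<inter> Ya \<subseteq> Ya" by blast
  note o = op_charts_Ya[OF V]
  have "res Ya (V \<inter> Ya) g \<in> (\<lambda>a. res V (V \<inter> Ya) (\<phi> U a)) ` carrier (X.Sec U)"
  proof (rule C.plus_sections_rho[folded C.analytic_V])
   show "res Ya (V \<inter> Ya) g \<in> carrier (Sec (V \<inter> Ya))" by (rule res_carr[OF op_Ya o sub gc])
   fix y assume y: "y \<in> V \<inter> Ya"
   have "\<one>\<^bsub>Sec Ya\<^esub> \<in> carrier (Sec Ya)" using cring.cring_simprules(6)[OF sec_cring[OF op_Ya]] .
   moreover have "(g, \<one>\<^bsub>Sec Ya\<^esub>) \<in> val Ya y" using g y unfolding plus_def by blast
   ultimately show "(res Ya (V \<inter> Ya) g, \<one>\<^bsub>Sec (V \<inter> Ya)\<^esub>) \<in> val (V \<inter> Ya) y"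
    using val_res[OF op_Ya o sub y gc] ring_hom_one[OF res_hom[OF op_Ya o sub]] by metis
  qed
  then obtain a where "a \<in> carrier (X.Sec U)" "res Ya (V \<inter> Ya) g = res V (V \<inter> Ya) (\<phi> U a)" by blast
  then show ?thesis using C.psi_carr by metis
 qed
 then obtain s where s: "\<And>V. V \<in> charts ==> s V \<in> carrier (Sec V)"
  "\<And>V. V \<in> charts ==> res V (V \<inter> Ya) (s V) = res Ya (V \<inter> Ya) g" by metis
 have "\<exists>!b. b \<in> carrier (Sec (\<Union>charts)) \<and> (\<forall>V\<in>charts. res (\<Union>charts) V b = s V)"
 proof (rule glue[OF op_charts s(1)])
  fix V V' assume V: "V \<in> charts" and V': "V' \<in> charts"
  obtain U h where c: "V = pre U" "Spf_chart X U h" using V unfolding charts_def by blast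
  obtain U' h' where c': "V' = pre U'" "Spf_chart X U' h'" using V' unfolding charts_def by blast
  have oU: "X.op (U \<inter> U')" using c(2) c'(2) unfolding Spf_chart_def by blast
  have eq: "V \<inter> V' = pre (U \<inter> U')" unfolding c(1) c'(1) by blast
  have o: "op (V \<inter> V')" unfolding eq by (rule op_pre[OF oU])
  have oa: "op (V \<inter> V' \<inter> Ya)" using o op_Ya by blast
  have r: "res (V \<inter> V') (V \<inter> V' \<inter> Ya) (res Z (V \<inter> V') (s Z)) = res Ya (V \<inter> V' \<inter> Ya) g"
   if Z: "Z \<in> charts" "V \<inter> V' \<subseteq> Z" for Z
  proof -
   note oZ = op_charts[OF Z(1)] and oZa = op_charts_Ya[OF Z(1)]
   have sub: "V \<inter> V' \<inter> Ya \<subseteq> Z \<inter> Ya" using Z(2) by blast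
   have "res (V \<inter> V') (V \<inter> V' \<inter> Ya) (res Z (V \<inter> V') (s Z)) = res Z (V \<inter> V' \<inter> Ya) (s Z)"
    by (rule res_res[OF oZ o oa Int_lower1 Z(2) s(1)[OF Z(1)]])
   also have "\<dots> = res (Z \<inter> Ya) (V \<inter> V' \<inter> Ya) (res Z (Z \<inter> Ya) (s Z))"
    by (rule res_res[OF oZ oZa oa sub Int_lower1 s(1)[OF Z(1)], symmetric])
   also have "\<dots> = res Ya (V \<inter> V' \<inter> Ya) g" unfolding s(2)[OF Z(1)]
    by (rule res_res[OF op_Ya oZa oa sub Int_lower2 gc])
   finally show ?thesis .
  qed
  have "res V (V \<inter> V') (s V) \<in> carrier (Sec (V \<inter> V'))" "res V' (V \<inter> V') (s V') \<in> carrier (Sec (V \<inter> V'))"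
   using res_carr[OF op_charts[OF V] o Int_lower1 s(1)[OF V]]
    res_carr[OF op_charts[OF V'] o Int_lower2 s(1)[OF V']] by auto
  moreover have "res (V \<inter> V') (V \<inter> V' \<inter> Ya) (res V (V \<inter> V') (s V)) = res (V \<inter> V') (V \<inter> V' \<inter> Ya) (res V' (V \<inter> V') (s V'))"
   using r[OF V] r[OF V'] by simp
  ultimately show "res V (V \<inter> V') (s V) = res V' (V \<inter> V') (s V')"
   using eq_on_analytic[OF oU, folded eq] by blast
 qed
 then obtain b where b: "b \<in> carrier (Sec Top)" "\<And>V. V \<in> charts ==> res Top V b = s V"
  unfolding Union_charts by blast
 have "res Top Ya b = g"
 proof (rule sections_eq[where C = "(\<lambda>V. V \<inter> Ya) ` charts"])
  show "Ya = \<Union>((\<lambda>V. V \<inter> Ya) ` charts)" using Union_charts Ya_Top by blast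
  show "res Top Ya b \<in> carrier (Sec Ya)" by (rule res_carr[OF op_top op_Ya Ya_Top b(1)])
  fix Z assume "Z \<in> (\<lambda>V. V \<inter> Ya) ` charts"
  then obtain V where V: "V \<in> charts" "Z = V \<inter> Ya" by blast
  have sub: "V \<inter> Ya \<subseteq> Ya" by blast
  have "res Ya Z (res Top Ya b) = res Top Z b" unfolding V(2)
   by (rule res_res[OF op_top op_Ya op_charts_Ya[OF V(1)] sub Ya_Top b(1)])
  also have "\<dots> = res V Z (res Top V b)" unfolding V(2)
   by (rule res_res[OF op_top op_charts[OF V(1)] op_charts_Ya[OF V(1)] Int_lower1 charts_sub[OF V(1)] b(1), symmetric])
  finally show "res Ya Z (res Top Ya b) = res Ya Z g" unfolding b(2)[OF V(1)] V(2) s(2)[OF V(1)] .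
 qed (use op_charts_Ya gc in auto)
 then show ?thesis using b(1) by blast
qed

lemma chart_neighbourhood:
 assumes V: "V \<in> charts" and b: "b \<in> carrier (Sec Top)" and Z: "openin (topo (Sec V)) Z" "res Top V b \<in> Z"
 shows "\<exists>M. openin (topo (Sec Ya)) M \<and> res Top Ya b \<in> M \<and>
  (\<forall>x\<in>carrier (Sec Top). res Top Ya x \<in> M --> res Top V x \<in> Z)"
proof -
 obtain U h where c: "V = pre U" "Spf_chart X U h" using V unfolding charts_def by blast
 obtain I r f where "normal_spa (X.Sec U) I r f Y (pre U) (\<phi> U)" using chart_normal[OF c(2)] by blast
 then interpret C: normal_spa "X.Sec U" I r f Y V "\<phi> U" unfolding c(1) .
 note oV = op_charts[OF V] and oVa = op_charts_Ya[OF V] and VT = charts_sub[OF V]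
 obtain N where N: "openin (topo (Sec (V \<inter> Ya))) N" "res V (V \<inter> Ya) (res Top V b) \<in> N"
  "\<And>x. x \<in> carrier (Sec V) ==> res V (V \<inter> Ya) x \<in> N ==> x \<in> Z"
  using C.analytic_neighbourhood[OF res_carr[OF op_top oV VT b] Z] unfolding C.analytic_V by blast
 have sub: "V \<inter> Ya \<subseteq> Ya" by blast
 have rr: "res V (V \<inter> Ya) (res Top V x) = res Ya (V \<inter> Ya) (res Top Ya x)" if x: "x \<in> carrier (Sec Top)" for x
  using res_res[OF op_top oV oVa Int_lower1 VT x] res_res[OF op_top op_Ya oVa sub Ya_Top x] by simp
 let ?M = "{g \<in> topspace (topo (Sec Ya)). res Ya (V \<inter> Ya) g \<in> N}"
 have tY: "topspace (topo (Sec Ya)) = carrier (Sec Ya)" by (rule topring.topspace_T[OF sec_topring[OF op_Ya]])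
 have "continuous_map (topo (Sec Ya)) (topo (Sec (V \<inter> Ya))) (res Ya (V \<inter> Ya))"
  using res_top_hom[OF op_Ya oVa sub] unfolding top_ring_hom_def by blast
 from openin_continuous_map_preimage[OF this N(1)] have "openin (topo (Sec Ya)) ?M" .
 moreover have "res Top Ya b \<in> ?M" using N(2) rr[OF b] res_carr[OF op_top op_Ya Ya_Top b] tY by simp
 moreover have "res Top V x \<in> Z" if x: "x \<in> carrier (Sec Top)" "res Top Ya x \<in> ?M" for x
  using N(3)[OF res_carr[OF op_top oV VT x(1)]] rr[OF x(1)] x(2) by simp
 ultimately show ?thesis by blast
qed

text \<open>The sections over \<open>Y\<close> carry the topology induced from the product over all
  charts, of which there may be infinitely many. A basic open set of the product constrains only
  finitely many coordinates, so finitely many neighbourhoods over the analytic locus have to be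
  intersected. Every function of \<open>plus\<close> in this intersection extends, which gives
  openness of the image.\<close>

lemma res_open_map: "open_map (topo (Sec Top)) (subtopology (topo (Sec Ya)) plus) (res Top Ya)"
 unfolding open_map_def
proof (intro allI impI)
 fix S assume S: "openin (topo (Sec Top)) S"
 have tT: "topspace (topo (Sec Top)) = carrier (Sec Top)" by (rule topring.topspace_T[OF sec_topring[OF op_top]])
 have tY: "topspace (topo (Sec Ya)) = carrier (Sec Ya)" by (rule topring.topspace_T[OF sec_topring[OF op_Ya]])
 have Sc: "S \<subseteq> carrier (Sec Top)" using openin_subset[OF S] tT by simp
 define E where "E = (\<lambda>b. \<lambda>V\<in>charts. res Top V b)"
 let ?P = "product_topology (\<lambda>V. topo (Sec V)) charts"
 have E: "homeomorphic_map (topo (Sec Top)) (subtopology ?P (E ` carrier (Sec Top))) E"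
  using embedding[of charts, OF op_charts] unfolding Union_charts embedding_map_def E_def tT .
 have injE: "inj_on E (carrier (Sec Top))" using homeomorphic_imp_injective_map[OF E] unfolding tT .
 have "openin (subtopology ?P (E ` carrier (Sec Top))) (E ` S)"
  using homeomorphic_imp_open_map[OF E] S unfolding open_map_def by blast
 then obtain S' where S': "openin ?P S'" "E ` S = S' \<inter> E ` carrier (Sec Top)"
  unfolding openin_subtopology by blast
 show "openin (subtopology (topo (Sec Ya)) plus) (res Top Ya ` S)"
 proof (subst openin_subopen, intro ballI)
  fix g assume "g \<in> res Top Ya ` S"
  then obtain b where b: "b \<in> S" "g = res Top Ya b" by blast
  have bc: "b \<in> carrier (Sec Top)" using b(1) Sc by blast
  have "E b \<in> S'" using S'(2) b(1) by blast
  from S'(1)[unfolded openin_product_topology_alt, rule_format, OF this] obtain Z where Z: "finite {V \<in> charts. Z V \<noteq> topspace (topo (Sec V))}" "\<forall>V\<in>charts. openin (topo (Sec V)) (Z V)"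
   "E b \<in> Pi\<^sub>E charts Z" "Pi\<^sub>E charts Z \<subseteq> S'"
   by (elim exE conjE)
  define K where "K = {V \<in> charts. Z V \<noteq> topspace (topo (Sec V))}"
  have "\<forall>V. V \<in> K --> (\<exists>M. openin (topo (Sec Ya)) M \<and> res Top Ya b \<in> M \<and>
    (\<forall>x\<in>carrier (Sec Top). res Top Ya x \<in> M --> res Top V x \<in> Z V))"
  proof (intro allI impI)
   fix V assume "V \<in> K"
   then have V: "V \<in> charts" unfolding K_def by blast
   have "res Top V b \<in> Z V" using PiE_mem[OF Z(3) V] V unfolding E_def by simp
   from chart_neighbourhood[OF V bc Z(2)[rule_format, OF V] this]
   show "\<exists>M. openin (topo (Sec Ya)) M \<and> res Top Ya b \<in> M \<and>
    (\<forall>x\<in>carrier (Sec Top). res Top Ya x \<in> M --> res Top V x \<in> Z V)" .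
  qed
  then obtain M where M: "\<And>V. V \<in> K ==> openin (topo (Sec Ya)) (M V)" "\<And>V. V \<in> K ==> res Top Ya b \<in> M V"
   "\<And>V x. V \<in> K ==> x \<in> carrier (Sec Top) ==> res Top Ya x \<in> M V ==> res Top V x \<in> Z V" by metis
  let ?N = "\<Inter>(insert (carrier (Sec Ya)) (M ` K))"
  have "openin (topo (Sec Ya)) (carrier (Sec Ya))" using openin_topspace[of "topo (Sec Ya)"] tY by simp
  then have "openin (topo (Sec Ya)) ?N" using M(1) Z(1) unfolding K_def[symmetric] by (intro openin_Inter) auto
  then have "openin (subtopology (topo (Sec Ya)) plus) (?N \<inter> plus)" by (rule openin_subtopology_Int)
  moreover have "g \<in> ?N \<inter> plus" unfolding b(2)
   using M(2) res_plus[OF bc] res_carr[OF op_top op_Ya Ya_Top bc] by blast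
  moreover have "?N \<inter> plus \<subseteq> res Top Ya ` S"
  proof
   fix g' assume g': "g' \<in> ?N \<inter> plus"
   obtain x where x: "x \<in> carrier (Sec Top)" "res Top Ya x = g'" using plus_extends g' by blast
   have "res Top V x \<in> Z V" if V: "V \<in> charts" for V
   proof (cases "V \<in> K")
    case True
    then show ?thesis using M(3)[OF True x(1)] g' x(2) by blast
   next
    case False
    then have "Z V = carrier (Sec V)"
     using V topring.topspace_T[OF sec_topring[OF op_charts[OF V]]] unfolding K_def by simp
    then show ?thesis using res_carr[OF op_top op_charts[OF V] charts_sub[OF V] x(1)] by simp
   qed
   then have "E x \<in> Pi\<^sub>E charts Z" unfolding E_def by auto
   then have "E x \<in> E ` S" using Z(4) S'(2) x(1) by blast
   then have "x \<in> S" using inj_onD[OF injE] x(1) Sc by blast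
   then show "g' \<in> res Top Ya ` S" using x(2) by blast
  qed
  ultimately show "\<exists>T. openin (subtopology (topo (Sec Ya)) plus) T \<and> g \<in> T \<and> T \<subseteq> res Top Ya ` S" by blast
 qed
qed

theorem restriction_iso: "top_ring_iso (Sec Top) (plus_sections Y Ya) (res Top Ya)"
proof -
 have P: "plus_sections Y Ya = (Sec Ya)\<lparr>carrier := plus, topo := subtopology (topo (Sec Ya)) plus\<rparr>"
  unfolding plus_sections_def plus_def Let_def by simp
 have im: "res Top Ya ` carrier (Sec Top) = plus" using res_plus plus_extends by blast
 have tT: "topspace (topo (Sec Top)) = carrier (Sec Top)" by (rule topring.topspace_T[OF sec_topring[OF op_top]])
 have tY: "topspace (topo (Sec Ya)) = carrier (Sec Ya)" by (rule topring.topspace_T[OF sec_topring[OF op_Ya]])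
 note h = res_hom[OF op_top op_Ya Ya_Top]
 have "res Top Ya \<in> ring_hom (Sec Top) (plus_sections Y Ya)"
  unfolding P by (rule ring_hom_memI)
   (use res_plus ring_hom_mult[OF h] ring_hom_add[OF h] ring_hom_one[OF h] in auto)
 then have "res Top Ya \<in> ring_iso (Sec Top) (plus_sections Y Ya)"
  unfolding ring_iso_def using im res_inj unfolding P bij_betw_def by simp
 moreover have "homeomorphic_map (topo (Sec Top)) (subtopology (topo (Sec Ya)) plus) (res Top Ya)"
 proof (rule bijective_open_imp_homeomorphic_map[OF _ res_open_map])
  have "continuous_map (topo (Sec Top)) (topo (Sec Ya)) (res Top Ya)"
   using res_top_hom[OF op_top op_Ya Ya_Top] unfolding top_ring_hom_def by blast
  then show "continuous_map (topo (Sec Top)) (subtopology (topo (Sec Ya)) plus) (res Top Ya)"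
   unfolding continuous_map_in_subtopology tT using im by blast
  show "res Top Ya ` topspace (topo (Sec Top)) = topspace (subtopology (topo (Sec Ya)) plus)"
   unfolding tT im topspace_subtopology tY plus_def by blast
  show "inj_on (res Top Ya) (topspace (topo (Sec Top)))" unfolding tT by (rule res_inj)
 qed
 ultimately show ?thesis unfolding top_ring_iso_def P by simp
qed

end

theorem proposition3:
 fixes X :: "('x, 'a) trspace" and Y :: "('y, 'b) vspace"
  and \<pi> :: "'y \<Rightarrow> 'x" and \<phi> :: "'x set \<Rightarrow> 'a \<Rightarrow> 'b"
 assumes "formal_scheme X"
  and "normal_formal_scheme X"
  and "excellent_formal_scheme X"
  and "nowhere_discrete X"
  and "attached_adic_space X Y \<pi> \<phi>"
 shows "top_ring_iso (sect Y (topspace (under Y))) (plus_sections Y (analytic_points Y))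
     (restr Y (topspace (under Y)) (analytic_points Y))"
proof -
 have v: "valued_space Y" using assms(5) unfolding attached_adic_space_def by (rule conjunct1)
 have "topologically_ringed_space X" using assms(1) unfolding formal_scheme_def by (rule conjunct1)
 moreover have "topologically_ringed_space Y" using v unfolding valued_space_def by (rule conjunct1)
 ultimately have "attached_normal X Y \<pi> \<phi>"
  using v assms(2,4,5) by (intro attached_normal.intro attached_normal_axioms.intro trspace.intro
   valued.intro valued_axioms.intro)
 then show ?thesis by (rule attached_normal.restriction_iso)
qed

end
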